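(* Let $f\in L_p^0(\mathbb{T}^2)$, $1<p<\infty$, $\alpha_i>0$, $n_i\in\mathbb{N}$, $i=1,2$. Then $$\begin{aligned}\omega_{\alpha_1,\alpha_2}\Big(f,\frac{\pi}{n_1},\frac{\pi}{n_2}\Big)_{L_p(\mathbb{T}^2)}\asymp\;& n_1^{-\alpha_1}n_2^{-\alpha_2}\big\|s_{n_1,n_2}^{(\alpha_1,\alpha_2)}(f)\big\|_{L_p(\mathbb{T}^2)}+n_1^{-\alpha_1}\big\|s_{n_1,\infty}^{(\alpha_1,0)}(f-s_{\infty,n_2}(f))\big\|_{L_p(\mathbb{T}^2)}\\&+n_2^{-\alpha_2}\big\|s_{\infty,n_2}^{(0,\alpha_2)}(f-s_{n_1,\infty}(f))\big\|_{L_p(\mathbb{T}^2)}+\big\|f-s_{n_1,\infty}(f)-s_{\infty,n_2}(f)+s_{n_1,n_2}(f)\big\|_{L_p(\mathbb{T}^2)}.\end{aligned}$$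
   Context: $L_p(\mathbb{T}^2)$, $1<p<\infty$, is the space of measurable functions $f(x,y)$ that are $2\pi$-periodic in each variable with $\|f\|_{L_p(\mathbb{T}^2)}=\big(\int_0^{2\pi}\int_0^{2\pi}|f(x,y)|^p\,dx\,dy\big)^{1/p}<\infty$; $L_p^0(\mathbb{T}^2)$ is the set of $f\in L_p(\mathbb{T}^2)$ with $\int_0^{2\pi}f(x,y)\,dy=0$ for a.e. $x$ and $\int_0^{2\pi}f(x,y)\,dx=0$ for a.e. $y$. $\mathbb{N}=\{1,2,\ldots\}$. For $\alpha_1,\alpha_2>0$ the (fractional) differences are $\Delta_{h_1}^{\alpha_1}(f)=\sum_{\nu=0}^\infty(-1)^\nu\binom{\alpha_1}{\nu}f(x+(\alpha_1-\nu)h_1,y)$ and $\Delta_{h_2}^{\alpha_2}(f)=\sum_{\nu=0}^\infty(-1)^\nu\binom{\alpha_2}{\nu}f(x,y+(\alpha_2-\nu)h_2)$, where $\binom{\alpha}{0}=1$, $\binom{\alpha}{\nu}=\frac{\alpha(\alpha-1)\cdots(\alpha-\nu+1)}{\nu!}$ for $\nu\ge1$. The mixed modulus of smoothness is $\omega_{\alpha_1,\alpha_2}(f,\delta_1,\delta_2)_{L_p(\mathbb{T}^2)}=\sup_{|h_i|\le\delta_i,\,i=1,2}\|\Delta_{h_1}^{\alpha_1}(\Delta_{h_2}^{\alpha_2}(f))\|_{L_p(\mathbb{T}^2)}$. Partial sums of the Fourier series: with the Dirichlet kernel $D_m(t)=\frac{\sin((m+\frac12)t)}{2\sin(t/2)}$,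 $s_{m_1,\infty}(f)=\frac1\pi\int_0^{2\pi}f(x+t_1,y)D_{m_1}(t_1)\,dt_1$, $s_{\infty,m_2}(f)=\frac1\pi\int_0^{2\pi}f(x,y+t_2)D_{m_2}(t_2)\,dt_2$, $s_{m_1,m_2}(f)=\frac1{\pi^2}\int_0^{2\pi}\int_0^{2\pi}f(x+t_1,y+t_2)D_{m_1}(t_1)D_{m_2}(t_2)\,dt_1\,dt_2$. A superscript $(\rho_1,\rho_2)$ denotes the Weyl derivative of order $\rho_1\ge0$ in $x$ and $\rho_2\ge0$ in $y$: for a function with zero mean in each variable and Fourier series $\sum_{n_1,n_2\ne0}c_{n_1,n_2}e^{i(n_1x+n_2y)}$ it is the function with Fourier series $\sum_{n_1,n_2\neq0}(in_1)^{\rho_1}(in_2)^{\rho_2}c_{n_1,n_2}e^{i(n_1x+n_2y)}$, where $(in)^{\rho}=|n|^\rho e^{i\pi\rho\,\mathrm{sign}(n)/2}$. E.g. $s_{n_1,\infty}^{(\alpha_1,0)}(g)$ is the Weyl derivative of order $(\alpha_1,0)$ of $s_{n_1,\infty}(g)$. $A\asymp B$ means $C^{-1}B\le A\le CB$ with a constant $C>0$ independent of $f,n_1,n_2$ ($C$ may depend on $p,\alpha_1,\alpha_2$). *)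

theory Defs
  imports "HOL-Analysis.Analysis"
begin

text \<open>
  Functions on the two-dimensional torus are complex-valued functions on the plane that are
  \<open>2 * pi\<close>-periodic in each variable. Measurability is Lebesgue measurability, so
  \<open>lebesgue\<close> is used for all integrals, both on the line and on the plane.
\<close>

definition periodic2 :: "(real \<times> real \<Rightarrow> complex) \<Rightarrow> bool" where
  "periodic2 f \<longleftrightarrow> (\<forall>x y. f (x + 2 * pi, y) = f (x, y) \<and> f (x, y + 2 * pi) = f (x, y))"

definition square2pi :: "(real \<times> real) set" where
  "square2pi = {0..2 * pi} \<times> {0..2 * pi}"

text \<open>
  The norm takes values in \<open>ennreal\<close>, so that it is \<open>\<infinity>\<close> (and not a default
  value) when the integral diverges; \<open>ennreal\<close> has no real powers, hence the case distinction.
\<close>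

definition Lp_norm :: "real \<Rightarrow> (real \<times> real \<Rightarrow> complex) \<Rightarrow> ennreal" where
  "Lp_norm p f =
     (let I = (\<integral>\<^sup>+ z \<in> square2pi. ennreal (norm (f z) powr p) \<partial>lebesgue)
      in if I = \<infinity> then \<infinity> else ennreal (enn2real I powr (1 / p)))"

definition Lp_space :: "real \<Rightarrow> (real \<times> real \<Rightarrow> complex) set" where
  "Lp_space p = {f. f \<in> borel_measurable lebesgue \<and> periodic2 f \<and> Lp_norm p f < \<infinity>}"

definition Lp0_space :: "real \<Rightarrow> (real \<times> real \<Rightarrow> complex) set" where
  "Lp0_space p = {f \<in> Lp_space p.
     (AE x in lebesgue. (LINT y : {0..2 * pi} | lebesgue. f (x, y)) = 0) \<and>
     (AE y in lebesgue. (LINT x : {0..2 * pi} | lebesgue. f (x, y)) = 0)}"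

text \<open>
  The series defining the fractional differences are taken pointwise; for \<open>f\<close> in
  \<open>Lp_space p\<close> and \<open>\<alpha> > 0\<close> they converge absolutely at almost every point, because
  the coefficients \<open>\<alpha> gchoose \<nu>\<close> are absolutely summable.
\<close>

definition diff1 :: "real \<Rightarrow> real \<Rightarrow> (real \<times> real \<Rightarrow> complex) \<Rightarrow> real \<times> real \<Rightarrow> complex" where
  "diff1 \<alpha> h f = (\<lambda>(x, y).
     \<Sum>\<nu>. of_real ((- 1) ^ \<nu> * (\<alpha> gchoose \<nu>)) * f (x + (\<alpha> - real \<nu>) * h, y))"

definition diff2 :: "real \<Rightarrow> real \<Rightarrow> (real \<times> real \<Rightarrow> complex) \<Rightarrow> real \<times> real \<Rightarrow> complex" where
  "diff2 \<alpha> h f = (\<lambda>(x, y).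
     \<Sum>\<nu>. of_real ((- 1) ^ \<nu> * (\<alpha> gchoose \<nu>)) * f (x, y + (\<alpha> - real \<nu>) * h))"

definition mixed_modulus ::
    "real \<Rightarrow> real \<Rightarrow> real \<Rightarrow> (real \<times> real \<Rightarrow> complex) \<Rightarrow> real \<Rightarrow> real \<Rightarrow> ennreal" where
  "mixed_modulus p \<alpha>1 \<alpha>2 f \<delta>1 \<delta>2 =
     (SUP (h1, h2) \<in> {(h1, h2). \<bar>h1\<bar> \<le> \<delta>1 \<and> \<bar>h2\<bar> \<le> \<delta>2}.
        Lp_norm p (diff1 \<alpha>1 h1 (diff2 \<alpha>2 h2 f)))"

text \<open>
  At multiples of \<open>2 * pi\<close> division by zero makes the kernel \<open>0\<close> instead of its limit
  \<open>m + 1/2\<close>. This is immaterial, as the kernel only occurs under integrals.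
\<close>

definition dirichlet_kernel :: "nat \<Rightarrow> real \<Rightarrow> real" where
  "dirichlet_kernel m t = sin ((real m + 1 / 2) * t) / (2 * sin (t / 2))"

text \<open>
  \<open>psum1 m f\<close>, \<open>psum2 m f\<close> and \<open>psum12 m1 m2 f\<close> are the partial sums
  \<open>s\<^bsub>m,\<infinity>\<^esub>(f)\<close>, \<open>s\<^bsub>\<infinity>,m\<^esub>(f)\<close> and
  \<open>s\<^bsub>m1,m2\<^esub>(f)\<close> of the Fourier series.
\<close>

definition psum1 :: "nat \<Rightarrow> (real \<times> real \<Rightarrow> complex) \<Rightarrow> real \<times> real \<Rightarrow> complex" where
  "psum1 m f = (\<lambda>(x, y). of_real (1 / pi) *
     (LINT t : {0..2 * pi} | lebesgue. f (x + t, y) * of_real (dirichlet_kernel m t)))"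

definition psum2 :: "nat \<Rightarrow> (real \<times> real \<Rightarrow> complex) \<Rightarrow> real \<times> real \<Rightarrow> complex" where
  "psum2 m f = (\<lambda>(x, y). of_real (1 / pi) *
     (LINT t : {0..2 * pi} | lebesgue. f (x, y + t) * of_real (dirichlet_kernel m t)))"

definition psum12 :: "nat \<Rightarrow> nat \<Rightarrow> (real \<times> real \<Rightarrow> complex) \<Rightarrow> real \<times> real \<Rightarrow> complex" where
  "psum12 m1 m2 f = (\<lambda>(x, y). of_real (1 / pi\<^sup>2) *
     (LINT t : square2pi | lebesgue. f (x + fst t, y + snd t) *
        of_real (dirichlet_kernel m1 (fst t) * dirichlet_kernel m2 (snd t))))"

definition fourier_coeff :: "(real \<times> real \<Rightarrow> complex) \<Rightarrow> int \<Rightarrow> int \<Rightarrow> complex" where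
  "fourier_coeff f k1 k2 = of_real (1 / (4 * pi\<^sup>2)) *
     (LINT z : square2pi | lebesgue. f z * cis (- (of_int k1 * fst z + of_int k2 * snd z)))"

text \<open>
  \<open>weyl_factor \<rho> n\<close> is \<open>(i n)\<^sup>\<rho>\<close> for \<open>n \<noteq> 0\<close>, with the branch
  \<open>\<bar>n\<bar>\<^sup>\<rho> exp (i \<pi> \<rho> sgn n / 2)\<close>.
\<close>

definition weyl_factor :: "real \<Rightarrow> int \<Rightarrow> complex" where
  "weyl_factor \<rho> n = of_real (\<bar>of_int n\<bar> powr \<rho>) * cis (pi * \<rho> * of_int (sgn n) / 2)"

text \<open>
  \<open>is_weyl_deriv \<rho>1 \<rho>2 f g\<close>: the integrable periodic function \<open>g\<close> has the Fourier
  series obtained from that of \<open>f\<close> by termwise differentiation (\<open>f\<close> is meant to have zero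
  mean in each variable). As \<open>g\<close> is determined by its Fourier coefficients up to a null set,
  \<open>weyl_deriv\<close> picks any such function.
\<close>

definition is_weyl_deriv ::
    "real \<Rightarrow> real \<Rightarrow> (real \<times> real \<Rightarrow> complex) \<Rightarrow> (real \<times> real \<Rightarrow> complex) \<Rightarrow> bool" where
  "is_weyl_deriv \<rho>1 \<rho>2 f g \<longleftrightarrow>
     g \<in> borel_measurable lebesgue \<and> periodic2 g \<and> set_integrable lebesgue square2pi g \<and>
     (\<forall>k1 k2. fourier_coeff g k1 k2 =
        (if k1 \<noteq> 0 \<and> k2 \<noteq> 0
         then weyl_factor \<rho>1 k1 * weyl_factor \<rho>2 k2 * fourier_coeff f k1 k2 else 0))"

definition weyl_deriv ::
    "real \<Rightarrow> real \<Rightarrow> (real \<times> real \<Rightarrow> complex) \<Rightarrow> real \<times> real \<Rightarrow> complex" where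
  "weyl_deriv \<rho>1 \<rho>2 f = (SOME g. is_weyl_deriv \<rho>1 \<rho>2 f g)"

end

theory Submission imports Defs begin

text \<open>
  Fejer means reduce the comparison of \<open>L\<^sub>p\<close> norms of integrable functions whose Fourier
  coefficients are given by multipliers of those of \<open>f\<close> to the same comparison for trigonometric
  polynomials. The multipliers that occur are products of one-variable symbols, so it suffices to
  compare, in one variable, the symbol of the fractional difference with that of the truncated
  derivative (frequencies \<open>\<bar>j\<bar> \<le> n\<close>) and of the remainder (frequencies
  \<open>\<bar>j\<bar> > n\<close>), and to do this in each variable in turn.

  The projection onto a half-line of frequencies is bounded on \<open>L\<^sub>p\<close> for
  \<open>1 < p < \<infinity>\<close> by the mean value inequality for an explicit subharmonic function; by
  Abel summation so is every multiplier of bounded variation. At low frequencies the quotient of the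
  two symbols is, up to a translation, a power of \<open>sin x / x\<close> and hence monotone. At high
  frequencies differences of even order \<open>2 q > \<alpha>\<close> are averaged over all steps of size at most
  \<open>\<pi> / n\<close>: the resulting symbol is at least \<open>1\<close> and of bounded variation, so it
  can be inverted.
\<close>

section \<open>Projection onto a half-line of frequencies\<close>

text \<open>\<open>weyl_deriv\<close> is a choice function: of the derivatives in the theorem only
  integrability and the Fourier coefficients are known, so norms must be read off from coefficients.
  This is what the Fejer means provide: the norm of an integrable function, finite or not, is the
  supremum of the norms of its Fejer means.

  The obstacle is the lower bound at high frequencies. For one step h the symbol of the difference
  vanishes at every frequency j with h j in 2 pi Z, so no single step controls the tail, and for a
  general order its phase varies with h, so averages over h might cancel. A further difference of
  order 2 q - alpha turns the symbol, up to sign and a translation, into a nonnegative power of the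
  squared sine. The tent weight has a transform that decays like 1 / u^2 together with its
  derivative, whence bounded variation.

  Since the tail needs all steps, the one-variable lower bounds are stated for an arbitrary bound B
  valid for all admissible steps, not as factorisations of symbols. In this form they can be applied
  in one variable while the step in the other is held fixed.\<close>

lemma continuous_on_UNIV_integrable_on:
  fixes f :: "real \<Rightarrow> 'a::euclidean_space"
  assumes "continuous_on UNIV f" shows "f integrable_on {a..b}"
  by (rule integrable_continuous_real) (rule continuous_on_subset[OF assms], simp)

text \<open>Polar form of the Laplacian: for U(r, t) = Phi(F(r e^(it))) the operator (r d/dr)^2 +
  (d/dt)^2 gives the Laplacian of Phi at F, times |z F'(z)|^2, which is nonnegative. Integration
  over t kills the t-derivative, so r I'(r) is nondecreasing and starts at 0; hence the circle mean
  I grows from r = 0 to r = 1.\<close>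

lemma subharmonic_composition_circle_mean:
  fixes \<Phi> Px Py Pxx Pxy Pyy :: "complex \<Rightarrow> real" and F F1 F2 :: "complex \<Rightarrow> complex"
  assumes D0: "\<And>z. (\<Phi> has_derivative (\<lambda>h. Px z * Re h + Py z * Im h)) (at z)"
    and Dx: "\<And>z. (Px has_derivative (\<lambda>h. Pxx z * Re h + Pxy z * Im h)) (at z)"
    and Dy: "\<And>z. (Py has_derivative (\<lambda>h. Pxy z * Re h + Pyy z * Im h)) (at z)"
    and cont: "continuous_on UNIV Pxx" "continuous_on UNIV Pxy" "continuous_on UNIV Pyy"
    and lap: "\<And>z. Pxx z + Pyy z \<ge> 0"
    and F: "\<And>z. (F has_field_derivative F1 z) (at z)"
    and F1: "\<And>z. (F1 has_field_derivative F2 z) (at z)"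
    and F2: "continuous_on UNIV F2"
  shows "2 * pi * \<Phi> (F 0) \<le> integral {0..2*pi} (\<lambda>t. \<Phi> (F (cis t)))"
proof -
  have cPhi: "continuous_on UNIV \<Phi>" "continuous_on UNIV Px" "continuous_on UNIV Py"
    using D0 Dx Dy by (metis continuous_at_imp_continuous_on has_derivative_continuous)+
  have cF: "continuous_on UNIV F" "continuous_on UNIV F1"
    using F F1 by (metis DERIV_isCont continuous_at_imp_continuous_on)+
  define u where "u r t = of_real r * cis t" for r t
  \<comment> \<open>F has r-derivative H / r along rays and t-derivative i H along circles, so
    \<open>H\<close> serves both directions.\<close>
  define H where "H z = z * F1 z" for z
  define H' where "H' z = F1 z + z * F2 z" for z
  have dH: "(H has_field_derivative H' z) (at z)" for z
    unfolding H_def H'_def using F1[of z] by (auto intro!: derivative_eq_intros)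
  have cH: "continuous_on UNIV H" "continuous_on UNIV H'"
    unfolding H_def H'_def using cF F2 by (auto intro!: continuous_intros)
  have comp_cont: "continuous_on S (\<lambda>x. g (h x))" if "continuous_on UNIV g" "continuous_on S h"
    for g :: "complex \<Rightarrow> 'b::topological_space" and h :: "'c::topological_space \<Rightarrow> complex" and S
    by (rule continuous_on_compose2[OF that]) simp
  have dr: "((\<lambda>r. g (u r t)) has_vector_derivative cis t * g' (u r t)) (at r)"
    if "\<And>z. (g has_field_derivative g' z) (at z)" for g g' r t
  proof -
    have "((\<lambda>r. u r t) has_vector_derivative cis t) (at r)"
      unfolding u_def by (auto intro!: derivative_eq_intros simp: has_vector_derivative_def scaleR_conv_of_real)
    from field_vector_diff_chain_at[OF this that[of "u r t"]] show ?thesis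
      by (simp add: o_def mult.commute)
  qed
  have dt: "((\<lambda>t. g (u r t)) has_vector_derivative \<i> * u r t * g' (u r t)) (at t)"
    if "\<And>z. (g has_field_derivative g' z) (at z)" for g g' r t
  proof -
    have "((\<lambda>t. u r t) has_vector_derivative \<i> * u r t) (at t)"
      unfolding u_def has_vector_derivative_def
      by (auto intro!: derivative_eq_intros simp: scaleR_conv_of_real algebra_simps)
    from field_vector_diff_chain_at[OF this that[of "u r t"]] show ?thesis
      by (simp add: o_def)
  qed
  have chain: "((\<lambda>r. G (v r)) has_real_derivative (Gx (v r) * Re v' + Gy (v r) * Im v')) (at r)"
    if "\<And>z. (G has_derivative (\<lambda>h. Gx z * Re h + Gy z * Im h)) (at z)"
      "(v has_vector_derivative v') (at r)" for G Gx Gy :: "complex \<Rightarrow> real" and v v' r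
  proof -
    have "((\<lambda>r. G (v r)) has_derivative (\<lambda>x. (Gx (v r) * Re (x *\<^sub>R v') + Gy (v r) * Im (x *\<^sub>R v')))) (at r)"
      using diff_chain_at[OF that(2)[unfolded has_vector_derivative_def] that(1)] by (simp add: o_def)
    then show ?thesis
      by (rule has_derivative_imp_has_field_derivative) (simp add: algebra_simps)
  qed
  have Rev: "((\<lambda>r. Re (v r)) has_real_derivative Re v') (at r)"
        "((\<lambda>r. Im (v r)) has_real_derivative Im v') (at r)"
    if "(v has_vector_derivative v') (at r)" for v v' r
    using that by (simp_all add: has_vector_derivative_complex_iff)
  define I where "I r = integral {0..2*pi} (\<lambda>t. \<Phi> (F (u r t)))" for r
  \<comment> \<open>In terms of U: \<open>k\<close> is dU/dr, \<open>K\<close> is r dU/dr with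
    r-derivative \<open>K'\<close>, and \<open>L\<close> is dU/dt with t-derivative
    \<open>L'\<close>.\<close>
  define k where "k r t = Px (F (u r t)) * Re (cis t * F1 (u r t)) + Py (F (u r t)) * Im (cis t * F1 (u r t))" for r t
  define K where "K r t = Px (F (u r t)) * Re (H (u r t)) + Py (F (u r t)) * Im (H (u r t))" for r t
  define K' where "K' r t = (Pxx (F (u r t)) * Re (cis t * F1 (u r t)) + Pxy (F (u r t)) * Im (cis t * F1 (u r t))) * Re (H (u r t))
       + Px (F (u r t)) * Re (cis t * H' (u r t))
       + (Pxy (F (u r t)) * Re (cis t * F1 (u r t)) + Pyy (F (u r t)) * Im (cis t * F1 (u r t))) * Im (H (u r t))
       + Py (F (u r t)) * Im (cis t * H' (u r t))" for r t
  define L where "L r t = - Px (F (u r t)) * Im (H (u r t)) + Py (F (u r t)) * Re (H (u r t))" for r t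
  define L' where "L' r t = (Pxx (F (u r t)) * Im (H (u r t)) - Pxy (F (u r t)) * Re (H (u r t))) * Im (H (u r t))
       - Px (F (u r t)) * Re (u r t * H' (u r t))
       + (- Pxy (F (u r t)) * Im (H (u r t)) + Pyy (F (u r t)) * Re (H (u r t))) * Re (H (u r t))
       - Py (F (u r t)) * Im (u r t * H' (u r t))" for r t
  have cu: "continuous_on S (\<lambda>x. u (a x) (b x))" if "continuous_on S a" "continuous_on S b" for a b :: "'c::topological_space \<Rightarrow> real" and S
    unfolding u_def cis_conv_exp using that by (auto intro!: continuous_intros)
  note ci = continuous_intros comp_cont[OF cPhi(1)] comp_cont[OF cPhi(2)] comp_cont[OF cPhi(3)]
     comp_cont[OF cont(1)] comp_cont[OF cont(2)] comp_cont[OF cont(3)] comp_cont[OF cF(1)] comp_cont[OF cF(2)]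
     comp_cont[OF cH(1)] comp_cont[OF cH(2)] cu
  have ck: "continuous_on UNIV (\<lambda>(r,t). k r t)" and cK: "continuous_on UNIV (\<lambda>(r,t). K r t)"
    and cK': "continuous_on UNIV (\<lambda>(r,t). K' r t)"
    unfolding k_def K_def K'_def case_prod_unfold cis_conv_exp by (intro ci)+
  have cu': "continuous_on UNIV (\<lambda>t. \<Phi> (F (u r t)))" "continuous_on UNIV (K r)" "continuous_on UNIV (K' r)" "continuous_on UNIV (L' r)" for r
    unfolding K_def K'_def L'_def cis_conv_exp by (intro ci)+
  have derI: "(I has_real_derivative integral {0..2*pi} (k r)) (at r)" for r
    unfolding I_def interval_cbox
  proof (rule leibniz_rule_field_derivative[where U=UNIV, simplified])
    show "((\<lambda>x. \<Phi> (F (u x t))) has_real_derivative k x t) (at x)" for x t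
      unfolding k_def by (rule chain[OF D0 dr[OF F]])
    show "(\<lambda>t. \<Phi> (F (u x t))) integrable_on cbox 0 (2 * pi)" for x
      unfolding interval_cbox[symmetric] by (rule continuous_on_UNIV_integrable_on[OF cu'(1)])
    show "continuous_on (UNIV \<times> cbox 0 (2 * pi)) (\<lambda>(x, t). k x t)"
      by (rule continuous_on_subset[OF ck]) simp
  qed
  define J where "J r = integral {0..2*pi} (K r)" for r
  have derJ: "(J has_real_derivative integral {0..2*pi} (K' r)) (at r)" for r
    unfolding J_def interval_cbox
  proof (rule leibniz_rule_field_derivative[where U=UNIV, simplified])
    show "((\<lambda>x. K x t) has_real_derivative K' x t) (at x)" for x t
      unfolding K_def K'_def
      by (rule derivative_eq_intros chain[OF Dx dr[OF F]] chain[OF Dy dr[OF F]] Rev dr[OF dH] refl)+ (simp add: algebra_simps)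
    show "K x integrable_on cbox 0 (2 * pi)" for x
      unfolding interval_cbox[symmetric] by (rule continuous_on_UNIV_integrable_on[OF cu'(2)])
    show "continuous_on (UNIV \<times> cbox 0 (2 * pi)) (\<lambda>(x, t). K' x t)"
      by (rule continuous_on_subset[OF cK']) simp
  qed
  have dL: "((L r) has_real_derivative L' r t) (at t)" for r t
    unfolding L_def L'_def
    by (rule derivative_eq_intros chain[OF Dx dt[OF F]] chain[OF Dy dt[OF F]] Rev dt[OF dH] refl)+
      (simp add: H_def algebra_simps)
  have intL: "integral {0..2*pi} (L' r) = 0" for r
  proof -
    have "(L' r has_integral (L r (2*pi) - L r 0)) {0..2*pi}"
      by (rule fundamental_theorem_of_calculus)
        (use dL in \<open>auto simp: has_real_derivative_iff_has_vector_derivative[symmetric] intro: has_field_derivative_at_within\<close>)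
    moreover have "L r (2*pi) = L r 0" by (simp add: L_def u_def)
    ultimately show ?thesis by (simp add: integral_unique)
  qed
  \<comment> \<open>The first-order terms of r K' and L' come from z H'(z) with opposite signs, and
    the mixed second derivatives cancel as well; what remains is the Laplacian times |H|^2.\<close>
  have pos: "r * K' r t + L' r t \<ge> 0" for r t
  proof -
    have a: "r * Re (cis t * X) = Re (u r t * X)" "r * Im (cis t * X) = Im (u r t * X)" for X
      unfolding u_def by (auto simp: algebra_simps)
    have alg: "(a * x + b * y) * x + d * X + (b * x + c * y) * y + e * Y
        + ((a * y - b * x) * y - d * X + (- b * y + c * x) * x - e * Y) = (a + c) * (x * x + y * y)"
      for a b c d e x y X Y :: real by algebra
    define A where "A = H (u r t)"
    have Re_eq: "r * Re (cis t * F1 (u r t)) = Re A" "r * Im (cis t * F1 (u r t)) = Im A"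
      unfolding a A_def H_def by auto
    have "r * K' r t = (Pxx (F (u r t)) * (r * Re (cis t * F1 (u r t))) + Pxy (F (u r t)) * (r * Im (cis t * F1 (u r t)))) * Re (H (u r t))
       + Px (F (u r t)) * (r * Re (cis t * H' (u r t)))
       + (Pxy (F (u r t)) * (r * Re (cis t * F1 (u r t))) + Pyy (F (u r t)) * (r * Im (cis t * F1 (u r t)))) * Im (H (u r t))
       + Py (F (u r t)) * (r * Im (cis t * H' (u r t)))"
      unfolding K'_def by algebra
    then have "r * K' r t + L' r t = (Pxx (F (u r t)) + Pyy (F (u r t))) * ((Re A)\<^sup>2 + (Im A)\<^sup>2)"
      unfolding Re_eq L'_def A_def[symmetric] unfolding a power2_eq_square
      by (simp only: alg)
    then show ?thesis using lap by simp
  qed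
  have J'pos: "integral {0..2*pi} (K' r) \<ge> 0" if "r > 0" for r
  proof -
    have "0 \<le> integral {0..2*pi} (\<lambda>t. r * K' r t + L' r t)"
      by (rule integral_nonneg) (use pos in \<open>auto intro!: integrable_add integrable_on_mult_right continuous_on_UNIV_integrable_on[OF cu'(3)] continuous_on_UNIV_integrable_on[OF cu'(4)]\<close>)
    also have "\<dots> = r * integral {0..2*pi} (K' r)"
      by (subst integral_add) (auto simp: intL intro!: integrable_on_mult_right continuous_on_UNIV_integrable_on[OF cu'(3)] continuous_on_UNIV_integrable_on[OF cu'(4)])
    finally show ?thesis using that by (simp add: zero_le_mult_iff)
  qed
  have J0: "J 0 = 0" by (simp add: J_def K_def[abs_def] u_def H_def)
  have cJ: "continuous_on S J" for S
    using derJ by (meson DERIV_isCont continuous_at_imp_continuous_on)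
  have cI: "continuous_on S I" for S
    using derI by (meson DERIV_isCont continuous_at_imp_continuous_on)
  have Jpos: "J r \<ge> 0" if "r > 0" for r
    using DERIV_nonneg_imp_increasing_open[of 0 r J] that derJ J'pos J0 cJ by (metis less_imp_le)
  have "integral {0..2*pi} (k r) \<ge> 0" if "r > 0" for r
  proof -
    have "J r = r * integral {0..2*pi} (k r)"
      unfolding J_def integral_mult_right[symmetric]
      by (rule integral_cong) (simp add: K_def k_def H_def u_def algebra_simps)
    then show ?thesis using Jpos[OF that] that by (simp add: zero_le_mult_iff)
  qed
  then have "I 0 \<le> I 1"
    using DERIV_nonneg_imp_increasing_open[of 0 1 I] derI cI by (metis zero_le_one)
  then show ?thesis by (simp add: I_def u_def)
qed

section \<open>Bounding the modulus of an analytic function by its real part in the mean\<close>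

lemma has_derivative_sq_norm_powr:
  fixes \<epsilon> q :: real assumes "\<epsilon> > 0"
  shows "((\<lambda>z. ((Re z)\<^sup>2 + (Im z)\<^sup>2 + \<epsilon>) powr q) has_derivative
     (\<lambda>h. 2 * q * ((Re z)\<^sup>2 + (Im z)\<^sup>2 + \<epsilon>) powr (q - 1) * (Re z * Re h + Im z * Im h))) (at z)"
proof -
  have pos: "(Re z)\<^sup>2 + (Im z)\<^sup>2 + \<epsilon> > 0" using assms by (meson add_nonneg_pos sum_power2_ge_zero)
  have "((\<lambda>z. (Re z)\<^sup>2 + (Im z)\<^sup>2 + \<epsilon>) has_derivative (\<lambda>h. 2 * (Re z * Re h + Im z * Im h))) (at z)"
    by (auto intro!: derivative_eq_intros simp: algebra_simps)
  then show ?thesis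
    by (rule has_derivative_eq_rhs[OF has_derivative_powr[OF _ has_derivative_const]])
      (use pos in \<open>auto simp: powr_diff field_simps\<close>)
qed

lemma has_derivative_sq_Re_powr:
  fixes \<epsilon> q :: real assumes "\<epsilon> > 0"
  shows "((\<lambda>z. ((Re z)\<^sup>2 + \<epsilon>) powr q) has_derivative
     (\<lambda>h. 2 * q * ((Re z)\<^sup>2 + \<epsilon>) powr (q - 1) * (Re z * Re h))) (at z)"
proof -
  have pos: "(Re z)\<^sup>2 + \<epsilon> > 0" using assms by (meson add_nonneg_pos zero_le_power2)
  have "((\<lambda>z. (Re z)\<^sup>2 + \<epsilon>) has_derivative (\<lambda>h. 2 * (Re z * Re h))) (at z)"
    by (auto intro!: derivative_eq_intros simp: algebra_simps)
  then show ?thesis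
    by (rule has_derivative_eq_rhs[OF has_derivative_powr[OF _ has_derivative_const]])
      (use pos in \<open>auto simp: powr_diff field_simps\<close>)
qed

lemma le_of_le_add_tendsto_zero:
  fixes a b :: real and g :: "real \<Rightarrow> real"
  assumes "\<And>\<epsilon>. \<epsilon> > 0 \<Longrightarrow> a \<le> b + g \<epsilon>" and "(g \<longlongrightarrow> 0) (at_right 0)"
  shows "a \<le> b"
proof -
  have "((\<lambda>\<epsilon>. b + g \<epsilon>) \<longlongrightarrow> b + 0) (at_right 0)" by (intro tendsto_intros assms)
  then show ?thesis
    using tendsto_lowerbound[where F="at_right (0::real)" and f="\<lambda>\<epsilon>. b + g \<epsilon>" and x=b and a=a] assms(1)
    by (auto simp: eventually_at_right_less intro!: eventually_mono[OF eventually_at_right_less])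
qed

text \<open>For \<open>p \<ge> 2\<close> and large \<open>A\<close> the function
  \<open>A (Re w)\<^sup>2 \<bar>w\<bar>\<^sup>p\<^sup>-\<^sup>2 - \<bar>w\<bar>\<^sup>p\<close> is subharmonic; replacing
  \<open>\<bar>w\<bar>\<^sup>2\<close> by \<open>\<bar>w\<bar>\<^sup>2 + \<epsilon>\<close> makes it smooth. Young's inequality bounds
  \<open>\<bar>w\<bar>\<^sup>p\<close> by \<open>C \<bar>Re w\<bar>\<^sup>p\<close> minus twice this function.\<close>

lemma norm_powr_le_Re_powr_circle_ge2:
  fixes p :: real assumes p: "p \<ge> 2"
  obtains C where "C > 0"
    "\<And>F F1 F2. \<lbrakk>\<And>z. (F has_field_derivative F1 z) (at z); \<And>z. (F1 has_field_derivative F2 z) (at z);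
       continuous_on UNIV F2; Im (F 0) = 0\<rbrakk> \<Longrightarrow>
     integral {0..2*pi} (\<lambda>t. norm (F (cis t)) powr p) \<le> C * integral {0..2*pi} (\<lambda>t. \<bar>Re (F (cis t))\<bar> powr p)"
proof -
  define q where "q = p / 2 - 1"
  have q: "q \<ge> 0" using p by (simp add: q_def)
  \<comment> \<open>With this value 2 A - 4 (q + 1) = 4 q (q + 1), so in the Laplacian the terms
    without Re z collapse to a multiple of s (s - N), where N = |z|^2 is at most s.\<close>
  define A where "A = 2 * (q + 1)\<^sup>2"
  have A: "A \<ge> 2"
  proof -
    have "(q+1)\<^sup>2 \<ge> 1" using q by (simp add: one_le_power)
    then show ?thesis by (simp add: A_def)
  qed
  \<comment> \<open>In the case s < 2 A x^2 of \<open>Young\<close>, replacing s^q by (2 A x^2)^q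
    produces this factor in front of x^p.\<close>
  define C where "C = 2 * A * (2 * A) powr q"
  have Young: "s powr (q + 1) \<le> C * x powr p - 2 * (A * x\<^sup>2 * s powr q - s powr (q + 1))"
    if "s > 0" "x \<ge> 0" for s x
  proof -
    have *: "2 * A * x\<^sup>2 * s powr q \<le> s powr (q + 1) + C * x powr p"
    proof (cases "2 * A * x\<^sup>2 \<le> s")
      case True
      then have "2 * A * x\<^sup>2 * s powr q \<le> s * s powr q" by (intro mult_right_mono) auto
      also have "\<dots> = s powr (q + 1)" using that by (simp add: powr_add)
      also have "\<dots> \<le> s powr (q + 1) + C * x powr p" using A that by (simp add: C_def)
      finally show ?thesis .
    next
      case False
      then have "x \<noteq> 0" using that by auto
      then have x: "x > 0" using that by simp
      have "2 * A * x\<^sup>2 * s powr q \<le> 2 * A * x\<^sup>2 * (2 * A * x\<^sup>2) powr q"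
        using A q that False by (intro mult_left_mono powr_mono2) auto
      also have "\<dots> = C * (x\<^sup>2 * (x\<^sup>2) powr q)" using A by (simp add: C_def powr_mult)
      also have "x\<^sup>2 * (x\<^sup>2) powr q = x powr p"
      proof -
        have "x\<^sup>2 = x powr 2" using x by (simp add: powr_numeral)
        then have "x\<^sup>2 * (x\<^sup>2) powr q = x powr (2 + 2 * q)" by (simp add: powr_powr powr_add)
        then show ?thesis by (simp add: q_def)
      qed
      finally show ?thesis using powr_ge_zero[of s "q + 1"] by linarith
    qed
    show ?thesis using * by simp
  qed
  have main: "integral {0..2*pi} (\<lambda>t. norm (F (cis t)) powr p) \<le> C * integral {0..2*pi} (\<lambda>t. \<bar>Re (F (cis t))\<bar> powr p)"
    if F: "\<And>z. (F has_field_derivative F1 z) (at z)" and F1: "\<And>z. (F1 has_field_derivative F2 z) (at z)"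
       and F2: "continuous_on UNIV F2" and F0: "Im (F 0) = 0" for F F1 F2
  proof (rule le_of_le_add_tendsto_zero[where g = "\<lambda>\<epsilon>. 4 * pi * (\<epsilon> * ((Re (F 0))\<^sup>2 + \<epsilon>) powr q)"])
    fix \<epsilon> :: real assume e: "\<epsilon> > 0"
    define s where "s z = (Re z)\<^sup>2 + (Im z)\<^sup>2 + \<epsilon>" for z
    have s: "s z > 0" for z unfolding s_def using e by (meson add_nonneg_pos sum_power2_ge_zero)
    have ds: "((\<lambda>z. s z powr q) has_derivative (\<lambda>h. 2 * q * s z powr (q - 1) * (Re z * Re h + Im z * Im h))) (at z)" for q z
      unfolding s_def by (rule has_derivative_sq_norm_powr[OF e])
    define \<Phi> where "\<Phi> z = A * (Re z)\<^sup>2 * s z powr q - s z powr (q + 1)" for z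
    define Px where "Px z = 2 * A * Re z * s z powr q + 2 * A * q * (Re z)^3 * s z powr (q - 1) - 2 * (q + 1) * Re z * s z powr q" for z
    define Py where "Py z = 2 * A * q * (Re z)\<^sup>2 * Im z * s z powr (q - 1) - 2 * (q + 1) * Im z * s z powr q" for z
    define Pxx where "Pxx z = 2 * A * s z powr q + 10 * A * q * (Re z)\<^sup>2 * s z powr (q - 1) + 4 * A * q * (q - 1) * (Re z)^4 * s z powr (q - 1 - 1)
       - 2 * (q + 1) * s z powr q - 4 * (q + 1) * q * (Re z)\<^sup>2 * s z powr (q - 1)" for z
    define Pxy where "Pxy z = 4 * A * q * Re z * Im z * s z powr (q - 1) + 4 * A * q * (q - 1) * (Re z)^3 * Im z * s z powr (q - 1 - 1)
       - 4 * (q + 1) * q * Re z * Im z * s z powr (q - 1)" for z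
    define Pyy where "Pyy z = 2 * A * q * (Re z)\<^sup>2 * s z powr (q - 1) + 4 * A * q * (q - 1) * (Re z)\<^sup>2 * (Im z)\<^sup>2 * s z powr (q - 1 - 1)
       - 2 * (q + 1) * s z powr q - 4 * (q + 1) * q * (Im z)\<^sup>2 * s z powr (q - 1)" for z
    have cF: "continuous_on UNIV F" using F by (meson DERIV_isCont continuous_at_imp_continuous_on)
    have cFc: "continuous_on UNIV (\<lambda>t. F (cis t))"
      by (rule continuous_on_compose2[OF cF]) (auto intro!: continuous_intros)
    have cs: "continuous_on S (\<lambda>z. s (h z))" if "continuous_on S h" for S :: "'z::topological_space set" and h
      unfolding s_def using that by (auto intro!: continuous_intros)
    have s0: "s z \<noteq> 0" for z using s[of z] by simp
    have mean: "2 * pi * \<Phi> (F 0) \<le> integral {0..2*pi} (\<lambda>t. \<Phi> (F (cis t)))"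
    proof (rule subharmonic_composition_circle_mean[where F = F, OF _ _ _ _ _ _ _ F F1 F2])
      fix z
      show "(\<Phi> has_derivative (\<lambda>h. Px z * Re h + Py z * Im h)) (at z)"
        unfolding \<Phi>_def Px_def Py_def
        by (rule derivative_eq_intros ds refl)+ (auto simp: algebra_simps power_numeral_reduce)
      show "(Px has_derivative (\<lambda>h. Pxx z * Re h + Pxy z * Im h)) (at z)"
        unfolding Px_def Pxx_def Pxy_def
        by (rule derivative_eq_intros ds refl)+ (auto simp: algebra_simps power_numeral_reduce)
      show "(Py has_derivative (\<lambda>h. Pxy z * Re h + Pyy z * Im h)) (at z)"
        unfolding Py_def Pxy_def Pyy_def
        by (rule derivative_eq_intros ds refl)+ (auto simp: algebra_simps power_numeral_reduce)
      show "continuous_on UNIV Pxx" "continuous_on UNIV Pxy" "continuous_on UNIV Pyy"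
        unfolding Pxx_def Pxy_def Pyy_def using s0 by (auto intro!: continuous_intros cs)
      define w where "w = s z powr (q - 1 - 1)"
      define N where "N = (Re z)\<^sup>2 + (Im z)\<^sup>2"
      have w: "w > 0" using s[of z] by (simp add: w_def)
      have w1: "s z powr (q - 1) = s z * w" "s z powr q = (s z)\<^sup>2 * w"
        using s[of z] by (auto simp: w_def powr_diff power2_eq_square)
      have Ns: "0 \<le> N" "N \<le> s z" using e by (auto simp: N_def s_def)
      have "Pxx z + Pyy z = w * (A * (12 * q * (Re z)\<^sup>2 * s z + 4 * q * (q - 1) * (Re z)\<^sup>2 * N) + (2 * A - 4 * (q + 1)) * (s z)\<^sup>2 - 4 * (q + 1) * q * N * s z)"
        unfolding Pxx_def Pyy_def w_def[symmetric] w1 N_def by (simp add: algebra_simps power_numeral_reduce)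
      also have "\<dots> = w * (A * (4 * q * (Re z)\<^sup>2 * (3 * s z + (q - 1) * N)) + 4 * (q + 1) * q * (s z * (s z - N)))"
        unfolding A_def by (simp add: algebra_simps power_numeral_reduce)
      also have "\<dots> \<ge> 0"
      proof -
        have "3 * s z + (q - 1) * N = (3 * s z - N) + q * N" by (simp add: algebra_simps)
        then have "0 \<le> 3 * s z + (q - 1) * N" using Ns mult_nonneg_nonneg[OF q Ns(1)] s[of z] by linarith
        then have "0 \<le> A * (4 * q * (Re z)\<^sup>2 * (3 * s z + (q - 1) * N))" using A q by simp
        moreover have "0 \<le> 4 * (q + 1) * q * (s z * (s z - N))" using q Ns s[of z] by simp
        ultimately show ?thesis using w by simp
      qed
      finally show "0 \<le> Pxx z + Pyy z" .
    qed
    \<comment> \<open>F 0 is real, so the only negative contribution to Phi (F 0) carries a factor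
      epsilon; it is the error that disappears in the limit.\<close>
    have \<Phi>0: "- \<Phi> (F 0) \<le> \<epsilon> * ((Re (F 0))\<^sup>2 + \<epsilon>) powr q"
    proof -
      have "\<Phi> (F 0) = ((Re (F 0))\<^sup>2 + \<epsilon>) powr q * ((A - 1) * (Re (F 0))\<^sup>2 - \<epsilon>)"
        using s[of "F 0"] by (simp add: \<Phi>_def s_def F0 powr_add algebra_simps)
      moreover have "((Re (F 0))\<^sup>2 + \<epsilon>) powr q * ((A - 1) * (Re (F 0))\<^sup>2) \<ge> 0" using A by auto
      ultimately show ?thesis by (simp add: algebra_simps)
    qed
    have pw: "norm (F (cis t)) powr p \<le> C * \<bar>Re (F (cis t))\<bar> powr p - 2 * \<Phi> (F (cis t))" for t
    proof -
      let ?z = "F (cis t)"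
      have "norm ?z powr p = ((norm ?z)\<^sup>2) powr (q + 1)"
        by (cases "?z = 0") (use p in \<open>auto simp: powr_powr q_def powr_numeral[symmetric] simp del: powr_numeral\<close>)
      also have "\<dots> \<le> s ?z powr (q + 1)"
        unfolding cmod_power2 s_def using e q by (intro powr_mono2) auto
      also have "\<dots> \<le> C * \<bar>Re ?z\<bar> powr p - 2 * \<Phi> ?z"
        using Young[OF s abs_ge_zero] by (simp add: \<Phi>_def)
      finally show ?thesis .
    qed
    have c1: "continuous_on UNIV (\<lambda>t. norm (F (cis t)) powr p)"
       "continuous_on UNIV (\<lambda>t. \<bar>Re (F (cis t))\<bar> powr p)"
      using p by (auto intro!: continuous_intros cFc continuous_on_powr')
    have c2: "continuous_on UNIV (\<lambda>t. \<Phi> (F (cis t)))"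
      unfolding \<Phi>_def using s0 by (auto intro!: continuous_intros cFc cs)
    note ints = continuous_on_UNIV_integrable_on[OF c1(1)] continuous_on_UNIV_integrable_on[OF c1(2)] continuous_on_UNIV_integrable_on[OF c2]
    have "integral {0..2*pi} (\<lambda>t. norm (F (cis t)) powr p) \<le> integral {0..2*pi} (\<lambda>t. C * \<bar>Re (F (cis t))\<bar> powr p - 2 * \<Phi> (F (cis t)))"
      by (intro integral_le integrable_diff integrable_on_mult_right ints pw)
    also have "\<dots> = C * integral {0..2*pi} (\<lambda>t. \<bar>Re (F (cis t))\<bar> powr p) - 2 * integral {0..2*pi} (\<lambda>t. \<Phi> (F (cis t)))"
      by (subst integral_diff) (auto intro!: integrable_on_mult_right ints)
    also have "\<dots> \<le> C * integral {0..2*pi} (\<lambda>t. \<bar>Re (F (cis t))\<bar> powr p) + 4 * pi * (- \<Phi> (F 0))"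
      using mean by simp
    also have "\<dots> \<le> C * integral {0..2*pi} (\<lambda>t. \<bar>Re (F (cis t))\<bar> powr p) + 4 * pi * (\<epsilon> * ((Re (F 0))\<^sup>2 + \<epsilon>) powr q)"
      by (intro add_left_mono mult_left_mono \<Phi>0) auto
    finally show "integral {0..2*pi} (\<lambda>t. norm (F (cis t)) powr p) \<le> C * integral {0..2*pi} (\<lambda>t. \<bar>Re (F (cis t))\<bar> powr p) + 4 * pi * (\<epsilon> * ((Re (F 0))\<^sup>2 + \<epsilon>) powr q)" .
  next
    have "((\<lambda>\<epsilon>. 4 * pi * (\<epsilon> * ((Re (F 0))\<^sup>2 + 1) powr q)) \<longlongrightarrow> 4 * pi * (0 * ((Re (F 0))\<^sup>2 + 1) powr q)) (at_right 0)"
      by (intro tendsto_intros)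
    then have lim: "((\<lambda>\<epsilon>. 4 * pi * (\<epsilon> * ((Re (F 0))\<^sup>2 + 1) powr q)) \<longlongrightarrow> 0) (at_right 0)" by simp
    show "((\<lambda>\<epsilon>. 4 * pi * (\<epsilon> * ((Re (F 0))\<^sup>2 + \<epsilon>) powr q)) \<longlongrightarrow> 0) (at_right 0)"
    proof (rule tendsto_sandwich[OF _ _ tendsto_const lim])
      show "\<forall>\<^sub>F \<epsilon> in at_right 0. 0 \<le> 4 * pi * (\<epsilon> * ((Re (F 0))\<^sup>2 + \<epsilon>) powr q)"
        by (rule eventually_at_rightI[of 0 1]) auto
      show "\<forall>\<^sub>F \<epsilon> in at_right 0. 4 * pi * (\<epsilon> * ((Re (F 0))\<^sup>2 + \<epsilon>) powr q) \<le> 4 * pi * (\<epsilon> * ((Re (F 0))\<^sup>2 + 1) powr q)"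
        by (rule eventually_at_rightI[of 0 1]) (use q in \<open>auto intro!: mult_left_mono powr_mono2\<close>)
    qed
  qed
  have "C > 0" using A by (simp add: C_def)
  then show ?thesis using main that by blast
qed

text \<open>For \<open>p < 2\<close> the subharmonic function is
  \<open>C \<bar>Re w\<bar>\<^sup>p - \<bar>w\<bar>\<^sup>p\<close>, again regularised by \<open>\<epsilon>\<close>.\<close>

lemma norm_powr_le_Re_powr_circle_less2:
  fixes p :: real assumes p: "1 < p" "p < 2"
  obtains C where "C > 0"
    "\<And>F F1 F2. \<lbrakk>\<And>z. (F has_field_derivative F1 z) (at z); \<And>z. (F1 has_field_derivative F2 z) (at z);
       continuous_on UNIV F2; Im (F 0) = 0\<rbrakk> \<Longrightarrow>
     integral {0..2*pi} (\<lambda>t. norm (F (cis t)) powr p) \<le> C * integral {0..2*pi} (\<lambda>t. \<bar>Re (F (cis t))\<bar> powr p)"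
proof -
  define b where "b = p / 2"
  have b: "1/2 < b" "b < 1" using p by (auto simp: b_def)
  \<comment> \<open>The Laplacian of v^b is at least 2 b (2 b - 1) v^(b - 1), while s^b has
    Laplacian at most 4 b s^(b - 1), which is at most 4 b v^(b - 1). This C balances the two; 2 b -
    1 = p - 1 is positive because p > 1.\<close>
  define C where "C = 2 / (2 * b - 1)"
  have C: "C \<ge> 2" using b by (simp add: C_def field_simps)
  have Cb: "C * (2 * b - 1) = 2" using b by (simp add: C_def divide_simps)
  have powr_b: "norm z powr p = ((norm z)\<^sup>2) powr b" for z :: complex
    by (cases "z = 0") (use p in \<open>auto simp: powr_powr b_def powr_numeral[symmetric] simp del: powr_numeral\<close>)
  have powr_bR: "\<bar>x\<bar> powr p = (x\<^sup>2) powr b" for x :: real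
    using powr_b[of "of_real x"] by simp
  have main: "integral {0..2*pi} (\<lambda>t. norm (F (cis t)) powr p) \<le> C * integral {0..2*pi} (\<lambda>t. \<bar>Re (F (cis t))\<bar> powr p)"
    if F: "\<And>z. (F has_field_derivative F1 z) (at z)" and F1: "\<And>z. (F1 has_field_derivative F2 z) (at z)"
       and F2: "continuous_on UNIV F2" and F0: "Im (F 0) = 0" for F F1 F2
  proof (rule le_of_le_add_tendsto_zero[where g = "\<lambda>\<epsilon>. C * 2 * pi * \<epsilon> powr b"])
    fix \<epsilon> :: real assume e: "\<epsilon> > 0"
    define s where "s z = (Re z)\<^sup>2 + (Im z)\<^sup>2 + \<epsilon>" for z
    define v where "v z = (Re z)\<^sup>2 + \<epsilon>" for z
    have s: "s z > 0" for z unfolding s_def using e by (meson add_nonneg_pos sum_power2_ge_zero)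
    have v: "v z > 0" for z unfolding v_def using e by (meson add_nonneg_pos zero_le_power2)
    have ds: "((\<lambda>z. s z powr q) has_derivative (\<lambda>h. 2 * q * s z powr (q - 1) * (Re z * Re h + Im z * Im h))) (at z)" for q z
      unfolding s_def by (rule has_derivative_sq_norm_powr[OF e])
    have dv: "((\<lambda>z. v z powr q) has_derivative (\<lambda>h. 2 * q * v z powr (q - 1) * (Re z * Re h))) (at z)" for q z
      unfolding v_def by (rule has_derivative_sq_Re_powr[OF e])
    have vb: "v z * v z powr (r - 1) = v z powr r" for z r
      using v[of z] by (simp add: powr_mult_base)
    define \<Phi> where "\<Phi> z = C * v z powr b - s z powr b" for z
    define Px where "Px z = 2 * C * b * Re z * v z powr (b - 1) - 2 * b * Re z * s z powr (b - 1)" for z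
    define Py where "Py z = - 2 * b * Im z * s z powr (b - 1)" for z
    define Pxx where "Pxx z = 2 * C * b * v z powr (b - 1) + 4 * C * b * (b - 1) * (Re z)\<^sup>2 * v z powr (b - 1 - 1)
       - 2 * b * s z powr (b - 1) - 4 * b * (b - 1) * (Re z)\<^sup>2 * s z powr (b - 1 - 1)" for z
    define Pxy where "Pxy z = - 4 * b * (b - 1) * Re z * Im z * s z powr (b - 1 - 1)" for z
    define Pyy where "Pyy z = - 2 * b * s z powr (b - 1) - 4 * b * (b - 1) * (Im z)\<^sup>2 * s z powr (b - 1 - 1)" for z
    have cF: "continuous_on UNIV F" using F by (meson DERIV_isCont continuous_at_imp_continuous_on)
    have cFc: "continuous_on UNIV (\<lambda>t. F (cis t))"
      by (rule continuous_on_compose2[OF cF]) (auto intro!: continuous_intros)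
    have cs: "continuous_on S (\<lambda>z. s (h z))" if "continuous_on S h" for S :: "'z::topological_space set" and h
      unfolding s_def using that by (auto intro!: continuous_intros)
    have cv: "continuous_on S (\<lambda>z. v (h z))" if "continuous_on S h" for S :: "'z::topological_space set" and h
      unfolding v_def using that by (auto intro!: continuous_intros)
    have s0: "s z \<noteq> 0" "v z \<noteq> 0" for z using s[of z] v[of z] by auto
    have mean: "2 * pi * \<Phi> (F 0) \<le> integral {0..2*pi} (\<lambda>t. \<Phi> (F (cis t)))"
    proof (rule subharmonic_composition_circle_mean[where F = F, OF _ _ _ _ _ _ _ F F1 F2])
      fix z
      show "(\<Phi> has_derivative (\<lambda>h. Px z * Re h + Py z * Im h)) (at z)"
        unfolding \<Phi>_def Px_def Py_def
        by (rule derivative_eq_intros ds dv refl)+ (auto simp: algebra_simps power_numeral_reduce)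
      show "(Px has_derivative (\<lambda>h. Pxx z * Re h + Pxy z * Im h)) (at z)"
        unfolding Px_def Pxx_def Pxy_def
        by (rule derivative_eq_intros ds dv refl)+ (auto simp: algebra_simps power_numeral_reduce)
      show "(Py has_derivative (\<lambda>h. Pxy z * Re h + Pyy z * Im h)) (at z)"
        unfolding Py_def Pxy_def Pyy_def
        by (rule derivative_eq_intros ds dv refl)+ (auto simp: algebra_simps power_numeral_reduce)
      show "continuous_on UNIV Pxx" "continuous_on UNIV Pxy" "continuous_on UNIV Pyy"
        unfolding Pxx_def Pxy_def Pyy_def using s0 by (auto intro!: continuous_intros cs cv)
      have "2 * C * b * v z powr (b - 1) + 4 * C * b * (b - 1) * (Re z)\<^sup>2 * v z powr (b - 1 - 1)
         = 2 * C * b * v z powr (b - 1 - 1) * (v z + 2 * (b - 1) * (Re z)\<^sup>2)"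
        unfolding vb[of z "b - 1", symmetric] by (simp add: algebra_simps)
      also have "\<dots> \<ge> 2 * C * b * v z powr (b - 1 - 1) * ((2 * b - 1) * v z)"
      proof (intro mult_left_mono)
        have "v z + 2 * (b - 1) * (Re z)\<^sup>2 = (2 * b - 1) * v z + 2 * (1 - b) * \<epsilon>"
          by (simp add: v_def algebra_simps)
        then show "(2 * b - 1) * v z \<le> v z + 2 * (b - 1) * (Re z)\<^sup>2" using b e by simp
      qed (use C b in auto)
      also have "2 * C * b * v z powr (b - 1 - 1) * ((2 * b - 1) * v z) = 2 * b * (C * (2 * b - 1)) * (v z * v z powr (b - 1 - 1))"
        by simp
      also have "\<dots> = 4 * b * v z powr (b - 1)" unfolding Cb vb by simp
      finally have 1: "4 * b * v z powr (b - 1) \<le> 2 * C * b * v z powr (b - 1) + 4 * C * b * (b - 1) * (Re z)\<^sup>2 * v z powr (b - 1 - 1)" .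
      have "4 * b * s z powr (b - 1) \<le> 4 * b * v z powr (b - 1)"
        using b v[of z] by (intro mult_left_mono powr_mono2') (auto simp: v_def s_def)
      with 1 have 2: "4 * b * s z powr (b - 1) \<le> 2 * C * b * v z powr (b - 1) + 4 * C * b * (b - 1) * (Re z)\<^sup>2 * v z powr (b - 1 - 1)" by simp
      have 3: "0 \<le> 4 * b * (1 - b) * (((Re z)\<^sup>2 + (Im z)\<^sup>2) * s z powr (b - 1 - 1))" using b by simp
      show "0 \<le> Pxx z + Pyy z" using 2 3 unfolding Pxx_def Pyy_def by (simp add: algebra_simps)
    qed
    have \<Phi>0: "\<Phi> (F 0) \<ge> 0"
    proof -
      have "\<Phi> (F 0) = (C - 1) * ((Re (F 0))\<^sup>2 + \<epsilon>) powr b" by (simp add: \<Phi>_def s_def v_def F0 algebra_simps)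
      then show ?thesis using C by simp
    qed
    have pw: "norm (F (cis t)) powr p \<le> C * (\<bar>Re (F (cis t))\<bar> powr p + \<epsilon> powr b) - \<Phi> (F (cis t))" for t
    proof -
      let ?z = "F (cis t)"
      have "norm ?z powr p \<le> s ?z powr b"
        unfolding powr_b cmod_power2 s_def using e b by (intro powr_mono2) auto
      also have "\<dots> = C * v ?z powr b - \<Phi> ?z" by (simp add: \<Phi>_def)
      also have "v ?z powr b \<le> \<bar>Re ?z\<bar> powr p + \<epsilon> powr b"
      proof -
        have "v ?z powr b = (Re ?z)\<^sup>2 * v ?z powr (b - 1) + \<epsilon> * v ?z powr (b - 1)"
          unfolding vb[of ?z b, symmetric] by (simp add: v_def algebra_simps)
        also have "(Re ?z)\<^sup>2 * v ?z powr (b - 1) \<le> ((Re ?z)\<^sup>2) powr b"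
        proof (cases "Re ?z = 0")
          case False
          then have "(Re ?z)\<^sup>2 * v ?z powr (b - 1) \<le> (Re ?z)\<^sup>2 * ((Re ?z)\<^sup>2) powr (b - 1)"
            using b e by (intro mult_left_mono powr_mono2') (auto simp: v_def)
          also have "\<dots> = ((Re ?z)\<^sup>2) powr b" using False by (simp add: powr_diff)
          finally show ?thesis .
        qed simp
        also have "\<epsilon> * v ?z powr (b - 1) \<le> \<epsilon> * \<epsilon> powr (b - 1)"
          using b e by (intro mult_left_mono powr_mono2') (auto simp: v_def)
        also have "\<dots> = \<epsilon> powr b" using e by (simp add: powr_diff)
        finally show ?thesis by (simp add: powr_bR)
      qed
      finally show ?thesis using C by simp
    qed
    have c1: "continuous_on UNIV (\<lambda>t. norm (F (cis t)) powr p)"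
       "continuous_on UNIV (\<lambda>t. \<bar>Re (F (cis t))\<bar> powr p)"
      using p by (auto intro!: continuous_intros cFc continuous_on_powr')
    have c2: "continuous_on UNIV (\<lambda>t. \<Phi> (F (cis t)))"
      unfolding \<Phi>_def using s0 by (auto intro!: continuous_intros cFc cs cv)
    note ints = continuous_on_UNIV_integrable_on[OF c1(1)] continuous_on_UNIV_integrable_on[OF c1(2)] continuous_on_UNIV_integrable_on[OF c2]
    have "integral {0..2*pi} (\<lambda>t. norm (F (cis t)) powr p) \<le> integral {0..2*pi} (\<lambda>t. C * (\<bar>Re (F (cis t))\<bar> powr p + \<epsilon> powr b) - \<Phi> (F (cis t)))"
      by (intro integral_le integrable_diff integrable_on_mult_right integrable_add ints pw) auto
    also have "\<dots> = C * (integral {0..2*pi} (\<lambda>t. \<bar>Re (F (cis t))\<bar> powr p) + 2 * pi * \<epsilon> powr b) - integral {0..2*pi} (\<lambda>t. \<Phi> (F (cis t)))"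
    proof -
      have "integral {0..2*pi} (\<lambda>t. \<bar>Re (F (cis t))\<bar> powr p + \<epsilon> powr b) = integral {0..2*pi} (\<lambda>t. \<bar>Re (F (cis t))\<bar> powr p) + 2 * pi * \<epsilon> powr b"
        by (subst integral_add) (auto intro!: ints)
      then show ?thesis
        by (subst integral_diff) (auto intro!: integrable_on_mult_right integrable_add ints)
    qed
    also have "\<dots> \<le> C * (integral {0..2*pi} (\<lambda>t. \<bar>Re (F (cis t))\<bar> powr p) + 2 * pi * \<epsilon> powr b)"
      using mean \<Phi>0 by (smt (verit, best) mult_nonneg_nonneg pi_ge_zero)
    finally show "integral {0..2*pi} (\<lambda>t. norm (F (cis t)) powr p) \<le> C * integral {0..2*pi} (\<lambda>t. \<bar>Re (F (cis t))\<bar> powr p) + C * 2 * pi * \<epsilon> powr b"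
      by (simp add: algebra_simps)
  next
    have "((\<lambda>\<epsilon>::real. \<epsilon> powr b) \<longlongrightarrow> 0 powr b) (at_right 0)"
      by (rule tendsto_powr2) (use b in \<open>auto intro!: tendsto_intros eventually_at_rightI[of 0 1]\<close>)
    then have "((\<lambda>\<epsilon>. C * 2 * pi * \<epsilon> powr b) \<longlongrightarrow> C * 2 * pi * 0 powr b) (at_right 0)"
      by (rule tendsto_mult_left)
    then show "((\<lambda>\<epsilon>. C * 2 * pi * \<epsilon> powr b) \<longlongrightarrow> 0) (at_right 0)" by simp
  qed
  have "C > 0" using C by simp
  then show ?thesis using main that by blast
qed

text \<open>Convexity: the graph of x^p lies above its tangent at m. The left side is linear in x,
  so the inequality can be integrated; with m a mean value this gives Jensen's inequality.\<close>

lemma powr_tangent_le: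
  fixes p x m :: real
  assumes "p \<ge> 1" "x \<ge> 0" "m \<ge> 0"
  shows "p * m powr (p - 1) * x \<le> x powr p + (p - 1) * m powr p"
proof (cases "x = 0 \<or> m = 0")
  case True then show ?thesis using assms by auto
next
  case False
  have "(x powr p) powr (1 / p) * (m powr p) powr ((p - 1) / p) \<le> (1 / p) * x powr p + (p - 1) / p * m powr p"
    by (rule Youngs_inequality_0) (use assms False in \<open>auto simp: field_simps\<close>)
  moreover have "p * ((p - 1) / p) = p - 1" using assms by simp
  ultimately have "x * m powr (p - 1) \<le> (1 / p) * x powr p + (p - 1) / p * m powr p"
    using assms False by (simp add: powr_powr)
  then show ?thesis using assms by (simp add: field_simps)
qed

section \<open>The Riesz projection for trigonometric polynomials in one variable\<close>

lemma cis_has_integral_period: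
  "((\<lambda>t. cis (of_int j * t)) has_integral (if j = 0 then 2 * of_real pi else 0)) {0..2 * pi}"
proof (cases "j = 0")
  case True
  have "((\<lambda>t::real. 1::complex) has_integral (2 * pi - 0) *\<^sub>R 1) {0..2 * pi}"
    by (metis has_integral_const_real content_real pi_ge_zero zero_le_mult_iff zero_le_numeral)
  then show ?thesis using True by (simp add: scaleR_conv_of_real)
next
  case False
  have "((\<lambda>t. cis (of_int j * t)) has_integral (cis (of_int j * (2 * pi)) / (\<i> * of_int j) - cis (of_int j * 0) / (\<i> * of_int j))) {0..2*pi}"
  proof (rule fundamental_theorem_of_calculus)
    fix t :: real
    show "((\<lambda>t. cis (of_int j * t) / (\<i> * of_int j)) has_vector_derivative cis (of_int j * t)) (at t within {0..2 * pi})"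
      unfolding has_vector_derivative_def using False
      by (auto intro!: derivative_eq_intros simp: scaleR_conv_of_real field_simps)
  qed simp
  moreover have "cis (of_int j * (2 * pi)) = 1"
    using cis_multiple_2pi[of "of_int j"] by (simp add: mult_ac)
  ultimately show ?thesis using False by simp
qed

text \<open>M. Riesz's theorem. Folding the negative frequencies over by conjugation yields an
  analytic polynomial with the same real part on the circle, whose norm the preceding estimates
  control. Twice the projection is a combination of two such polynomials and the constant
  term.\<close>

lemma trig_poly_half_line_bound:
  fixes p :: real assumes p: "1 < p"
  shows "\<exists>C>0. \<forall>S a m. finite S \<longrightarrow>
     integral {0..2*pi} (\<lambda>t. norm (\<Sum>j\<in>{j\<in>S. m \<le> j}. a j * cis (of_int j * t)) powr p)
       \<le> C * integral {0..2*pi} (\<lambda>t. norm (\<Sum>j\<in>S. a j * cis (of_int j * t)) powr p)"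
proof -
  obtain C0 where C0: "C0 > 0"
    "\<And>F F1 F2. \<lbrakk>\<And>z. (F has_field_derivative F1 z) (at z); \<And>z. (F1 has_field_derivative F2 z) (at z);
       continuous_on UNIV F2; Im (F 0) = 0\<rbrakk> \<Longrightarrow>
     integral {0..2*pi} (\<lambda>t. norm (F (cis t)) powr p) \<le> C0 * integral {0..2*pi} (\<lambda>t. \<bar>Re (F (cis t))\<bar> powr p)"
    using p norm_powr_le_Re_powr_circle_ge2[of p] norm_powr_le_Re_powr_circle_less2[of p] by (metis not_less)
  define g where "g S a t = (\<Sum>j\<in>S. a j * cis (of_int j * t))" for S and a :: "int \<Rightarrow> complex" and t
  have cg: "continuous_on UNIV (g S a)" for S a
    unfolding g_def by (intro continuous_intros)
  have cgp: "continuous_on UNIV (\<lambda>t. norm (h t) powr p)" if "continuous_on UNIV h" for h :: "real \<Rightarrow> complex"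
    using p that by (auto intro!: continuous_intros continuous_on_powr')
  note int_p = continuous_on_UNIV_integrable_on[OF cgp]
  define N where "N h = integral {0..2*pi} (\<lambda>t. norm (h t) powr p)" for h :: "real \<Rightarrow> complex"
  \<comment> \<open>Conjugation preserves real parts and turns e^(ijt) with j < 0 into a positive
    power. The constant term is made real because the mean value estimates need Im (F 0) =
    0.\<close>
  define Fe where "Fe b j = (if j > 0 then b j else if j < 0 then cnj (b j) else of_real (Re (b 0)))" for b :: "int \<Rightarrow> complex" and j :: int
  define F where "F S b z = (\<Sum>j\<in>S. Fe b j * z ^ nat \<bar>j\<bar>)" for S b z
  have cF': "continuous_on UNIV (\<lambda>t. F S b (cis t))" for S b
    unfolding F_def by (intro continuous_intros)
  have cis_pow: "j > 0 \<Longrightarrow> cis t ^ nat j = cis (of_int j * t)"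
     "j < 0 \<Longrightarrow> cis t ^ nat (- j) = cis (- (of_int j * t))" for j t
    by (auto simp: Complex.DeMoivre)
  have F_bound: "N (\<lambda>t. F S b (cis t)) \<le> C0 * N (g S b)" if S: "finite S" for S b
  proof -
    have "N (\<lambda>t. F S b (cis t)) \<le> C0 * integral {0..2*pi} (\<lambda>t. \<bar>Re (F S b (cis t))\<bar> powr p)"
      unfolding N_def
    proof (rule C0(2))
      show "(F S b has_field_derivative (\<Sum>j\<in>S. Fe b j * (of_nat (nat \<bar>j\<bar>) * z ^ (nat \<bar>j\<bar> - 1)))) (at z)" for z
        unfolding F_def[abs_def] by (auto intro!: derivative_eq_intros sum.cong)
      show "((\<lambda>z. \<Sum>j\<in>S. Fe b j * (of_nat (nat \<bar>j\<bar>) * z ^ (nat \<bar>j\<bar> - 1))) has_field_derivative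
         (\<Sum>j\<in>S. Fe b j * (of_nat (nat \<bar>j\<bar>) * (of_nat (nat \<bar>j\<bar> - 1) * z ^ (nat \<bar>j\<bar> - 1 - 1))))) (at z)" for z
        by (rule derivative_eq_intros refl)+ (auto intro!: sum.cong)
      show "continuous_on UNIV (\<lambda>z. \<Sum>j\<in>S. Fe b j * (of_nat (nat \<bar>j\<bar>) * (of_nat (nat \<bar>j\<bar> - 1) * z ^ (nat \<bar>j\<bar> - 1 - 1))))"
        by (intro continuous_intros)
      have "Im (Fe b j * 0 ^ nat \<bar>j\<bar>) = 0" for j by (cases "j = 0") (auto simp: Fe_def)
      then show "Im (F S b 0) = 0" unfolding F_def Im_sum by (intro sum.neutral) blast
    qed
    also have "integral {0..2*pi} (\<lambda>t. \<bar>Re (F S b (cis t))\<bar> powr p) \<le> N (g S b)"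
      unfolding N_def
    proof (intro integral_le int_p cg continuous_on_UNIV_integrable_on)
      have cF: "continuous_on UNIV (\<lambda>t. F S b (cis t))" unfolding F_def by (intro continuous_intros)
      show "continuous_on UNIV (\<lambda>t. \<bar>Re (F S b (cis t))\<bar> powr p)"
        using p cF by (auto intro!: continuous_intros continuous_on_powr')
      fix t
      have "Re (Fe b j * cis t ^ nat \<bar>j\<bar>) = Re (b j * cis (of_int j * t))" for j
        by (cases j "0::int" rule: linorder_cases) (auto simp: Fe_def cis_pow)
      then have "Re (F S b (cis t)) = Re (g S b t)"
        unfolding F_def g_def Re_sum by (intro sum.cong refl)
      then show "\<bar>Re (F S b (cis t))\<bar> powr p \<le> norm (g S b t) powr p"
        using p by (auto intro!: powr_mono2 abs_Re_le_cmod)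
    qed
    finally show ?thesis using C0 by simp
  qed
  \<comment> \<open>a 0 is the mean of g, so this is Jensen's inequality, obtained by integrating
    the tangent inequality at |a 0|.\<close>
  have a0_bound: "2 * pi * norm (a 0) powr p \<le> N (g S a)" if S: "finite S" "0 \<in> S" for S a
  proof -
    let ?m = "norm (a 0)"
    have "((\<lambda>t. \<Sum>j\<in>S. a j * cis (of_int j * t)) has_integral (\<Sum>j\<in>S. a j * (if j = 0 then 2 * of_real pi else 0))) {0..2*pi}"
      by (intro has_integral_sum S has_integral_mult_right cis_has_integral_period)
    also have "(\<Sum>j\<in>S. a j * (if j = 0 then 2 * of_real pi else 0)) = (\<Sum>j\<in>S. if j = 0 then a j * (2 * of_real pi) else 0)"
      by (intro sum.cong) auto
    also have "\<dots> = a 0 * (2 * of_real pi)" using S by (simp add: sum.delta)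
    finally have "integral {0..2*pi} (g S a) = a 0 * (2 * of_real pi)"
      by (simp add: g_def[abs_def] integral_unique)
    then have "2 * pi * ?m = norm (integral {0..2*pi} (g S a))" by (simp add: norm_mult)
    also have "\<dots> \<le> integral {0..2*pi} (\<lambda>t. norm (g S a t))"
      by (intro integral_norm_bound_integral continuous_on_UNIV_integrable_on continuous_intros cg) auto
    finally have 1: "2 * pi * ?m \<le> integral {0..2*pi} (\<lambda>t. norm (g S a t))" .
    have "p * ?m powr (p - 1) * integral {0..2*pi} (\<lambda>t. norm (g S a t)) = integral {0..2*pi} (\<lambda>t. p * ?m powr (p - 1) * norm (g S a t))"
      by simp
    also have "\<dots> \<le> integral {0..2*pi} (\<lambda>t. norm (g S a t) powr p + (p - 1) * ?m powr p)"
      by (intro integral_le powr_tangent_le integrable_add int_p continuous_on_UNIV_integrable_on continuous_intros cg) (use p in auto)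
    also have "\<dots> = N (g S a) + 2 * pi * (p - 1) * ?m powr p"
      unfolding N_def by (subst integral_add) (auto intro!: int_p cg)
    finally have 2: "p * ?m powr (p - 1) * integral {0..2*pi} (\<lambda>t. norm (g S a t)) \<le> N (g S a) + 2 * pi * (p - 1) * ?m powr p" .
    have "p * ?m powr (p - 1) * (2 * pi * ?m) \<le> p * ?m powr (p - 1) * integral {0..2*pi} (\<lambda>t. norm (g S a t))"
      using p by (intro mult_left_mono 1) auto
    also note 2
    also have "p * ?m powr (p - 1) * (2 * pi * ?m) = 2 * pi * p * ?m powr p"
      using powr_mult_base[of ?m "p - 1"] by (simp add: algebra_simps)
    finally show ?thesis by (simp add: algebra_simps)
  qed
  have N_nonneg: "N h \<ge> 0" for h unfolding N_def by (cases "(\<lambda>t. norm (h t) powr p) integrable_on {0..2*pi}") (auto intro: integral_nonneg simp: not_integrable_integral)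
  define C where "C = 3 powr p * (2 * C0 + 1)"
  have base: "N (g {j\<in>S. 0 \<le> j} a) \<le> C * N (g S a)" if S: "finite S" for S a
  proof -
    define a0 where "a0 = (if 0 \<in> S then a 0 else 0)"
    \<comment> \<open>Coefficientwise: for j > 0 both polynomials contribute a j; for j < 0 the
      conjugations make them cancel; at 0 they recombine real and imaginary part of a 0, which is
      needed once more.\<close>
    have split: "2 * g {j\<in>S. 0 \<le> j} a t = F S a (cis t) + \<i> * F S (\<lambda>j. - \<i> * a j) (cis t) + a0" for t
    proof -
      have "2 * g {j\<in>S. 0 \<le> j} a t = (\<Sum>j\<in>S. if 0 \<le> j then 2 * (a j * cis (of_int j * t)) else 0)"
        unfolding g_def sum_distrib_left using S by (simp add: sum.inter_filter)
      also have "\<dots> = (\<Sum>j\<in>S. Fe a j * cis t ^ nat \<bar>j\<bar> + \<i> * (Fe (\<lambda>j. - \<i> * a j) j * cis t ^ nat \<bar>j\<bar>) + (if j = 0 then a 0 else 0))"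
      proof (rule sum.cong[OF refl])
        fix j
        show "(if 0 \<le> j then 2 * (a j * cis (of_int j * t)) else 0) =
         Fe a j * cis t ^ nat \<bar>j\<bar> + \<i> * (Fe (\<lambda>j. - \<i> * a j) j * cis t ^ nat \<bar>j\<bar>) + (if j = 0 then a 0 else 0)"
          by (cases j "0::int" rule: linorder_cases) (auto simp: Fe_def cis_pow complex_eq_iff)
      qed
      also have "\<dots> = F S a (cis t) + \<i> * F S (\<lambda>j. - \<i> * a j) (cis t) + a0"
        unfolding F_def a0_def using S by (simp add: sum.distrib sum_distrib_left sum.delta)
      finally show ?thesis .
    qed
    have a0N: "2 * pi * norm a0 powr p \<le> N (g S a)"
      unfolding a0_def using a0_bound[of S a] S N_nonneg p by auto
    have Ng: "N (g S (\<lambda>j. - \<i> * a j)) = N (g S a)"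
    proof -
      have "g S (\<lambda>j. - \<i> * a j) t = - \<i> * g S a t" for t
        unfolding g_def sum_distrib_left by (simp add: mult_ac)
      then show ?thesis by (simp add: N_def norm_mult)
    qed
    let ?F1 = "\<lambda>t. F S a (cis t)" and ?F2 = "\<lambda>t. F S (\<lambda>j. - \<i> * a j) (cis t)"
    have cF: "continuous_on UNIV ?F1" "continuous_on UNIV ?F2" by (rule cF')+
    have pw: "norm (g {j\<in>S. 0 \<le> j} a t) powr p \<le> 3 powr p * (norm (?F1 t) powr p + norm (?F2 t) powr p + norm a0 powr p)" for t
    proof -
      define M where "M = max (norm (?F1 t)) (max (norm (?F2 t)) (norm a0))"
      have "2 * norm (g {j\<in>S. 0 \<le> j} a t) = norm (2 * g {j\<in>S. 0 \<le> j} a t)" by (simp add: norm_mult)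
      also have "\<dots> \<le> norm (?F1 t) + norm (\<i> * ?F2 t) + norm a0"
        unfolding split by (meson add_mono_thms_linordered_semiring(3) norm_triangle_ineq order_trans)
      also have "\<dots> \<le> 3 * M" by (simp add: M_def norm_mult)
      finally have "norm (g {j\<in>S. 0 \<le> j} a t) \<le> 3 * M" by (smt (verit) norm_ge_zero)
      then have "norm (g {j\<in>S. 0 \<le> j} a t) powr p \<le> (3 * M) powr p"
        using p by (intro powr_mono2) auto
      also have "\<dots> = 3 powr p * M powr p" by (rule powr_mult)
      also have "M powr p \<le> norm (?F1 t) powr p + norm (?F2 t) powr p + norm a0 powr p"
        unfolding M_def max_def by (simp add: add_nonneg_nonneg)
      finally show ?thesis by simp
    qed
    have "N (g {j\<in>S. 0 \<le> j} a) \<le> integral {0..2*pi} (\<lambda>t. 3 powr p * (norm (?F1 t) powr p + norm (?F2 t) powr p + norm a0 powr p))"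
      unfolding N_def by (intro integral_le pw int_p cg integrable_on_mult_right integrable_add cF) auto
    also have "\<dots> = 3 powr p * (N ?F1 + N ?F2 + 2 * pi * norm a0 powr p)"
    proof -
      have "integral {0..2*pi} (\<lambda>t. norm (?F1 t) powr p + norm (?F2 t) powr p + norm a0 powr p) =
         integral {0..2*pi} (\<lambda>t. norm (?F1 t) powr p + norm (?F2 t) powr p) + integral {0..2*pi} (\<lambda>t. norm a0 powr p)"
        by (intro integral_add integrable_add int_p cF) auto
      also have "\<dots> = N ?F1 + N ?F2 + 2 * pi * norm a0 powr p"
        unfolding N_def by (subst integral_add) (auto intro!: int_p cF')
      finally show ?thesis by simp
    qed
    also have "\<dots> \<le> 3 powr p * (C0 * N (g S a) + C0 * N (g S a) + N (g S a))"
      using F_bound[OF S, of a] F_bound[OF S, of "\<lambda>j. - \<i> * a j"] a0N unfolding Ng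
      by (intro mult_left_mono add_mono) auto
    finally show ?thesis by (simp add: C_def algebra_simps)
  qed
  have "N (g {j\<in>S. m \<le> j} a) \<le> C * N (g S a)" if S: "finite S" for S a m
  proof -
    \<comment> \<open>Moving the cut from m to 0 multiplies the polynomial by a unimodular character
      and leaves all moduli unchanged, so the constant does not depend on m.\<close>
    define S' where "S' = (\<lambda>j. j - m) ` S"
    have shift: "g ((\<lambda>j. j - m) ` R) (\<lambda>j. a (j + m)) t = cis (- of_int m * t) * g R a t" for R t
    proof -
      have "g ((\<lambda>j. j - m) ` R) (\<lambda>j. a (j + m)) t = (\<Sum>j\<in>R. a j * cis (of_int (j - m) * t))"
        unfolding g_def by (subst sum.reindex) (auto simp: inj_on_def)
      also have "\<dots> = (\<Sum>j\<in>R. cis (- of_int m * t) * (a j * cis (of_int j * t)))"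
      proof (rule sum.cong[OF refl])
        fix j
        have "cis (of_int (j - m) * t) = cis (- of_int m * t) * cis (of_int j * t)"
          by (simp add: cis_mult algebra_simps)
        then show "a j * cis (of_int (j - m) * t) = cis (- of_int m * t) * (a j * cis (of_int j * t))" by simp
      qed
      finally show ?thesis by (simp add: g_def sum_distrib_left)
    qed
    have "{j\<in>S'. 0 \<le> j} = (\<lambda>j. j - m) ` {j\<in>S. m \<le> j}" by (auto simp: S'_def)
    then have "N (g {j\<in>S'. 0 \<le> j} (\<lambda>j. a (j + m))) = N (g {j\<in>S. m \<le> j} a)"
      unfolding N_def by (simp add: shift norm_mult)
    moreover have "N (g S' (\<lambda>j. a (j + m))) = N (g S a)"
      unfolding N_def S'_def by (simp add: shift norm_mult)
    ultimately show ?thesis using base[of S' "\<lambda>j. a (j + m)"] S by (simp add: S'_def)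
  qed
  then have "\<And>S a m. finite S \<Longrightarrow>
     integral {0..2*pi} (\<lambda>t. norm (\<Sum>j\<in>{j\<in>S. m \<le> j}. a j * cis (of_int j * t)) powr p)
       \<le> C * integral {0..2*pi} (\<lambda>t. norm (\<Sum>j\<in>S. a j * cis (of_int j * t)) powr p)"
    unfolding N_def g_def .
  moreover have "C > 0" using C0 p by (simp add: C_def)
  ultimately show ?thesis by blast
qed

section \<open>The norm on the torus\<close>

lemma square2pi_measurable [measurable]: "square2pi \<in> sets borel"
  unfolding square2pi_def by (intro borel_closed closed_Times) auto

lemma nn_integral_square2pi:
  assumes [measurable]: "h \<in> borel_measurable borel"
  shows "(\<integral>\<^sup>+z\<in>square2pi. h z \<partial>lborel) =
      (\<integral>\<^sup>+x\<in>{0..2*pi}. (\<integral>\<^sup>+y\<in>{0..2*pi}. h (x, y) \<partial>lborel) \<partial>lborel)"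
    and "(\<integral>\<^sup>+z\<in>square2pi. h z \<partial>lborel) =
      (\<integral>\<^sup>+y\<in>{0..2*pi}. (\<integral>\<^sup>+x\<in>{0..2*pi}. h (x, y) \<partial>lborel) \<partial>lborel)"
proof -
  have [measurable]: "h \<in> borel_measurable (lborel \<Otimes>\<^sub>M lborel)"
    by (simp add: lborel_prod)
  have ind: "indicator square2pi (x, y) = (indicator {0..2*pi} x * indicator {0..2*pi} y :: ennreal)" for x y
    by (auto simp: square2pi_def indicator_def)
  have [measurable]: "(\<lambda>x. h (x, y)) \<in> borel_measurable borel" "(\<lambda>y. h (x, y)) \<in> borel_measurable borel" for x y
    by (intro measurable_compose[OF _ assms(1)] borel_measurable_continuous_onI continuous_intros)+
  have 1: "(\<integral>\<^sup>+y. h (x, y) * indicator square2pi (x, y) \<partial>lborel) = (\<integral>\<^sup>+y\<in>{0..2*pi}. h (x, y) \<partial>lborel) * indicator {0..2*pi} x" for x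
    unfolding ind by (subst nn_integral_multc[symmetric]) (auto simp: mult_ac)
  have 2: "(\<integral>\<^sup>+x. h (x, y) * indicator square2pi (x, y) \<partial>lborel) = (\<integral>\<^sup>+x\<in>{0..2*pi}. h (x, y) \<partial>lborel) * indicator {0..2*pi} y" for y
    unfolding ind by (subst nn_integral_multc[symmetric]) (auto simp: mult_ac)
  show "(\<integral>\<^sup>+z\<in>square2pi. h z \<partial>lborel) = (\<integral>\<^sup>+x\<in>{0..2*pi}. (\<integral>\<^sup>+y\<in>{0..2*pi}. h (x, y) \<partial>lborel) \<partial>lborel)"
    unfolding lborel_prod[symmetric] by (subst lborel.nn_integral_fst[symmetric]) (auto simp: 1 lborel_prod)
  show "(\<integral>\<^sup>+z\<in>square2pi. h z \<partial>lborel) = (\<integral>\<^sup>+y\<in>{0..2*pi}. (\<integral>\<^sup>+x\<in>{0..2*pi}. h (x, y) \<partial>lborel) \<partial>lborel)"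
    unfolding lborel_prod[symmetric] by (subst lborel_pair.nn_integral_snd[symmetric]) (auto simp: 2 lborel_prod)
qed

lemma nn_integral_lborel_translate:
  fixes h :: "real \<Rightarrow> ennreal"
  assumes [measurable]: "h \<in> borel_measurable borel"
  shows "(\<integral>\<^sup>+x. h (x + a) \<partial>lborel) = (\<integral>\<^sup>+x. h x \<partial>lborel)"
  using nn_integral_real_affine[of h 1 a] by (simp add: add.commute)

lemma nn_integral_periodic_shift:
  fixes h :: "real \<Rightarrow> ennreal"
  assumes [measurable]: "h \<in> borel_measurable borel" and per: "\<And>x. h (x + 2 * pi) = h x"
  shows "(\<integral>\<^sup>+x\<in>{0..2*pi}. h (x + a) \<partial>lborel) = (\<integral>\<^sup>+x\<in>{0..2*pi}. h x \<partial>lborel)"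
proof -
  have half_open: "(\<integral>\<^sup>+x\<in>{0..2*pi}. f x \<partial>lborel) = (\<integral>\<^sup>+x\<in>{0..<2*pi}. f x \<partial>lborel)" for f :: "real \<Rightarrow> ennreal"
    by (intro nn_integral_cong_AE eventually_mono[OF AE_lborel_singleton[of "2*pi"]]) (auto simp: indicator_def)
  have pern: "h (x + of_nat n * (2 * pi)) = h x" for x n
  proof (induction n)
    case (Suc n)
    have "h (x + of_nat (Suc n) * (2 * pi)) = h ((x + of_nat n * (2 * pi)) + 2 * pi)"
      by (simp add: algebra_simps)
    then show ?case using per Suc by simp
  qed simp
  have peri: "h (x + of_int m * (2 * pi)) = h x" for x m
  proof (cases "m \<ge> 0")
    case True then show ?thesis using pern[of x "nat m"] by simp
  next
    case False then show ?thesis using pern[of "x + of_int m * (2 * pi)" "nat (- m)"] by simp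
  qed
  have shift: "(\<integral>\<^sup>+x\<in>{u..<v}. h x \<partial>lborel) = (\<integral>\<^sup>+x\<in>{u - of_int m * (2*pi)..<v - of_int m * (2*pi)}. h x \<partial>lborel)" for u v m
    by (subst nn_integral_lborel_translate[of _ "of_int m * (2*pi)", symmetric])
      (auto simp: peri indicator_def intro!: nn_integral_cong)
  \<comment> \<open>b is the multiple of 2 pi inside (a, a + 2 pi]. The interval from a to b is
    moved back by m periods, the rest by m + 1, and the two images tile [0, 2 pi); half-open
    intervals avoid an overlap.\<close>
  define m where "m = \<lfloor>a / (2 * pi)\<rfloor>"
  define b where "b = of_int (m + 1) * (2 * pi)"
  have b: "a \<le> b" "b \<le> a + 2 * pi"
  proof -
    have "of_int m \<le> a / (2 * pi)" "a / (2 * pi) \<le> of_int m + 1"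
      unfolding m_def by linarith+
    then show "a \<le> b" "b \<le> a + 2 * pi"
      by (simp_all add: b_def field_simps)
  qed
  have add: "(\<integral>\<^sup>+x\<in>{u..<w}. h x \<partial>lborel) = (\<integral>\<^sup>+x\<in>{u..<v}. h x \<partial>lborel) + (\<integral>\<^sup>+x\<in>{v..<w}. h x \<partial>lborel)"
    if "u \<le> v" "v \<le> w" for u v w
    by (subst nn_integral_add[symmetric]) (use that in \<open>auto simp: indicator_def intro!: nn_integral_cong\<close>)
  have "(\<integral>\<^sup>+x\<in>{0..<2*pi}. h (x + a) \<partial>lborel) = (\<integral>\<^sup>+x\<in>{a..<a + 2*pi}. h x \<partial>lborel)"
    by (subst (2) nn_integral_lborel_translate[of _ a, symmetric]) (auto simp: indicator_def intro!: nn_integral_cong)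
  also have "\<dots> = (\<integral>\<^sup>+x\<in>{a..<b}. h x \<partial>lborel) + (\<integral>\<^sup>+x\<in>{b..<a + 2*pi}. h x \<partial>lborel)"
    by (rule add[OF b])
  also have "(\<integral>\<^sup>+x\<in>{a..<b}. h x \<partial>lborel) = (\<integral>\<^sup>+x\<in>{a + 2*pi - b..<2*pi}. h x \<partial>lborel)"
    by (subst shift[of _ _ m]) (simp add: b_def algebra_simps)
  also have "(\<integral>\<^sup>+x\<in>{b..<a + 2*pi}. h x \<partial>lborel) = (\<integral>\<^sup>+x\<in>{0..<a + 2*pi - b}. h x \<partial>lborel)"
    by (subst shift[of _ _ "m + 1"]) (simp add: b_def algebra_simps)
  also have "(\<integral>\<^sup>+x\<in>{a + 2*pi - b..<2*pi}. h x \<partial>lborel) + (\<integral>\<^sup>+x\<in>{0..<a + 2*pi - b}. h x \<partial>lborel) = (\<integral>\<^sup>+x\<in>{0..<2*pi}. h x \<partial>lborel)"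
    by (subst (3) add[of _ "a + 2*pi - b"]) (use b in \<open>auto simp: add.commute\<close>)
  finally show ?thesis unfolding half_open .
qed

lemma nn_integral_square2pi_shift:
  fixes h :: "real \<times> real \<Rightarrow> ennreal"
  assumes [measurable]: "h \<in> borel_measurable borel"
    and per: "\<And>x y. h (x + 2 * pi, y) = h (x, y)" "\<And>x y. h (x, y + 2 * pi) = h (x, y)"
  shows "(\<integral>\<^sup>+z\<in>square2pi. h (z + a) \<partial>lborel) = (\<integral>\<^sup>+z\<in>square2pi. h z \<partial>lborel)"
proof -
  obtain a1 a2 where a: "a = (a1, a2)" by (cases a)
  have [measurable]: "(\<lambda>x. h (x, y)) \<in> borel_measurable borel" "(\<lambda>y. h (x, y)) \<in> borel_measurable borel" for x y
    by (intro measurable_compose[OF _ assms(1)] borel_measurable_continuous_onI continuous_intros)+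
  have m[measurable]: "(\<lambda>z. h (z + a)) \<in> borel_measurable borel" for a
    by (intro measurable_compose[OF _ assms(1)] borel_measurable_continuous_onI continuous_intros)
  have "(\<integral>\<^sup>+z\<in>square2pi. h (z + a) \<partial>lborel) = (\<integral>\<^sup>+x\<in>{0..2*pi}. (\<integral>\<^sup>+y\<in>{0..2*pi}. h (x + a1, y + a2) \<partial>lborel) \<partial>lborel)"
    by (subst nn_integral_square2pi(1)) (auto simp: a)
  also have "\<dots> = (\<integral>\<^sup>+x\<in>{0..2*pi}. (\<integral>\<^sup>+y\<in>{0..2*pi}. h (x + a1, y) \<partial>lborel) \<partial>lborel)"
    by (subst nn_integral_periodic_shift) (auto simp: per)
  also have "\<dots> = (\<integral>\<^sup>+z\<in>square2pi. h (z + (a1, 0)) \<partial>lborel)"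
    by (subst nn_integral_square2pi(1)) auto
  also have "\<dots> = (\<integral>\<^sup>+y\<in>{0..2*pi}. (\<integral>\<^sup>+x\<in>{0..2*pi}. h (x + a1, y) \<partial>lborel) \<partial>lborel)"
    by (subst nn_integral_square2pi(2)) auto
  also have "\<dots> = (\<integral>\<^sup>+y\<in>{0..2*pi}. (\<integral>\<^sup>+x\<in>{0..2*pi}. h (x, y) \<partial>lborel) \<partial>lborel)"
    by (subst nn_integral_periodic_shift) (auto simp: per)
  also have "\<dots> = (\<integral>\<^sup>+z\<in>square2pi. h z \<partial>lborel)"
    by (subst nn_integral_square2pi(2)) auto
  finally show ?thesis .
qed

section \<open>Norm inequalities for averages, limits and symmetries\<close>

lemma Lp_norm_lborel:
  "Lp_norm p f = (let I = (\<integral>\<^sup>+ z \<in> square2pi. ennreal (norm (f z) powr p) \<partial>lborel)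
      in if I = \<infinity> then \<infinity> else ennreal (enn2real I powr (1 / p)))"
  by (simp add: Lp_norm_def nn_integral_completion)

text \<open>Replaces the root and the case distinction at infinity by an inequality between p-th
  powers; by \<open>ennreal_le_boundI\<close> finite bounds b are enough.\<close>

lemma Lp_norm_le_iff:
  assumes "p > 0" "b \<ge> 0"
  shows "Lp_norm p g \<le> ennreal b \<longleftrightarrow> (\<integral>\<^sup>+ z \<in> square2pi. ennreal (norm (g z) powr p) \<partial>lborel) \<le> ennreal (b powr p)"
proof -
  define I where "I = (\<integral>\<^sup>+ z \<in> square2pi. ennreal (norm (g z) powr p) \<partial>lborel)"
  show ?thesis
  proof (cases I)
    case (real r)
    have "r powr (1 / p) \<le> b \<longleftrightarrow> r \<le> b powr p"
    proof
      assume "r powr (1 / p) \<le> b"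
      then have "(r powr (1 / p)) powr p \<le> b powr p" using assms by (intro powr_mono2) auto
      then show "r \<le> b powr p" using real assms by (simp add: powr_powr)
    next
      assume "r \<le> b powr p"
      then have "r powr (1 / p) \<le> (b powr p) powr (1 / p)" using assms real by (intro powr_mono2) auto
      then show "r powr (1 / p) \<le> b" using real assms by (simp add: powr_powr)
    qed
    then show ?thesis using real assms I_def[symmetric] by (simp add: Lp_norm_lborel Let_def)
  next
    case top
    then show ?thesis using I_def[symmetric] by (simp add: Lp_norm_lborel top_unique)
  qed
qed

lemma Lp_norm_cong_AE:
  assumes "AE z in lborel. norm (f z) = norm (g z)"
  shows "Lp_norm p f = Lp_norm p g"
  unfolding Lp_norm_lborel
  by (subst nn_integral_cong_AE[where v="\<lambda>z. ennreal (norm (g z) powr p) * indicator square2pi z"])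
    (use assms in auto)

lemma ennreal_le_boundI:
  fixes x y :: ennreal
  assumes "\<And>b. 0 \<le> b \<Longrightarrow> y \<le> ennreal b \<Longrightarrow> x \<le> ennreal b"
  shows "x \<le> y"
  using assms[of "enn2real y"] by (cases y) auto

lemma Lp_norm_zero [simp]: "Lp_norm p (\<lambda>z. 0) = 0"
  by (simp add: Lp_norm_lborel Let_def)

text \<open>Minkowski's integral inequality for a uniform bound B: Jensen's inequality for the
  measure |w| / W at each point, followed by Tonelli. The measure is kept general so that both
  finite sums and Fejer averages are instances.\<close>

lemma Lp_norm_weighted_average:
  fixes w :: "'a \<Rightarrow> complex" and F :: "'a \<Rightarrow> real \<times> real \<Rightarrow> complex"
  assumes "sigma_finite_measure M" and p: "1 \<le> p"
    and F[measurable]: "(\<lambda>(t, z). F t z) \<in> borel_measurable (M \<Otimes>\<^sub>M lborel)"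
    and w: "integrable M w"
    and le: "\<And>t. t \<in> space M \<Longrightarrow> Lp_norm p (F t) \<le> B"
  shows "Lp_norm p (\<lambda>z. LINT t|M. w t * F t z) \<le> ennreal (LINT t|M. norm (w t)) * B"
proof -
  interpret sigma_finite_measure M by fact
  interpret pair_sigma_finite M "lborel :: (real \<times> real) measure"
    by (intro pair_sigma_finite.intro sigma_finite_measure_axioms lborel.sigma_finite_measure_axioms)
  have [measurable]: "w \<in> borel_measurable M" using w by simp
  have [measurable]: "(\<lambda>t. F t z) \<in> borel_measurable M" for z
    by (rule measurable_compose[OF _ F[unfolded case_prod_unfold], of "\<lambda>t. (t, z)", simplified]) simp
  define W where "W = (LINT t|M. norm (w t))"
  have W: "(\<integral>\<^sup>+t. ennreal (norm (w t)) \<partial>M) = ennreal W"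
    unfolding W_def by (intro nn_integral_eq_integral integrable_norm w) auto
  have W0: "W \<ge> 0" unfolding W_def by (rule Bochner_Integration.integral_nonneg) auto
  show ?thesis unfolding W_def[symmetric]
  proof (cases "W = 0")
    case True
    then have "AE t in M. w t = 0"
      using W True by (simp add: nn_integral_0_iff_AE)
    then have "(LINT t|M. w t * F t z) = 0" for z
      by (intro integral_eq_zero_AE) auto
    then show "Lp_norm p (\<lambda>z. LINT t|M. w t * F t z) \<le> ennreal W * B" by simp
  next
    case False
    then have Wpos: "W > 0" using W0 by simp
    show "Lp_norm p (\<lambda>z. LINT t|M. w t * F t z) \<le> ennreal W * B"
    proof (cases B)
      case top
      then show ?thesis using Wpos by (simp add: ennreal_mult_top)
    next
      case (real b)
      have pw: "ennreal (norm (LINT t|M. w t * F t z) powr p) \<le> ennreal (W powr (p - 1)) * (\<integral>\<^sup>+t. ennreal (norm (w t) * norm (F t z) powr p) \<partial>M)" for z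
      proof -
        define R where "R = (\<integral>\<^sup>+t. ennreal (norm (w t) * norm (F t z) powr p) \<partial>M)"
        define I where "I = norm (LINT t|M. w t * F t z)"
        have "ennreal (I powr p) \<le> ennreal (W powr (p - 1)) * R"
        proof (cases R)
          case top
          then show ?thesis using Wpos by (simp add: ennreal_mult_top)
        next
          case (real r)
          \<comment> \<open>The point at which the tangent to x^p is taken; for it the tangent
            inequality is exactly Jensen's.\<close>
          define m where "m = I / W"
          have I0: "I \<ge> 0" by (simp add: I_def)
          have m0: "m \<ge> 0" using I0 Wpos by (simp add: m_def)
          \<comment> \<open>Where the integrand is not integrable the Bochner integral is 0 and the
            bound is trivial, so no integrability of F has to be assumed.\<close>
          have Ib: "ennreal I \<le> (\<integral>\<^sup>+t. ennreal (norm (w t) * norm (F t z)) \<partial>M)"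
          proof (cases "integrable M (\<lambda>t. w t * F t z)")
            case True
            then show ?thesis unfolding I_def using integral_norm_bound_ennreal[OF True] by (simp add: norm_mult)
          qed (simp add: I_def not_integrable_integral_eq)
          have "ennreal (p * m powr (p - 1) * I) \<le> ennreal (p * m powr (p - 1)) * (\<integral>\<^sup>+t. ennreal (norm (w t) * norm (F t z)) \<partial>M)"
            using Ib p by (subst ennreal_mult) (auto intro!: mult_left_mono I0)
          also have "\<dots> = (\<integral>\<^sup>+t. ennreal (norm (w t) * (p * m powr (p - 1) * norm (F t z))) \<partial>M)"
            using p by (subst nn_integral_cmult[symmetric]) (auto simp: ennreal_mult[symmetric] mult_ac)
          also have "\<dots> \<le> (\<integral>\<^sup>+t. ennreal (norm (w t) * (norm (F t z) powr p + (p - 1) * m powr p)) \<partial>M)"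
            using p m0 by (intro nn_integral_mono ennreal_leI mult_left_mono powr_tangent_le) auto
          also have "\<dots> = (\<integral>\<^sup>+t. ennreal (norm (w t) * norm (F t z) powr p) + ennreal ((p - 1) * m powr p) * ennreal (norm (w t)) \<partial>M)"
          proof (intro nn_integral_cong)
            fix t
            have "norm (w t) * (norm (F t z) powr p + (p - 1) * m powr p) = norm (w t) * norm (F t z) powr p + (p - 1) * m powr p * norm (w t)"
              by (simp only: distrib_left mult_ac)
            then show "ennreal (norm (w t) * (norm (F t z) powr p + (p - 1) * m powr p)) = ennreal (norm (w t) * norm (F t z) powr p) + ennreal ((p - 1) * m powr p) * ennreal (norm (w t))"
              using p by (simp only:) (subst ennreal_plus, auto simp: ennreal_mult)
          qed
          also have "\<dots> = R + ennreal ((p - 1) * m powr p) * ennreal W"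
            by (subst nn_integral_add) (auto simp: R_def nn_integral_cmult W)
          also have "\<dots> = ennreal (r + (p - 1) * m powr p * W)"
            using real p W0 by (simp add: ennreal_mult[symmetric] ennreal_plus[symmetric] del: ennreal_plus)
          finally have "p * m powr (p - 1) * I \<le> r + (p - 1) * m powr p * W"
            using real p W0 by (subst (asm) ennreal_le_iff) auto
          moreover have "m powr (p - 1) * I = m powr p * W"
          proof -
            have "I = m * W" using Wpos by (simp add: m_def)
            then show ?thesis using powr_mult_base[OF m0, of "p - 1"] by (simp add: mult_ac)
          qed
          ultimately have "p * (m powr p * W) \<le> r + (p - 1) * (m powr p * W)"
            by (simp add: mult.assoc)
          then have "m powr p * W \<le> r" by (simp add: left_diff_distrib)
          then have "W powr (p - 1) * (m powr p * W) \<le> W powr (p - 1) * r" by (intro mult_left_mono) auto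
          moreover have "W powr (p - 1) * (m powr p * W) = I powr p"
          proof -
            have "W powr (p - 1) * W = W powr p" using powr_mult_base[OF W0, of "p - 1"] by (simp add: mult_ac)
            then have "W powr (p - 1) * (m powr p * W) = m powr p * W powr p" by (simp add: mult_ac)
            also have "\<dots> = (m * W) powr p" by (simp add: powr_mult)
            finally show ?thesis using Wpos by (simp add: m_def)
          qed
          ultimately show ?thesis using real by (simp add: ennreal_mult[symmetric])
        qed
        then show ?thesis unfolding R_def I_def .
      qed
      have "(\<integral>\<^sup>+ z \<in> square2pi. ennreal (norm (LINT t|M. w t * F t z) powr p) \<partial>lborel)
         \<le> (\<integral>\<^sup>+ z \<in> square2pi. ennreal (W powr (p - 1)) * (\<integral>\<^sup>+t. ennreal (norm (w t) * norm (F t z) powr p) \<partial>M) \<partial>lborel)"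
        by (intro nn_integral_mono mult_right_mono pw) auto
      also have "\<dots> = (\<integral>\<^sup>+ z. ennreal (W powr (p - 1)) * (\<integral>\<^sup>+t. ennreal (norm (w t) * norm (F t z) powr p) * indicator square2pi z \<partial>M) \<partial>lborel)"
        by (intro nn_integral_cong, subst nn_integral_multc) (auto simp: mult_ac)
      also have "\<dots> = ennreal (W powr (p - 1)) * (\<integral>\<^sup>+ z. (\<integral>\<^sup>+t. ennreal (norm (w t) * norm (F t z) powr p) * indicator square2pi z \<partial>M) \<partial>lborel)"
        by (intro nn_integral_cmult) measurable
      also have "(\<integral>\<^sup>+ z. (\<integral>\<^sup>+t. ennreal (norm (w t) * norm (F t z) powr p) * indicator square2pi z \<partial>M) \<partial>lborel)
          = (\<integral>\<^sup>+t. (\<integral>\<^sup>+ z. ennreal (norm (w t) * norm (F t z) powr p) * indicator square2pi z \<partial>lborel) \<partial>M)"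
        by (intro Fubini') measurable
      also have "\<dots> \<le> (\<integral>\<^sup>+t. ennreal (norm (w t)) * ennreal (b powr p) \<partial>M)"
      proof (intro nn_integral_mono)
        fix t assume t: "t \<in> space M"
        have [measurable]: "(\<lambda>z. F t z) \<in> borel_measurable lborel"
          by (rule measurable_compose[OF _ F[unfolded case_prod_unfold], of "\<lambda>z. (t, z)", simplified]) (use t in simp)
        have "(\<integral>\<^sup>+ z. ennreal (norm (w t) * norm (F t z) powr p) * indicator square2pi z \<partial>lborel)
           = ennreal (norm (w t)) * (\<integral>\<^sup>+ z \<in> square2pi. ennreal (norm (F t z) powr p) \<partial>lborel)"
          by (subst nn_integral_cmult[symmetric]) (auto simp: ennreal_mult mult_ac)
        also have "\<dots> \<le> ennreal (norm (w t)) * ennreal (b powr p)"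
          using le[OF t] real p by (intro mult_left_mono) (simp_all add: Lp_norm_le_iff)
        finally show "(\<integral>\<^sup>+ z. ennreal (norm (w t) * norm (F t z) powr p) * indicator square2pi z \<partial>lborel) \<le> \<dots>" .
      qed
      also have "\<dots> = ennreal W * ennreal (b powr p)"
        by (subst nn_integral_multc) (auto simp: W)
      also have "ennreal (W powr (p - 1)) * (ennreal W * ennreal (b powr p)) = ennreal ((W * b) powr p)"
      proof -
        have "W powr (p - 1) * (W * b powr p) = (W * b) powr p"
          using powr_mult_base[OF W0, of "p - 1"] by (simp add: powr_mult mult_ac)
        then show ?thesis using W0 by (simp add: ennreal_mult[symmetric])
      qed
      finally have "(\<integral>\<^sup>+ z \<in> square2pi. ennreal (norm (LINT t|M. w t * F t z) powr p) \<partial>lborel) \<le> ennreal ((W * b) powr p)"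
        by (simp add: mult_left_mono)
      then have "Lp_norm p (\<lambda>z. LINT t|M. w t * F t z) \<le> ennreal (W * b)"
        using p W0 real by (subst Lp_norm_le_iff) auto
      then show ?thesis using real W0 by (simp add: ennreal_mult)
    qed
  qed
qed

lemma Lp_norm_sum_le:
  assumes "1 \<le> p" "finite S" "\<And>i. i \<in> S \<Longrightarrow> g i \<in> borel_measurable borel" "\<And>i. i \<in> S \<Longrightarrow> Lp_norm p (g i) \<le> B"
  shows "Lp_norm p (\<lambda>z. \<Sum>i\<in>S. w i * g i z) \<le> ennreal (\<Sum>i\<in>S. norm (w i)) * B"
proof -
  have "(\<lambda>(i, z). g i z) \<in> borel_measurable (count_space S \<Otimes>\<^sub>M lborel)"
    using assms(2,3) by (intro measurable_pair_measure_countable1) (auto intro: countable_finite)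
  from Lp_norm_weighted_average[OF sigma_finite_measure_count_space_finite[OF assms(2)] assms(1) this, of w B]
  show ?thesis using assms by (simp add: lebesgue_integral_count_space_finite integrable_count_space)
qed

text \<open>Fatou's lemma applied to the p-th powers.\<close>

lemma Lp_norm_lim_le:
  assumes "p > 0" and [measurable]: "\<And>n. g n \<in> borel_measurable borel"
    and lim: "AE z in lborel. (\<lambda>n. g n z) \<longlonglongrightarrow> G z" and le: "\<And>n. Lp_norm p (g n) \<le> B"
  shows "Lp_norm p G \<le> B"
proof (rule ennreal_le_boundI)
  fix b assume b: "0 \<le> b" "B \<le> ennreal b"
  have "(\<integral>\<^sup>+ z \<in> square2pi. ennreal (norm (G z) powr p) \<partial>lborel) = (\<integral>\<^sup>+ z. liminf (\<lambda>n. ennreal (norm (g n z) powr p) * indicator square2pi z) \<partial>lborel)"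
  proof (intro nn_integral_cong_AE eventually_mono[OF lim])
    fix z assume "(\<lambda>n. g n z) \<longlonglongrightarrow> G z"
    then have "(\<lambda>n. norm (g n z) powr p) \<longlonglongrightarrow> norm (G z) powr p"
      by (intro tendsto_powr2 tendsto_norm tendsto_const) (use assms(1) in auto)
    then have "(\<lambda>n. ennreal (norm (g n z) powr p) * indicator square2pi z) \<longlonglongrightarrow> ennreal (norm (G z) powr p) * indicator square2pi z"
      by (cases "z \<in> square2pi") (auto intro!: tendsto_ennrealI)
    then show "ennreal (norm (G z) powr p) * indicator square2pi z = liminf (\<lambda>n. ennreal (norm (g n z) powr p) * indicator square2pi z)"
      by (simp add: lim_imp_Liminf)
  qed
  also have "\<dots> \<le> liminf (\<lambda>n. (\<integral>\<^sup>+ z. ennreal (norm (g n z) powr p) * indicator square2pi z \<partial>lborel))"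
    by (intro nn_integral_liminf) measurable
  also have "\<dots> \<le> liminf (\<lambda>n::nat. ennreal (b powr p))"
  proof (intro Liminf_mono always_eventually allI)
    fix n
    have "Lp_norm p (g n) \<le> ennreal b" using le b by (meson order_trans)
    then show "(\<integral>\<^sup>+ z. ennreal (norm (g n z) powr p) * indicator square2pi z \<partial>lborel) \<le> ennreal (b powr p)"
      using assms(1) b by (simp add: Lp_norm_le_iff)
  qed
  also have "\<dots> = ennreal (b powr p)" by (simp add: Liminf_const)
  finally show "Lp_norm p G \<le> ennreal b" using assms(1) b by (simp add: Lp_norm_le_iff)
qed

lemma Lp_norm_swap:
  assumes [measurable]: "g \<in> borel_measurable borel"
  shows "Lp_norm p (\<lambda>z. g (prod.swap z)) = Lp_norm p g"
proof -
  have [measurable]: "(\<lambda>z. g (prod.swap z)) \<in> borel_measurable borel"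
    by (intro measurable_compose[OF _ assms] borel_measurable_continuous_onI) (auto simp: prod.swap_def intro!: continuous_intros)
  show ?thesis
    unfolding Lp_norm_lborel by (subst nn_integral_square2pi(1), simp, subst nn_integral_square2pi(2)) simp_all
qed

text \<open>Reflection at pi instead of 0 maps the square onto itself, so that periodicity does not
  enter.\<close>

lemma Lp_norm_reflect:
  assumes [measurable]: "g \<in> borel_measurable borel"
  shows "Lp_norm p (\<lambda>z. g (2 * pi - fst z, snd z)) = Lp_norm p g"
proof -
  have [measurable]: "(\<lambda>z. g (2 * pi - fst z, snd z)) \<in> borel_measurable borel" "(\<lambda>x. g (x, y)) \<in> borel_measurable borel" for y
    by (intro measurable_compose[OF _ assms] borel_measurable_continuous_onI continuous_intros)+
  have "(\<integral>\<^sup>+x\<in>{0..2*pi}. ennreal (norm (g (2 * pi - x, y)) powr p) \<partial>lborel) = (\<integral>\<^sup>+x\<in>{0..2*pi}. ennreal (norm (g (x, y)) powr p) \<partial>lborel)" for y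
    by (subst (2) nn_integral_real_affine[where c = "-1" and t = "2 * pi"]) (auto simp: indicator_def intro!: nn_integral_cong)
  then show ?thesis
    unfolding Lp_norm_lborel by (subst (1 2) nn_integral_square2pi(2)) simp_all
qed

lemma Lp_norm_shift:
  assumes [measurable]: "g \<in> borel_measurable borel" and "periodic2 g"
  shows "Lp_norm p (\<lambda>z. g (z + a)) = Lp_norm p g"
  unfolding Lp_norm_lborel
  by (subst nn_integral_square2pi_shift[where h = "\<lambda>z. ennreal (norm (g z) powr p)"])
    (use assms in \<open>auto simp: periodic2_def\<close>)

section \<open>Multipliers on trigonometric polynomials\<close>

text \<open>The coefficients are a function on all integer pairs and N does the cutting off, so that
  a multiplier acts on \<open>c\<close> pointwise without any condition on supports.\<close>

definition trig_poly :: "nat \<Rightarrow> (int \<Rightarrow> int \<Rightarrow> complex) \<Rightarrow> real \<times> real \<Rightarrow> complex" where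
  "trig_poly N c z = (\<Sum>j\<in>{-int N..int N}. \<Sum>k\<in>{-int N..int N}. c j k * cis (of_int j * fst z + of_int k * snd z))"

lemma trig_poly_cong:
  "(\<And>j k. \<bar>j\<bar> \<le> int N \<Longrightarrow> \<bar>k\<bar> \<le> int N \<Longrightarrow> c j k = d j k) \<Longrightarrow> trig_poly N c = trig_poly N d"
  unfolding trig_poly_def by (intro ext sum.cong refl) auto

lemma continuous_on_trig_poly: "continuous_on S (trig_poly N c)"
  unfolding trig_poly_def[abs_def] by (intro continuous_intros)

lemma borel_measurable_trig_poly [measurable]: "trig_poly N c \<in> borel_measurable borel"
  by (intro borel_measurable_continuous_onI continuous_on_trig_poly)

lemma cis_add_period: "cis (a + of_int j * (2 * pi)) = cis a"
  using cis_mult[of a "of_int j * (2 * pi)"] cis_multiple_2pi[of "of_int j"] by (simp add: mult_ac)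

lemma periodic2_trig_poly: "periodic2 (trig_poly N c)"
proof -
  have "cis (of_int j * (x + 2 * pi) + of_int k * y) = cis (of_int j * x + of_int k * y)"
    "cis (of_int j * x + of_int k * (y + 2 * pi)) = cis (of_int j * x + of_int k * y)" for j k x y
    using cis_add_period[of "of_int j * x + of_int k * y" j] cis_add_period[of "of_int j * x + of_int k * y" k]
    by (simp_all add: algebra_simps)
  then show ?thesis by (simp add: periodic2_def trig_poly_def)
qed

lemma trig_poly_shift:
  "trig_poly N (\<lambda>j k. cis (of_int j * a + of_int k * b) * c j k) z = trig_poly N c (z + (a, b))"
proof -
  have "cis (of_int j * fst (z + (a, b)) + of_int k * snd (z + (a, b))) =
      cis (of_int j * a + of_int k * b) * cis (of_int j * fst z + of_int k * snd z)" for j k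
    by (simp add: cis_mult algebra_simps)
  then show ?thesis unfolding trig_poly_def by (intro sum.cong refl) simp
qed

lemma trig_poly_swap: "trig_poly N (\<lambda>j k. c k j) z = trig_poly N c (prod.swap z)"
  unfolding trig_poly_def by (subst sum.swap) (simp add: add.commute)

lemma trig_poly_reflect: "trig_poly N (\<lambda>j k. c (- j) k) z = trig_poly N c (2 * pi - fst z, snd z)"
  unfolding trig_poly_def
proof (rule sum.reindex_bij_witness[of _ uminus uminus])
  fix j :: int
  have "cis (of_int (- j) * (2 * pi - fst z) + of_int k * snd z) = cis (of_int j * fst z + of_int k * snd z)" for k
    using cis_add_period[of "of_int j * fst z + of_int k * snd z" "- j"] by (simp add: algebra_simps)
  then show "(\<Sum>k = - int N..int N. c (- j) k * cis (of_int (- j) * fst (2 * pi - fst z, snd z) + of_int k * snd (2 * pi - fst z, snd z))) =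
         (\<Sum>k = - int N..int N. c (- j) k * cis (of_int j * fst z + of_int k * snd z))"
    by simp
qed auto

lemma trig_poly_sum:
  "trig_poly N (\<lambda>j k. (\<Sum>i\<in>S. w i * l i j k) * c j k) z = (\<Sum>i\<in>S. w i * trig_poly N (\<lambda>j k. l i j k * c j k) z)"
proof -
  have "trig_poly N (\<lambda>j k. (\<Sum>i\<in>S. w i * l i j k) * c j k) z =
     (\<Sum>j\<in>{-int N..int N}. \<Sum>k\<in>{-int N..int N}. \<Sum>i\<in>S. w i * (l i j k * c j k * cis (of_int j * fst z + of_int k * snd z)))"
    unfolding trig_poly_def by (simp add: sum_distrib_right mult.assoc)
  also have "\<dots> = (\<Sum>i\<in>S. \<Sum>j\<in>{-int N..int N}. \<Sum>k\<in>{-int N..int N}. w i * (l i j k * c j k * cis (of_int j * fst z + of_int k * snd z)))"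
  proof -
    have "(\<Sum>k\<in>{-int N..int N}. \<Sum>i\<in>S. w i * (l i j k * c j k * cis (of_int j * fst z + of_int k * snd z)))
       = (\<Sum>i\<in>S. \<Sum>k\<in>{-int N..int N}. w i * (l i j k * c j k * cis (of_int j * fst z + of_int k * snd z)))" for j
      by (rule sum.swap)
    then show ?thesis by (simp only: sum.swap[of _ S])
  qed
  finally show ?thesis unfolding trig_poly_def sum_distrib_left .
qed

text \<open>Testing on polynomials of every degree with one constant avoids all questions of
  convergence. The clause 0 \<le> K matters because \<open>ennreal\<close> sends negative numbers to
  0.\<close>

definition Lp_multiplier :: "real \<Rightarrow> real \<Rightarrow> (int \<Rightarrow> int \<Rightarrow> complex) \<Rightarrow> bool" where
  "Lp_multiplier p K l \<longleftrightarrow> 0 \<le> K \<and>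
     (\<forall>N c. Lp_norm p (trig_poly N (\<lambda>j k. l j k * c j k)) \<le> ennreal K * Lp_norm p (trig_poly N c))"

section \<open>Algebra of multipliers\<close>

lemma Lp_multiplierD: "Lp_multiplier p K l \<Longrightarrow> Lp_norm p (trig_poly N (\<lambda>j k. l j k * c j k)) \<le> ennreal K * Lp_norm p (trig_poly N c)"
  by (auto simp: Lp_multiplier_def)

lemma Lp_multiplier_nonneg: "Lp_multiplier p K l \<Longrightarrow> 0 \<le> K"
  by (simp add: Lp_multiplier_def)

lemma Lp_multiplier_mono: "Lp_multiplier p K l \<Longrightarrow> K \<le> L \<Longrightarrow> Lp_multiplier p L l"
  unfolding Lp_multiplier_def by (meson ennreal_leI mult_right_mono order_trans zero_le)

lemma Lp_multiplier_mult:
  assumes "Lp_multiplier p K l" "Lp_multiplier p L m"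
  shows "Lp_multiplier p (K * L) (\<lambda>j k. l j k * m j k)"
  unfolding Lp_multiplier_def
proof (intro conjI allI)
  show "0 \<le> K * L" using assms by (simp add: Lp_multiplier_def)
  fix N c
  have "Lp_norm p (trig_poly N (\<lambda>j k. l j k * (m j k * c j k))) \<le> ennreal K * Lp_norm p (trig_poly N (\<lambda>j k. m j k * c j k))"
    by (rule Lp_multiplierD[OF assms(1)])
  also have "\<dots> \<le> ennreal K * (ennreal L * Lp_norm p (trig_poly N c))"
    by (intro mult_left_mono Lp_multiplierD[OF assms(2)]) auto
  finally show "Lp_norm p (trig_poly N (\<lambda>j k. l j k * m j k * c j k)) \<le> ennreal (K * L) * Lp_norm p (trig_poly N c)"
    using assms by (simp add: mult.assoc ennreal_mult Lp_multiplier_def)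
qed

lemma Lp_multiplier_sum:
  assumes "1 \<le> p" "finite S" "\<And>i. i \<in> S \<Longrightarrow> Lp_multiplier p K (l i)" "0 \<le> K"
  shows "Lp_multiplier p ((\<Sum>i\<in>S. norm (w i)) * K) (\<lambda>j k. \<Sum>i\<in>S. w i * l i j k)"
  unfolding Lp_multiplier_def
proof (intro conjI allI)
  show "0 \<le> (\<Sum>i\<in>S. norm (w i)) * K" using assms(4) by (auto intro!: mult_nonneg_nonneg sum_nonneg)
  fix N c
  have "Lp_norm p (trig_poly N (\<lambda>j k. (\<Sum>i\<in>S. w i * l i j k) * c j k)) =
      Lp_norm p (\<lambda>z. \<Sum>i\<in>S. w i * trig_poly N (\<lambda>j k. l i j k * c j k) z)"
    by (intro arg_cong[of _ _ "Lp_norm p"] ext trig_poly_sum)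
  also have "\<dots> \<le> ennreal (\<Sum>i\<in>S. norm (w i)) * (ennreal K * Lp_norm p (trig_poly N c))"
    by (intro Lp_norm_sum_le assms Lp_multiplierD) auto
  finally show "Lp_norm p (trig_poly N (\<lambda>j k. (\<Sum>i\<in>S. w i * l i j k) * c j k))
      \<le> ennreal ((\<Sum>i\<in>S. norm (w i)) * K) * Lp_norm p (trig_poly N c)"
    using assms(4) by (simp add: mult.assoc ennreal_mult sum_nonneg)
qed

lemma Lp_multiplier_add:
  assumes "1 \<le> p" "Lp_multiplier p K l" "Lp_multiplier p K m"
  shows "Lp_multiplier p (2 * K) (\<lambda>j k. l j k + m j k)"
  using Lp_multiplier_sum[where S = "UNIV :: bool set" and l = "\<lambda>b. if b then l else m" and w = "\<lambda>_. 1" and p = p and K = K] assms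
  by (auto simp: UNIV_bool Lp_multiplier_nonneg add.commute)

lemma Lp_multiplier_cmult:
  assumes "1 \<le> p" "Lp_multiplier p K l"
  shows "Lp_multiplier p (norm a * K) (\<lambda>j k. a * l j k)"
  using Lp_multiplier_sum[where S = "{()}" and l = "\<lambda>_. l" and w = "\<lambda>_. a" and p = p and K = K] assms
  by (auto simp: Lp_multiplier_nonneg)

text \<open>For fixed N only finitely many coefficients occur, so pointwise convergence of the
  symbols gives pointwise convergence of the polynomials, and Fatou's lemma applies.\<close>

lemma Lp_multiplier_lim:
  assumes "0 < p" "\<And>n. Lp_multiplier p K (l n)" "\<And>j k. (\<lambda>n::nat. l n j k) \<longlonglongrightarrow> L j k"
  shows "Lp_multiplier p K L"
  unfolding Lp_multiplier_def
proof (intro conjI allI)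
  show "0 \<le> K" using Lp_multiplier_nonneg[OF assms(2)] .
  fix N c
  show "Lp_norm p (trig_poly N (\<lambda>j k. L j k * c j k)) \<le> ennreal K * Lp_norm p (trig_poly N c)"
  proof (rule Lp_norm_lim_le[OF assms(1) _ _ Lp_multiplierD[OF assms(2)]])
    show "AE z in lborel. (\<lambda>n. trig_poly N (\<lambda>j k. l n j k * c j k) z) \<longlonglongrightarrow> trig_poly N (\<lambda>j k. L j k * c j k) z"
      unfolding trig_poly_def by (intro AE_I2 tendsto_intros assms(3))
  qed simp
qed

lemma Lp_multiplier_translation: "Lp_multiplier p 1 (\<lambda>j k. cis (of_int j * a + of_int k * b))"
  unfolding Lp_multiplier_def
proof (intro conjI allI)
  fix N c
  have "Lp_norm p (trig_poly N (\<lambda>j k. cis (of_int j * a + of_int k * b) * c j k)) = Lp_norm p (\<lambda>z. trig_poly N c (z + (a, b)))"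
    by (intro arg_cong[of _ _ "Lp_norm p"] ext trig_poly_shift)
  also have "\<dots> = Lp_norm p (trig_poly N c)" by (intro Lp_norm_shift periodic2_trig_poly) simp
  finally show "Lp_norm p (trig_poly N (\<lambda>j k. cis (of_int j * a + of_int k * b) * c j k)) \<le> ennreal 1 * Lp_norm p (trig_poly N c)"
    by simp
qed simp

lemma Lp_multiplier_one: "Lp_multiplier p 1 (\<lambda>j k. 1)"
  using Lp_multiplier_translation[of p 0 0] by simp

lemma Lp_multiplier_reflect:
  assumes "Lp_multiplier p K l" shows "Lp_multiplier p K (\<lambda>j k. l (- j) k)"
  unfolding Lp_multiplier_def
proof (intro conjI allI)
  fix N c
  have refl: "Lp_norm p (trig_poly N (\<lambda>j k. c (- j) k)) = Lp_norm p (trig_poly N c)" for c :: "int \<Rightarrow> int \<Rightarrow> complex"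
    using Lp_norm_reflect[of "trig_poly N c" p] by (simp add: trig_poly_reflect[symmetric])
  show "Lp_norm p (trig_poly N (\<lambda>j k. l (- j) k * c j k)) \<le> ennreal K * Lp_norm p (trig_poly N c)"
    using Lp_multiplierD[OF assms, of N "\<lambda>j k. c (- j) k"] refl[of "\<lambda>j k. l j k * c (- j) k"] refl[of c] by simp
qed (use assms in \<open>simp add: Lp_multiplier_def\<close>)

lemma Lp_multiplier_swap:
  assumes "Lp_multiplier p K l" shows "Lp_multiplier p K (\<lambda>j k. l k j)"
  unfolding Lp_multiplier_def
proof (intro conjI allI)
  fix N c
  have swap: "Lp_norm p (trig_poly N (\<lambda>j k. c k j)) = Lp_norm p (trig_poly N c)" for c :: "int \<Rightarrow> int \<Rightarrow> complex"
    using Lp_norm_swap[of "trig_poly N c" p] by (simp add: trig_poly_swap[symmetric])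
  show "Lp_norm p (trig_poly N (\<lambda>j k. l k j * c j k)) \<le> ennreal K * Lp_norm p (trig_poly N c)"
    using Lp_multiplierD[OF assms, of N "\<lambda>j k. c k j"] swap[of "\<lambda>j k. l j k * c k j"] swap[of c] by simp
qed (use assms in \<open>simp add: Lp_multiplier_def\<close>)

text \<open>The projection acts in x alone: the one-variable bound is applied on each line of
  constant y, with coefficients that depend on y, and then integrated in y.\<close>

lemma Lp_multiplier_half_line:
  assumes "1 < p"
  obtains K where "K > 0" "\<And>m. Lp_multiplier p K (\<lambda>j k. if m \<le> j then 1 else 0)"
proof -
  obtain C where C: "C > 0"
    "\<And>S a m. finite S \<Longrightarrow>
     integral {0..2*pi} (\<lambda>t. norm (\<Sum>j\<in>{j\<in>S. m \<le> j}. a j * cis (of_int j * t)) powr p)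
       \<le> C * integral {0..2*pi} (\<lambda>t. norm (\<Sum>j\<in>S. a j * cis (of_int j * t)) powr p)"
    using trig_poly_half_line_bound[OF assms] by blast
  have "Lp_multiplier p (C powr (1 / p)) (\<lambda>j k. if m \<le> j then 1 else 0)" for m
    unfolding Lp_multiplier_def
  proof (intro conjI allI)
    fix N and c :: "int \<Rightarrow> int \<Rightarrow> complex"
    let ?c' = "\<lambda>j k. (if m \<le> j then 1 else 0) * c j k"
    let ?S = "{-int N..int N}"
    define a where "a y j = (\<Sum>k\<in>?S. c j k * cis (of_int k * y))" for y j
    have tp: "trig_poly N c (x, y) = (\<Sum>j\<in>?S. a y j * cis (of_int j * x))" for x y
      unfolding trig_poly_def a_def sum_distrib_right
      by (intro sum.cong refl) (simp add: cis_mult add.commute[of "of_int _ * x"])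
    have tp': "trig_poly N ?c' (x, y) = (\<Sum>j\<in>{j\<in>?S. m \<le> j}. a y j * cis (of_int j * x))" for x y
    proof -
      have "trig_poly N ?c' (x, y) = (\<Sum>j\<in>?S. if m \<le> j then a y j * cis (of_int j * x) else 0)"
        unfolding trig_poly_def a_def sum_distrib_right
        by (intro sum.cong refl) (auto simp: cis_mult add.commute[of "of_int _ * x"] intro!: sum.cong)
      also have "\<dots> = (\<Sum>j\<in>{j\<in>?S. m \<le> j}. a y j * cis (of_int j * x))"
        by (rule sum.inter_filter[symmetric]) simp
      finally show ?thesis .
    qed
    have nn_eq: "(\<integral>\<^sup>+x\<in>{0..2*pi}. ennreal (norm (h x) powr p) \<partial>lborel) = ennreal (integral {0..2*pi} (\<lambda>x. norm (h x) powr p))"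
      if "continuous_on UNIV h" for h :: "real \<Rightarrow> complex"
    proof -
      have "continuous_on UNIV (\<lambda>x. norm (h x) powr p)"
        using assms that by (auto intro!: continuous_intros continuous_on_powr')
      then have "((\<lambda>x. norm (h x) powr p) has_integral integral {0..2*pi} (\<lambda>x. norm (h x) powr p)) {0..2*pi}"
        by (intro integrable_integral continuous_on_UNIV_integrable_on)
      from nn_integral_has_integral_lebesgue[OF _ this] show ?thesis
        by (simp add: ennreal_mult' ennreal_indicator mult.commute)
    qed
    have "(\<integral>\<^sup>+z\<in>square2pi. ennreal (norm (trig_poly N ?c' z) powr p) \<partial>lborel)
       = (\<integral>\<^sup>+y\<in>{0..2*pi}. (\<integral>\<^sup>+x\<in>{0..2*pi}. ennreal (norm (trig_poly N ?c' (x, y)) powr p) \<partial>lborel) \<partial>lborel)"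
      by (intro nn_integral_square2pi) measurable
    also have "\<dots> \<le> (\<integral>\<^sup>+y\<in>{0..2*pi}. ennreal C * (\<integral>\<^sup>+x\<in>{0..2*pi}. ennreal (norm (trig_poly N c (x, y)) powr p) \<partial>lborel) \<partial>lborel)"
    proof (intro nn_integral_mono mult_right_mono)
      fix y :: real
      show "(\<integral>\<^sup>+x\<in>{0..2*pi}. ennreal (norm (trig_poly N ?c' (x, y)) powr p) \<partial>lborel) \<le>
         ennreal C * (\<integral>\<^sup>+x\<in>{0..2*pi}. ennreal (norm (trig_poly N c (x, y)) powr p) \<partial>lborel)"
        unfolding tp tp' using C(1) C(2)[where S = ?S and m = m and a = "a y"]
        by (subst (1 2) nn_eq) (auto intro!: continuous_intros ennreal_leI simp: ennreal_mult'[symmetric])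
    qed auto
    also have "\<dots> = (\<integral>\<^sup>+y. ennreal C * ((\<integral>\<^sup>+x\<in>{0..2*pi}. ennreal (norm (trig_poly N c (x, y)) powr p) \<partial>lborel) * indicator {0..2*pi} y) \<partial>lborel)"
      by (simp add: mult.assoc)
    also have "\<dots> = ennreal C * (\<integral>\<^sup>+y\<in>{0..2*pi}. (\<integral>\<^sup>+x\<in>{0..2*pi}. ennreal (norm (trig_poly N c (x, y)) powr p) \<partial>lborel) \<partial>lborel)"
    proof (intro nn_integral_cmult)
      have [measurable]: "(\<lambda>(y, x). trig_poly N c (x, y)) \<in> borel_measurable (lborel \<Otimes>\<^sub>M lborel)"
        unfolding lborel_prod trig_poly_def case_prod_unfold by (auto intro!: borel_measurable_continuous_onI continuous_intros)
      show "(\<lambda>y. (\<integral>\<^sup>+x\<in>{0..2*pi}. ennreal (norm (trig_poly N c (x, y)) powr p) \<partial>lborel) * indicator {0..2*pi} y) \<in> borel_measurable lborel"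
        by measurable
    qed
    also have "(\<integral>\<^sup>+y\<in>{0..2*pi}. (\<integral>\<^sup>+x\<in>{0..2*pi}. ennreal (norm (trig_poly N c (x, y)) powr p) \<partial>lborel) \<partial>lborel) =
        (\<integral>\<^sup>+z\<in>square2pi. ennreal (norm (trig_poly N c z) powr p) \<partial>lborel)"
      by (intro nn_integral_square2pi(2)[symmetric]) measurable
    finally have le: "(\<integral>\<^sup>+z\<in>square2pi. ennreal (norm (trig_poly N ?c' z) powr p) \<partial>lborel) \<le> ennreal C * (\<integral>\<^sup>+z\<in>square2pi. ennreal (norm (trig_poly N c z) powr p) \<partial>lborel)" .
    show "Lp_norm p (trig_poly N ?c') \<le> ennreal (C powr (1 / p)) * Lp_norm p (trig_poly N c)"
    proof (cases "Lp_norm p (trig_poly N c)")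
      case top
      then show ?thesis using C by (simp add: ennreal_mult_top)
    next
      case (real b)
      then have "(\<integral>\<^sup>+z\<in>square2pi. ennreal (norm (trig_poly N c z) powr p) \<partial>lborel) \<le> ennreal (b powr p)"
        using assms by (subst Lp_norm_le_iff[symmetric]) auto
      from order_trans[OF le mult_left_mono[OF this]]
      have "(\<integral>\<^sup>+z\<in>square2pi. ennreal (norm (trig_poly N ?c' z) powr p) \<partial>lborel) \<le> ennreal C * ennreal (b powr p)"
        by simp
      also have "\<dots> = ennreal ((C powr (1 / p) * b) powr p)"
        using C assms real by (simp add: powr_mult powr_powr ennreal_mult)
      finally show ?thesis using real assms by (simp add: Lp_norm_le_iff[symmetric] ennreal_mult[symmetric])
    qed
  qed simp
  then show ?thesis using C that[of "C powr (1 / p)"] by simp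
qed

text \<open>Abel summation: on the frequencies up to N the symbol is the sum of the increments g m -
  g (m - 1) times the projections onto j \<ge> m. The total weight is at most V for every N; g 0 = 0
  lets the sum telescope to g.\<close>

lemma Lp_multiplier_bounded_variation:
  assumes p: "1 \<le> p" and half: "\<And>m. Lp_multiplier p K (\<lambda>j k. if m \<le> j then 1 else 0)"
    and g0: "g 0 = 0" and V: "\<And>M. (\<Sum>m=1..M. norm (g m - g (m - 1))) \<le> V"
  shows "Lp_multiplier p (V * K) (\<lambda>j k. if 1 \<le> j then g (nat j) else 0)"
  unfolding Lp_multiplier_def
proof (intro conjI allI)
  have K: "K \<ge> 0" using half Lp_multiplier_nonneg by blast
  moreover have V0: "V \<ge> 0" using V[of 0] by simp
  ultimately show "0 \<le> V * K" by simp
  fix N c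
  let ?l = "\<lambda>j k. \<Sum>m\<in>{1..N}. (g m - g (m - 1)) * (if int m \<le> j then 1 else 0)"
  have sum_Mul: "Lp_multiplier p ((\<Sum>m\<in>{1..N}. norm (g m - g (m - 1))) * K) ?l"
    by (rule Lp_multiplier_sum[OF p finite_atLeastAtMost half K])
  have tel: "(\<Sum>m=1..n. g m - g (m - 1)) = g n" for n :: nat
    by (induction n) (auto simp: g0)
  have eq: "(if 1 \<le> j then g (nat j) else 0) = ?l j k" if "\<bar>j\<bar> \<le> int N" for j k :: int
  proof -
    have "?l j k = (\<Sum>m\<in>{1..N}. if int m \<le> j then g m - g (m - 1) else 0)"
      by (intro sum.cong) auto
    also have "\<dots> = (\<Sum>m\<in>{m\<in>{1..N}. int m \<le> j}. g m - g (m - 1))"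
      by (rule sum.inter_filter[symmetric]) simp
    also have "{m\<in>{1..N}. int m \<le> j} = {1..nat j}" using that by auto
    also have "(\<Sum>m=1..nat j. g m - g (m - 1)) = g (nat j)" by (rule tel)
    finally show ?thesis by (simp only:) (auto simp: g0)
  qed
  have "trig_poly N (\<lambda>j k. (if 1 \<le> j then g (nat j) else 0) * c j k) = trig_poly N (\<lambda>j k. ?l j k * c j k)"
    by (rule trig_poly_cong) (simp only: eq)
  then have "Lp_norm p (trig_poly N (\<lambda>j k. (if 1 \<le> j then g (nat j) else 0) * c j k))
     \<le> ennreal ((\<Sum>m=1..N. norm (g m - g (m - 1))) * K) * Lp_norm p (trig_poly N c)"
    using Lp_multiplierD[OF sum_Mul] by simp
  also have "\<dots> \<le> ennreal (V * K) * Lp_norm p (trig_poly N c)"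
    by (intro mult_right_mono ennreal_leI mult_right_mono V K) auto
  finally show "Lp_norm p (trig_poly N (\<lambda>j k. (if 1 \<le> j then g (nat j) else 0) * c j k)) \<le> ennreal (V * K) * Lp_norm p (trig_poly N c)" .
qed

lemma Lp_multiplier_even_bounded_variation:
  assumes p: "1 \<le> p" and half: "\<And>m. Lp_multiplier p K (\<lambda>j k. if m \<le> j then 1 else 0)"
    and g0: "g 0 = 0" and V: "\<And>M. (\<Sum>m=1..M. norm (g m - g (m - 1))) \<le> V"
  shows "Lp_multiplier p (2 * (V * K)) (\<lambda>j k. g (nat \<bar>j\<bar>))"
proof -
  have "(if 1 \<le> j then g (nat j) else 0) + (if 1 \<le> - j then g (nat (- j)) else 0) = g (nat \<bar>j\<bar>)" for j
    by (cases j "0::int" rule: linorder_cases) (auto simp: g0)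
  moreover note Lp_multiplier_bounded_variation[where g = g, OF p half g0 V]
  ultimately show ?thesis
    using Lp_multiplier_add[OF p Lp_multiplier_bounded_variation[where g = g, OF p half g0 V] Lp_multiplier_reflect[OF Lp_multiplier_bounded_variation[where g = g, OF p half g0 V]]]
    by simp
qed

text \<open>The jump from g 0 = 0 to g 1 costs at most L, the monotone remainder at most another
  L.\<close>

lemma variation_monotone_le:
  fixes g :: "nat \<Rightarrow> real"
  assumes g: "\<And>m. 1 \<le> m \<Longrightarrow> 0 \<le> g m \<and> g m \<le> L" and g0: "g 0 = 0"
    and mono: "(\<forall>m\<ge>1. g m \<le> g (Suc m)) \<or> (\<forall>m\<ge>1. g (Suc m) \<le> g m)"
  shows "(\<Sum>m=1..M. \<bar>g m - g (m - 1)\<bar>) \<le> 2 * L"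
proof -
  have "(\<Sum>m=1..Suc M. \<bar>g m - g (m - 1)\<bar>) = g 1 + \<bar>g (Suc M) - g 1\<bar>" for M
    using mono
  proof
    assume mono: "\<forall>m\<ge>1. g m \<le> g (Suc m)"
    have "(\<Sum>m=1..Suc M. \<bar>g m - g (m - 1)\<bar>) = g (Suc M) \<and> g 1 \<le> g (Suc M)"
    proof (induction M)
      case (Suc M)
      then show ?case using mono[rule_format, of "Suc M"] by auto
    qed (use g[of 1] g0 in auto)
    then show ?thesis by simp
  next
    assume mono: "\<forall>m\<ge>1. g (Suc m) \<le> g m"
    have "(\<Sum>m=1..Suc M. \<bar>g m - g (m - 1)\<bar>) = g 1 + (g 1 - g (Suc M)) \<and> g (Suc M) \<le> g 1"
    proof (induction M)
      case (Suc M)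
      then show ?case using mono[rule_format, of "Suc M"] by auto
    qed (use g[of 1] g0 in auto)
    then show ?thesis by simp
  qed
  moreover have "g 1 + \<bar>g (Suc M) - g 1\<bar> \<le> 2 * L" for M
    using g[of 1] g[of "Suc M"] by auto
  moreover have "0 \<le> L" using g[of 1] by linarith
  ultimately show ?thesis by (cases M) auto
qed

lemma Lp_multiplier_even_monotone:
  fixes g :: "nat \<Rightarrow> real"
  assumes p: "1 \<le> p" and half: "\<And>m. Lp_multiplier p K (\<lambda>j k. if m \<le> j then 1 else 0)"
    and g: "\<And>m. 1 \<le> m \<Longrightarrow> 0 \<le> g m \<and> g m \<le> L" and g0: "g 0 = 0"
    and mono: "(\<forall>m\<ge>1. g m \<le> g (Suc m)) \<or> (\<forall>m\<ge>1. g (Suc m) \<le> g m)"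
  shows "Lp_multiplier p (4 * L * K) (\<lambda>j k. of_real (g (nat \<bar>j\<bar>)))"
proof -
  have "(\<Sum>m=1..M. norm (complex_of_real (g m) - complex_of_real (g (m - 1)))) \<le> 2 * L" for M
    using variation_monotone_le[OF g g0 mono, of M] by (simp add: of_real_diff[symmetric] del: of_real_diff)
  from Lp_multiplier_even_bounded_variation[where g = "\<lambda>m. complex_of_real (g m)", OF p half _ this] g0
  show ?thesis by (simp add: mult_ac)
qed

text \<open>Used to correct phases that depend only on the sign of the frequency; these arise when
  the step h is negative.\<close>

lemma Lp_multiplier_sign:
  assumes p: "1 \<le> p" and half: "\<And>m. Lp_multiplier p K (\<lambda>j k. if m \<le> j then 1 else 0)"
    and ab: "norm a \<le> 1" "norm b \<le> 1"
  shows "Lp_multiplier p (2 * K) (\<lambda>j k. if 1 \<le> j then a else if j \<le> -1 then b else 0)"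
proof -
  have K: "0 \<le> K" using half Lp_multiplier_nonneg by blast
  have 1: "Lp_multiplier p K (\<lambda>j k. a * (if 1 \<le> j then 1 else 0))"
    by (rule Lp_multiplier_mono[OF Lp_multiplier_cmult[OF p half]]) (use ab K in \<open>auto intro: mult_left_le_one_le\<close>)
  have 2: "Lp_multiplier p K (\<lambda>j k. b * (if 1 \<le> - j then 1 else 0))"
    by (rule Lp_multiplier_mono[OF Lp_multiplier_cmult[OF p Lp_multiplier_reflect[OF half]]]) (use ab K in \<open>auto intro: mult_left_le_one_le\<close>)
  have "(\<lambda>(j::int) (k::int). a * (if 1 \<le> j then 1 else 0) + b * (if 1 \<le> - j then 1 else 0)) = (\<lambda>j k. if 1 \<le> j then a else if j \<le> -1 then b else 0)"
    by (intro ext) auto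
  with Lp_multiplier_add[OF p 1 2] show ?thesis by (simp only:)
qed

section \<open>Symbols of fractional differences\<close>

text \<open>For n \<ge> a the recursion of the binomial coefficients makes |a gchoose n| the
  telescoping difference of n |a gchoose n| / a, so the partial sums are bounded by the first such
  value.\<close>

lemma summable_gbinomial:
  fixes a :: real assumes "a > 0"
  shows "summable (\<lambda>n. \<bar>a gchoose n\<bar>)"
proof -
  define f where "f n = of_nat n * \<bar>a gchoose n\<bar> / a" for n
  have rec: "\<bar>a gchoose n\<bar> = f n - f (Suc n)" if "real n \<ge> a" for n
  proof -
    have "of_nat (Suc n) * (a gchoose Suc n) = (a - of_nat n) * (a gchoose n)"
      using gbinomial_mult_1[of a n] by (simp add: algebra_simps)
    then have "\<bar>of_nat (Suc n) * (a gchoose Suc n)\<bar> = \<bar>(a - of_nat n) * (a gchoose n)\<bar>" by simp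
    then have "of_nat (Suc n) * \<bar>a gchoose Suc n\<bar> = (of_nat n - a) * \<bar>a gchoose n\<bar>"
      using that by (simp add: abs_mult)
    then show ?thesis using assms unfolding f_def by (simp add: field_simps)
  qed
  define m where "m = nat \<lceil>a\<rceil>"
  have m: "real (n + m) \<ge> a" for n unfolding m_def by linarith
  have "summable (\<lambda>n. \<bar>a gchoose (n + m)\<bar>)"
  proof (rule summableI_nonneg_bounded)
    fix n
    have "(\<Sum>i<n. \<bar>a gchoose (i + m)\<bar>) = (\<Sum>i<n. f (i + m) - f (Suc i + m))"
      using rec[OF m] by simp
    also have "\<dots> = f m - f (n + m)"
      by (subst sum_lessThan_telescope') simp
    also have "\<dots> \<le> f m" using assms by (simp add: f_def)
    finally show "(\<Sum>i<n. \<bar>a gchoose (i + m)\<bar>) \<le> f m" .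
  qed simp
  then show ?thesis by (subst (asm) summable_iff_shift)
qed

definition frac_coeff :: "real \<Rightarrow> nat \<Rightarrow> real" where
  "frac_coeff \<alpha> \<nu> = (- 1) ^ \<nu> * (\<alpha> gchoose \<nu>)"

text \<open>The symbol at theta = h j of the difference without its shift by alpha h; the shift is
  restored in \<open>frac_symbol\<close>.\<close>

definition diff_symbol :: "real \<Rightarrow> real \<Rightarrow> complex" where
  "diff_symbol \<alpha> \<theta> = (\<Sum>\<nu>. of_real (frac_coeff \<alpha> \<nu>) * cis (- (real \<nu> * \<theta>)))"

lemma summable_frac_coeff:
  assumes "\<alpha> > 0"
  shows "summable (\<lambda>\<nu>. \<bar>frac_coeff \<alpha> \<nu>\<bar>)"
  using summable_gbinomial[OF assms] by (simp add: frac_coeff_def abs_mult power_abs)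

lemma diff_symbol_sums:
  assumes "\<alpha> > 0"
  shows "(\<lambda>\<nu>. of_real (frac_coeff \<alpha> \<nu>) * cis (- (real \<nu> * \<theta>))) sums diff_symbol \<alpha> \<theta>"
  unfolding diff_symbol_def
  by (rule summable_sums, rule summable_norm_cancel) (use summable_frac_coeff[OF assms] in \<open>simp add: norm_mult\<close>)

text \<open>The binomial series on the boundary circle, by Abel's limit theorem in its easy (absolutely
  convergent) case.\<close>

lemma diff_symbol_eq:
  assumes a: "\<alpha> > 0"
  shows "diff_symbol \<alpha> \<theta> = (1 - cis (- \<theta>)) powr (of_real \<alpha>)"
proof -
  define w where "w = - cis (- \<theta>)"
  have term_eq: "of_real (frac_coeff \<alpha> \<nu>) * cis (- (real \<nu> * \<theta>)) = (of_real \<alpha> gchoose \<nu>) * w ^ \<nu>" for \<nu>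
  proof -
    have "w ^ \<nu> = (- 1) ^ \<nu> * cis (- (real \<nu> * \<theta>))"
      unfolding w_def by (subst power_minus) (simp add: Complex.DeMoivre)
    moreover have "of_real (\<alpha> gchoose \<nu>) = (complex_of_real \<alpha> gchoose \<nu>)"
      by (simp add: gbinomial_prod_rev)
    ultimately show ?thesis by (simp add: frac_coeff_def)
  qed
  define f where "f r n = (of_real \<alpha> gchoose n) * (of_real r * w) ^ n" for r and n :: nat
  have gb: "norm (complex_of_real \<alpha> gchoose n) = \<bar>\<alpha> gchoose n\<bar>" for n
  proof -
    have "complex_of_real (\<alpha> gchoose n) = (complex_of_real \<alpha> gchoose n)" by (simp add: gbinomial_prod_rev)
    then show ?thesis by (metis norm_of_real)
  qed
  have "uniform_limit {0..1} (\<lambda>n r. \<Sum>i<n. f r i) (\<lambda>r. \<Sum>i. f r i) sequentially"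
  proof (rule Weierstrass_m_test)
    show "norm (f r n) \<le> \<bar>\<alpha> gchoose n\<bar>" if "r \<in> {0..1}" for n r
    proof -
      have "norm (f r n) = \<bar>\<alpha> gchoose n\<bar> * r ^ n"
        using that by (simp add: f_def gb norm_mult norm_power w_def)
      also have "\<dots> \<le> \<bar>\<alpha> gchoose n\<bar>" using that by (intro mult_right_le_one_le) (auto intro: power_le_one)
      finally show ?thesis .
    qed
  qed (rule summable_gbinomial[OF a])
  then have "continuous_on {0..1} (\<lambda>r. \<Sum>i. f r i)"
    by (rule uniform_limit_theorem[rotated]) (auto simp: f_def intro!: always_eventually continuous_intros)
  then have "((\<lambda>r. \<Sum>i. f r i) \<longlongrightarrow> (\<Sum>i. f 1 i)) (at 1 within {0..1})"
    by (auto simp: continuous_on_def)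
  then have lim1: "((\<lambda>r. \<Sum>i. f r i) \<longlongrightarrow> (\<Sum>i. f 1 i)) (at_left 1)"
    by (rule tendsto_within_subset[where S="{0..1::real}", THEN filterlim_mono]) (auto simp: at_within_Icc_at_left)
  have ev: "\<forall>\<^sub>F r in at_left 1. (1 + of_real r * w) powr (of_real \<alpha>) = (\<Sum>i. f r i)"
  proof (rule eventually_at_leftI[of 0])
    fix r :: real assume "r \<in> {0<..<1}"
    then have "norm (of_real r * w) < 1" by (simp add: norm_mult w_def)
    from gen_binomial_complex[OF this, of "of_real \<alpha>"] show "(1 + of_real r * w) powr (of_real \<alpha>) = (\<Sum>i. f r i)"
      unfolding f_def by (simp add: sums_iff)
  qed simp
  have "((\<lambda>r. (1 + of_real r * w) powr (of_real \<alpha>)) \<longlongrightarrow> (1 + of_real 1 * w) powr (of_real \<alpha>)) (at_left 1)"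
  proof (intro tendsto_powr_complex' tendsto_intros)
    \<comment> \<open>1 - e^(-i theta) has nonnegative real part, zero only if the number itself is
      zero. So the limit point avoids the cut of the principal power, except at 0, where a positive
      exponent gives continuity.\<close>
    show "1 + complex_of_real 1 * w \<notin> \<real>\<^sub>\<le>\<^sub>0 \<or> 1 + complex_of_real 1 * w = 0 \<and> 0 < Re (complex_of_real \<alpha>)"
    proof (cases "1 + w = 0")
      case False
      have "Re (1 + w) \<ge> 0" by (simp add: w_def)
      moreover have "Re (1 + w) = 0 \<Longrightarrow> 1 + w = 0"
      proof -
        assume "Re (1 + w) = 0"
        then have "cos \<theta> = 1" by (simp add: w_def)
        moreover then have "sin \<theta> = 0" using sin_zero_abs_cos_one[of \<theta>] by (simp add: sin_cos_squared_add2 cos_one_sin_zero)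
        ultimately show "1 + w = 0" by (simp add: w_def complex_eq_iff)
      qed
      ultimately show ?thesis using False a by (auto simp: complex_nonpos_Reals_iff)
    qed (use a in simp)
  qed
  then have "((\<lambda>r. \<Sum>i. f r i) \<longlongrightarrow> (1 + w) powr (of_real \<alpha>)) (at_left 1)"
    by (subst (asm) tendsto_cong[OF ev]) simp
  from tendsto_unique[OF _ lim1 this] have "(\<Sum>i. f 1 i) = (1 + w) powr (of_real \<alpha>)" by simp
  then show ?thesis unfolding diff_symbol_def term_eq by (simp add: f_def w_def)
qed

lemma diff_symbol_0: "\<alpha> > 0 \<Longrightarrow> diff_symbol \<alpha> 0 = 0"
  by (simp add: diff_symbol_eq)

lemma one_minus_cis:
  "1 - cis (- \<theta>) = of_real (2 * sin (\<theta> / 2)) * cis (pi / 2 - \<theta> / 2)"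
proof -
  have "cos \<theta> = 1 - 2 * (sin (\<theta> / 2))\<^sup>2" using cos_double_sin[of "\<theta> / 2"] by simp
  moreover have "sin \<theta> = 2 * sin (\<theta> / 2) * cos (\<theta> / 2)" using sin_double[of "\<theta> / 2"] by simp
  ultimately show ?thesis
    by (simp add: complex_eq_iff cos_diff sin_diff power2_eq_square)
qed

text \<open>For 0 < |theta| \<le> pi the argument of 1 - e^(-i theta) is pi sgn(theta) / 2 - theta /
  2, inside (-pi/2, pi/2), so the power just scales it. The result splits into a translation, a
  positive even function and the phase of the Weyl factor; hence only the positive part
  distinguishes differences from derivatives.\<close>

lemma diff_symbol_polar:
  assumes a: "\<alpha> > 0" and \<theta>: "\<bar>\<theta>\<bar> \<le> pi"
  shows "cis (\<alpha> * \<theta>) * diff_symbol \<alpha> \<theta> =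
     cis (\<alpha> * \<theta> / 2) * of_real ((2 * \<bar>sin (\<theta> / 2)\<bar>) powr \<alpha>) * cis (pi * \<alpha> * sgn \<theta> / 2)"
proof (cases "\<theta> = 0")
  case False
  define r where "r = 2 * \<bar>sin (\<theta> / 2)\<bar>"
  define x where "x = pi * sgn \<theta> / 2 - \<theta> / 2"
  have sin_pos: "\<bar>sin (\<theta> / 2)\<bar> = sgn \<theta> * sin (\<theta> / 2) \<and> sin (\<theta> / 2) \<noteq> 0"
  proof (cases "\<theta> > 0")
    case True
    then have "sin (\<theta> / 2) > 0" using \<theta> by (intro sin_gt_zero) auto
    then show ?thesis using True by simp
  next
    case *: False
    then have "sin (- \<theta> / 2) > 0" using False \<theta> by (intro sin_gt_zero) auto
    then show ?thesis using * False by simp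
  qed
  then have r: "r > 0" unfolding r_def using zero_less_abs_iff[of "sin (\<theta> / 2)"] by linarith
  have x: "x \<in> {-pi<..pi}"
  proof (cases "\<theta> > 0")
    case True then show ?thesis using \<theta> by (auto simp: x_def)
  next
    case *: False then show ?thesis using False \<theta> by (auto simp: x_def)
  qed
  have "1 - cis (- \<theta>) = rcis r x"
  proof (cases "\<theta> > 0")
    case True
    then show ?thesis using sin_pos by (simp add: one_minus_cis r_def x_def rcis_def)
  next
    case *: False
    then have s: "sgn \<theta> = -1" using False by simp
    have "cis (pi / 2 - \<theta> / 2) = - cis x"
      unfolding x_def s using cis_mult[of "- pi / 2 - \<theta> / 2" pi] by simp
    then show ?thesis using sin_pos s by (simp add: one_minus_cis r_def rcis_def)
  qed
  moreover have "Ln (rcis r x) = Complex (ln r) x" by (rule Ln_rcis[OF r x])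
  moreover have "rcis r x \<noteq> 0" using r by simp
  ultimately have "diff_symbol \<alpha> \<theta> = exp (of_real \<alpha> * Complex (ln r) x)"
    using a by (simp add: diff_symbol_eq powr_def)
  also have "\<dots> = of_real (r powr \<alpha>) * cis (\<alpha> * x)"
    using r by (simp add: exp_eq_polar powr_def)
  finally have "cis (\<alpha> * \<theta>) * diff_symbol \<alpha> \<theta> = of_real (r powr \<alpha>) * cis (\<alpha> * \<theta> + \<alpha> * x)"
    by (simp add: cis_mult[symmetric])
  also have "\<alpha> * \<theta> + \<alpha> * x = \<alpha> * \<theta> / 2 + pi * \<alpha> * sgn \<theta> / 2" by (simp add: x_def algebra_simps)
  finally show ?thesis by (simp add: cis_mult[symmetric] r_def)
qed (use a in \<open>simp add: diff_symbol_0\<close>)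

section \<open>Differences of even order and powers of the squared sine\<close>

lemma diff_symbol_add:
  assumes "a > 0" "b > 0"
  shows "diff_symbol (a + b) \<theta> = diff_symbol a \<theta> * diff_symbol b \<theta>"
  using assms by (cases "1 - cis (- \<theta>) = 0") (simp_all add: diff_symbol_eq powr_add)

text \<open>Recentring a difference of even order by q steps removes its phase: the symbol is real
  and, up to the sign (-1)^q, nonnegative, so averages over steps cannot cancel.\<close>

lemma four_sin_sq_power_eq:
  assumes "q > 0"
  shows "of_real ((4 * (sin (\<theta> / 2))\<^sup>2) ^ q) = (- 1) ^ q * cis (real q * \<theta>) * diff_symbol (real (2 * q)) \<theta>"
proof -
  have "diff_symbol (real (2 * q)) \<theta> = (1 - cis (- \<theta>)) ^ (2 * q)"
    using assms powr_nat'[of "1 - cis (- \<theta>)" "2 * q"] by (simp add: diff_symbol_eq)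
  also have "\<dots> = ((1 - cis (- \<theta>))\<^sup>2) ^ q" by (simp add: power_mult)
  also have "(1 - cis (- \<theta>))\<^sup>2 = - (of_real (4 * (sin (\<theta> / 2))\<^sup>2) * cis (- \<theta>))"
  proof -
    have "(cis (pi / 2 - \<theta> / 2))\<^sup>2 = - cis (- \<theta>)"
      using cis_mult[of pi "- \<theta>"] by (simp add: Complex.DeMoivre power2_eq_square cis_mult)
    then show ?thesis by (simp add: one_minus_cis power_mult_distrib)
  qed
  also have "(- (of_real (4 * (sin (\<theta> / 2))\<^sup>2) * cis (- \<theta>))) ^ q = (- 1) ^ q * of_real ((4 * (sin (\<theta> / 2))\<^sup>2) ^ q) * cis (- (real q * \<theta>))"
    by (subst power_minus) (simp add: power_mult_distrib Complex.DeMoivre)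
  finally have "(- 1) ^ q * cis (real q * \<theta>) * diff_symbol (real (2 * q)) \<theta> =
     ((- 1) ^ q * (- 1) ^ q) * of_real ((4 * (sin (\<theta> / 2))\<^sup>2) ^ q) * (cis (real q * \<theta>) * cis (- (real q * \<theta>)))"
    by (simp only: mult_ac)
  also have "\<dots> = of_real ((4 * (sin (\<theta> / 2))\<^sup>2) ^ q)"
    unfolding minus_one_mult_self cis_mult by simp
  finally show ?thesis by simp
qed

text \<open>A form in which theta enters each summand through a single character, so that averaging
  over the step can be done term by term.\<close>

lemma four_sin_sq_power_expand:
  "of_real ((4 * (sin (\<theta> / 2))\<^sup>2) ^ q) = (\<Sum>l\<le>2*q. (- 1) ^ (q + l) * of_nat (2 * q choose l) * cis (of_int (int q - int l) * \<theta>))"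
proof -
  have "of_real (4 * (sin (\<theta> / 2))\<^sup>2) = - (cis \<theta> * (1 - cis (- \<theta>))\<^sup>2)"
  proof -
    have "(cis (pi / 2 - \<theta> / 2))\<^sup>2 = - cis (- \<theta>)"
      using cis_mult[of pi "- \<theta>"] by (simp add: Complex.DeMoivre power2_eq_square cis_mult)
    moreover have "cis \<theta> * cis (- \<theta>) = 1" by (simp add: cis_mult)
    ultimately show ?thesis by (simp add: one_minus_cis power_mult_distrib mult_ac)
  qed
  then have "of_real ((4 * (sin (\<theta> / 2))\<^sup>2) ^ q) = (- 1) ^ q * cis (real q * \<theta>) * (1 - cis (- \<theta>)) ^ (2 * q)"
  proof -
    have "(- (A * B\<^sup>2)) ^ q = (- 1) ^ q * A ^ q * B ^ (2 * q)" for A B :: complex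
      by (subst power_minus) (simp add: power_mult_distrib power_mult)
    then show ?thesis
      using \<open>of_real (4 * (sin (\<theta> / 2))\<^sup>2) = - (cis \<theta> * (1 - cis (- \<theta>))\<^sup>2)\<close>
      by (simp only: of_real_power Complex.DeMoivre)
  qed
  also have "(1 - cis (- \<theta>)) ^ (2 * q) = (\<Sum>l\<le>2*q. of_nat (2 * q choose l) * (- cis (- \<theta>)) ^ l)"
    using binomial_ring[of "- cis (- \<theta>)" 1 "2 * q"] by simp
  also have "(- 1) ^ q * cis (real q * \<theta>) * \<dots> = (\<Sum>l\<le>2*q. (- 1) ^ (q + l) * of_nat (2 * q choose l) * cis (of_int (int q - int l) * \<theta>))"
    unfolding sum_distrib_left
  proof (rule sum.cong[OF refl])
    fix l
    have "(- cis (- \<theta>)) ^ l = (- 1) ^ l * cis (- (real l * \<theta>))"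
      by (subst power_minus) (simp add: Complex.DeMoivre)
    moreover have "cis (of_int (int q - int l) * \<theta>) = cis (real q * \<theta>) * cis (- (real l * \<theta>))"
      by (simp add: cis_mult left_diff_distrib)
    ultimately show "(- 1) ^ q * cis (real q * \<theta>) * (of_nat (2 * q choose l) * (- cis (- \<theta>)) ^ l) =
         (- 1) ^ (q + l) * of_nat (2 * q choose l) * cis (of_int (int q - int l) * \<theta>)"
      by (simp add: power_add mult_ac)
  qed
  finally show ?thesis .
qed

text \<open>The derivative has the sign of t cos t - sin t, which is nonpositive on [0, pi] because
  its negative vanishes at 0 and has derivative t sin t.\<close>

lemma sinc_antimono:
  assumes "0 < x" "x \<le> y" "y \<le> pi / 2"
  shows "sin y / y \<le> sin x / x"
proof -
  have f: "x * cos x \<le> sin x" if "0 \<le> x" "x \<le> pi" for x :: real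
  proof -
    have "sin 0 - 0 * cos 0 \<le> sin x - x * cos x"
    proof (rule DERIV_nonneg_imp_nondecreasing[OF that(1)])
      fix t assume "0 \<le> t" "t \<le> x"
      then show "\<exists>D. ((\<lambda>t. sin t - t * cos t) has_real_derivative D) (at t) \<and> 0 \<le> D"
        by (intro exI[of _ "t * sin t"] conjI) (use that in \<open>auto intro!: derivative_eq_intros mult_nonneg_nonneg sin_ge_zero\<close>)
    qed
    then show ?thesis by simp
  qed
  show ?thesis
  proof (rule DERIV_nonpos_imp_nonincreasing[OF assms(2)])
    fix t assume t: "x \<le> t" "t \<le> y"
    then have "t > 0" "t \<le> pi" using assms by auto
    then show "\<exists>D. ((\<lambda>t. sin t / t) has_real_derivative D) (at t) \<and> D \<le> 0"
      by (intro exI[of _ "(t * cos t - sin t) / (t * t)"] conjI)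
         (use f[of t] in \<open>auto intro!: derivative_eq_intros divide_nonpos_nonneg simp: mult_ac\<close>)
  qed
qed

text \<open>An absolutely convergent series of translations; the constant is the sum of the
  coefficients' moduli and hence independent of h.\<close>

lemma Lp_multiplier_diff_symbol:
  assumes "1 \<le> p" "\<alpha> > 0"
  shows "Lp_multiplier p (\<Sum>\<nu>. \<bar>frac_coeff \<alpha> \<nu>\<bar>) (\<lambda>j k. diff_symbol \<alpha> (h * of_int j))"
proof (rule Lp_multiplier_lim)
  show "p > 0" using assms by simp
  fix n :: nat
  let ?S = "\<lambda>n j k. \<Sum>\<nu>\<in>{..<n}. of_real (frac_coeff \<alpha> \<nu>) * cis (of_int j * (- (real \<nu> * h)) + of_int k * 0)"
  have "Lp_multiplier p ((\<Sum>\<nu>\<in>{..<n}. norm (complex_of_real (frac_coeff \<alpha> \<nu>))) * 1) (?S n)"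
    by (intro Lp_multiplier_sum assms Lp_multiplier_translation) auto
  moreover have "(\<Sum>\<nu>\<in>{..<n}. norm (complex_of_real (frac_coeff \<alpha> \<nu>))) * 1 \<le> (\<Sum>\<nu>. \<bar>frac_coeff \<alpha> \<nu>\<bar>)"
    using sum_le_suminf[OF summable_frac_coeff[OF assms(2)], of "{..<n}"] by simp
  ultimately show "Lp_multiplier p (\<Sum>\<nu>. \<bar>frac_coeff \<alpha> \<nu>\<bar>) (?S n)" by (rule Lp_multiplier_mono)
next
  fix j k :: int
  show "(\<lambda>n. \<Sum>\<nu>\<in>{..<n}. of_real (frac_coeff \<alpha> \<nu>) * cis (of_int j * (- (real \<nu> * h)) + of_int k * 0)) \<longlonglongrightarrow> diff_symbol \<alpha> (h * of_int j)"
    using diff_symbol_sums[OF assms(2), of "h * of_int j"] by (simp add: sums_def mult_ac)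
qed

text \<open>The factor by which a fractional difference with step h multiplies the Fourier
  coefficients in its variable.\<close>

definition frac_symbol :: "real \<Rightarrow> real \<Rightarrow> int \<Rightarrow> complex" where
  "frac_symbol \<alpha> h j = cis (\<alpha> * (h * of_int j)) * diff_symbol \<alpha> (h * of_int j)"

text \<open>Belongs to n^(-alpha) times the derivative of order alpha of the n-th partial sum;
  \<open>high_symbol\<close> belongs to the remainder of that sum. Every term of the theorem has a
  product of two of these as symbol.\<close>

definition low_symbol :: "real \<Rightarrow> nat \<Rightarrow> int \<Rightarrow> complex" where
  "low_symbol \<alpha> n j = (if \<bar>j\<bar> \<le> int n then of_real (real n powr (- \<alpha>)) * weyl_factor \<alpha> j else 0)"

definition high_symbol :: "nat \<Rightarrow> int \<Rightarrow> complex" where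
  "high_symbol n j = (if \<bar>j\<bar> \<le> int n then 0 else 1)"

section \<open>Comparison with the truncated derivative at low frequencies\<close>

lemma frac_symbol_0: "\<alpha> > 0 \<Longrightarrow> frac_symbol \<alpha> h 0 = 0"
  by (simp add: frac_symbol_def diff_symbol_0)

lemma low_symbol_0: "\<alpha> > 0 \<Longrightarrow> low_symbol \<alpha> n 0 = 0"
  by (simp add: low_symbol_def weyl_factor_def)

lemma Lp_multiplier_frac_symbol:
  assumes "1 \<le> p" "\<alpha> > 0"
  shows "Lp_multiplier p (\<Sum>\<nu>. \<bar>frac_coeff \<alpha> \<nu>\<bar>) (\<lambda>j k. frac_symbol \<alpha> h j)"
  using Lp_multiplier_mult[OF Lp_multiplier_translation[of p "\<alpha> * h" 0] Lp_multiplier_diff_symbol[OF assms, of h]]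
  by (simp add: frac_symbol_def mult_ac)

text \<open>By the polar form the quotient is a translation, times (n |h| sin x / x)^alpha with x =
  |h j| / 2, times a phase depending on the signs of h and j. The middle factor is bounded by
  pi^alpha and decreases in |j|, and the three constants multiply to the one stated.\<close>

lemma frac_symbol_low_factor:
  assumes p: "1 \<le> p" and a: "\<alpha> > 0" and n: "n \<ge> 1" and h: "\<bar>h\<bar> \<le> pi / real n"
    and half: "\<And>m. Lp_multiplier p K (\<lambda>j k. if m \<le> j then 1 else 0)"
  shows "\<exists>\<rho>. Lp_multiplier p (8 * pi powr \<alpha> * K * K) (\<lambda>j k. \<rho> j) \<and>
     (\<forall>j. \<bar>j\<bar> \<le> int n \<longrightarrow> frac_symbol \<alpha> h j = \<rho> j * low_symbol \<alpha> n j)"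
proof (cases "h = 0")
  case True
  have K: "0 \<le> K" using half Lp_multiplier_nonneg by blast
  show ?thesis
    by (rule exI[of _ "\<lambda>_. 0"]) (use True a K in \<open>auto simp: frac_symbol_def diff_symbol_0 Lp_multiplier_def trig_poly_def[abs_def]\<close>)
next
  case False
  \<comment> \<open>Freezing the frequency at n keeps x inside (0, pi/2], where sin x / x decreases,
    and makes G monotone on all m \<ge> 1; beyond n its value is irrelevant to the claim.\<close>
  define x where "x m = real (min m n) * \<bar>h\<bar> / 2" for m
  define G where "G m = (if m = 0 then 0 else ((real n * \<bar>h\<bar>) * (sin (x m) / x m)) powr \<alpha>)" for m
  have x: "0 < x m" "x m \<le> pi / 2" if "1 \<le> m" for m
  proof -
    show "0 < x m" using that False n by (simp add: x_def)
    have "real (min m n) * \<bar>h\<bar> \<le> real n * (pi / real n)" using h by (intro mult_mono) auto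
    then show "x m \<le> pi / 2" using n by (simp add: x_def)
  qed
  have sinc: "0 \<le> sin (x m) / x m" "sin (x m) / x m \<le> 1" if "1 \<le> m" for m
    using x[OF that] sin_x_le_x[of "x m"] sin_ge_zero[of "x m"] by auto
  have nh: "0 \<le> real n * \<bar>h\<bar>" "real n * \<bar>h\<bar> \<le> pi" using h n by (auto simp: field_simps)
  have 1: "0 \<le> G m \<and> G m \<le> pi powr \<alpha>" if "1 \<le> m" for m
  proof -
    have "(real n * \<bar>h\<bar>) * (sin (x m) / x m) \<le> pi * 1"
      using sinc[OF that] nh by (intro mult_mono) auto
    with mult_nonneg_nonneg[OF nh(1) sinc(1)[OF that]]
    have "((real n * \<bar>h\<bar>) * (sin (x m) / x m)) powr \<alpha> \<le> pi powr \<alpha>"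
      by (intro powr_mono2) (use a in simp_all)
    then show ?thesis using that by (simp add: G_def)
  qed
  have 2: "G (Suc m) \<le> G m" if "1 \<le> m" for m
  proof -
    have "sin (x (Suc m)) / x (Suc m) \<le> sin (x m) / x m"
      using x[OF that] x[of "Suc m"] by (intro sinc_antimono) (auto simp: x_def mult_right_mono)
    then have "(real n * \<bar>h\<bar>) * (sin (x (Suc m)) / x (Suc m)) \<le> (real n * \<bar>h\<bar>) * (sin (x m) / x m)"
      using nh by (intro mult_left_mono) auto
    with mult_nonneg_nonneg[OF nh(1) sinc(1)[of "Suc m"]]
    have "((real n * \<bar>h\<bar>) * (sin (x (Suc m)) / x (Suc m))) powr \<alpha> \<le> ((real n * \<bar>h\<bar>) * (sin (x m) / x m)) powr \<alpha>"
      by (intro powr_mono2) (use a in simp_all)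
    then show ?thesis using that by (simp add: G_def)
  qed
  have G0: "G 0 = 0" by (simp add: G_def)
  have MG: "Lp_multiplier p (4 * pi powr \<alpha> * K) (\<lambda>j k. of_real (G (nat \<bar>j\<bar>)))"
    by (rule Lp_multiplier_even_monotone[where g = G, OF p half 1 G0]) (use 2 in auto)
  \<comment> \<open>For h < 0 the sign of h j is opposite to that of j, and S turns the phase of the
    Weyl factor into its conjugate.\<close>
  define S where "S j = (if 1 \<le> j then (if h > 0 then 1 else cis (- pi * \<alpha>)) else if j \<le> -1 then (if h > 0 then 1 else cis (pi * \<alpha>)) else 0)" for j :: int
  define \<rho> where "\<rho> j = cis (of_int j * (\<alpha> * h / 2) + of_int (0::int) * 0) * (of_real (G (nat \<bar>j\<bar>)) * S j)" for j
  have "Lp_multiplier p (1 * (4 * pi powr \<alpha> * K * (2 * K))) (\<lambda>j k. cis (of_int j * (\<alpha> * h / 2) + of_int k * 0) * (of_real (G (nat \<bar>j\<bar>)) * S j))"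
    unfolding S_def
    by (intro Lp_multiplier_mult Lp_multiplier_translation MG Lp_multiplier_sign p half) auto
  then have M: "Lp_multiplier p (8 * pi powr \<alpha> * K * K) (\<lambda>j k. \<rho> j)" by (simp add: \<rho>_def mult_ac)
  have "frac_symbol \<alpha> h j = \<rho> j * low_symbol \<alpha> n j" if j: "\<bar>j\<bar> \<le> int n" for j
  proof (cases "j = 0")
    case False
    define m where "m = nat \<bar>j\<bar>"
    have m: "1 \<le> m" "m \<le> n" using False j by (auto simp: m_def)
    have mj: "real m = \<bar>of_int j\<bar>" by (simp add: m_def)
    define \<theta> where "\<theta> = h * of_int j"
    have \<theta>: "\<bar>\<theta>\<bar> = real m * \<bar>h\<bar>" by (simp add: \<theta>_def abs_mult mj)
    have "real m * \<bar>h\<bar> \<le> real n * (pi / real n)" using h m by (intro mult_mono) auto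
    then have "\<bar>\<theta>\<bar> \<le> pi" using \<theta> n by simp
    from diff_symbol_polar[OF a this]
    have D: "frac_symbol \<alpha> h j = cis (\<alpha> * \<theta> / 2) * of_real ((2 * \<bar>sin (\<theta> / 2)\<bar>) powr \<alpha>) * cis (pi * \<alpha> * sgn \<theta> / 2)"
      by (simp add: frac_symbol_def \<theta>_def)
    have xm: "x m = \<bar>\<theta>\<bar> / 2" using m by (simp add: x_def \<theta>)
    have sin_eq: "\<bar>sin (\<theta> / 2)\<bar> = sin (x m)"
    proof -
      have "\<bar>sin (\<theta> / 2)\<bar> = \<bar>sin (x m)\<bar>" by (cases "\<theta> \<ge> 0") (auto simp: xm)
      then show ?thesis using x[OF m(1)] sin_ge_zero[of "x m"] by simp
    qed
    have G_eq: "G m * (real n powr (- \<alpha>) * real m powr \<alpha>) = (2 * \<bar>sin (\<theta> / 2)\<bar>) powr \<alpha>"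
    proof -
      have "2 * \<bar>sin (\<theta> / 2)\<bar> = ((real n * \<bar>h\<bar>) * (sin (x m) / x m)) * (real m / real n)"
        unfolding sin_eq using m n \<open>h \<noteq> 0\<close> by (simp add: x_def field_simps)
      moreover have "0 \<le> (real n * \<bar>h\<bar>) * (sin (x m) / x m)"
        by (rule mult_nonneg_nonneg[OF nh(1) sinc(1)[OF m(1)]])
      ultimately have "(2 * \<bar>sin (\<theta> / 2)\<bar>) powr \<alpha> = ((real n * \<bar>h\<bar>) * (sin (x m) / x m)) powr \<alpha> * (real m / real n) powr \<alpha>"
        by (simp only: powr_mult)
      moreover have "(real m / real n) powr \<alpha> = real n powr (- \<alpha>) * real m powr \<alpha>"
        by (simp add: powr_divide powr_minus_divide)
      moreover have "G m = ((real n * \<bar>h\<bar>) * (sin (x m) / x m)) powr \<alpha>" using m by (simp add: G_def)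
      ultimately show ?thesis by (simp only:)
    qed
    have S_eq: "S j * cis (pi * \<alpha> * of_int (sgn j) / 2) = cis (pi * \<alpha> * sgn \<theta> / 2)"
      using False \<open>h \<noteq> 0\<close> by (auto simp: S_def \<theta>_def sgn_if cis_mult zero_less_mult_iff)
    have c: "cis (of_int j * (\<alpha> * h / 2) + of_int (0::int) * 0) = cis (\<alpha> * \<theta> / 2)"
      by (simp add: \<theta>_def mult_ac)
    have low: "low_symbol \<alpha> n j = of_real (real n powr (- \<alpha>) * real m powr \<alpha>) * cis (pi * \<alpha> * of_int (sgn j) / 2)"
      using j by (simp add: low_symbol_def weyl_factor_def mj)
    have "\<rho> j * low_symbol \<alpha> n j = cis (\<alpha> * \<theta> / 2) * of_real (G m * (real n powr (- \<alpha>) * real m powr \<alpha>)) *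
       (S j * cis (pi * \<alpha> * of_int (sgn j) / 2))"
      unfolding \<rho>_def low c m_def[symmetric] of_real_mult by (simp only: mult_ac)
    then show ?thesis unfolding D S_eq G_eq by simp
  qed (use a in \<open>simp add: frac_symbol_0 low_symbol_0\<close>)
  then show ?thesis using M by blast
qed

text \<open>The reciprocal quotient at the largest step pi / n, the step for which every frequency
  up to n stays within a half-period: there sin x / x is at least 2 / pi, so the reciprocal is
  bounded, and it increases in |j|. As the step is positive, no sign correction is needed.\<close>

lemma low_symbol_frac_factor:
  assumes p: "1 \<le> p" and a: "\<alpha> > 0" and n: "n \<ge> 1"
    and half: "\<And>m. Lp_multiplier p K (\<lambda>j k. if m \<le> j then 1 else 0)"
  shows "\<exists>l. Lp_multiplier p (4 * K) (\<lambda>j k. l j) \<and>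
     (\<forall>j. \<bar>j\<bar> \<le> int n \<longrightarrow> low_symbol \<alpha> n j = l j * frac_symbol \<alpha> (pi / real n) j)"
proof -
  define h where "h = pi / real n"
  have h: "h > 0" "real n * h = pi" using n by (auto simp: h_def)
  define x where "x m = real (min m n) * h / 2" for m
  define G where "G m = (if m = 0 then 0 else (inverse pi * inverse (sin (x m) / x m)) powr \<alpha>)" for m
  have x: "0 < x m" "x m \<le> pi / 2" if "1 \<le> m" for m
  proof -
    show "0 < x m" using that h n by (simp add: x_def)
    have "real (min m n) * h \<le> real n * h" using h by (intro mult_right_mono) auto
    then show "x m \<le> pi / 2" using h by (simp add: x_def)
  qed
  have sinc: "2 / pi \<le> sin (x m) / x m" if "1 \<le> m" for m
    using sinc_antimono[of "x m" "pi / 2"] x[OF that] by simp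
  have sinc_pos: "0 < sin (x m) / x m" if "1 \<le> m" for m
    using sinc[OF that] pi_gt_zero by (smt (verit) divide_pos_pos)
  have 1: "0 \<le> G m \<and> G m \<le> 1" if "1 \<le> m" for m
  proof -
    have "inverse (sin (x m) / x m) \<le> inverse (2 / pi)" by (intro le_imp_inverse_le sinc that) auto
    then have "inverse pi * inverse (sin (x m) / x m) \<le> inverse pi * inverse (2 / pi)" by (intro mult_left_mono) auto
    also have "\<dots> \<le> 1" by simp
    finally have "inverse pi * inverse (sin (x m) / x m) \<le> 1" .
    moreover have "0 \<le> inverse pi * inverse (sin (x m) / x m)"
      using sinc_pos[OF that] by (intro mult_nonneg_nonneg) (auto simp del: inverse_divide)
    ultimately have "(inverse pi * inverse (sin (x m) / x m)) powr \<alpha> \<le> 1 powr \<alpha>" using a by (intro powr_mono2) auto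
    then show ?thesis using that by (simp add: G_def)
  qed
  have 2: "G m \<le> G (Suc m)" if "1 \<le> m" for m
  proof -
    have "sin (x (Suc m)) / x (Suc m) \<le> sin (x m) / x m"
      using x[OF that] x[of "Suc m"] h by (intro sinc_antimono) (auto simp: x_def mult_right_mono)
    then have "inverse (sin (x m) / x m) \<le> inverse (sin (x (Suc m)) / x (Suc m))"
      using sinc_pos[of "Suc m"] by (intro le_imp_inverse_le) auto
    then have "inverse pi * inverse (sin (x m) / x m) \<le> inverse pi * inverse (sin (x (Suc m)) / x (Suc m))" by (intro mult_left_mono) auto
    moreover have "0 \<le> inverse pi * inverse (sin (x m) / x m)"
      using sinc_pos[OF that] by (intro mult_nonneg_nonneg) (auto simp del: inverse_divide)
    ultimately have "(inverse pi * inverse (sin (x m) / x m)) powr \<alpha> \<le> (inverse pi * inverse (sin (x (Suc m)) / x (Suc m))) powr \<alpha>"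
      using a by (intro powr_mono2) auto
    then show ?thesis using that by (simp add: G_def)
  qed
  have G0: "G 0 = 0" by (simp add: G_def)
  have MG: "Lp_multiplier p (4 * 1 * K) (\<lambda>j k. of_real (G (nat \<bar>j\<bar>)))"
    by (rule Lp_multiplier_even_monotone[where g = G, OF p half 1 G0]) (use 2 in auto)
  define l where "l j = cis (of_int j * (- \<alpha> * h / 2) + of_int (0::int) * 0) * of_real (G (nat \<bar>j\<bar>))" for j
  have "Lp_multiplier p (1 * (4 * 1 * K)) (\<lambda>j k. cis (of_int j * (- \<alpha> * h / 2) + of_int k * 0) * of_real (G (nat \<bar>j\<bar>)))"
    by (intro Lp_multiplier_mult Lp_multiplier_translation MG)
  then have M: "Lp_multiplier p (4 * K) (\<lambda>j k. l j)" by (simp add: l_def)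
  have "low_symbol \<alpha> n j = l j * frac_symbol \<alpha> h j" if j: "\<bar>j\<bar> \<le> int n" for j
  proof (cases "j = 0")
    case False
    define m where "m = nat \<bar>j\<bar>"
    have m: "1 \<le> m" "m \<le> n" using False j by (auto simp: m_def)
    have mj: "real m = \<bar>of_int j\<bar>" by (simp add: m_def)
    define \<theta> where "\<theta> = h * of_int j"
    have \<theta>: "\<bar>\<theta>\<bar> = real m * h" using h by (simp add: \<theta>_def abs_mult mj)
    have "real m * h \<le> real n * h" using h m by (intro mult_right_mono) auto
    then have "\<bar>\<theta>\<bar> \<le> pi" using \<theta> h by simp
    from diff_symbol_polar[OF a this]
    have D: "frac_symbol \<alpha> h j = cis (\<alpha> * \<theta> / 2) * of_real ((2 * \<bar>sin (\<theta> / 2)\<bar>) powr \<alpha>) * cis (pi * \<alpha> * sgn \<theta> / 2)"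
      by (simp add: frac_symbol_def \<theta>_def)
    have xm: "x m = \<bar>\<theta>\<bar> / 2" using m by (simp add: x_def \<theta>)
    have sin_eq: "\<bar>sin (\<theta> / 2)\<bar> = sin (x m)"
    proof -
      have "\<bar>sin (\<theta> / 2)\<bar> = \<bar>sin (x m)\<bar>" by (cases "\<theta> \<ge> 0") (auto simp: xm)
      then show ?thesis using x[OF m(1)] sin_ge_zero[of "x m"] by simp
    qed
    have G_eq: "G m * (2 * \<bar>sin (\<theta> / 2)\<bar>) powr \<alpha> = real n powr (- \<alpha>) * real m powr \<alpha>"
    proof -
      have sp: "sin (x m) > 0" using sinc_pos[OF m(1)] x[OF m(1)] by (simp add: zero_less_divide_iff)
      have "0 \<le> inverse pi * inverse (sin (x m) / x m)"
        using sinc_pos[OF m(1)] by (intro mult_nonneg_nonneg) (auto simp del: inverse_divide)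
      then have "G m * (2 * \<bar>sin (\<theta> / 2)\<bar>) powr \<alpha> = ((inverse pi * inverse (sin (x m) / x m)) * (2 * \<bar>sin (\<theta> / 2)\<bar>)) powr \<alpha>"
        using m by (simp only: G_def powr_mult) simp
      also have "(inverse pi * inverse (sin (x m) / x m)) * (2 * \<bar>sin (\<theta> / 2)\<bar>) = real m / real n"
        unfolding sin_eq using sp m n h by (simp add: x_def h_def field_simps)
      also have "(real m / real n) powr \<alpha> = real n powr (- \<alpha>) * real m powr \<alpha>"
        by (simp add: powr_divide powr_minus_divide)
      finally show ?thesis .
    qed
    have c1: "cis (of_int j * (- \<alpha> * h / 2) + of_int (0::int) * 0) * cis (\<alpha> * \<theta> / 2) = 1"
      by (simp add: cis_mult \<theta>_def mult_ac)
    have c2: "cis (pi * \<alpha> * sgn \<theta> / 2) = cis (pi * \<alpha> * of_int (sgn j) / 2)"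
      using h by (auto simp: \<theta>_def sgn_if zero_less_mult_iff)
    have "l j * frac_symbol \<alpha> h j = (cis (of_int j * (- \<alpha> * h / 2) + of_int (0::int) * 0) * cis (\<alpha> * \<theta> / 2)) *
       of_real (G m * (2 * \<bar>sin (\<theta> / 2)\<bar>) powr \<alpha>) * cis (pi * \<alpha> * sgn \<theta> / 2)"
      unfolding D l_def m_def[symmetric] of_real_mult by (simp only: mult_ac)
    also have "\<dots> = low_symbol \<alpha> n j"
      unfolding c1 c2 G_eq using j by (simp add: low_symbol_def weyl_factor_def mj)
    finally show ?thesis by simp
  qed (use a in \<open>simp add: frac_symbol_0 low_symbol_0\<close>)
  then show ?thesis using M unfolding h_def by blast
qed

lemma Lp_multiplier_high_symbol:
  assumes p: "1 \<le> p" and half: "\<And>m. Lp_multiplier p K (\<lambda>j k. if m \<le> j then 1 else 0)"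
  shows "Lp_multiplier p (2 * K) (\<lambda>j k. high_symbol n j)"
proof -
  have "(\<lambda>(j::int) (k::int). (if int n + 1 \<le> j then 1 else 0) + (if int n + 1 \<le> - j then 1 else (0::complex))) = (\<lambda>j k. high_symbol n j)"
    by (intro ext) (auto simp: high_symbol_def)
  with Lp_multiplier_add[OF p half[of "int n + 1"] Lp_multiplier_reflect[OF half[of "int n + 1"]]] show ?thesis by (simp only:)
qed

lemma Lp_multiplier_low_cutoff:
  assumes p: "1 \<le> p" and half: "\<And>m. Lp_multiplier p K (\<lambda>j k. if m \<le> j then 1 else 0)"
  shows "Lp_multiplier p (2 * K) (\<lambda>j k. 1 - high_symbol n j)"
proof -
  have "(\<lambda>(j::int) (k::int). (if - int n \<le> j then 1 else 0) + (-1) * (if int n + 1 \<le> j then 1 else (0::complex))) = (\<lambda>j k. 1 - high_symbol n j)"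
    by (intro ext) (auto simp: high_symbol_def)
  moreover have "Lp_multiplier p K (\<lambda>j k. (-1) * (if int n + 1 \<le> j then 1 else 0))"
    using Lp_multiplier_cmult[OF p half, of "-1"] by simp
  note Lp_multiplier_add[OF p half[of "- int n"] this]
  ultimately show ?thesis by (simp only:)
qed

section \<open>Averaged differences at high frequencies\<close>

text \<open>The Fourier transform of the tent function \<open>max 0 (1 - \<bar>s\<bar>)\<close>.\<close>

definition tent_transform :: "real \<Rightarrow> real" where
  "tent_transform u = (if u = 0 then 1 else (2 - 2 * cos u) / u\<^sup>2)"

lemma tent_transform_minus [simp]: "tent_transform (- u) = tent_transform u"
  by (simp add: tent_transform_def)

text \<open>The threshold 1 / 2 is what Bernoulli's inequality requires in
  \<open>tent_symbol_ge_1\<close>; the crude estimate 4 / 9 already lies below it.\<close>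

lemma tent_transform_le:
  assumes "pi \<le> \<bar>u\<bar>" shows "tent_transform u \<le> 1 / 2"
proof -
  have "pi\<^sup>2 \<le> u\<^sup>2" using assms by (metis abs_le_square_iff abs_of_nonneg pi_ge_zero)
  moreover have "3\<^sup>2 \<le> pi\<^sup>2" using pi_gt3 by (intro power_mono) auto
  ultimately have u: "9 \<le> u\<^sup>2" by simp
  have "2 - 2 * cos u \<le> 4" using cos_ge_minus_one[of u] by linarith
  then have "2 - 2 * cos u \<le> u\<^sup>2 / 2" using u by linarith
  then show ?thesis using u by (auto simp: tent_transform_def divide_le_eq)
qed

text \<open>The derivative is at most 5 / t^2, and adding or subtracting 5 / t therefore gives a
  monotone function. A bound of the form 1 / u - 1 / v telescopes when summed over consecutive
  frequencies.\<close>

lemma tent_transform_diff_le: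
  assumes "pi \<le> u" "u \<le> v"
  shows "\<bar>tent_transform v - tent_transform u\<bar> \<le> 5 * (1 / u - 1 / v)"
proof -
  have u0: "u > 0" using assms pi_gt_zero by linarith
  define D where "D t = 2 * sin t / t\<^sup>2 - 2 * (2 - 2 * cos t) / t ^ 3" for t :: real
  have der: "(tent_transform has_real_derivative D t) (at t)" if "u \<le> t" for t
  proof -
    have t: "t > 0" using that u0 by simp
    have "((\<lambda>u. (2 - 2 * cos u) / u\<^sup>2) has_real_derivative D t) (at t)"
      using t unfolding D_def
      by (auto intro!: derivative_eq_intros simp: field_simps power2_eq_square power3_eq_cube)
    then show ?thesis
      by (rule DERIV_cong_ev[THEN iffD1, rotated 3, OF _ refl _ refl])
        (use t in \<open>auto simp: tent_transform_def intro!: eventually_mono[OF eventually_nhds_in_open[of "{0<..}"]]\<close>)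
  qed
  have D: "\<bar>D t\<bar> \<le> 5 / t\<^sup>2" if "u \<le> t" for t
  proof -
    have t: "t > 3" "t > 0" using that assms pi_gt3 by linarith+
    have "\<bar>2 * sin t / t\<^sup>2\<bar> \<le> 2 / t\<^sup>2" using abs_sin_le_one[of t] t by (simp add: abs_mult divide_right_mono)
    moreover have "\<bar>2 * (2 - 2 * cos t) / t ^ 3\<bar> \<le> 3 / t\<^sup>2"
    proof -
      have "\<bar>2 * (2 - 2 * c)\<bar> \<le> 8" if "- 1 \<le> c" "c \<le> 1" for c :: real
        using that by (simp add: abs_le_iff)
      from this[OF cos_ge_minus_one cos_le_one] have "\<bar>2 * (2 - 2 * cos t)\<bar> \<le> 8" .
      then have "\<bar>2 * (2 - 2 * cos t) / t ^ 3\<bar> \<le> 8 / t ^ 3" using t by (simp add: divide_right_mono)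
      \<comment> \<open>Here t > 3 is used, so that 8 \<le> 3 t.\<close>
      also have "\<dots> \<le> (3 * t) / t ^ 3" using t by (intro divide_right_mono) auto
      also have "\<dots> = 3 / t\<^sup>2" using t by (simp add: power2_eq_square power3_eq_cube)
      finally show ?thesis .
    qed
    ultimately have "\<bar>D t\<bar> \<le> 2 / t\<^sup>2 + 3 / t\<^sup>2"
      unfolding D_def by (intro order_trans[OF abs_triangle_ineq4] add_mono)
    then show ?thesis by simp
  qed
  have inv: "((\<lambda>t. 5 / t) has_real_derivative - (5 / t\<^sup>2)) (at t)" if "u \<le> t" for t
    using that u0 by (auto intro!: derivative_eq_intros simp: power2_eq_square)
  have "tent_transform v + 5 / v \<le> tent_transform u + 5 / u"
    by (rule DERIV_nonpos_imp_nonincreasing[OF assms(2), of "\<lambda>t. tent_transform t + 5 / t"])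
      (use D in \<open>fastforce intro!: exI derivative_intros der inv simp: abs_le_iff\<close>)
  moreover have "tent_transform u - 5 / u \<le> tent_transform v - 5 / v"
    by (rule DERIV_nonneg_imp_nondecreasing[OF assms(2), of "\<lambda>t. tent_transform t - 5 / t"])
      (use D in \<open>fastforce intro!: exI derivative_intros der inv simp: abs_le_iff\<close>)
  ultimately show ?thesis by (simp add: abs_le_iff algebra_simps)
qed

text \<open>The tent is the law of the difference of two independent uniform variables on [0, 1].
  Hence the double sum factors into the squared modulus of a Riemann sum for the integral of e^(isu)
  over [0, 1]. Discrete averages are used so that only finite sums of differences have to be
  estimated.\<close>

lemma tent_average_tendsto:
  "(\<lambda>M. \<Sum>x\<in>{..<Suc M}\<times>{..<Suc M}. of_real (1 / (real (Suc M))\<^sup>2) * cis ((real (fst x) - real (snd x)) * u / real (Suc M)))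
     \<longlonglongrightarrow> of_real (tent_transform u)"
proof (cases "u = 0")
  case True
  have "(\<Sum>x\<in>{..<Suc M}\<times>{..<Suc M}. of_real (1 / (real (Suc M))\<^sup>2) * cis ((real (fst x) - real (snd x)) * u / real (Suc M))) = 1" for M
  proof -
    have "(\<Sum>x\<in>{..<Suc M}\<times>{..<Suc M}. of_real (1 / (real (Suc M))\<^sup>2) * cis ((real (fst x) - real (snd x)) * u / real (Suc M)))
      = of_nat (Suc M * Suc M) * of_real (1 / (real (Suc M))\<^sup>2)"
      using True by (simp add: card_cartesian_product)
    also have "\<dots> = of_real (real (Suc M * Suc M) * (1 / (real (Suc M))\<^sup>2))" by (simp only: of_real_mult of_real_of_nat_eq)
    also have "real (Suc M * Suc M) * (1 / (real (Suc M))\<^sup>2) = 1" by (simp only: power2_eq_square of_nat_mult) simp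
    finally show ?thesis by simp
  qed
  then show ?thesis using True by (simp add: tent_transform_def)
next
  case False
  define S where "S M = (\<Sum>i<Suc M. cis (real i * u / real (Suc M)))" for M
  have prod: "(\<Sum>x\<in>{..<Suc M}\<times>{..<Suc M}. of_real (1 / (real (Suc M))\<^sup>2) * cis ((real (fst x) - real (snd x)) * u / real (Suc M)))
     = (S M / of_real (real (Suc M))) * cnj (S M / of_real (real (Suc M)))" for M
  proof -
    have "cis ((real i - real i') * u / real (Suc M)) = cis (real i * u / real (Suc M)) * cnj (cis (real i' * u / real (Suc M)))" for i i'
      by (simp add: cis_cnj cis_mult left_diff_distrib diff_divide_distrib)
    then have "(\<Sum>x\<in>{..<Suc M}\<times>{..<Suc M}. of_real (1 / (real (Suc M))\<^sup>2) * cis ((real (fst x) - real (snd x)) * u / real (Suc M)))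
       = (\<Sum>x\<in>{..<Suc M}\<times>{..<Suc M}. of_real (1 / (real (Suc M))\<^sup>2) *
           (cis (real (fst x) * u / real (Suc M)) * cnj (cis (real (snd x) * u / real (Suc M)))))"
      by (simp only:)
    also have "\<dots> = of_real (1 / (real (Suc M))\<^sup>2) * (S M * cnj (S M))"
    proof -
      have "S M * cnj (S M) = (\<Sum>x\<in>{..<Suc M}\<times>{..<Suc M}. cis (real (fst x) * u / real (Suc M)) * cnj (cis (real (snd x) * u / real (Suc M))))"
        unfolding S_def cnj_sum sum_product sum.cartesian_product case_prod_unfold ..
      then show ?thesis by (simp only: sum_distrib_left)
    qed
    finally show ?thesis by (simp add: power2_eq_square del: of_nat_Suc)
  qed
  have d: "((\<lambda>x. (cis (u * x) - 1) / of_real x) \<longlongrightarrow> \<i> * of_real u) (at 0)"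
  proof -
    have "((\<lambda>x. cis (u * x)) has_vector_derivative \<i> * of_real u) (at 0)"
      unfolding has_vector_derivative_def
      by (auto intro!: derivative_eq_intros simp: scaleR_conv_of_real mult_ac)
    then have "((\<lambda>h. norm (cis (u * h) - 1 - of_real h * (\<i> * of_real u)) / norm h) \<longlongrightarrow> 0) (at 0)"
      by (simp add: has_vector_derivative_def has_derivative_at scaleR_conv_of_real)
    then have "((\<lambda>h. norm ((cis (u * h) - 1) / of_real h - \<i> * of_real u)) \<longlongrightarrow> 0) (at 0)"
    proof (rule Lim_transform_eventually)
      have "norm (cis (u * h) - 1 - of_real h * (\<i> * of_real u)) / norm h = norm ((cis (u * h) - 1) / of_real h - \<i> * of_real u)"
        if "h \<noteq> 0" for h
      proof -
        have "(cis (u * h) - 1) / of_real h - \<i> * of_real u = (cis (u * h) - 1 - of_real h * (\<i> * of_real u)) / of_real h"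
          using that by (simp add: diff_divide_distrib)
        then show ?thesis by (simp add: norm_divide)
      qed
      then show "\<forall>\<^sub>F h in at 0. norm (cis (u * h) - 1 - of_real h * (\<i> * of_real u)) / norm h = norm ((cis (u * h) - 1) / of_real h - \<i> * of_real u)"
        by (simp add: eventually_at_filter)
    qed
    then show ?thesis by (rule LIM_zero_cancel[OF tendsto_norm_zero_cancel])
  qed
  have lim0: "(\<lambda>M. 1 / real (Suc M)) \<longlonglongrightarrow> 0" using LIMSEQ_inverse_real_of_nat unfolding inverse_eq_divide .
  have lim: "(\<lambda>M. (cis (u * (1 / real (Suc M))) - 1) / of_real (1 / real (Suc M))) \<longlonglongrightarrow> \<i> * of_real u"
    by (rule filterlim_compose[OF d]) (simp add: filterlim_at lim0 del: of_nat_Suc)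
  have iu: "\<i> * of_real u \<noteq> 0" using False by simp
  \<comment> \<open>The Riemann sum is geometric, and its denominator is the difference quotient of
    e^(iux) at 0 with increment 1 / (M + 1). The nonzero limit of that quotient ensures that the
    ratio is eventually different from 1.\<close>
  have ev: "\<forall>\<^sub>F M in sequentially. (cis u - 1) / ((cis (u * (1 / real (Suc M))) - 1) / of_real (1 / real (Suc M))) = S M / of_real (real (Suc M))"
    using tendsto_imp_eventually_ne[OF lim iu]
  proof eventually_elim
    case (elim M)
    define w where "w = cis (u * (1 / real (Suc M)))"
    have w: "w \<noteq> 1" using elim by (auto simp: w_def)
    have "cis (real i * u / real (Suc M)) = w ^ i" for i by (simp add: w_def Complex.DeMoivre mult_ac)
    then have "S M = (\<Sum>i<Suc M. w ^ i)" unfolding S_def by (simp only:)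
    also have "\<dots> = (w ^ Suc M - 1) / (w - 1)" by (rule geometric_sum[OF w])
    finally have "S M = (w ^ Suc M - 1) / (w - 1)" .
    moreover have "w ^ Suc M = cis u" unfolding w_def Complex.DeMoivre by (simp del: of_nat_Suc)
    ultimately show ?case unfolding w_def[symmetric] by (simp del: of_nat_Suc)
  qed
  have "(\<lambda>M. S M / of_real (real (Suc M))) \<longlonglongrightarrow> (cis u - 1) / (\<i> * of_real u)"
    by (rule Lim_transform_eventually[OF tendsto_divide[OF tendsto_const lim iu] ev])
  then have "(\<lambda>M. (S M / of_real (real (Suc M))) * cnj (S M / of_real (real (Suc M)))) \<longlonglongrightarrow> (cis u - 1) / (\<i> * of_real u) * cnj ((cis u - 1) / (\<i> * of_real u))"
    by (intro tendsto_mult tendsto_cnj)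
  also have "(cis u - 1) / (\<i> * of_real u) * cnj ((cis u - 1) / (\<i> * of_real u)) = of_real (tent_transform u)"
  proof -
    have "(cis u - 1) * cnj (cis u - 1) = of_real (2 - 2 * cos u)"
      using sin_cos_squared_add3[of u] by (simp add: complex_eq_iff algebra_simps)
    moreover have "\<i> * of_real u * cnj (\<i> * of_real u) = of_real (u\<^sup>2)" by (simp add: complex_eq_iff power2_eq_square)
    ultimately show ?thesis
      unfolding complex_cnj_divide times_divide_times_eq using False by (simp only: tent_transform_def) simp
  qed
  finally show ?thesis unfolding prod .
qed

text \<open>The average of \<open>(4 sin\<^sup>2 (s u / 2))\<^sup>q\<close> over \<open>s\<close> with the tent function as density.\<close>

definition tent_symbol :: "nat \<Rightarrow> real \<Rightarrow> real" where
  "tent_symbol q u = (\<Sum>l\<le>2*q. (- 1) ^ (q + l) * real (2 * q choose l) * tent_transform (of_int (int q - int l) * u))"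

text \<open>Expands the power of the sine into characters and averages each of them with
  \<open>tent_average_tendsto\<close>.\<close>

lemma tent_symbol_tendsto:
  "(\<lambda>M. \<Sum>x\<in>{..<Suc M}\<times>{..<Suc M}. complex_of_real (1 / (real (Suc M))\<^sup>2) *
       of_real ((4 * (sin ((real (fst x) - real (snd x)) * u / real (Suc M) / 2))\<^sup>2) ^ q))
     \<longlonglongrightarrow> of_real (tent_symbol q u)"
proof -
  let ?c = "\<lambda>l. (- 1) ^ (q + l) * of_nat (2 * q choose l) :: complex"
  have eq: "(\<Sum>x\<in>{..<Suc M}\<times>{..<Suc M}. complex_of_real (1 / (real (Suc M))\<^sup>2) *
       of_real ((4 * (sin ((real (fst x) - real (snd x)) * u / real (Suc M) / 2))\<^sup>2) ^ q))
     = (\<Sum>l\<le>2*q. ?c l * (\<Sum>x\<in>{..<Suc M}\<times>{..<Suc M}. of_real (1 / (real (Suc M))\<^sup>2) *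
          cis ((real (fst x) - real (snd x)) * (of_int (int q - int l) * u) / real (Suc M))))" for M
    unfolding four_sin_sq_power_expand sum_distrib_left
    by (subst sum.swap) (intro sum.cong refl, simp add: mult_ac)
  have "complex_of_real (tent_symbol q u) = (\<Sum>l\<le>2*q. ?c l * of_real (tent_transform (of_int (int q - int l) * u)))"
    by (simp add: tent_symbol_def)
  then show ?thesis
    unfolding eq by (simp only:) (intro tendsto_sum tendsto_mult tendsto_const tent_average_tendsto)
qed

lemma tent_symbol_minus [simp]: "tent_symbol q (- u) = tent_symbol q u"
  by (simp add: tent_symbol_def)

text \<open>Bernoulli's inequality reduces the lower bound to the exponent \<open>q = 1\<close>.\<close>

lemma tent_symbol_ge_1:
  assumes "pi \<le> \<bar>u\<bar>" shows "1 \<le> tent_symbol q u"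
proof -
  let ?\<theta> = "\<lambda>M x. (real (fst x) - real (snd x)) * u / real (Suc M)"
  let ?S = "\<lambda>M. {..<Suc M}\<times>{..<Suc M}"
  let ?w = "\<lambda>M. 1 / (real (Suc M))\<^sup>2"
  have w_sum: "(\<Sum>x\<in>?S M. ?w M) = 1" for M
    by (simp only: sum_constant card_cartesian_product card_lessThan of_nat_mult power2_eq_square) (simp del: of_nat_Suc)
  have l1: "(\<lambda>M. \<Sum>x\<in>?S M. ?w M * (4 * (sin (?\<theta> M x / 2))\<^sup>2) ^ q) \<longlonglongrightarrow> tent_symbol q u"
    using tendsto_Re[OF tent_symbol_tendsto[of u q]] by (simp del: of_nat_Suc)
  have "(\<lambda>M. \<Sum>x\<in>?S M. ?w M * cos (?\<theta> M x)) \<longlonglongrightarrow> tent_transform u"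
    using tendsto_Re[OF tent_average_tendsto[of u]] by (simp del: of_nat_Suc)
  then have l2: "(\<lambda>M. 1 + real q * (1 - 2 * (\<Sum>x\<in>?S M. ?w M * cos (?\<theta> M x)))) \<longlonglongrightarrow> 1 + real q * (1 - 2 * tent_transform u)"
    by (intro tendsto_intros)
  have le: "1 + real q * (1 - 2 * (\<Sum>x\<in>?S M. ?w M * cos (?\<theta> M x))) \<le> (\<Sum>x\<in>?S M. ?w M * (4 * (sin (?\<theta> M x / 2))\<^sup>2) ^ q)" for M
  proof -
    have "1 + real q * (1 - 2 * (\<Sum>x\<in>?S M. ?w M * cos (?\<theta> M x))) = (\<Sum>x\<in>?S M. ?w M) * (1 + real q) - 2 * real q * (\<Sum>x\<in>?S M. ?w M * cos (?\<theta> M x))"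
      unfolding w_sum by (simp add: algebra_simps)
    also have "\<dots> = (\<Sum>x\<in>?S M. ?w M * (1 + real q * (1 - 2 * cos (?\<theta> M x))))"
      unfolding sum_distrib_right sum_distrib_left sum_subtractf[symmetric]
      by (intro sum.cong refl) (simp add: algebra_simps del: of_nat_Suc)
    also have "\<dots> \<le> (\<Sum>x\<in>?S M. ?w M * (4 * (sin (?\<theta> M x / 2))\<^sup>2) ^ q)"
    proof (intro sum_mono mult_left_mono)
      fix x
      \<comment> \<open>Writes the base of the power as 1 + x with x \<ge> -1, the form needed for
        Bernoulli's inequality; the average of x is 1 - 2 \<open>tent_transform u\<close> in the
        limit.\<close>
      have "4 * (sin (\<theta> / 2))\<^sup>2 = 1 + (1 - 2 * cos \<theta>)" for \<theta> :: real
        using cos_double_sin[of "\<theta> / 2"] by simp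
      moreover have "-1 \<le> 1 - 2 * cos (?\<theta> M x)" using cos_le_one[of "?\<theta> M x"] by linarith
      ultimately show "1 + real q * (1 - 2 * cos (?\<theta> M x)) \<le> (4 * (sin (?\<theta> M x / 2))\<^sup>2) ^ q"
        using Bernoulli_inequality[of "1 - 2 * cos (?\<theta> M x)" q] by (simp only:)
    qed simp
    finally show ?thesis .
  qed
  have "1 + real q * (1 - 2 * tent_transform u) \<le> tent_symbol q u"
    using l2 l1 by (rule LIMSEQ_le) (use le in blast)
  moreover have "0 \<le> real q * (1 - 2 * tent_transform u)" using tent_transform_le[OF assms] by simp
  ultimately show ?thesis by linarith
qed

text \<open>Each term is the tent transform at r u for an integer r: for r = 0 it is constant, for
  |r| \<ge> 1 its variation is that of the case r = 1 or smaller. The binomial coefficients of order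
  2 q add up to 4^q.\<close>

lemma tent_symbol_diff_le:
  assumes "pi \<le> u" "u \<le> v"
  shows "\<bar>tent_symbol q v - tent_symbol q u\<bar> \<le> 4 ^ q * (5 * (1 / u - 1 / v))"
proof -
  have u0: "u > 0" using assms pi_gt_zero by linarith
  have nn: "0 \<le> 5 * (1 / u - 1 / v)" using assms u0 by (simp add: field_simps)
  have r: "\<bar>tent_transform (of_int r * v) - tent_transform (of_int r * u)\<bar> \<le> 5 * (1 / u - 1 / v)" for r :: int
  proof -
    have pos: "\<bar>tent_transform (of_int r * v) - tent_transform (of_int r * u)\<bar> \<le> 5 * (1 / u - 1 / v)" if "r \<ge> 1" for r :: int
    proof -
      have r1: "real_of_int r \<ge> 1" using that by simp
      have ru: "u \<le> of_int r * u" using r1 u0 by simp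
      have "\<bar>tent_transform (of_int r * v) - tent_transform (of_int r * u)\<bar> \<le> 5 * (1 / (of_int r * u) - 1 / (of_int r * v))"
        using r1 assms ru by (intro tent_transform_diff_le) (auto intro: mult_left_mono)
      also have "\<dots> = (5 * (1 / u - 1 / v)) * (1 / of_int r)" using r1 u0 assms by (simp add: field_simps)
      also have "\<dots> \<le> (5 * (1 / u - 1 / v)) * 1" using nn r1 by (intro mult_left_mono) auto
      finally show ?thesis by simp
    qed
    show ?thesis
    proof (cases r "0::int" rule: linorder_cases)
      case less then show ?thesis using pos[of "- r"] by simp
    next
      case equal then show ?thesis using nn by simp
    next
      case greater then show ?thesis using pos[of r] by simp
    qed
  qed
  have "\<bar>tent_symbol q v - tent_symbol q u\<bar> = \<bar>\<Sum>l\<le>2*q. (- 1) ^ (q + l) * real (2 * q choose l) *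
      (tent_transform (of_int (int q - int l) * v) - tent_transform (of_int (int q - int l) * u))\<bar>"
    by (simp add: tent_symbol_def sum_subtractf[symmetric] right_diff_distrib)
  also have "\<dots> \<le> (\<Sum>l\<le>2*q. \<bar>(- 1) ^ (q + l) * real (2 * q choose l) *
      (tent_transform (of_int (int q - int l) * v) - tent_transform (of_int (int q - int l) * u))\<bar>)"
    by (rule sum_abs)
  also have "\<dots> \<le> (\<Sum>l\<le>2*q. real (2 * q choose l) * (5 * (1 / u - 1 / v)))"
    by (intro sum_mono) (simp only: abs_mult power_abs abs_minus_cancel abs_one power_one mult_1 abs_of_nat, intro mult_left_mono r, simp)
  also have "\<dots> = real (\<Sum>l\<le>2*q. 2 * q choose l) * (5 * (1 / u - 1 / v))"
    by (simp only: sum_distrib_right of_nat_sum)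
  also have "real (\<Sum>l\<le>2*q. 2 * q choose l) = 4 ^ q"
    unfolding choose_row_sum by (simp add: power_mult)
  finally show ?thesis .
qed

text \<open>The tail is reached in three moves: a difference of order 2 q - alpha raises the order
  to 2 q, averaging over steps replaces the oscillating symbol by \<open>tent_symbol\<close>, and
  division by the latter is a multiplier of bounded variation on |j| > n, because there the argument
  is at least pi.\<close>

lemma high_symbol_bound:
  assumes p: "1 \<le> p" and a: "\<alpha> > 0" and q: "\<alpha> < real (2 * q)" and n: "n \<ge> 1"
    and half: "\<And>m. Lp_multiplier p K (\<lambda>j k. if m \<le> j then 1 else 0)"
    and B: "\<And>h. \<bar>h\<bar> \<le> pi / real n \<Longrightarrow> Lp_norm p (trig_poly N (\<lambda>j k. frac_symbol \<alpha> h j * c j k)) \<le> B"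
  shows "Lp_norm p (trig_poly N (\<lambda>j k. high_symbol n j * c j k)) \<le>
    ennreal (4 * (1 + 5 * 4 ^ q) * K * K * (\<Sum>\<nu>. \<bar>frac_coeff (real (2 * q) - \<alpha>) \<nu>\<bar>)) * B"
proof -
  define K1 where "K1 = (\<Sum>\<nu>. \<bar>frac_coeff (real (2 * q) - \<alpha>) \<nu>\<bar>)"
  define \<delta> where "\<delta> = pi / real n"
  have \<delta>: "\<delta> > 0" "real n * \<delta> = pi" using n by (auto simp: \<delta>_def)
  have q0: "q > 0" using a q by (cases q) auto
  have K: "0 \<le> K" using half Lp_multiplier_nonneg by blast
  have A: "Lp_norm p (trig_poly N (\<lambda>j k. of_real ((4 * (sin (h * of_int j / 2))\<^sup>2) ^ q) * c j k)) \<le> ennreal K1 * B"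
    if h: "\<bar>h\<bar> \<le> \<delta>" for h
  proof -
    \<comment> \<open>The difference of order 2 q - alpha, with the translation by (q - alpha) h
      that completes the shift alpha h in \<open>frac_symbol\<close> to the symmetric shift q
      h.\<close>
    let ?e = "\<lambda>j k. (- 1) ^ q * (cis (of_int j * ((real q - \<alpha>) * h) + of_int k * 0) * diff_symbol (real (2 * q) - \<alpha>) (h * of_int j))"
    have "Lp_multiplier p (norm ((- 1) ^ q :: complex) * (1 * K1)) ?e"
      unfolding K1_def by (intro Lp_multiplier_cmult Lp_multiplier_mult Lp_multiplier_translation Lp_multiplier_diff_symbol p) (use q in auto)
    then have M: "Lp_multiplier p K1 ?e" by (simp add: norm_power)
    have "of_real ((4 * (sin (h * of_int j / 2))\<^sup>2) ^ q) * c j k = ?e j k * (frac_symbol \<alpha> h j * c j k)" for j k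
    proof -
      have "diff_symbol (real (2 * q)) (h * of_int j) = diff_symbol (real (2 * q) - \<alpha>) (h * of_int j) * diff_symbol \<alpha> (h * of_int j)"
        using diff_symbol_add[of "real (2 * q) - \<alpha>" \<alpha> "h * of_int j"] q a by simp
      moreover have "cis (real q * (h * of_int j)) = cis (of_int j * ((real q - \<alpha>) * h) + of_int k * 0) * cis (\<alpha> * (h * of_int j))"
        by (simp add: cis_mult algebra_simps)
      ultimately show ?thesis unfolding four_sin_sq_power_eq[OF q0] frac_symbol_def by (simp only: mult_ac)
    qed
    then have "Lp_norm p (trig_poly N (\<lambda>j k. of_real ((4 * (sin (h * of_int j / 2))\<^sup>2) ^ q) * c j k)) =
       Lp_norm p (trig_poly N (\<lambda>j k. ?e j k * (frac_symbol \<alpha> h j * c j k)))" by (simp only:)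
    also have "\<dots> \<le> ennreal K1 * Lp_norm p (trig_poly N (\<lambda>j k. frac_symbol \<alpha> h j * c j k))" by (rule Lp_multiplierD[OF M])
    also have "\<dots> \<le> ennreal K1 * B" using B h by (intro mult_left_mono) (auto simp: \<delta>_def)
    finally show ?thesis .
  qed
  have avg: "Lp_norm p (trig_poly N (\<lambda>j k. (\<Sum>x\<in>{..<Suc M}\<times>{..<Suc M}. complex_of_real (1 / (real (Suc M))\<^sup>2) *
       of_real ((4 * (sin ((real (fst x) - real (snd x)) * (\<delta> * of_int j) / real (Suc M) / 2))\<^sup>2) ^ q)) * c j k)) \<le> ennreal K1 * B" for M
  proof -
    let ?S = "{..<Suc M}\<times>{..<Suc M}"
    let ?h = "\<lambda>x. (real (fst x) - real (snd x)) * \<delta> / real (Suc M)"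
    let ?g = "\<lambda>x. trig_poly N (\<lambda>j k. of_real ((4 * (sin (?h x * of_int j / 2))\<^sup>2) ^ q) * c j k)"
    have "Lp_norm p (\<lambda>z. \<Sum>x\<in>?S. of_real (1 / (real (Suc M))\<^sup>2) * ?g x z) \<le> ennreal (\<Sum>x\<in>?S. norm (complex_of_real (1 / (real (Suc M))\<^sup>2))) * (ennreal K1 * B)"
    proof (intro Lp_norm_sum_le p A)
      fix x :: "nat \<times> nat" assume "x \<in> ?S"
      then have "\<bar>real (fst x) - real (snd x)\<bar> \<le> real (Suc M)" by auto
      then have "\<bar>real (fst x) - real (snd x)\<bar> * \<delta> \<le> real (Suc M) * \<delta>" using \<delta> by (intro mult_right_mono) auto
      then show "\<bar>?h x\<bar> \<le> \<delta>" using \<delta> by (simp add: abs_mult divide_le_eq mult.commute del: of_nat_Suc)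
    qed auto
    also have "(\<Sum>x\<in>?S. norm (complex_of_real (1 / (real (Suc M))\<^sup>2))) = 1"
      by (simp only: norm_of_real sum_constant card_cartesian_product card_lessThan of_nat_mult power2_eq_square) (simp del: of_nat_Suc)
    finally have "Lp_norm p (\<lambda>z. \<Sum>x\<in>?S. of_real (1 / (real (Suc M))\<^sup>2) * ?g x z) \<le> ennreal K1 * B" by simp
    moreover have "(\<lambda>z. \<Sum>x\<in>?S. of_real (1 / (real (Suc M))\<^sup>2) * ?g x z) =
      trig_poly N (\<lambda>j k. (\<Sum>x\<in>?S. complex_of_real (1 / (real (Suc M))\<^sup>2) * of_real ((4 * (sin (?h x * of_int j / 2))\<^sup>2) ^ q)) * c j k)"
      by (rule ext) (rule trig_poly_sum[symmetric])
    ultimately show ?thesis by (simp add: mult_ac del: of_nat_Suc)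
  qed
  have mB: "Lp_norm p (trig_poly N (\<lambda>j k. of_real (tent_symbol q (\<delta> * of_int j)) * c j k)) \<le> ennreal K1 * B"
  proof (rule Lp_norm_lim_le[OF _ _ _ avg])
    show "AE z in lborel. (\<lambda>M. trig_poly N (\<lambda>j k. (\<Sum>x\<in>{..<Suc M}\<times>{..<Suc M}. complex_of_real (1 / (real (Suc M))\<^sup>2) *
       of_real ((4 * (sin ((real (fst x) - real (snd x)) * (\<delta> * of_int j) / real (Suc M) / 2))\<^sup>2) ^ q)) * c j k) z)
       \<longlonglongrightarrow> trig_poly N (\<lambda>j k. of_real (tent_symbol q (\<delta> * of_int j)) * c j k) z"
      unfolding trig_poly_def by (intro AE_I2 tendsto_sum tendsto_mult tendsto_const tent_symbol_tendsto)
  qed (use p in auto)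
  \<comment> \<open>The reciprocal is frozen at its value at n for smaller k, where
    \<open>tent_symbol\<close> may be small; the cutoff to |j| > n removes these frequencies
    anyway.\<close>
  define G where "G k = (if k = 0 then 0 else inverse (tent_symbol q (\<delta> * real (max k n))))" for k :: nat
  have pi_le: "pi \<le> \<delta> * real k" if "n \<le> k" for k
  proof -
    have "pi = \<delta> * real n" using \<delta> by (simp add: mult.commute)
    also have "\<dots> \<le> \<delta> * real k" using that \<delta> by (intro mult_left_mono) auto
    finally show ?thesis .
  qed
  have ge1: "1 \<le> tent_symbol q (\<delta> * real k)" if "n \<le> k" for k
    by (rule tent_symbol_ge_1) (use pi_le[OF that] in linarith)
  \<comment> \<open>1 accounts for the jump from G 0 = 0 to G 1, the rest for the variation beyond
    n.\<close>
  define V where "V = 1 + 5 * (4::real) ^ q"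
  have var: "(\<Sum>m=1..M. norm (complex_of_real (G m) - complex_of_real (G (m - 1)))) \<le> V" for M
  proof -
    \<comment> \<open>A telescoping majorant of the variation: constant up to n, afterwards
      following \<open>tent_symbol_diff_le\<close>. The step from \<open>tent_symbol\<close> to its
      reciprocal costs nothing because inversion is 1-Lipschitz on [1, infinity).\<close>
    define E where "E k = 4 ^ q * (5 * (1 / (\<delta> * real n) - 1 / (\<delta> * real (max k n))))" for k :: nat
    have step: "\<bar>G (Suc k) - G k\<bar> \<le> E (Suc k) - E k" if "k \<ge> 1" for k
    proof (cases "Suc k \<le> n")
      case True
      then show ?thesis using that by (simp add: G_def E_def max_def)
    next
      case False
      then have k: "n \<le> k" by simp
      have "\<bar>inverse y - inverse x\<bar> \<le> \<bar>y - x\<bar>" if "1 \<le> x" "1 \<le> y" for x y :: real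
      proof -
        have "inverse y - inverse x = (x - y) / (x * y)" using that by (simp add: field_simps)
        moreover have "1 \<le> x * y" using that mult_mono[of 1 x 1 y] by simp
        ultimately show ?thesis by (simp add: abs_divide divide_le_eq abs_minus_commute mult_le_cancel_left1)
      qed
      from this[OF ge1[OF k] ge1[of "Suc k"]]
      have "\<bar>G (Suc k) - G k\<bar> \<le> \<bar>tent_symbol q (\<delta> * real (Suc k)) - tent_symbol q (\<delta> * real k)\<bar>"
        using k that by (simp add: G_def max_def del: of_nat_Suc)
      also have "\<dots> \<le> 4 ^ q * (5 * (1 / (\<delta> * real k) - 1 / (\<delta> * real (Suc k))))"
        by (rule tent_symbol_diff_le) (use \<delta> pi_le[OF k] in auto)
      also have "\<dots> = E (Suc k) - E k" using k by (simp add: E_def max_def right_diff_distrib del: of_nat_Suc)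
      finally show ?thesis .
    qed
    have sum: "(\<Sum>m=1..Suc M. \<bar>G m - G (m - 1)\<bar>) \<le> 1 + E (Suc M)" for M
    proof (induction M)
      case 0
      have "\<bar>G 1\<bar> \<le> 1" using ge1[of "max 1 n"] by (simp add: G_def inverse_le_1_iff)
      moreover have "E 1 = 0" using n by (simp add: E_def max_def)
      ultimately show ?case by (simp add: G_def)
    next
      case (Suc M)
      then show ?case using step[of "Suc M"] by simp
    qed
    have E_le: "E k \<le> 5 * 4 ^ q" for k
    proof -
      have "1 / (\<delta> * real n) - 1 / (\<delta> * real (max k n)) \<le> 1 / pi" using \<delta> by (simp add: mult.commute)
      also have "\<dots> \<le> 1" using pi_gt3 by simp
      finally have "E k \<le> 4 ^ q * (5 * 1)" unfolding E_def by (intro mult_left_mono) auto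
      then show ?thesis by simp
    qed
    have "(\<Sum>m=1..M. \<bar>G m - G (m - 1)\<bar>) \<le> V"
    proof (cases M)
      case (Suc m)
      then show ?thesis using sum[of m] E_le[of "Suc m"] by (simp only: V_def)
    qed (simp add: V_def)
    then show ?thesis by (simp add: of_real_diff[symmetric] del: of_real_diff)
  qed
  have MG: "Lp_multiplier p (2 * (V * K)) (\<lambda>j k. of_real (G (nat \<bar>j\<bar>)))"
    by (rule Lp_multiplier_even_bounded_variation[where g = "\<lambda>m. complex_of_real (G m)", OF p half _ var]) (simp add: G_def)
  note MM = Lp_multiplier_mult[OF Lp_multiplier_high_symbol[where n = n, OF p half] MG]
  have fac: "high_symbol n j * c j k = high_symbol n j * of_real (G (nat \<bar>j\<bar>)) * (of_real (tent_symbol q (\<delta> * of_int j)) * c j k)" for j k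
  proof (cases "\<bar>j\<bar> \<le> int n")
    case False
    have "tent_symbol q (\<delta> * of_int j) = tent_symbol q (\<delta> * real (nat \<bar>j\<bar>))"
      by (cases "j \<ge> 0") auto
    moreover have "1 \<le> tent_symbol q (\<delta> * real (nat \<bar>j\<bar>))" using False by (intro ge1) auto
    moreover have "G (nat \<bar>j\<bar>) = inverse (tent_symbol q (\<delta> * real (nat \<bar>j\<bar>)))"
    proof -
      have "max (nat \<bar>j\<bar>) n = nat \<bar>j\<bar>" "nat \<bar>j\<bar> \<noteq> 0" using False by auto
      then show ?thesis by (simp only: G_def if_False)
    qed
    ultimately show ?thesis by simp
  qed (simp add: high_symbol_def)
  have "Lp_norm p (trig_poly N (\<lambda>j k. high_symbol n j * c j k)) =
     Lp_norm p (trig_poly N (\<lambda>j k. high_symbol n j * of_real (G (nat \<bar>j\<bar>)) * (of_real (tent_symbol q (\<delta> * of_int j)) * c j k)))"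
    by (simp only: fac[symmetric])
  also have "\<dots> \<le> ennreal (2 * K * (2 * (V * K))) * Lp_norm p (trig_poly N (\<lambda>j k. of_real (tent_symbol q (\<delta> * of_int j)) * c j k))"
    by (rule Lp_multiplierD[OF MM])
  also have "\<dots> \<le> ennreal (2 * K * (2 * (V * K))) * (ennreal K1 * B)"
    by (intro mult_left_mono mB) auto
  also have "\<dots> = ennreal (4 * V * K * K * K1) * B"
  proof -
    have K10: "0 \<le> K1" unfolding K1_def using q by (intro suminf_nonneg summable_frac_coeff) auto
    have "ennreal (2 * K * (2 * (V * K))) * ennreal K1 = ennreal (2 * K * (2 * (V * K)) * K1)"
      using K K10 by (intro ennreal_mult[symmetric]) (auto simp: V_def)
    then show ?thesis by (simp add: mult.assoc[symmetric]) (simp add: mult_ac)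
  qed
  finally show ?thesis unfolding V_def K1_def .
qed

text \<open>The upper estimate is an identity between symbols, one step at a time. The lower one is
  not: the high part uses all steps up to pi / n, so it is phrased with a common bound B for these
  steps.\<close>

lemma one_variable_multipliers:
  assumes p: "1 < p" and a: "\<alpha> > 0"
  obtains K where "K > 0"
    "\<And>n h. \<lbrakk>1 \<le> n; \<bar>h\<bar> \<le> pi / real n\<rbrakk> \<Longrightarrow> \<exists>\<rho> \<eta>. Lp_multiplier p K (\<lambda>j k. \<rho> j) \<and> Lp_multiplier p K (\<lambda>j k. \<eta> j) \<and>
       (\<forall>j. frac_symbol \<alpha> h j = \<rho> j * low_symbol \<alpha> n j + \<eta> j * high_symbol n j)"
    "\<And>n N c B \<nu>. \<lbrakk>1 \<le> n; \<nu> = low_symbol \<alpha> n \<or> \<nu> = high_symbol n;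
       \<And>h. \<bar>h\<bar> \<le> pi / real n \<Longrightarrow> Lp_norm p (trig_poly N (\<lambda>j k. frac_symbol \<alpha> h j * c j k)) \<le> B\<rbrakk>
       \<Longrightarrow> Lp_norm p (trig_poly N (\<lambda>j k. \<nu> j * c j k)) \<le> ennreal K * B"
proof -
  have p1: "1 \<le> p" using p by simp
  obtain H where H: "H > 0" "\<And>m. Lp_multiplier p H (\<lambda>j k. if m \<le> j then 1 else 0)"
    using Lp_multiplier_half_line[OF p] by blast
  obtain q :: nat where q': "\<alpha> < real q" using reals_Archimedean2 by blast
  then have q: "\<alpha> < real (2 * q)" by simp
  define K1 where "K1 = 8 * pi powr \<alpha> * H * H"
  define K2 where "K2 = (\<Sum>\<nu>. \<bar>frac_coeff \<alpha> \<nu>\<bar>)"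
  define K3 where "K3 = 4 * (1 + 5 * 4 ^ q) * H * H * (\<Sum>\<nu>. \<bar>frac_coeff (real (2 * q) - \<alpha>) \<nu>\<bar>)"
  define K4 where "K4 = 2 * H * (4 * H)"
  define K where "K = max (max K1 K2) (max K3 K4)"
  have K: "K1 \<le> K" "K2 \<le> K" "K3 \<le> K" "K4 \<le> K" by (auto simp: K_def)
  have "K4 > 0" using H by (simp add: K4_def)
  then have K0: "K > 0" using K by linarith
  show ?thesis
  proof (rule that[OF K0])
    fix n h assume n: "1 \<le> n" "\<bar>h\<bar> \<le> pi / real n"
    obtain \<rho> where \<rho>: "Lp_multiplier p K1 (\<lambda>j k. \<rho> j)" "\<And>j. \<bar>j\<bar> \<le> int n \<Longrightarrow> frac_symbol \<alpha> h j = \<rho> j * low_symbol \<alpha> n j"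
      using frac_symbol_low_factor[OF p1 a n H(2)] unfolding K1_def by blast
    \<comment> \<open>At high frequencies the difference itself is the bounded factor.\<close>
    have "frac_symbol \<alpha> h j = \<rho> j * low_symbol \<alpha> n j + frac_symbol \<alpha> h j * high_symbol n j" for j
      by (cases "\<bar>j\<bar> \<le> int n") (simp_all add: \<rho>(2) high_symbol_def low_symbol_def)
    moreover have "Lp_multiplier p K (\<lambda>j k. \<rho> j)" by (rule Lp_multiplier_mono[OF \<rho>(1) K(1)])
    moreover have "Lp_multiplier p K (\<lambda>j k. frac_symbol \<alpha> h j)"
      by (rule Lp_multiplier_mono[OF Lp_multiplier_frac_symbol[OF p1 a] K(2)[unfolded K2_def]])
    ultimately show "\<exists>\<rho> \<eta>. Lp_multiplier p K (\<lambda>j k. \<rho> j) \<and> Lp_multiplier p K (\<lambda>j k. \<eta> j) \<and>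
       (\<forall>j. frac_symbol \<alpha> h j = \<rho> j * low_symbol \<alpha> n j + \<eta> j * high_symbol n j)" by blast
  next
    fix n N B and c :: "int \<Rightarrow> int \<Rightarrow> complex" and \<nu>
    assume n: "1 \<le> n" and \<nu>: "\<nu> = low_symbol \<alpha> n \<or> \<nu> = high_symbol n"
      and B: "\<And>h. \<bar>h\<bar> \<le> pi / real n \<Longrightarrow> Lp_norm p (trig_poly N (\<lambda>j k. frac_symbol \<alpha> h j * c j k)) \<le> B"
    from \<nu> show "Lp_norm p (trig_poly N (\<lambda>j k. \<nu> j * c j k)) \<le> ennreal K * B"
    proof
      assume \<nu>: "\<nu> = high_symbol n"
      have "Lp_norm p (trig_poly N (\<lambda>j k. \<nu> j * c j k)) \<le> ennreal K3 * B"
        unfolding \<nu> K3_def by (rule high_symbol_bound[OF p1 a q n H(2) B])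
      also have "\<dots> \<le> ennreal K * B" by (intro mult_right_mono ennreal_leI K) auto
      finally show ?thesis .
    next
      assume \<nu>: "\<nu> = low_symbol \<alpha> n"
      obtain l where l: "Lp_multiplier p (4 * H) (\<lambda>j k. l j)" "\<And>j. \<bar>j\<bar> \<le> int n \<Longrightarrow> low_symbol \<alpha> n j = l j * frac_symbol \<alpha> (pi / real n) j"
        using low_symbol_frac_factor[OF p1 a n H(2)] by blast
      \<comment> \<open>The factor l reproduces \<open>low_symbol\<close> only for |j| \<le> n; 1 -
        \<open>high_symbol\<close> cuts it off beyond.\<close>
      have eq: "\<nu> j * c j k = (1 - high_symbol n j) * l j * (frac_symbol \<alpha> (pi / real n) j * c j k)" for j k
      proof (cases "\<bar>j\<bar> \<le> int n")
        case True then show ?thesis by (simp add: \<nu> l(2) high_symbol_def)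
      qed (simp add: \<nu> high_symbol_def low_symbol_def)
      have "Lp_norm p (trig_poly N (\<lambda>j k. \<nu> j * c j k)) \<le> ennreal K4 * Lp_norm p (trig_poly N (\<lambda>j k. frac_symbol \<alpha> (pi / real n) j * c j k))"
        unfolding eq K4_def by (rule Lp_multiplierD[OF Lp_multiplier_mult[OF Lp_multiplier_low_cutoff[OF p1 H(2)] l(1)]])
      also have "\<dots> \<le> ennreal K * B" by (intro mult_mono ennreal_leI K B) auto
      finally show ?thesis .
    qed
  qed
qed

section \<open>Combining the two variables\<close>

lemma Lp_norm_trig_poly_swap: "Lp_norm p (trig_poly N (\<lambda>j k. c k j)) = Lp_norm p (trig_poly N c)"
  using Lp_norm_swap[of "trig_poly N c" p] by (simp add: trig_poly_swap[symmetric])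

lemma Lp_norm_trig_poly_add4:
  assumes "1 \<le> p"
  shows "Lp_norm p (trig_poly N (\<lambda>j k. a j k + b j k + c j k + d j k)) \<le>
    4 * (Lp_norm p (trig_poly N a) + Lp_norm p (trig_poly N b) + Lp_norm p (trig_poly N c) + Lp_norm p (trig_poly N d))"
proof -
  define g where "g i = trig_poly N (if i = 0 then a else if i = 1 then b else if i = 2 then c else d)" for i :: nat
  let ?B = "Lp_norm p (trig_poly N a) + Lp_norm p (trig_poly N b) + Lp_norm p (trig_poly N c) + Lp_norm p (trig_poly N d)"
  have le: "Lp_norm p (g i) \<le> ?B" for i
    unfolding g_def by (auto intro: add_increasing2 add_increasing)
  have eq: "trig_poly N (\<lambda>j k. a j k + b j k + c j k + d j k) = (\<lambda>z. \<Sum>i\<in>{0, 1, 2, 3}. 1 * g i z)"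
    by (rule ext) (simp add: g_def trig_poly_def sum.distrib distrib_right add.assoc)
  have "Lp_norm p (\<lambda>z. \<Sum>i\<in>{0, 1, 2, 3}. 1 * g i z) \<le> ennreal (\<Sum>i\<in>{0, 1, 2, 3 :: nat}. norm (1 :: complex)) * ?B"
    by (intro Lp_norm_sum_le assms le) (auto simp: g_def)
  then show ?thesis by (simp add: eq)
qed

text \<open>For the upper estimate the two one-variable decompositions are multiplied out into four
  terms. The lower estimate is iterated: first in j with the step in k fixed, then in k with the
  bound just obtained.\<close>

lemma trig_poly_mixed_equivalence:
  assumes p: "1 < p" and a: "\<alpha>1 > 0" "\<alpha>2 > 0"
  obtains C where "C > 0"
    "\<And>n1 n2 h1 h2 N c. \<lbrakk>1 \<le> n1; 1 \<le> n2; \<bar>h1\<bar> \<le> pi / real n1; \<bar>h2\<bar> \<le> pi / real n2\<rbrakk> \<Longrightarrow>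
      Lp_norm p (trig_poly N (\<lambda>j k. frac_symbol \<alpha>1 h1 j * frac_symbol \<alpha>2 h2 k * c j k)) \<le> ennreal C *
       (Lp_norm p (trig_poly N (\<lambda>j k. low_symbol \<alpha>1 n1 j * low_symbol \<alpha>2 n2 k * c j k)) +
        Lp_norm p (trig_poly N (\<lambda>j k. low_symbol \<alpha>1 n1 j * high_symbol n2 k * c j k)) +
        Lp_norm p (trig_poly N (\<lambda>j k. high_symbol n1 j * low_symbol \<alpha>2 n2 k * c j k)) +
        Lp_norm p (trig_poly N (\<lambda>j k. high_symbol n1 j * high_symbol n2 k * c j k)))"
    "\<And>n1 n2 \<mu> \<nu> N c B. \<lbrakk>1 \<le> n1; 1 \<le> n2; \<mu> = low_symbol \<alpha>1 n1 \<or> \<mu> = high_symbol n1;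
       \<nu> = low_symbol \<alpha>2 n2 \<or> \<nu> = high_symbol n2;
       \<And>h1 h2. \<lbrakk>\<bar>h1\<bar> \<le> pi / real n1; \<bar>h2\<bar> \<le> pi / real n2\<rbrakk> \<Longrightarrow>
         Lp_norm p (trig_poly N (\<lambda>j k. frac_symbol \<alpha>1 h1 j * frac_symbol \<alpha>2 h2 k * c j k)) \<le> B\<rbrakk> \<Longrightarrow>
       Lp_norm p (trig_poly N (\<lambda>j k. \<mu> j * \<nu> k * c j k)) \<le> ennreal C * B"
proof -
  have p1: "1 \<le> p" using p by simp
  show ?thesis
  proof (rule one_variable_multipliers[OF p a(1)])
    fix K1 assume K1: "K1 > 0"
      and up1: "\<And>n h. \<lbrakk>1 \<le> n; \<bar>h\<bar> \<le> pi / real n\<rbrakk> \<Longrightarrow> \<exists>\<rho> \<eta>. Lp_multiplier p K1 (\<lambda>j k. \<rho> j) \<and> Lp_multiplier p K1 (\<lambda>j k. \<eta> j) \<and>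
       (\<forall>j. frac_symbol \<alpha>1 h j = \<rho> j * low_symbol \<alpha>1 n j + \<eta> j * high_symbol n j)"
      and lo1: "\<And>n N c B \<nu>. \<lbrakk>1 \<le> n; \<nu> = low_symbol \<alpha>1 n \<or> \<nu> = high_symbol n;
       \<And>h. \<bar>h\<bar> \<le> pi / real n \<Longrightarrow> Lp_norm p (trig_poly N (\<lambda>j k. frac_symbol \<alpha>1 h j * c j k)) \<le> B\<rbrakk>
       \<Longrightarrow> Lp_norm p (trig_poly N (\<lambda>j k. \<nu> j * c j k)) \<le> ennreal K1 * B"
    show ?thesis
    proof (rule one_variable_multipliers[OF p a(2)])
      fix K2 assume K2: "K2 > 0"
        and up2: "\<And>n h. \<lbrakk>1 \<le> n; \<bar>h\<bar> \<le> pi / real n\<rbrakk> \<Longrightarrow> \<exists>\<rho> \<eta>. Lp_multiplier p K2 (\<lambda>j k. \<rho> j) \<and> Lp_multiplier p K2 (\<lambda>j k. \<eta> j) \<and>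
         (\<forall>j. frac_symbol \<alpha>2 h j = \<rho> j * low_symbol \<alpha>2 n j + \<eta> j * high_symbol n j)"
        and lo2: "\<And>n N c B \<nu>. \<lbrakk>1 \<le> n; \<nu> = low_symbol \<alpha>2 n \<or> \<nu> = high_symbol n;
         \<And>h. \<bar>h\<bar> \<le> pi / real n \<Longrightarrow> Lp_norm p (trig_poly N (\<lambda>j k. frac_symbol \<alpha>2 h j * c j k)) \<le> B\<rbrakk>
         \<Longrightarrow> Lp_norm p (trig_poly N (\<lambda>j k. \<nu> j * c j k)) \<le> ennreal K2 * B"
      define C where "C = 4 * (K1 * K2)"
      show ?thesis
      proof (rule that[of C])
        show "C > 0" using K1 K2 by (simp add: C_def)
        fix n1 n2 h1 h2 N and c :: "int \<Rightarrow> int \<Rightarrow> complex"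
        assume n: "1 \<le> n1" "1 \<le> n2" and h: "\<bar>h1\<bar> \<le> pi / real n1" "\<bar>h2\<bar> \<le> pi / real n2"
        obtain \<rho>1 \<eta>1 where 1: "Lp_multiplier p K1 (\<lambda>j k. \<rho>1 j)" "Lp_multiplier p K1 (\<lambda>j k. \<eta>1 j)"
          "\<And>j. frac_symbol \<alpha>1 h1 j = \<rho>1 j * low_symbol \<alpha>1 n1 j + \<eta>1 j * high_symbol n1 j"
          using up1[OF n(1) h(1)] by blast
        obtain \<rho>2 \<eta>2 where 2: "Lp_multiplier p K2 (\<lambda>j k. \<rho>2 j)" "Lp_multiplier p K2 (\<lambda>j k. \<eta>2 j)"
          "\<And>j. frac_symbol \<alpha>2 h2 j = \<rho>2 j * low_symbol \<alpha>2 n2 j + \<eta>2 j * high_symbol n2 j"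
          using up2[OF n(2) h(2)] by blast
        have pr: "Lp_norm p (trig_poly N (\<lambda>j k. r j * s k * d j k)) \<le> ennreal (K1 * K2) * Lp_norm p (trig_poly N d)"
          if "Lp_multiplier p K1 (\<lambda>j k. r j)" "Lp_multiplier p K2 (\<lambda>j k. s j)" for r s d
          by (rule Lp_multiplierD[OF Lp_multiplier_mult[OF that(1) Lp_multiplier_swap[OF that(2)]]])
        let ?L1 = "low_symbol \<alpha>1 n1" and ?H1 = "high_symbol n1" and ?L2 = "low_symbol \<alpha>2 n2" and ?H2 = "high_symbol n2"
        have "Lp_norm p (trig_poly N (\<lambda>j k. frac_symbol \<alpha>1 h1 j * frac_symbol \<alpha>2 h2 k * c j k)) =
          Lp_norm p (trig_poly N (\<lambda>j k. \<rho>1 j * \<rho>2 k * (?L1 j * ?L2 k * c j k) + \<rho>1 j * \<eta>2 k * (?L1 j * ?H2 k * c j k)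
            + \<eta>1 j * \<rho>2 k * (?H1 j * ?L2 k * c j k) + \<eta>1 j * \<eta>2 k * (?H1 j * ?H2 k * c j k)))"
          unfolding 1(3) 2(3) by (simp add: algebra_simps)
        also have "\<dots> \<le> 4 * (Lp_norm p (trig_poly N (\<lambda>j k. \<rho>1 j * \<rho>2 k * (?L1 j * ?L2 k * c j k)))
            + Lp_norm p (trig_poly N (\<lambda>j k. \<rho>1 j * \<eta>2 k * (?L1 j * ?H2 k * c j k)))
            + Lp_norm p (trig_poly N (\<lambda>j k. \<eta>1 j * \<rho>2 k * (?H1 j * ?L2 k * c j k)))
            + Lp_norm p (trig_poly N (\<lambda>j k. \<eta>1 j * \<eta>2 k * (?H1 j * ?H2 k * c j k))))"
          by (rule Lp_norm_trig_poly_add4[OF p1])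
        also have "\<dots> \<le> 4 * (ennreal (K1 * K2) * Lp_norm p (trig_poly N (\<lambda>j k. ?L1 j * ?L2 k * c j k))
            + ennreal (K1 * K2) * Lp_norm p (trig_poly N (\<lambda>j k. ?L1 j * ?H2 k * c j k))
            + ennreal (K1 * K2) * Lp_norm p (trig_poly N (\<lambda>j k. ?H1 j * ?L2 k * c j k))
            + ennreal (K1 * K2) * Lp_norm p (trig_poly N (\<lambda>j k. ?H1 j * ?H2 k * c j k)))"
          by (intro mult_left_mono add_mono pr 1 2) auto
        also have "\<dots> = ennreal C * (Lp_norm p (trig_poly N (\<lambda>j k. ?L1 j * ?L2 k * c j k)) + Lp_norm p (trig_poly N (\<lambda>j k. ?L1 j * ?H2 k * c j k))
            + Lp_norm p (trig_poly N (\<lambda>j k. ?H1 j * ?L2 k * c j k)) + Lp_norm p (trig_poly N (\<lambda>j k. ?H1 j * ?H2 k * c j k)))"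
        proof -
          have "ennreal C = 4 * ennreal (K1 * K2)"
            using K1 K2 unfolding C_def by (subst ennreal_mult) auto
          then show ?thesis by (simp add: distrib_left mult.assoc)
        qed
        finally show "Lp_norm p (trig_poly N (\<lambda>j k. frac_symbol \<alpha>1 h1 j * frac_symbol \<alpha>2 h2 k * c j k)) \<le> \<dots>" .
      next
        fix n1 n2 \<mu> \<nu> N B and c :: "int \<Rightarrow> int \<Rightarrow> complex"
        assume n: "1 \<le> n1" "1 \<le> n2" and \<mu>: "\<mu> = low_symbol \<alpha>1 n1 \<or> \<mu> = high_symbol n1"
          and \<nu>: "\<nu> = low_symbol \<alpha>2 n2 \<or> \<nu> = high_symbol n2"
          and B: "\<And>h1 h2. \<lbrakk>\<bar>h1\<bar> \<le> pi / real n1; \<bar>h2\<bar> \<le> pi / real n2\<rbrakk> \<Longrightarrow>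
             Lp_norm p (trig_poly N (\<lambda>j k. frac_symbol \<alpha>1 h1 j * frac_symbol \<alpha>2 h2 k * c j k)) \<le> B"
        \<comment> \<open>With h2 fixed, \<open>frac_symbol \<alpha>2 h2 k\<close> becomes part of
          the coefficients, so the one-variable bound applies with h1 running; the swap of indices
          then allows the same in the other variable.\<close>
        have "Lp_norm p (trig_poly N (\<lambda>j k. \<mu> j * (frac_symbol \<alpha>2 h2 k * c j k))) \<le> ennreal K1 * B"
          if "\<bar>h2\<bar> \<le> pi / real n2" for h2
          by (rule lo1[OF n(1) \<mu>]) (use B[OF _ that] in \<open>simp add: mult.assoc\<close>)
        moreover have "Lp_norm p (trig_poly N (\<lambda>j k. frac_symbol \<alpha>2 h2 j * (\<mu> k * c k j))) = Lp_norm p (trig_poly N (\<lambda>j k. \<mu> j * (frac_symbol \<alpha>2 h2 k * c j k)))" for h2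
          using Lp_norm_trig_poly_swap[of p N "\<lambda>j k. \<mu> j * (frac_symbol \<alpha>2 h2 k * c j k)"] by (simp add: mult_ac)
        ultimately have "Lp_norm p (trig_poly N (\<lambda>j k. \<nu> j * (\<mu> k * c k j))) \<le> ennreal K2 * (ennreal K1 * B)"
          by (intro lo2[OF n(2) \<nu>]) simp
        moreover have "Lp_norm p (trig_poly N (\<lambda>j k. \<nu> j * (\<mu> k * c k j))) = Lp_norm p (trig_poly N (\<lambda>j k. \<mu> j * \<nu> k * c j k))"
          using Lp_norm_trig_poly_swap[of p N "\<lambda>j k. \<mu> j * \<nu> k * c j k"] by (simp add: mult_ac)
        moreover have "ennreal K2 * (ennreal K1 * B) \<le> ennreal C * B"
        proof -
          have "ennreal K2 * ennreal K1 \<le> ennreal C"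
            using K1 K2 by (subst ennreal_mult[symmetric]) (auto simp: C_def intro!: ennreal_leI)
          then show ?thesis by (simp add: mult.assoc[symmetric] mult_right_mono)
        qed
        ultimately show "Lp_norm p (trig_poly N (\<lambda>j k. \<mu> j * \<nu> k * c j k)) \<le> ennreal C * B" by simp
      qed
    qed
  qed
qed

section \<open>Integrable functions on the torus\<close>

text \<open>Subsets of null sets are measurable in the completion, so f inherits measurability from
  g although nothing is assumed about f itself.\<close>

lemma borel_measurable_completion_cong_AE:
  fixes f g :: "'a \<Rightarrow> 'b::topological_space"
  assumes g: "g \<in> borel_measurable (completion M)" and ae: "AE x in M. f x = g x"
  shows "f \<in> borel_measurable (completion M)"
proof (rule measurableI)
  fix A :: "'b set" assume A: "A \<in> sets borel"
  have 1: "Measurable.pred (completion M) (\<lambda>x. f x \<in> A \<and> f x \<noteq> g x)" "Measurable.pred (completion M) (\<lambda>x. f x \<noteq> g x)"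
    by (rule sets_completion_AE, use ae in auto)+
  have "{x \<in> space (completion M). g x \<in> A} \<in> sets (completion M)"
    using measurable_sets[OF g A] by (simp add: vimage_def Int_def conj_commute)
  then have "Measurable.pred (completion M) (\<lambda>x. g x \<in> A)" by (simp add: pred_def)
  then have "Measurable.pred (completion M) (\<lambda>x. (g x \<in> A \<and> \<not> f x \<noteq> g x) \<or> (f x \<in> A \<and> f x \<noteq> g x))"
    using 1 by measurable
  moreover have "((g x \<in> A \<and> \<not> f x \<noteq> g x) \<or> (f x \<in> A \<and> f x \<noteq> g x)) \<longleftrightarrow> f x \<in> A" for x by auto
  ultimately have "Measurable.pred (completion M) (\<lambda>x. f x \<in> A)" by simp
  then show "f -` A \<inter> space (completion M) \<in> sets (completion M)"
    by (simp add: pred_def vimage_def Int_def conj_commute)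
qed simp

section \<open>Periodic Borel versions\<close>

lemma AE_lborel_translate:
  fixes a :: "'a::euclidean_space"
  assumes "AE z in lborel. P z" shows "AE z in lborel. P (z + a)"
proof -
  have "AE z in distr lborel borel ((+) a). P z" by (subst lborel_distr_plus) (rule assms)
  from AE_distrD[OF _ this] show ?thesis by (simp add: add.commute)
qed

definition reduce2pi :: "real \<times> real \<Rightarrow> real \<times> real" where
  "reduce2pi z = (fst z - 2 * pi * of_int \<lfloor>fst z / (2 * pi)\<rfloor>, snd z - 2 * pi * of_int \<lfloor>snd z / (2 * pi)\<rfloor>)"

lemma reduce2pi_measurable [measurable]: "reduce2pi \<in> borel_measurable borel"
proof -
  have [measurable]: "fst \<in> borel_measurable (borel :: (real \<times> real) measure)" "snd \<in> borel_measurable (borel :: (real \<times> real) measure)"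
    by (intro borel_measurable_continuous_onI continuous_intros)+
  show ?thesis unfolding reduce2pi_def[abs_def] by measurable
qed

lemma reduce2pi_bounds: "0 \<le> x - 2 * pi * of_int \<lfloor>x / (2 * pi)\<rfloor>" "x - 2 * pi * of_int \<lfloor>x / (2 * pi)\<rfloor> < 2 * pi"
proof -
  have "of_int \<lfloor>x / (2 * pi)\<rfloor> * (2 * pi) \<le> x"
    by (subst pos_le_divide_eq[symmetric]) simp_all
  moreover have "x < (of_int \<lfloor>x / (2 * pi)\<rfloor> + 1) * (2 * pi)"
    by (subst pos_divide_less_eq[symmetric]) (simp, linarith)
  ultimately show "0 \<le> x - 2 * pi * of_int \<lfloor>x / (2 * pi)\<rfloor>" "x - 2 * pi * of_int \<lfloor>x / (2 * pi)\<rfloor> < 2 * pi"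
    by (simp_all add: algebra_simps)
qed

lemma reduce2pi_in_square: "reduce2pi z \<in> square2pi"
  using reduce2pi_bounds[of "fst z"] reduce2pi_bounds[of "snd z"] by (auto simp: reduce2pi_def square2pi_def)

lemma reduce2pi_eq_translate: "\<exists>m n :: int. reduce2pi z = z + (2 * pi * of_int m, 2 * pi * of_int n)"
  by (intro exI[of _ "- \<lfloor>fst z / (2 * pi)\<rfloor>"] exI[of _ "- \<lfloor>snd z / (2 * pi)\<rfloor>"]) (auto simp: reduce2pi_def prod_eq_iff)

lemma periodic2_translate:
  assumes "periodic2 f" shows "f (z + (2 * pi * of_int m, 2 * pi * of_int n)) = f z"
proof -
  have n1: "f (x + 2 * pi * real k, y) = f (x, y)" "f (x, y + 2 * pi * real k) = f (x, y)" for x y and k :: nat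
  proof (induction k)
    case (Suc k)
    { case 1 show ?case using assms Suc(1) unfolding periodic2_def by (metis add.assoc distrib_left mult.right_neutral of_nat_Suc add.commute) }
    { case 2 show ?case using assms Suc(2) unfolding periodic2_def by (metis add.assoc distrib_left mult.right_neutral of_nat_Suc add.commute) }
  qed auto
  have n2: "f (x + 2 * pi * of_int k, y) = f (x, y)" "f (x, y + 2 * pi * of_int k) = f (x, y)" for x y and k :: int
  proof -
    show "f (x + 2 * pi * of_int k, y) = f (x, y)"
      using n1(1)[of x "nat k" y] n1(1)[of "x + 2 * pi * of_int k" "nat (- k)" y] by (cases "k \<ge> 0") auto
    show "f (x, y + 2 * pi * of_int k) = f (x, y)"
      using n1(2)[of x y "nat k"] n1(2)[of x "y + 2 * pi * of_int k" "nat (- k)"] by (cases "k \<ge> 0") auto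
  qed
  show ?thesis by (cases z) (simp add: n2)
qed

lemma periodic2_reduce: "periodic2 f \<Longrightarrow> f (reduce2pi z) = f z"
  using reduce2pi_eq_translate[of z] periodic2_translate[of f z] by auto

lemma reduce2pi_period: "reduce2pi (x + 2 * pi, y) = reduce2pi (x, y)" "reduce2pi (x, y + 2 * pi) = reduce2pi (x, y)"
proof -
  have "\<lfloor>(t + 2 * pi) / (2 * pi)\<rfloor> = \<lfloor>t / (2 * pi)\<rfloor> + 1" for t :: real by (simp add: add_divide_distrib)
  then show "reduce2pi (x + 2 * pi, y) = reduce2pi (x, y)" "reduce2pi (x, y + 2 * pi) = reduce2pi (x, y)"
    by (simp_all add: reduce2pi_def algebra_simps)
qed

text \<open>Reduction translates each point by one of countably many lattice vectors, so it pulls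
  null sets back to null sets.\<close>

lemma AE_reduce2pi:
  assumes "AE z in lborel. P z" shows "AE z in lborel. P (reduce2pi z)"
proof -
  have "AE z in lborel. \<forall>m n :: int. P (z + (2 * pi * of_int m, 2 * pi * of_int n))"
    unfolding AE_all_countable by (intro allI AE_lborel_translate assms)
  then show ?thesis by eventually_elim (metis reduce2pi_eq_translate)
qed

lemma AE_periodic:
  assumes "AE z in lborel. z \<in> square2pi \<longrightarrow> P z" and "\<And>z. P (reduce2pi z) \<Longrightarrow> P z"
  shows "AE z in lborel. P z"
  using AE_reduce2pi[OF assms(1)] by eventually_elim (use assms(2) reduce2pi_in_square in blast)

text \<open>A Borel version found by completion need not be periodic; composing it with
  \<open>reduce2pi\<close> makes it so and keeps it equal to f almost everywhere.\<close>

lemma ex_periodic_borel_version: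
  assumes f: "f \<in> borel_measurable lebesgue" and per: "periodic2 f"
  obtains g where "g \<in> borel_measurable borel" "periodic2 g" "AE z in lborel. f z = g z"
proof -
  have "(\<lambda>z. Re (f z)) \<in> borel_measurable lebesgue" "(\<lambda>z. Im (f z)) \<in> borel_measurable lebesgue"
    using f by (auto simp: borel_measurable_complex_iff)
  from this[THEN completion_ex_borel_measurable_real] obtain u v where
    [measurable]: "u \<in> borel_measurable lborel" "v \<in> borel_measurable lborel" and
    ae: "AE z in lborel. Re (f z) = u z" "AE z in lborel. Im (f z) = v z" by blast
  define g where "g z = Complex (u (reduce2pi z)) (v (reduce2pi z))" for z
  have [measurable]: "u \<in> borel_measurable borel" "v \<in> borel_measurable borel" using \<open>u \<in> _\<close> \<open>v \<in> _\<close> by simp_all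
  have "g \<in> borel_measurable borel" unfolding borel_measurable_complex_iff g_def by simp
  moreover have "periodic2 g" by (simp add: periodic2_def g_def reduce2pi_period)
  moreover have "AE z in lborel. f z = g z"
  proof -
    have "AE z in lborel. f (reduce2pi z) = Complex (u (reduce2pi z)) (v (reduce2pi z))"
      by (rule AE_reduce2pi) (use ae in eventually_elim, simp add: complex_eq_iff)
    then show ?thesis by (simp add: g_def periodic2_reduce[OF per])
  qed
  ultimately show ?thesis by (rule that)
qed

text \<open>The nonnegative case, applied to indicators, says that z and z + a have the same
  distribution after reduction. Equality of these image measures transfers integrals and
  integrability of complex functions at once.\<close>

lemma integral_square2pi_shift:
  fixes g :: "real \<times> real \<Rightarrow> complex"
  assumes [measurable]: "g \<in> borel_measurable borel" and per: "periodic2 g"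
  shows "(LINT z:square2pi|lborel. g (z + a)) = (LINT z:square2pi|lborel. g z)"
    and "set_integrable lborel square2pi (\<lambda>z. g (z + a)) \<longleftrightarrow> set_integrable lborel square2pi g"
proof -
  define M where "M = density lborel (indicator square2pi :: real \<times> real \<Rightarrow> ennreal)"
  have sets_M [measurable_cong, simp]: "sets M = sets borel" by (simp add: M_def)
  have sh[measurable]: "(\<lambda>z. z + b) \<in> borel_measurable borel" for b :: "real \<times> real"
    by (intro borel_measurable_continuous_onI continuous_intros)
  have eq: "distr M borel (\<lambda>z. reduce2pi (z + a)) = distr M borel reduce2pi"
  proof (rule measure_eqI)
    fix A assume "A \<in> sets (distr M borel (\<lambda>z. reduce2pi (z + a)))"
    then have [measurable]: "A \<in> sets borel" by simp
    have e: "emeasure (distr M borel (\<lambda>z. reduce2pi (z + b))) A = (\<integral>\<^sup>+z\<in>square2pi. indicator A (reduce2pi (z + b)) \<partial>lborel)" for b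
    proof -
      have "emeasure (distr M borel (\<lambda>z. reduce2pi (z + b))) A = (\<integral>\<^sup>+z. indicator A z \<partial>distr M borel (\<lambda>z. reduce2pi (z + b)))"
        by (subst nn_integral_indicator) auto
      also have "\<dots> = (\<integral>\<^sup>+z. indicator A (reduce2pi (z + b)) \<partial>M)" by (subst nn_integral_distr) measurable
      also have "\<dots> = (\<integral>\<^sup>+z\<in>square2pi. indicator A (reduce2pi (z + b)) \<partial>lborel)"
        unfolding M_def by (subst nn_integral_density) (auto simp: mult.commute)
      finally show ?thesis .
    qed
    have "(\<integral>\<^sup>+z\<in>square2pi. indicator A (reduce2pi (z + a)) \<partial>lborel) = (\<integral>\<^sup>+z\<in>square2pi. indicator A (reduce2pi z) \<partial>lborel)"
      by (rule nn_integral_square2pi_shift[where h = "\<lambda>z. indicator A (reduce2pi z)"]) (auto simp: reduce2pi_period)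
    then show "emeasure (distr M borel (\<lambda>z. reduce2pi (z + a))) A = emeasure (distr M borel reduce2pi) A"
      using e[of a] e[of 0] by simp
  qed simp
  have M_int: "(LINT z:square2pi|lborel. h z) = integral\<^sup>L M h" "set_integrable lborel square2pi h \<longleftrightarrow> integrable M h"
    if [measurable]: "h \<in> borel_measurable borel" for h :: "real \<times> real \<Rightarrow> complex"
  proof -
    have M': "M = density lborel (\<lambda>z. ennreal (indicator square2pi z))" by (simp add: M_def ennreal_indicator)
    show "(LINT z:square2pi|lborel. h z) = integral\<^sup>L M h"
      unfolding M' set_lebesgue_integral_def by (subst integral_density) auto
    show "set_integrable lborel square2pi h \<longleftrightarrow> integrable M h"
      unfolding M' set_integrable_def by (subst integrable_density) auto
  qed
  have D: "integral\<^sup>L M (\<lambda>z. g (z + b)) = integral\<^sup>L (distr M borel (\<lambda>z. reduce2pi (z + b))) g"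
    "integrable M (\<lambda>z. g (z + b)) \<longleftrightarrow> integrable (distr M borel (\<lambda>z. reduce2pi (z + b))) g" for b
    by (subst integral_distr integrable_distr_eq; simp add: periodic2_reduce[OF per])+
  have [measurable]: "(\<lambda>z. g (z + a)) \<in> borel_measurable borel" by measurable
  show "(LINT z:square2pi|lborel. g (z + a)) = (LINT z:square2pi|lborel. g z)"
    using D(1)[of a] D(1)[of 0] eq by (simp add: M_int)
  show "set_integrable lborel square2pi (\<lambda>z. g (z + a)) \<longleftrightarrow> set_integrable lborel square2pi g"
    using D(2)[of a] D(2)[of 0] eq by (simp add: M_int)
qed

section \<open>Fourier coefficients and averages of translates\<close>

lemma borel_measurable_cis [measurable (raw)]:
  assumes "f \<in> borel_measurable M" shows "(\<lambda>x. cis (f x)) \<in> borel_measurable M"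
  by (rule borel_measurable_continuous_on[OF _ assms]) (intro continuous_intros)

lemma borel_measurable_fst_snd [measurable]:
  "fst \<in> borel_measurable (borel :: (real \<times> real) measure)"
  "snd \<in> borel_measurable (borel :: (real \<times> real) measure)"
  by (intro borel_measurable_continuous_onI continuous_intros)+

lemma borel_imp_lebesgue_measurable: "f \<in> borel_measurable borel \<Longrightarrow> f \<in> borel_measurable lebesgue"
  by (simp add: measurable_completion)

lemma set_lebesgue_integral_lebesgue_eq_lborel:
  fixes f :: "real \<times> real \<Rightarrow> complex"
  assumes [measurable]: "f \<in> borel_measurable borel"
  shows "(LINT z:square2pi|lebesgue. f z) = (LINT z:square2pi|lborel. f z)"
    and "set_integrable lebesgue square2pi f \<longleftrightarrow> set_integrable lborel square2pi f"
  unfolding set_lebesgue_integral_def set_integrable_def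
  by (intro integral_completion integrable_completion; measurable)+

lemma fourier_coeff_lborel:
  assumes [measurable]: "f \<in> borel_measurable borel"
  shows "fourier_coeff f j k = of_real (1 / (4 * pi\<^sup>2)) *
     (LINT z:square2pi|lborel. f z * cis (- (of_int j * fst z + of_int k * snd z)))"
proof -
  have "(\<lambda>z. f z * cis (- (of_int j * fst z + of_int k * snd z))) \<in> borel_measurable borel" by measurable
  from set_lebesgue_integral_lebesgue_eq_lborel(1)[OF this] show ?thesis by (simp only: fourier_coeff_def)
qed

text \<open>The requirements that \<open>is_weyl_deriv\<close> puts on g. All functions in the
  theorem belong to this class, and within it norms are determined by Fourier coefficients.\<close>

definition torus_L1 :: "(real \<times> real \<Rightarrow> complex) \<Rightarrow> bool" where
  "torus_L1 f \<longleftrightarrow> f \<in> borel_measurable lebesgue \<and> periodic2 f \<and> set_integrable lebesgue square2pi f"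

lemma fourier_coeff_cong_AE:
  assumes f: "f \<in> borel_measurable lebesgue" and g: "g \<in> borel_measurable borel"
    and ae: "AE z in lborel. f z = g z"
  shows "fourier_coeff f j k = fourier_coeff g j k"
proof -
  have [measurable]: "f \<in> borel_measurable lebesgue" "g \<in> borel_measurable lebesgue"
    "(\<lambda>z. cis (- (of_int j * fst z + of_int k * snd z))) \<in> borel_measurable lebesgue"
    "square2pi \<in> sets lebesgue"
    using f by (auto intro!: borel_imp_lebesgue_measurable g)
  have ae': "AE z in lebesgue. f z = g z" using ae by (simp add: AE_completion_iff)
  show ?thesis
    unfolding fourier_coeff_def set_lebesgue_integral_def
  proof (intro arg_cong[where f = "\<lambda>x. of_real (1 / (4 * pi\<^sup>2)) * x"] integral_cong_AE)
    show "AE z in lebesgue. indicat_real square2pi z *\<^sub>R (f z * cis (- (of_int j * fst z + of_int k * snd z))) =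
       indicat_real square2pi z *\<^sub>R (g z * cis (- (of_int j * fst z + of_int k * snd z)))"
      using ae' by eventually_elim simp
  qed measurable
qed

lemma set_integrable_square2pi_cong_AE:
  fixes f g :: "real \<times> real \<Rightarrow> complex"
  assumes f: "f \<in> borel_measurable lebesgue" and g: "g \<in> borel_measurable borel"
    and ae: "AE z in lborel. f z = g z"
  shows "set_integrable lebesgue square2pi f \<longleftrightarrow> set_integrable lborel square2pi g"
proof -
  have [measurable]: "f \<in> borel_measurable lebesgue" "g \<in> borel_measurable lebesgue" "square2pi \<in> sets lebesgue"
    using f g by (auto intro: borel_imp_lebesgue_measurable)
  have ae': "AE z in lebesgue. f z = g z" using ae by (simp add: AE_completion_iff)
  have "set_integrable lebesgue square2pi f \<longleftrightarrow> set_integrable lebesgue square2pi g"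
    unfolding set_integrable_def by (intro integrable_cong_AE) (use ae' in auto)
  then show ?thesis using set_lebesgue_integral_lebesgue_eq_lborel(2)[OF g] by simp
qed

lemma torus_L1_borel_version:
  assumes "torus_L1 f"
  obtains g where "g \<in> borel_measurable borel" "periodic2 g" "AE z in lborel. f z = g z"
    "set_integrable lborel square2pi g" "\<And>j k. fourier_coeff g j k = fourier_coeff f j k"
proof -
  from assms have f: "f \<in> borel_measurable lebesgue" "periodic2 f" "set_integrable lebesgue square2pi f"
    by (auto simp: torus_L1_def)
  obtain g where g: "g \<in> borel_measurable borel" "periodic2 g" "AE z in lborel. f z = g z"
    using ex_periodic_borel_version[OF f(1,2)] by blast
  then show ?thesis
    using that[OF g] set_integrable_square2pi_cong_AE[OF f(1) g(1,3)] f(3) fourier_coeff_cong_AE[OF f(1) g(1,3)] by simp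
qed

text \<open>Convolution with the image of the measure w dM under \<open>a\<close>. Tonelli and
  translation invariance give integrability, Fubini the factor on the Fourier side.\<close>

lemma average_of_translates:
  fixes w :: "'a \<Rightarrow> complex" and a :: "'a \<Rightarrow> real \<times> real"
  assumes M: "sigma_finite_measure M" and w: "integrable M w" and a[measurable]: "a \<in> borel_measurable M"
    and f[measurable]: "f \<in> borel_measurable borel" and per: "periodic2 f" and int: "set_integrable lborel square2pi f"
  defines "T \<equiv> \<lambda>z. LINT t|M. w t * f (z + a t)"
  shows "T \<in> borel_measurable borel" "periodic2 T" "set_integrable lborel square2pi T"
    "AE z in lborel. z \<in> square2pi \<longrightarrow> integrable M (\<lambda>t. w t * f (z + a t))"
    "fourier_coeff T j k = fourier_coeff f j k * (LINT t|M. w t * cis (of_int j * fst (a t) + of_int k * snd (a t)))"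
proof -
  interpret M: sigma_finite_measure M by fact
  interpret P: pair_sigma_finite M "lborel :: (real \<times> real) measure"
    by (intro pair_sigma_finite.intro M lborel.sigma_finite_measure_axioms)
  have [measurable]: "w \<in> borel_measurable M" using w by simp
  have mf: "(\<lambda>x. f (snd x + a (fst x))) \<in> borel_measurable (M \<Otimes>\<^sub>M lborel)"
    by (rule measurable_compose[OF _ f]) measurable
  then have mf'[measurable]: "(\<lambda>(t, z). w t * f (z + a t)) \<in> borel_measurable (M \<Otimes>\<^sub>M lborel)"
    unfolding case_prod_unfold by measurable
  have "(\<lambda>(z, t). w t * f (z + a t)) \<in> borel_measurable (lborel \<Otimes>\<^sub>M M)"
    using measurable_compose[OF measurable_pair_swap' mf'] by (simp add: case_prod_unfold)
  then have "T \<in> borel_measurable lborel"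
    unfolding T_def by (rule M.borel_measurable_lebesgue_integral)
  then show T[measurable]: "T \<in> borel_measurable borel" by simp
  have "f ((x, y) + (2 * pi, 0) + b) = f ((x, y) + b)" "f ((x, y) + (0, 2 * pi) + b) = f ((x, y) + b)" for x y b
  proof -
    show "f ((x, y) + (2 * pi, 0) + b) = f ((x, y) + b)"
      using periodic2_translate[OF per, of "(x, y) + b" 1 0] by (simp add: add_ac)
    show "f ((x, y) + (0, 2 * pi) + b) = f ((x, y) + b)"
      using periodic2_translate[OF per, of "(x, y) + b" 0 1] by (simp add: add_ac)
  qed
  then show "periodic2 T" by (simp add: periodic2_def T_def)
  define I where "I = (\<integral>\<^sup>+z\<in>square2pi. ennreal (norm (f z)) \<partial>lborel)"
  have I: "I < \<infinity>"
  proof -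
    have "(\<integral>\<^sup>+z. ennreal (norm (indicator square2pi z *\<^sub>R f z)) \<partial>lborel) < \<infinity>"
      using int unfolding set_integrable_def integrable_iff_bounded by blast
    also have "(\<integral>\<^sup>+z. ennreal (norm (indicator square2pi z *\<^sub>R f z)) \<partial>lborel) = I"
      unfolding I_def by (intro nn_integral_cong) (simp add: indicator_def)
    finally show ?thesis .
  qed
  \<comment> \<open>Needed for e = 1, to integrate the average, and for e a character, to exchange
    integrals in its Fourier coefficient.\<close>
  have integrable_P: "integrable (M \<Otimes>\<^sub>M lborel) (\<lambda>(t, z). w t * f (z + a t) * (e z * indicator square2pi z))"
    if [measurable]: "e \<in> borel_measurable borel" and e: "\<And>z. norm (e z) \<le> 1" for e :: "real \<times> real \<Rightarrow> complex"
  proof (rule integrableI_bounded)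
    have "(\<lambda>x. (case x of (t, z) \<Rightarrow> w t * f (z + a t)) * (e (snd x) * indicator square2pi (snd x))) \<in> borel_measurable (M \<Otimes>\<^sub>M lborel)"
      by measurable
    then show m: "(\<lambda>(t, z). w t * f (z + a t) * (e z * indicator square2pi z)) \<in> borel_measurable (M \<Otimes>\<^sub>M lborel)"
      by (simp add: case_prod_unfold)
    have "(\<integral>\<^sup>+x. ennreal (norm (case x of (t, z) \<Rightarrow> w t * f (z + a t) * (e z * indicator square2pi z))) \<partial>(M \<Otimes>\<^sub>M lborel))
        = (\<integral>\<^sup>+t. (\<integral>\<^sup>+z. ennreal (norm (w t * f (z + a t) * (e z * indicator square2pi z))) \<partial>lborel) \<partial>M)"
      by (subst lborel.nn_integral_fst[symmetric]) (use m in auto)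
    also have "\<dots> \<le> (\<integral>\<^sup>+t. ennreal (norm (w t)) * I \<partial>M)"
    proof (rule nn_integral_mono)
      fix t
      have [measurable]: "(\<lambda>z. f (z + a t)) \<in> borel_measurable borel" by measurable
      have "(\<integral>\<^sup>+z. ennreal (norm (w t * f (z + a t) * (e z * indicator square2pi z))) \<partial>lborel)
         \<le> (\<integral>\<^sup>+z. ennreal (norm (w t)) * (ennreal (norm (f (z + a t))) * indicator square2pi z) \<partial>lborel)"
      proof (rule nn_integral_mono)
        fix z
        have "norm (w t) * norm (f (z + a t)) * norm (e z) \<le> norm (w t) * norm (f (z + a t))"
          using e[of z] by (intro mult_right_le_one_le) auto
        then show "ennreal (norm (w t * f (z + a t) * (e z * indicator square2pi z))) \<le> ennreal (norm (w t)) * (ennreal (norm (f (z + a t))) * indicator square2pi z)"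
          by (cases "z \<in> square2pi") (auto simp: norm_mult ennreal_mult[symmetric] intro!: ennreal_leI)
      qed
      also have "\<dots> = ennreal (norm (w t)) * (\<integral>\<^sup>+z\<in>square2pi. ennreal (norm (f (z + a t))) \<partial>lborel)"
        by (intro nn_integral_cmult) measurable
      also have "(\<integral>\<^sup>+z\<in>square2pi. ennreal (norm (f (z + a t))) \<partial>lborel) = I"
        unfolding I_def by (rule nn_integral_square2pi_shift[where h = "\<lambda>z. ennreal (norm (f z))"]) (use per in \<open>auto simp: periodic2_def\<close>)
      finally show "(\<integral>\<^sup>+z. ennreal (norm (w t * f (z + a t) * (e z * indicator square2pi z))) \<partial>lborel) \<le> ennreal (norm (w t)) * I" .
    qed
    also have "\<dots> = (\<integral>\<^sup>+t. ennreal (norm (w t)) \<partial>M) * I" by (intro nn_integral_multc) measurable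
    also have "\<dots> < \<infinity>" using w I unfolding integrable_iff_bounded by (auto simp: ennreal_mult_less_top)
    finally show "(\<integral>\<^sup>+x. ennreal (norm (case x of (t, z) \<Rightarrow> w t * f (z + a t) * (e z * indicator square2pi z))) \<partial>(M \<Otimes>\<^sub>M lborel)) < \<infinity>" .
  qed
  have i1: "integrable (M \<Otimes>\<^sub>M lborel) (\<lambda>(t, z). w t * f (z + a t) * indicator square2pi z)"
    using integrable_P[of "\<lambda>_. 1"] by simp
  have "integrable lborel (\<lambda>z. LINT t|M. w t * f (z + a t) * indicator square2pi z)"
    by (rule P.integrable_snd[OF i1])
  then show "set_integrable lborel square2pi T"
    unfolding set_integrable_def T_def by (simp add: scaleR_conv_of_real mult.commute of_real_indicator)
  have "AE z in lborel. integrable M (\<lambda>t. w t * f (z + a t) * indicator square2pi z)"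
    using P.AE_integrable_snd[OF i1] .
  then show "AE z in lborel. z \<in> square2pi \<longrightarrow> integrable M (\<lambda>t. w t * f (z + a t))"
    by eventually_elim auto
  let ?e = "\<lambda>z. cis (- (of_int j * fst z + of_int k * snd z))"
  define W where "W = (LINT z:square2pi|lborel. f z * ?e z)"
  have i2: "integrable (M \<Otimes>\<^sub>M lborel) (\<lambda>(t, z). w t * f (z + a t) * (?e z * indicator square2pi z))"
  proof (rule integrable_P)
    show "?e \<in> borel_measurable borel" by measurable
  qed simp
  have "(LINT z:square2pi|lborel. T z * ?e z) = (LINT z|lborel. (LINT t|M. w t * f (z + a t) * (?e z * indicator square2pi z)))"
    unfolding set_lebesgue_integral_def T_def
    by (intro Bochner_Integration.integral_cong refl, subst integral_mult_left_zero) (simp split: split_indicator)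
  also have "\<dots> = (LINT t|M. (LINT z|lborel. w t * f (z + a t) * (?e z * indicator square2pi z)))"
    by (rule P.Fubini_integral[OF i2])
  also have "\<dots> = (LINT t|M. W * (w t * cis (of_int j * fst (a t) + of_int k * snd (a t))))"
  proof (intro Bochner_Integration.integral_cong refl)
    fix t
    define c where "c = cis (of_int j * fst (a t) + of_int k * snd (a t))"
    have eq: "?e z = c * ?e (z + a t)" for z
      unfolding c_def cis_mult by (simp add: algebra_simps)
    have "(LINT z|lborel. w t * f (z + a t) * (?e z * indicator square2pi z)) =
      (LINT z|lborel. (w t * c) * (indicator square2pi z *\<^sub>R (f (z + a t) * ?e (z + a t))))"
      by (intro Bochner_Integration.integral_cong refl) (subst eq, simp add: scaleR_conv_of_real mult_ac of_real_indicator)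
    also have "\<dots> = (w t * c) * (LINT z:square2pi|lborel. f (z + a t) * ?e (z + a t))"
      unfolding set_lebesgue_integral_def by (rule integral_mult_right_zero)
    also have "(LINT z:square2pi|lborel. f (z + a t) * ?e (z + a t)) = W"
      unfolding W_def
    proof (rule integral_square2pi_shift(1)[where g = "\<lambda>z. f z * ?e z"])
      have "cis (- (of_int j * (x + 2 * pi) + of_int k * y)) = cis (- (of_int j * x + of_int k * y))"
        "cis (- (of_int j * x + of_int k * (y + 2 * pi))) = cis (- (of_int j * x + of_int k * y))" for x y
        using cis_add_period[of "- (of_int j * x + of_int k * y)" "- j"] cis_add_period[of "- (of_int j * x + of_int k * y)" "- k"]
        by (simp_all add: algebra_simps)
      then show "periodic2 (\<lambda>z. f z * ?e z)" using per by (simp add: periodic2_def)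
    qed measurable
    finally show "(LINT z|lborel. w t * f (z + a t) * (?e z * indicator square2pi z)) = W * (w t * cis (of_int j * fst (a t) + of_int k * snd (a t)))"
      by (simp add: c_def mult_ac)
  qed
  also have "\<dots> = W * (LINT t|M. w t * cis (of_int j * fst (a t) + of_int k * snd (a t)))" by simp
  finally show "fourier_coeff T j k = fourier_coeff f j k * (LINT t|M. w t * cis (of_int j * fst (a t) + of_int k * snd (a t)))"
    unfolding fourier_coeff_lborel[OF T] fourier_coeff_lborel[OF f] W_def[symmetric] by simp
qed

text \<open>Fubini for null sets. The exceptional set of P is enlarged to a Borel null set, since P
  alone gives no measurable set in the product.\<close>

lemma AE_AE_translate:
  fixes a :: "'a \<Rightarrow> real \<times> real"
  assumes M: "sigma_finite_measure M" and a[measurable]: "a \<in> borel_measurable M" and ae: "AE z in lborel. P z"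
  shows "AE z in lborel. AE t in M. P (z + a t)"
proof -
  interpret P: pair_sigma_finite M "lborel :: (real \<times> real) measure"
    by (intro pair_sigma_finite.intro M lborel.sigma_finite_measure_axioms)
  from ae obtain N where N: "N \<in> null_sets lborel" "{z \<in> space lborel. \<not> P z} \<subseteq> N"
    unfolding eventually_ae_filter by blast
  have NB: "N \<in> sets borel" using N(1) by (simp add: null_sets_def)
  have aeN: "AE z in lborel. z \<notin> N" by (rule AE_not_in[OF N(1)])
  have "AE t in M. AE z in lborel. z + a t \<notin> N"
    by (intro AE_I2 AE_lborel_translate aeN)
  moreover have "{x \<in> space (M \<Otimes>\<^sub>M lborel). snd x + a (fst x) \<notin> N} \<in> sets (M \<Otimes>\<^sub>M lborel)"
    using NB by measurable
  ultimately have "AE z in lborel. AE t in M. z + a t \<notin> N"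
    using P.AE_commute[of "\<lambda>t z. z + a t \<notin> N"] by simp
  then show ?thesis
  proof eventually_elim
    case (elim z)
    then show ?case by eventually_elim (use N(2) in auto)
  qed
qed

text \<open>Covers partial sums (\<open>M\<close> is Lebesgue measure) and fractional differences (\<open>M\<close> is
  counting measure) alike. The formula for \<open>g\<close> is required only for Borel versions \<open>f0\<close> of
  \<open>f\<close> because \<open>f\<close> need not be measurable along lines.\<close>

lemma torus_L1_average:
  fixes w :: "'a \<Rightarrow> complex" and a :: "'a \<Rightarrow> real \<times> real"
  assumes f: "torus_L1 f" and M: "sigma_finite_measure M" and w: "integrable M w" and a: "a \<in> borel_measurable M"
    and g: "periodic2 g"
    and eq: "\<And>f0 z. \<lbrakk>f0 \<in> borel_measurable borel; AE t in M. f (z + a t) = f0 (z + a t);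
         integrable M (\<lambda>t. w t * f0 (z + a t))\<rbrakk> \<Longrightarrow> g z = (LINT t|M. w t * f0 (z + a t))"
  shows "torus_L1 g"
    "fourier_coeff g j k = fourier_coeff f j k * (LINT t|M. w t * cis (of_int j * fst (a t) + of_int k * snd (a t)))"
proof -
  obtain f0 where f0: "f0 \<in> borel_measurable borel" "periodic2 f0" "AE z in lborel. f z = f0 z"
    "set_integrable lborel square2pi f0" "\<And>j k. fourier_coeff f0 j k = fourier_coeff f j k"
    using torus_L1_borel_version[OF f] by blast
  define T where "T z = (LINT t|M. w t * f0 (z + a t))" for z
  note av = average_of_translates[OF M w a f0(1,2,4)]
  have T: "T \<in> borel_measurable borel" "periodic2 T" "set_integrable lborel square2pi T"
    "fourier_coeff T j k = fourier_coeff f0 j k * (LINT t|M. w t * cis (of_int j * fst (a t) + of_int k * snd (a t)))" for j k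
    using av unfolding T_def by blast+
  \<comment> \<open>On the square, f and its Borel version agree along almost all translates of
    almost every z and the average exists, so the formula for g applies; periodicity extends this to
    the plane.\<close>
  have "AE z in lborel. g z = T z"
  proof (rule AE_periodic)
    show "AE z in lborel. z \<in> square2pi \<longrightarrow> g z = T z"
      using av(4) AE_AE_translate[OF M a f0(3)]
      by eventually_elim (use eq[OF f0(1)] in \<open>auto simp: T_def\<close>)
    show "g (reduce2pi z) = T (reduce2pi z) \<Longrightarrow> g z = T z" for z
      by (simp add: periodic2_reduce[OF g] periodic2_reduce[OF T(2)])
  qed
  moreover have gm: "g \<in> borel_measurable lebesgue"
    by (rule borel_measurable_completion_cong_AE[OF borel_imp_lebesgue_measurable[OF T(1)]]) fact
  ultimately show "torus_L1 g" "fourier_coeff g j k = fourier_coeff f j k * (LINT t|M. w t * cis (of_int j * fst (a t) + of_int k * snd (a t)))"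
    using g T set_integrable_square2pi_cong_AE[OF gm T(1)] fourier_coeff_cong_AE[OF gm T(1)] f0(5) by (auto simp: torus_L1_def)
qed

section \<open>Density of trigonometric polynomials\<close>

text \<open>Trigonometric polynomials without a degree bound: closure under products needs no
  reindexing of sums, and inductions over approximations stay simple.\<close>

inductive exp_sum :: "(real \<times> real \<Rightarrow> complex) \<Rightarrow> bool" where
  character: "exp_sum (\<lambda>z. a * cis (of_int j * fst z + of_int k * snd z))"
| add: "exp_sum f \<Longrightarrow> exp_sum g \<Longrightarrow> exp_sum (\<lambda>z. f z + g z)"

lemma exp_sum_const: "exp_sum (\<lambda>z. a)"
  using exp_sum.character[of a 0 0] by simp

lemma exp_sum_mult:
  assumes "exp_sum f" "exp_sum g" shows "exp_sum (\<lambda>z. f z * g z)"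
  using assms
proof (induction f rule: exp_sum.induct)
  case (character a j k)
  from character show ?case
  proof (induction g rule: exp_sum.induct)
    case (character b j' k')
    have "exp_sum (\<lambda>z. (a * b) * cis (of_int (j + j') * fst z + of_int (k + k') * snd z))" by (rule exp_sum.character)
    also have "(\<lambda>z. (a * b) * cis (of_int (j + j') * fst z + of_int (k + k') * snd z)) =
      (\<lambda>z. a * cis (of_int j * fst z + of_int k * snd z) * (b * cis (of_int j' * fst z + of_int k' * snd z)))"
    proof
      fix z :: "real \<times> real"
      have "cis (of_int (j + j') * fst z + of_int (k + k') * snd z) = cis (of_int j * fst z + of_int k * snd z) * cis (of_int j' * fst z + of_int k' * snd z)"
        by (simp add: cis_mult algebra_simps)
      then show "(a * b) * cis (of_int (j + j') * fst z + of_int (k + k') * snd z) =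
        a * cis (of_int j * fst z + of_int k * snd z) * (b * cis (of_int j' * fst z + of_int k' * snd z))" by (simp only: mult_ac)
    qed
    finally show ?case .
  qed (simp add: distrib_left exp_sum.add)
qed (simp add: distrib_right exp_sum.add)

lemma trig_poly_pad:
  assumes "N \<le> M"
  shows "trig_poly N c = trig_poly M (\<lambda>j k. if \<bar>j\<bar> \<le> int N \<and> \<bar>k\<bar> \<le> int N then c j k else 0)"
proof
  fix z
  let ?B = "{-int N..int N} \<times> {-int N..int N}" and ?D = "{-int M..int M} \<times> {-int M..int M}"
  have "trig_poly N c z = (\<Sum>x\<in>?B. c (fst x) (snd x) * cis (of_int (fst x) * fst z + of_int (snd x) * snd z))"
    unfolding trig_poly_def sum.cartesian_product by (simp add: case_prod_unfold)
  also have "\<dots> = (\<Sum>x\<in>?D. (if \<bar>fst x\<bar> \<le> int N \<and> \<bar>snd x\<bar> \<le> int N then c (fst x) (snd x) else 0) * cis (of_int (fst x) * fst z + of_int (snd x) * snd z))"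
    by (rule sum.mono_neutral_cong_left) (use assms in auto)
  also have "\<dots> = trig_poly M (\<lambda>j k. if \<bar>j\<bar> \<le> int N \<and> \<bar>k\<bar> \<le> int N then c j k else 0) z"
    unfolding trig_poly_def sum.cartesian_product by (simp add: case_prod_unfold)
  finally show "trig_poly N c z = \<dots>" .
qed

lemma exp_sum_imp_trig_poly: "exp_sum f \<Longrightarrow> \<exists>N c. f = trig_poly N c"
proof (induction rule: exp_sum.induct)
  case (character a j k)
  define N where "N = nat (max \<bar>j\<bar> \<bar>k\<bar>)"
  have N: "j \<in> {-int N..int N}" "k \<in> {-int N..int N}" by (auto simp: N_def)
  have "(\<lambda>z. a * cis (of_int j * fst z + of_int k * snd z)) = trig_poly N (\<lambda>j' k'. if j' = j then if k' = k then a else 0 else 0)"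
  proof
    fix z :: "real \<times> real"
    have inner: "(\<Sum>k'\<in>{-int N..int N}. (if j' = j then if k' = k then a else 0 else 0) * cis (of_int j' * fst z + of_int k' * snd z))
      = (if j' = j then a * cis (of_int j * fst z + of_int k * snd z) else 0)" for j'
    proof (cases "j' = j")
      case True
      then have "(\<Sum>k'\<in>{-int N..int N}. (if j' = j then if k' = k then a else 0 else 0) * cis (of_int j' * fst z + of_int k' * snd z))
        = (\<Sum>k'\<in>{-int N..int N}. if k' = k then a * cis (of_int j * fst z + of_int k' * snd z) else 0)"
        by (intro sum.cong) auto
      then show ?thesis using True N(2) by (simp only: sum.delta finite_atLeastAtMost_int if_True refl)
    qed simp
    show "a * cis (of_int j * fst z + of_int k * snd z) = trig_poly N (\<lambda>j' k'. if j' = j then if k' = k then a else 0 else 0) z"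
      unfolding trig_poly_def inner using N(1) by (simp only: sum.delta finite_atLeastAtMost_int if_True)
  qed
  then show ?case by blast
next
  case (add f g)
  then obtain N c M d where "f = trig_poly N c" "g = trig_poly M d" by blast
  then have fg: "f = trig_poly (max N M) (\<lambda>j k. if \<bar>j\<bar> \<le> int N \<and> \<bar>k\<bar> \<le> int N then c j k else 0)"
    "g = trig_poly (max N M) (\<lambda>j k. if \<bar>j\<bar> \<le> int M \<and> \<bar>k\<bar> \<le> int M then d j k else 0)"
    using trig_poly_pad[of N "max N M" c] trig_poly_pad[of M "max N M" d] by simp_all
  have "trig_poly K (\<lambda>j k. u j k + v j k) = (\<lambda>z. trig_poly K u z + trig_poly K v z)" for K u v
    by (rule ext) (simp add: trig_poly_def distrib_right sum.distrib)
  from this[symmetric] show ?case unfolding fg by blast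
qed

text \<open>Through this map the Stone--Weierstrass theorem for real polynomials on \<open>complex \<times> complex\<close>
  yields approximation by exponential sums.\<close>

definition torus_embed :: "real \<times> real \<Rightarrow> complex \<times> complex" where
  "torus_embed z = (cis (fst z), cis (snd z))"

lemma continuous_on_torus_embed: "continuous_on S torus_embed"
  unfolding torus_embed_def by (intro continuous_intros)

lemma torus_embed_measurable [measurable]: "torus_embed \<in> borel_measurable borel"
  by (intro borel_measurable_continuous_onI continuous_on_torus_embed)

text \<open>A real linear functional on the embedded torus is a combination of the cosines and sines
  of the coordinates; sums and products of exponential sums remain exponential sums.\<close>

lemma exp_sum_real_polynomial:
  fixes g :: "complex \<times> complex \<Rightarrow> real"
  assumes "real_polynomial_function g"
  shows "exp_sum (\<lambda>z. of_real (g (torus_embed z)))"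
  using assms
proof (induction rule: real_polynomial_function.induct)
  case (linear f)
  interpret bounded_linear f by fact
  have cosx: "exp_sum (\<lambda>z. of_real (cos (fst z)))" "exp_sum (\<lambda>z. of_real (cos (snd z)))"
    and sinx: "exp_sum (\<lambda>z. of_real (sin (fst z)))" "exp_sum (\<lambda>z. of_real (sin (snd z)))"
  proof -
    have c: "of_real (cos t) = 1/2 * cis t + 1/2 * cis (- t)" and s: "of_real (sin t) = (1 / (2 * \<i>)) * cis t + (- 1 / (2 * \<i>)) * cis (- t)" for t :: real
      by (simp_all add: complex_eq_iff)
    show "exp_sum (\<lambda>z. of_real (cos (fst z)))"
      using exp_sum.add[OF exp_sum.character[of "1/2" 1 0] exp_sum.character[of "1/2" "-1" 0]] by (simp add: c)
    show "exp_sum (\<lambda>z. of_real (cos (snd z)))"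
      using exp_sum.add[OF exp_sum.character[of "1/2" 0 1] exp_sum.character[of "1/2" 0 "-1"]] by (simp add: c)
    show "exp_sum (\<lambda>z. of_real (sin (fst z)))"
      using exp_sum.add[OF exp_sum.character[of "1 / (2 * \<i>)" 1 0] exp_sum.character[of "- 1 / (2 * \<i>)" "-1" 0]] by (simp add: s)
    show "exp_sum (\<lambda>z. of_real (sin (snd z)))"
      using exp_sum.add[OF exp_sum.character[of "1 / (2 * \<i>)" 0 1] exp_sum.character[of "- 1 / (2 * \<i>)" 0 "-1"]] by (simp add: s)
  qed
  have "f (torus_embed z) = cos (fst z) * f (1, 0) + sin (fst z) * f (\<i>, 0) + (cos (snd z) * f (0, 1) + sin (snd z) * f (0, \<i>))" for z
  proof -
    have "torus_embed z = cos (fst z) *\<^sub>R (1, 0) + sin (fst z) *\<^sub>R (\<i>, 0) + (cos (snd z) *\<^sub>R (0, 1) + sin (snd z) *\<^sub>R (0, \<i>))"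
      by (simp add: torus_embed_def complex_eq_iff)
    then show ?thesis by (simp only: add scaleR) simp
  qed
  then show ?case
    by (simp only: of_real_add of_real_mult) (intro exp_sum.add exp_sum_mult exp_sum_const cosx sinx)
next
  case (const c)
  then show ?case by (rule exp_sum_const)
next
  case (add f g)
  then show ?case by (simp only: of_real_add) (rule exp_sum.add)
next
  case (mult f g)
  then show ?case by (simp only: of_real_mult) (rule exp_sum_mult)
qed

lemma exp_sum_measurable [measurable_dest]: "exp_sum f \<Longrightarrow> f \<in> borel_measurable borel"
  using exp_sum_imp_trig_poly borel_measurable_trig_poly by metis

section \<open>Approximation in the mean by exponential sums\<close>

definition square_measure :: "(real \<times> real) measure" where
  "square_measure = density lborel (indicator square2pi)"

lemma sets_square_measure [measurable_cong, simp]: "sets square_measure = sets borel"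
  by (simp add: square_measure_def)

lemma space_square_measure [simp]: "space square_measure = UNIV"
  by (simp add: square_measure_def)

lemma nn_integral_square_measure:
  "f \<in> borel_measurable borel \<Longrightarrow> (\<integral>\<^sup>+z. f z \<partial>square_measure) = (\<integral>\<^sup>+z\<in>square2pi. f z \<partial>lborel)"
  unfolding square_measure_def by (subst nn_integral_density) (auto simp: mult.commute)

lemma emeasure_square: "emeasure square_measure UNIV = ennreal (4 * pi\<^sup>2)"
proof -
  have "emeasure square_measure UNIV = (\<integral>\<^sup>+z. 1 \<partial>square_measure)" by simp
  also have "\<dots> = (\<integral>\<^sup>+z\<in>square2pi. 1 \<partial>lborel)" by (rule nn_integral_square_measure) simp
  also have "\<dots> = (\<integral>\<^sup>+x\<in>{0..2*pi}. (\<integral>\<^sup>+y\<in>{0..2*pi}. 1 \<partial>lborel) \<partial>lborel)" by (rule nn_integral_square2pi) simp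
  also have "\<dots> = ennreal (2 * pi) * ennreal (2 * pi)" by (simp add: nn_integral_cmult)
  also have "\<dots> = ennreal (4 * pi\<^sup>2)" by (simp add: ennreal_mult[symmetric] power2_eq_square)
  finally show ?thesis .
qed

lemma finite_square_measure: "finite_measure square_measure"
  by (rule finite_measureI) (simp add: emeasure_square)

text \<open>Membership in the L1 closure, expressed with the nonnegative integral so that the
  inductions below carry no integrability conditions.\<close>

definition exp_approximable :: "(real \<times> real \<Rightarrow> complex) \<Rightarrow> bool" where
  "exp_approximable f \<longleftrightarrow> (\<forall>\<epsilon>>0. \<exists>T. exp_sum T \<and> (\<integral>\<^sup>+z. ennreal (norm (f z - T z)) \<partial>square_measure) \<le> ennreal \<epsilon>)"

lemma nn_integral_norm_triangle:
  fixes f g h :: "real \<times> real \<Rightarrow> complex"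
  assumes [measurable]: "f \<in> borel_measurable borel" "g \<in> borel_measurable borel" "h \<in> borel_measurable borel"
  shows "(\<integral>\<^sup>+z. ennreal (norm (f z - h z)) \<partial>square_measure) \<le>
    (\<integral>\<^sup>+z. ennreal (norm (f z - g z)) \<partial>square_measure) + (\<integral>\<^sup>+z. ennreal (norm (g z - h z)) \<partial>square_measure)"
proof -
  have "(\<integral>\<^sup>+z. ennreal (norm (f z - h z)) \<partial>square_measure) \<le>
     (\<integral>\<^sup>+z. ennreal (norm (f z - g z)) + ennreal (norm (g z - h z)) \<partial>square_measure)"
  proof (rule nn_integral_mono)
    fix z show "ennreal (norm (f z - h z)) \<le> ennreal (norm (f z - g z)) + ennreal (norm (g z - h z))"
      using norm_triangle_ineq[of "f z - g z" "g z - h z"] by (simp add: ennreal_plus[symmetric] del: ennreal_plus)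
  qed
  also have "\<dots> = (\<integral>\<^sup>+z. ennreal (norm (f z - g z)) \<partial>square_measure) + (\<integral>\<^sup>+z. ennreal (norm (g z - h z)) \<partial>square_measure)"
    by (rule nn_integral_add) measurable
  finally show ?thesis .
qed

lemma exp_approximable_lim:
  assumes [measurable]: "f \<in> borel_measurable borel" "\<And>i::nat. s i \<in> borel_measurable borel"
    and s: "\<And>i. exp_approximable (s i)"
    and lim: "(\<lambda>i. (\<integral>\<^sup>+z. ennreal (norm (f z - s i z)) \<partial>square_measure)) \<longlonglongrightarrow> 0"
  shows "exp_approximable f"
  unfolding exp_approximable_def
proof (intro allI impI)
  fix \<epsilon> :: real assume e: "\<epsilon> > 0"
  have "\<forall>\<^sub>F i in sequentially. (\<integral>\<^sup>+z. ennreal (norm (f z - s i z)) \<partial>square_measure) < ennreal (\<epsilon> / 2)"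
    by (rule order_tendstoD(2)[OF lim]) (use e in simp)
  then obtain i where i: "(\<integral>\<^sup>+z. ennreal (norm (f z - s i z)) \<partial>square_measure) < ennreal (\<epsilon> / 2)"
    by (auto simp: eventually_sequentially)
  obtain T where T: "exp_sum T" "(\<integral>\<^sup>+z. ennreal (norm (s i z - T z)) \<partial>square_measure) \<le> ennreal (\<epsilon> / 2)"
    using s[of i] e unfolding exp_approximable_def by (meson half_gt_zero)
  have [measurable]: "T \<in> borel_measurable borel" using T(1) by (rule exp_sum_measurable)
  have "(\<integral>\<^sup>+z. ennreal (norm (f z - T z)) \<partial>square_measure) \<le> ennreal (\<epsilon> / 2) + ennreal (\<epsilon> / 2)"
    using i T(2) by (intro order_trans[OF nn_integral_norm_triangle[of f "s i" T]] add_mono) auto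
  also have "\<dots> = ennreal \<epsilon>" using e by (simp add: ennreal_plus[symmetric] del: ennreal_plus)
  finally show "\<exists>T. exp_sum T \<and> (\<integral>\<^sup>+z. ennreal (norm (f z - T z)) \<partial>square_measure) \<le> ennreal \<epsilon>" using T(1) by blast
qed

lemma exp_approximable_exp_sum: "exp_sum f \<Longrightarrow> exp_approximable f"
  unfolding exp_approximable_def by (intro allI impI exI[of _ f]) auto

lemma exp_approximable_add:
  assumes [measurable]: "f \<in> borel_measurable borel" "g \<in> borel_measurable borel"
    and fg: "exp_approximable f" "exp_approximable g"
  shows "exp_approximable (\<lambda>z. f z + g z)"
  unfolding exp_approximable_def
proof (intro allI impI)
  fix \<epsilon> :: real assume e: "\<epsilon> > 0"
  obtain T where T: "exp_sum T" "(\<integral>\<^sup>+z. ennreal (norm (f z - T z)) \<partial>square_measure) \<le> ennreal (\<epsilon> / 2)"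
    using fg(1) e unfolding exp_approximable_def by (meson half_gt_zero)
  obtain S where S: "exp_sum S" "(\<integral>\<^sup>+z. ennreal (norm (g z - S z)) \<partial>square_measure) \<le> ennreal (\<epsilon> / 2)"
    using fg(2) e unfolding exp_approximable_def by (meson half_gt_zero)
  have [measurable]: "T \<in> borel_measurable borel" "S \<in> borel_measurable borel" using T(1) S(1) by (auto dest: exp_sum_measurable)
  have "(\<integral>\<^sup>+z. ennreal (norm (f z + g z - (T z + S z))) \<partial>square_measure) \<le>
    (\<integral>\<^sup>+z. ennreal (norm (f z + g z - (T z + g z))) \<partial>square_measure) + (\<integral>\<^sup>+z. ennreal (norm (T z + g z - (T z + S z))) \<partial>square_measure)"
    by (rule nn_integral_norm_triangle) measurable
  also have "\<dots> \<le> ennreal (\<epsilon> / 2) + ennreal (\<epsilon> / 2)" using T(2) S(2) by (intro add_mono) simp_all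
  also have "\<dots> = ennreal \<epsilon>" using e by (simp add: ennreal_plus[symmetric] del: ennreal_plus)
  finally show "\<exists>T. exp_sum T \<and> (\<integral>\<^sup>+z. ennreal (norm (f z + g z - T z)) \<partial>square_measure) \<le> ennreal \<epsilon>"
    using exp_sum.add[OF T(1) S(1)] by blast
qed

lemma exp_approximable_cmult:
  assumes [measurable]: "f \<in> borel_measurable borel" and f: "exp_approximable f"
  shows "exp_approximable (\<lambda>z. c * f z)"
  unfolding exp_approximable_def
proof (intro allI impI)
  fix \<epsilon> :: real assume e: "\<epsilon> > 0"
  define d where "d = \<epsilon> / (norm c + 1)"
  have nc: "norm c + 1 > 0" by (smt (verit) norm_ge_zero)
  have "d > 0" using e nc by (simp add: d_def)
  then obtain T where T: "exp_sum T" "(\<integral>\<^sup>+z. ennreal (norm (f z - T z)) \<partial>square_measure) \<le> ennreal d"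
    using f unfolding exp_approximable_def by meson
  have [measurable]: "T \<in> borel_measurable borel" using T(1) by (rule exp_sum_measurable)
  have "(\<integral>\<^sup>+z. ennreal (norm (c * f z - c * T z)) \<partial>square_measure) = ennreal (norm c) * (\<integral>\<^sup>+z. ennreal (norm (f z - T z)) \<partial>square_measure)"
    by (subst nn_integral_cmult[symmetric]) (auto simp: ennreal_mult[symmetric] norm_mult[symmetric] right_diff_distrib)
  also have "\<dots> \<le> ennreal (norm c) * ennreal d" by (intro mult_left_mono T(2)) auto
  also have "\<dots> = ennreal (norm c * d)" using \<open>d > 0\<close> by (simp add: ennreal_mult)
  also have "\<dots> \<le> ennreal \<epsilon>" using e nc by (intro ennreal_leI) (simp add: d_def divide_le_eq mult.commute distrib_right)
  finally show "\<exists>T. exp_sum T \<and> (\<integral>\<^sup>+z. ennreal (norm (c * f z - T z)) \<partial>square_measure) \<le> ennreal \<epsilon>"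
    using exp_sum_mult[OF exp_sum_const T(1), of c] by blast
qed

lemma exp_approximable_bounded_lim:
  assumes [measurable]: "f \<in> borel_measurable borel" "\<And>i::nat. s i \<in> borel_measurable borel"
    and s: "\<And>i. exp_approximable (s i)" and bd: "\<And>i z. norm (s i z) \<le> 1"
    and lim: "\<And>z. (\<lambda>i. s i z) \<longlonglongrightarrow> f z"
  shows "exp_approximable f"
proof (rule exp_approximable_lim[OF _ _ s])
  show "(\<lambda>i. (\<integral>\<^sup>+z. ennreal (norm (f z - s i z)) \<partial>square_measure)) \<longlonglongrightarrow> 0"
  proof (rule nn_integral_dominated_convergence_norm[where w = "\<lambda>_. 1"])
    show "(\<integral>\<^sup>+x. ennreal 1 \<partial>square_measure) < \<infinity>" by (simp add: emeasure_square)
  qed (use bd lim in auto)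
qed measurable

lemma exp_approximable_continuous:
  fixes h :: "complex \<times> complex \<Rightarrow> real"
  assumes h: "continuous_on UNIV h"
  shows "exp_approximable (\<lambda>z. of_real (h (torus_embed z)))"
  unfolding exp_approximable_def
proof (intro allI impI)
  fix \<epsilon> :: real assume e: "\<epsilon> > 0"
  have [measurable]: "h \<in> borel_measurable borel" by (rule borel_measurable_continuous_onI[OF h])
  define d where "d = \<epsilon> / (4 * pi\<^sup>2)"
  have d: "d > 0" using e by (simp add: d_def)
  have K: "compact (sphere (0::complex) 1 \<times> sphere (0::complex) 1)" by (intro compact_Times compact_sphere)
  have hK: "continuous_on (sphere (0::complex) 1 \<times> sphere (0::complex) 1) h" by (rule continuous_on_subset[OF h]) simp
  show "\<exists>T. exp_sum T \<and> (\<integral>\<^sup>+z. ennreal (norm (of_real (h (torus_embed z)) - T z)) \<partial>square_measure) \<le> ennreal \<epsilon>"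
  proof (rule Stone_Weierstrass_real_polynomial_function[OF K hK d])
  fix g :: "complex \<times> complex \<Rightarrow> real"
  assume g: "real_polynomial_function g" "\<And>w. w \<in> sphere 0 1 \<times> sphere 0 1 \<Longrightarrow> \<bar>h w - g w\<bar> < d"
  have "norm (complex_of_real (h (torus_embed z)) - of_real (g (torus_embed z))) \<le> d" for z
    using g(2)[of "torus_embed z"] by (simp add: torus_embed_def of_real_diff[symmetric] del: of_real_diff)
  then have "(\<integral>\<^sup>+z. ennreal (norm (complex_of_real (h (torus_embed z)) - of_real (g (torus_embed z)))) \<partial>square_measure) \<le> (\<integral>\<^sup>+z. ennreal d \<partial>square_measure)"
    by (intro nn_integral_mono ennreal_leI)
  also have "\<dots> = ennreal \<epsilon>" using d e by (simp add: emeasure_square ennreal_mult[symmetric] d_def)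
  finally show "\<exists>T. exp_sum T \<and> (\<integral>\<^sup>+z. ennreal (norm (of_real (h (torus_embed z)) - T z)) \<partial>square_measure) \<le> ennreal \<epsilon>"
    using exp_sum_real_polynomial[OF g(1)] by blast
  qed
qed

text \<open>Dynkin's argument: open sets form a generator stable under intersection, their
  indicators are bounded limits of continuous functions, and the class survives complements and
  disjoint countable unions by dominated convergence.\<close>

lemma exp_approximable_indicator:
  assumes "A \<in> sets borel"
  shows "exp_approximable (\<lambda>z. indicator A (torus_embed z))"
proof -
  have "Int_stable {S :: (complex \<times> complex) set. open S}" by (auto simp: Int_stable_def)
  moreover have "{S :: (complex \<times> complex) set. open S} \<subseteq> Pow UNIV" by simp
  moreover have "A \<in> sigma_sets UNIV {S :: (complex \<times> complex) set. open S}" using assms by (simp add: borel_def)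
  ultimately show ?thesis
  proof (induction rule: sigma_sets_induct_disjoint)
    case (basic U)
    then have U: "open U" by simp
    show ?case
    proof (cases "U = UNIV")
      case True
      then show ?thesis using exp_approximable_exp_sum[OF exp_sum_const[of 1]] by simp
    next
      case False
      then have ne: "- U \<noteq> {}" by auto
      have cl: "closed (- U)" using U by auto
      \<comment> \<open>Increases with i to the indicator of U: the distance to the closed
        complement is positive exactly on U.\<close>
      define h where "h i w = min 1 (real i * infdist w (- U))" for i w
      have ch: "continuous_on UNIV (h i)" for i unfolding h_def by (intro continuous_intros)
      have [measurable]: "h i \<in> borel_measurable borel" for i by (rule borel_measurable_continuous_onI[OF ch])
      have [measurable]: "U \<in> sets borel" using U by simp
      show ?thesis
      proof (rule exp_approximable_bounded_lim[where s = "\<lambda>i z. of_real (h i (torus_embed z))"])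
        show "exp_approximable (\<lambda>z. of_real (h i (torus_embed z)))" for i
          by (rule exp_approximable_continuous[OF ch])
        show "norm (complex_of_real (h i (torus_embed z))) \<le> 1" for i z
          by (simp add: h_def infdist_nonneg)
        fix z
        have "(\<lambda>i. h i w) \<longlonglongrightarrow> indicator U w" for w
        proof (cases "w \<in> U")
          case True
          then have pos: "infdist w (- U) > 0"
            using in_closed_iff_infdist_zero[OF cl ne, of w] infdist_nonneg[of w "- U"] by (auto simp: less_le)
          obtain n where n: "1 / infdist w (- U) < real n" using reals_Archimedean2 by blast
          have "\<forall>i\<ge>n. h i w = 1"
          proof (intro allI impI)
            fix i assume "n \<le> i"
            then have "1 / infdist w (- U) \<le> real i" using n by linarith
            then have "1 \<le> real i * infdist w (- U)" using pos by (simp add: divide_le_eq)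
            then show "h i w = 1" by (simp add: h_def)
          qed
          then have "\<forall>\<^sub>F i in sequentially. h i w = 1" by (auto simp: eventually_sequentially)
          then show ?thesis using True by (simp add: tendsto_eventually)
        next
          case False
          then have "infdist w (- U) = 0" using in_closed_iff_infdist_zero[OF cl ne, of w] by auto
          then show ?thesis using False by (simp add: h_def)
        qed
        from tendsto_of_real[OF this[of "torus_embed z"], where 'a = complex]
        show "(\<lambda>i. complex_of_real (h i (torus_embed z))) \<longlonglongrightarrow> indicator U (torus_embed z)" by (simp add: of_real_indicator)
      qed measurable
    qed
  next
    case empty
    then show ?case using exp_approximable_exp_sum[OF exp_sum_const[of 0]] by simp
  next
    case (compl A)
    have [measurable]: "A \<in> sets borel" using compl(1) by (simp add: borel_def)
    have "exp_approximable (\<lambda>z. 1 + (-1) * indicator A (torus_embed z))"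
      by (intro exp_approximable_add exp_approximable_cmult compl exp_approximable_exp_sum exp_sum_const) measurable
    moreover have "(\<lambda>z. 1 + (-1) * indicator A (torus_embed z)) = (\<lambda>z. indicator (UNIV - A) (torus_embed z) :: complex)"
      by (auto simp: indicator_def)
    ultimately show ?case by simp
  next
    case (union A)
    have A[measurable]: "A i \<in> sets borel" for i using union(2) by (auto simp: borel_def)
    have ind_A: "(\<lambda>z. indicator B (torus_embed z) :: complex) \<in> borel_measurable borel" if "B \<in> sets borel" for B
      by (rule measurable_compose[OF torus_embed_measurable borel_measurable_indicator[OF that]])
    show ?case
    proof (rule exp_approximable_bounded_lim[where s = "\<lambda>n z. \<Sum>i<n. indicator (A i) (torus_embed z)"])
      show "exp_approximable (\<lambda>z. \<Sum>i<n. indicator (A i) (torus_embed z))" for n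
      proof (induction n)
        case 0
        then show ?case using exp_approximable_exp_sum[OF exp_sum_const[of 0]] by simp
      next
        case (Suc n)
        have "exp_approximable (\<lambda>z. (\<Sum>i<n. indicator (A i) (torus_embed z)) + indicator (A n) (torus_embed z))"
          by (intro exp_approximable_add borel_measurable_sum ind_A A Suc union.IH)
        then show ?case by simp
      qed
      have sum_eq: "(\<Sum>i<n. indicator (A i) w) = (indicator (\<Union>i<n. A i) w :: complex)" for n w
        by (rule indicator_UN_disjoint[symmetric, THEN trans]) (use union(1) in \<open>auto simp: disjoint_family_on_def\<close>)
      show "norm (\<Sum>i<n. indicator (A i) (torus_embed z) :: complex) \<le> 1" for n z
        unfolding sum_eq by (simp add: indicator_def)
      have "(\<lambda>n. indicator (\<Union>i<n. A i) w :: complex) \<longlonglongrightarrow> indicator (\<Union>i. A i) w" for w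
        by (rule LIMSEQ_indicator_UN)
      then show "(\<lambda>n. \<Sum>i<n. indicator (A i) (torus_embed z)) \<longlonglongrightarrow> (indicator (\<Union>i. A i) (torus_embed z) :: complex)" for z
        unfolding sum_eq .
      have "(\<Union>i. A i) \<in> sets borel" using A by (intro sets.countable_UN) auto
      then show "(\<lambda>z. indicator (\<Union>i. A i) (torus_embed z) :: complex) \<in> borel_measurable borel" by (rule ind_A)
      show "(\<lambda>z. \<Sum>i<n. indicator (A i) (torus_embed z) :: complex) \<in> borel_measurable borel" for n
        by (intro borel_measurable_sum ind_A A)
    qed
  qed
qed

lemma exp_approximable_integrable:
  assumes "integrable (distr square_measure borel torus_embed) G"
  shows "exp_approximable (\<lambda>z. G (torus_embed z))"
  using assms
proof (induction rule: integrable_induct)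
  case (base A c)
  have [measurable]: "A \<in> sets borel" using base by simp
  have "exp_approximable (\<lambda>z. c * indicator A (torus_embed z))"
    by (intro exp_approximable_cmult exp_approximable_indicator) measurable
  then show ?case by (simp add: scaleR_conv_of_real of_real_indicator mult.commute)
next
  case (add f g)
  have [measurable]: "f \<in> borel_measurable borel" "g \<in> borel_measurable borel"
    using borel_measurable_integrable[OF add.hyps(1)] borel_measurable_integrable[OF add.hyps(2)] by simp_all
  show ?case by (intro exp_approximable_add add.IH) measurable
next
  case (lim f s)
  have [measurable]: "f \<in> borel_measurable borel" "s i \<in> borel_measurable borel" for i
    using borel_measurable_integrable[OF lim.hyps(4)] borel_measurable_integrable[OF lim.hyps(1)[of i]] by simp_all
  show ?case
  proof (rule exp_approximable_lim[where s = "\<lambda>i z. s i (torus_embed z)"])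
    show "(\<lambda>i. (\<integral>\<^sup>+z. ennreal (norm (f (torus_embed z) - s i (torus_embed z))) \<partial>square_measure)) \<longlonglongrightarrow> 0"
    proof (rule nn_integral_dominated_convergence_norm[where w = "\<lambda>z. 2 * norm (f (torus_embed z))"])
      have "integrable square_measure (\<lambda>z. f (torus_embed z))"
        using lim.hyps(4) by (subst (asm) integrable_distr_eq) auto
      then have "integrable square_measure (\<lambda>z. 2 * f (torus_embed z))" by simp
      then show "(\<integral>\<^sup>+x. ennreal (2 * norm (f (torus_embed x))) \<partial>square_measure) < \<infinity>"
        unfolding integrable_iff_bounded by (simp add: norm_mult)
    qed (use lim.hyps(2,3) in auto)
  qed (use lim.IH in auto)
qed

text \<open>A Borel branch of the argument. The constant value on the closed negative half-axis
  leaves a continuous expression on the rest, and it is correct at -1, the only point of the unit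
  circle there.\<close>

definition circle_angle :: "complex \<Rightarrow> real" where
  "circle_angle u = (if u \<in> \<real>\<^sub>\<le>\<^sub>0 then pi else Im (Ln u))"

lemma circle_angle_measurable [measurable]: "circle_angle \<in> borel_measurable borel"
  unfolding circle_angle_def[abs_def]
  by (intro borel_measurable_continuous_on_if continuous_intros) auto

lemma cis_circle_angle: "cis (circle_angle (cis x)) = cis x"
proof (cases "cis x \<in> \<real>\<^sub>\<le>\<^sub>0")
  case True
  then have "Im (cis x) = 0" "Re (cis x) \<le> 0" by (auto simp: complex_nonpos_Reals_iff)
  moreover have "(Re (cis x))\<^sup>2 + (Im (cis x))\<^sup>2 = 1" by simp
  ultimately have "cis x = -1" by (auto simp: complex_eq_iff power2_eq_1_iff)
  then show ?thesis using True by (simp add: circle_angle_def)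
next
  case False
  have "exp (Ln (cis x)) = cis x" by simp
  moreover have "Re (Ln (cis x)) = 0" by simp
  ultimately have "cis (Im (Ln (cis x))) = cis x" by (metis exp_eq_polar exp_zero mult_1 of_real_1 exp_of_real)
  then show ?thesis using False by (simp add: circle_angle_def)
qed

text \<open>By periodicity f factors as G after \<open>torus_embed\<close>, with G Borel and
  integrable for the image measure; density is then a statement about integrable functions on the
  image.\<close>

lemma trig_poly_dense_L1:
  assumes [measurable]: "f \<in> borel_measurable borel" and per: "periodic2 f" and int: "set_integrable lborel square2pi f"
    and e: "\<epsilon> > 0"
  obtains N c where "(\<integral>\<^sup>+z. ennreal (norm (f z - trig_poly N c z)) \<partial>square_measure) \<le> ennreal \<epsilon>"
proof -
  define G where "G w = f (circle_angle (fst w), circle_angle (snd w))" for w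
  have [measurable]: "fst \<in> borel_measurable (borel :: (complex \<times> complex) measure)" "snd \<in> borel_measurable (borel :: (complex \<times> complex) measure)"
    by (intro borel_measurable_continuous_onI continuous_intros)+
  have [measurable]: "G \<in> borel_measurable borel" unfolding G_def by measurable
  have ang: "\<exists>m::int. circle_angle (cis x) = x + 2 * pi * of_int m" for x
  proof -
    have "sin (circle_angle (cis x)) = sin x \<and> cos (circle_angle (cis x)) = cos x"
      using cis_circle_angle[of x] by (simp add: complex_eq_iff)
    then show ?thesis unfolding sin_cos_eq_iff by (simp add: mult_ac)
  qed
  have G: "G (torus_embed z) = f z" for z
  proof -
    obtain m n :: int where "circle_angle (cis (fst z)) = fst z + 2 * pi * of_int m" "circle_angle (cis (snd z)) = snd z + 2 * pi * of_int n"
      using ang by meson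
    then show ?thesis using periodic2_translate[OF per, of z m n] by (simp add: G_def torus_embed_def plus_prod_def)
  qed
  have "integrable square_measure f"
  proof (rule integrableI_bounded)
    have "(\<integral>\<^sup>+z. ennreal (norm (f z)) \<partial>square_measure) = (\<integral>\<^sup>+z\<in>square2pi. ennreal (norm (f z)) \<partial>lborel)"
      by (rule nn_integral_square_measure) measurable
    also have "\<dots> = (\<integral>\<^sup>+z. ennreal (norm (indicator square2pi z *\<^sub>R f z)) \<partial>lborel)"
      by (intro nn_integral_cong) (simp add: indicator_def)
    also have "\<dots> < \<infinity>" using int unfolding set_integrable_def integrable_iff_bounded by blast
    finally show "(\<integral>\<^sup>+z. ennreal (norm (f z)) \<partial>square_measure) < \<infinity>" .
  qed simp
  then have "integrable (distr square_measure borel torus_embed) G"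
    by (subst integrable_distr_eq) (auto simp: G)
  from exp_approximable_integrable[OF this] have "exp_approximable f" by (simp add: G)
  then obtain T where T: "exp_sum T" "(\<integral>\<^sup>+z. ennreal (norm (f z - T z)) \<partial>square_measure) \<le> ennreal \<epsilon>"
    using e unfolding exp_approximable_def by blast
  then show ?thesis using that exp_sum_imp_trig_poly[OF T(1)] by blast
qed

section \<open>Orthogonality of characters\<close>

lemma integral_square_measure:
  fixes h :: "real \<times> real \<Rightarrow> complex"
  assumes [measurable]: "h \<in> borel_measurable borel"
  shows "integral\<^sup>L square_measure h = (LINT z:square2pi|lborel. h z)"
    and "integrable square_measure h \<longleftrightarrow> set_integrable lborel square2pi h"
proof -
  have M': "square_measure = density lborel (\<lambda>z. ennreal (indicator square2pi z))"
    by (simp add: square_measure_def ennreal_indicator)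
  show "integral\<^sup>L square_measure h = (LINT z:square2pi|lborel. h z)"
    unfolding M' set_lebesgue_integral_def by (subst integral_density) auto
  show "integrable square_measure h \<longleftrightarrow> set_integrable lborel square2pi h"
    unfolding M' set_integrable_def by (subst integrable_density) auto
qed

lemma integrable_square_measure_bounded:
  fixes h :: "real \<times> real \<Rightarrow> complex"
  assumes "h \<in> borel_measurable borel" "\<And>z. norm (h z) \<le> B"
  shows "integrable square_measure h"
  by (rule finite_measure.integrable_const_bound[OF finite_square_measure, of _ B]) (use assms in auto)

text \<open>A translation by half a wavelength changes the sign of a nontrivial character, so its
  integral over the periods equals its own negative.\<close>

lemma integral_character:
  "(LINT z|square_measure. cis (of_int j * fst z + of_int k * snd z)) = (if j = 0 \<and> k = 0 then of_real (4 * pi\<^sup>2) else 0)"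
proof (cases "j = 0 \<and> k = 0")
  case True
  have "measure square_measure UNIV = 4 * pi\<^sup>2" using emeasure_square by (simp add: measure_def)
  then show ?thesis using True by (simp add: scaleR_conv_of_real)
next
  case False
  define g where "g z = cis (of_int j * fst z + of_int k * snd z)" for z :: "real \<times> real"
  define a where "a = (if j \<noteq> 0 then (pi / of_int j, 0) else (0, pi / of_int k))"
  have [measurable]: "g \<in> borel_measurable borel" unfolding g_def by measurable
  have per: "periodic2 g"
    using cis_add_period[of "of_int j * _ + of_int k * _" j] cis_add_period[of "of_int j * _ + of_int k * _" k]
    by (simp add: periodic2_def g_def algebra_simps)
  have "cis (of_int j * fst a + of_int k * snd a) = -1" using False by (auto simp: a_def)
  then have "g (z + a) = - g z" for z
    using cis_mult[of "of_int j * fst z + of_int k * snd z" "of_int j * fst a + of_int k * snd a"]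
    by (simp add: g_def algebra_simps)
  then have "(LINT z:square2pi|lborel. g z) = - (LINT z:square2pi|lborel. g z)"
    using integral_square2pi_shift(1)[OF _ per, of a] by (simp add: set_lebesgue_integral_def)
  then have "(LINT z:square2pi|lborel. g z) = 0" by (simp add: eq_neg_iff_add_eq_0)
  moreover have "(LINT z|square_measure. g z) = (LINT z:square2pi|lborel. g z)" by (rule integral_square_measure) measurable
  ultimately show ?thesis using False by (auto simp: g_def)
qed

lemma fourier_coeff_square_measure:
  assumes [measurable]: "f \<in> borel_measurable borel"
  shows "fourier_coeff f j k = of_real (1 / (4 * pi\<^sup>2)) *
     (LINT z|square_measure. f z * cis (- (of_int j * fst z + of_int k * snd z)))"
proof -
  have "(\<lambda>z. f z * cis (- (of_int j * fst z + of_int k * snd z))) \<in> borel_measurable borel" by measurable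
  from integral_square_measure(1)[OF this] show ?thesis by (simp only: fourier_coeff_lborel[OF assms])
qed

lemma integrable_mult_character:
  assumes f: "f \<in> borel_measurable borel" and int: "integrable square_measure f"
  shows "integrable square_measure (\<lambda>z. f z * cis (- (of_int j * fst z + of_int k * snd z)))"
proof (rule Bochner_Integration.integrable_bound[OF int])
  show "(\<lambda>z. f z * cis (- (of_int j * fst z + of_int k * snd z))) \<in> borel_measurable square_measure"
    using f by measurable
qed (simp add: norm_mult)

lemma fourier_coeff_diff:
  assumes "f \<in> borel_measurable borel" "integrable square_measure f" "g \<in> borel_measurable borel" "integrable square_measure g"
  shows "fourier_coeff (\<lambda>z. f z - g z) j k = fourier_coeff f j k - fourier_coeff g j k"
proof -
  have m: "(\<lambda>z. f z - g z) \<in> borel_measurable borel" using assms by simp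
  show ?thesis
    unfolding fourier_coeff_square_measure[OF m] fourier_coeff_square_measure[OF assms(1)] fourier_coeff_square_measure[OF assms(3)]
      left_diff_distrib
    by (subst Bochner_Integration.integral_diff) (intro integrable_mult_character assms | simp add: right_diff_distrib)+
qed

lemma trig_poly_integrable: "integrable square_measure (trig_poly N c)"
proof (rule integrable_square_measure_bounded)
  show "norm (trig_poly N c z) \<le> (\<Sum>j\<in>{-int N..int N}. \<Sum>k\<in>{-int N..int N}. norm (c j k))" for z
    unfolding trig_poly_def by (intro sum_norm_le order_trans[OF norm_sum] sum_mono) (simp add: norm_mult)
qed simp

lemma fourier_coeff_trig_poly:
  "fourier_coeff (trig_poly N c) j k = (if \<bar>j\<bar> \<le> int N \<and> \<bar>k\<bar> \<le> int N then c j k else 0)"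
proof -
  let ?B = "{-int N..int N}"
  have "(LINT z|square_measure. trig_poly N c z * cis (- (of_int j * fst z + of_int k * snd z))) =
     (LINT z|square_measure. (\<Sum>j'\<in>?B. \<Sum>k'\<in>?B. c j' k' * cis (of_int (j' - j) * fst z + of_int (k' - k) * snd z)))"
    unfolding trig_poly_def sum_distrib_right
    by (intro Bochner_Integration.integral_cong refl sum.cong) (simp add: mult.assoc cis_mult algebra_simps)
  also have "\<dots> = (\<Sum>j'\<in>?B. \<Sum>k'\<in>?B. c j' k' * (LINT z|square_measure. cis (of_int (j' - j) * fst z + of_int (k' - k) * snd z)))"
  proof -
    have i: "integrable square_measure (\<lambda>z. c j' k' * cis (of_int (j' - j) * fst z + of_int (k' - k) * snd z))" for j' k'
    proof (rule integrable_square_measure_bounded[where B = "norm (c j' k')"])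
      show "(\<lambda>z. c j' k' * cis (of_int (j' - j) * fst z + of_int (k' - k) * snd z)) \<in> borel_measurable borel" by measurable
    qed (simp add: norm_mult)
    show ?thesis by (simp only: Bochner_Integration.integral_sum Bochner_Integration.integrable_sum i integral_mult_right_zero)
  qed
  also have "\<dots> = (\<Sum>j'\<in>?B. if j' = j then \<Sum>k'\<in>?B. if k' = k then c j' k' * of_real (4 * pi\<^sup>2) else 0 else 0)"
  proof (intro sum.cong refl)
    fix j'
    have "c j' k' * (LINT z|square_measure. cis (of_int (j' - j) * fst z + of_int (k' - k) * snd z)) =
      (if j' = j then if k' = k then c j' k' * of_real (4 * pi\<^sup>2) else 0 else 0)" for k'
      unfolding integral_character by auto
    then show "(\<Sum>k'\<in>?B. c j' k' * (LINT z|square_measure. cis (of_int (j' - j) * fst z + of_int (k' - k) * snd z))) =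
      (if j' = j then \<Sum>k'\<in>?B. if k' = k then c j' k' * of_real (4 * pi\<^sup>2) else 0 else 0)"
      by (simp only: split: if_split) simp
  qed
  also have "\<dots> = (if \<bar>j\<bar> \<le> int N \<and> \<bar>k\<bar> \<le> int N then c j k * of_real (4 * pi\<^sup>2) else 0)"
  proof -
    have delta: "(\<Sum>k'\<in>?B. if k' = k then c j' k' * of_real (4 * pi\<^sup>2) else 0) = (if \<bar>k\<bar> \<le> int N then c j' k * of_real (4 * pi\<^sup>2) else 0)" for j'
      by (simp only: sum.delta finite_atLeastAtMost_int atLeastAtMost_iff) auto
    show ?thesis unfolding delta by (simp only: sum.delta finite_atLeastAtMost_int atLeastAtMost_iff) auto
  qed
  finally have "(LINT z|square_measure. trig_poly N c z * cis (- (of_int j * fst z + of_int k * snd z))) =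
     (if \<bar>j\<bar> \<le> int N \<and> \<bar>k\<bar> \<le> int N then c j k * of_real (4 * pi\<^sup>2) else 0)" .
  then show ?thesis
    unfolding fourier_coeff_square_measure[OF borel_measurable_trig_poly] by (simp add: field_simps)
qed

section \<open>Fejer means\<close>

text \<open>Counts the pairs from {0..N} with difference j. In this form the expansion of the
  squared modulus in \<open>fejer_kernel\<close> is a mere rearrangement of sums; the familiar
  triangular weights are \<open>fejer_coeff_eq\<close>.\<close>

definition fejer_coeff :: "nat \<Rightarrow> int \<Rightarrow> real" where
  "fejer_coeff N j = (\<Sum>a\<in>{0..int N}. \<Sum>b\<in>{0..int N}. if a - b = j then 1 else 0) / (real N + 1)"

lemma fejer_coeff_eq:
  assumes "\<bar>j\<bar> \<le> int N" shows "fejer_coeff N j = (real N + 1 - \<bar>of_int j\<bar>) / (real N + 1)"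
proof -
  have "(\<Sum>b\<in>{0..int N}. if a - b = j then 1 else 0) = (if a \<in> {j..int N + j} then 1 else (0::real))" for a
  proof -
    have "(\<Sum>b\<in>{0..int N}. if a - b = j then 1 else 0) = (\<Sum>b\<in>{0..int N}. if b = a - j then 1 else (0::real))"
      by (intro sum.cong) auto
    then show ?thesis by (auto simp: sum.delta)
  qed
  then have "(\<Sum>a\<in>{0..int N}. \<Sum>b\<in>{0..int N}. if a - b = j then 1 else 0) = (\<Sum>a\<in>{0..int N}. if a \<in> {j..int N + j} then 1 else (0::real))"
    by (simp only:)
  also have "\<dots> = (\<Sum>a\<in>{0..int N} \<inter> {j..int N + j}. 1)"
    by (rule sum.inter_restrict[symmetric]) simp
  also have "{0..int N} \<inter> {j..int N + j} = {max 0 j..min (int N) (int N + j)}" by auto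
  also have "(\<Sum>a\<in>{max 0 j..min (int N) (int N + j)}. 1) = real N + 1 - \<bar>of_int j\<bar>"
    using assms by (cases "j \<ge> 0") (auto simp: max_def min_def of_nat_nat)
  finally show ?thesis by (simp add: fejer_coeff_def)
qed

lemma fejer_coeff_0 [simp]: "fejer_coeff N 0 = 1"
  using fejer_coeff_eq[of 0 N] by simp

lemma fejer_coeff_tendsto: "(\<lambda>N. fejer_coeff N j) \<longlonglongrightarrow> 1"
proof -
  have "(\<lambda>N. 1 - \<bar>of_int j\<bar> * inverse (real (Suc N))) \<longlonglongrightarrow> 1 - \<bar>of_int j\<bar> * 0"
    by (intro tendsto_intros LIMSEQ_inverse_real_of_nat)
  then have "(\<lambda>N. 1 - \<bar>of_int j\<bar> * inverse (real (Suc N))) \<longlonglongrightarrow> 1" by simp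
  then show ?thesis
  proof (rule Lim_transform_eventually)
    show "\<forall>\<^sub>F N in sequentially. 1 - \<bar>of_int j\<bar> * inverse (real (Suc N)) = fejer_coeff N j"
      using eventually_ge_at_top[of "nat \<bar>j\<bar>"]
      by eventually_elim (subst fejer_coeff_eq, auto simp: field_simps)
  qed
qed

definition fejer_kernel :: "nat \<Rightarrow> real \<Rightarrow> real" where
  "fejer_kernel N t = (norm (\<Sum>a\<in>{0..int N}. cis (of_int a * t)))\<^sup>2 / (real N + 1)"

lemma fejer_kernel_expand:
  "of_real (fejer_kernel N t) = (\<Sum>j\<in>{-int N..int N}. of_real (fejer_coeff N j) * cis (- (of_int j * t)))"
proof -
  have "(\<Sum>j\<in>{-int N..int N}. of_real (fejer_coeff N j) * cis (- (of_int j * t))) =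
    (\<Sum>j\<in>{-int N..int N}. \<Sum>a\<in>{0..int N}. \<Sum>b\<in>{0..int N}. if j = a - b then cis (- (of_int j * t)) else 0) / of_real (real N + 1)"
    unfolding fejer_coeff_def sum_divide_distrib of_real_divide of_real_sum sum_distrib_right times_divide_eq_left
    by (intro sum.cong refl arg_cong2[where f = "(/)"]) auto
  also have "(\<Sum>j\<in>{-int N..int N}. \<Sum>a\<in>{0..int N}. \<Sum>b\<in>{0..int N}. if j = a - b then cis (- (of_int j * t)) else 0) =
    (\<Sum>a\<in>{0..int N}. \<Sum>b\<in>{0..int N}. \<Sum>j\<in>{-int N..int N}. if j = a - b then cis (- (of_int j * t)) else 0)"
  proof -
    have "(\<Sum>j\<in>{-int N..int N}. \<Sum>b\<in>{0..int N}. if j = a - b then cis (- (of_int j * t)) else 0) =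
      (\<Sum>b\<in>{0..int N}. \<Sum>j\<in>{-int N..int N}. if j = a - b then cis (- (of_int j * t)) else 0)" for a
      by (rule sum.swap)
    then show ?thesis by (subst sum.swap) (simp only:)
  qed
  also have "\<dots> = (\<Sum>a\<in>{0..int N}. \<Sum>b\<in>{0..int N}. cnj (cis (of_int a * t)) * cis (of_int b * t))"
    by (intro sum.cong refl) (auto simp: sum.delta cis_cnj cis_mult left_diff_distrib)
  also have "\<dots> = cnj (\<Sum>a\<in>{0..int N}. cis (of_int a * t)) * (\<Sum>a\<in>{0..int N}. cis (of_int a * t))"
    by (simp add: sum_product)
  also have "\<dots> = of_real ((norm (\<Sum>a\<in>{0..int N}. cis (of_int a * t)))\<^sup>2)"
    using complex_norm_square[of "\<Sum>a\<in>{0..int N}. cis (of_int a * t)"] by (simp add: mult.commute)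
  finally show ?thesis by (simp add: fejer_kernel_def)
qed

text \<open>Depends on coefficients only, so the same polynomial serves every function with these
  coefficients, whatever representative is chosen.\<close>

definition fejer_mean :: "nat \<Rightarrow> (int \<Rightarrow> int \<Rightarrow> complex) \<Rightarrow> real \<times> real \<Rightarrow> complex" where
  "fejer_mean N c = trig_poly N (\<lambda>j k. of_real (fejer_coeff N j * fejer_coeff N k) * c j k)"

text \<open>The mean is an average of translates of f with a nonnegative weight of total mass 1, and
  each translate has the norm of f.\<close>

lemma Lp_norm_fejer_mean_le_borel:
  assumes p: "1 \<le> p" and f: "f \<in> borel_measurable borel" and per: "periodic2 f" and int: "set_integrable lborel square2pi f"
  shows "Lp_norm p (fejer_mean N (fourier_coeff f)) \<le> Lp_norm p f"
proof -
  let ?B = "{-int N..int N}"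
  \<comment> \<open>The factor 1 / (4 pi^2) normalises the mass: only the constant term of the
    product kernel, which is 1, survives integration.\<close>
  define w where "w t = complex_of_real (fejer_kernel N (fst t) * fejer_kernel N (snd t) / (4 * pi\<^sup>2))" for t :: "real \<times> real"
  let ?e = "\<lambda>j k z. cis (- (of_int j * fst z + of_int k * snd z))"
  have w_eq: "w t = (\<Sum>j\<in>?B. \<Sum>k\<in>?B. of_real (fejer_coeff N j * fejer_coeff N k / (4 * pi\<^sup>2)) * ?e j k t)" for t
  proof -
    have "w t = of_real (fejer_kernel N (fst t)) * of_real (fejer_kernel N (snd t)) * of_real (1 / (4 * pi\<^sup>2))"
      by (simp add: w_def)
    also have "\<dots> = (\<Sum>j\<in>?B. \<Sum>k\<in>?B. of_real (fejer_coeff N j) * cis (- (of_int j * fst t)) * (of_real (fejer_coeff N k) * cis (- (of_int k * snd t))) * of_real (1 / (4 * pi\<^sup>2)))"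
      by (simp only: fejer_kernel_expand sum_product) (simp only: sum_distrib_right)
    also have "\<dots> = (\<Sum>j\<in>?B. \<Sum>k\<in>?B. of_real (fejer_coeff N j * fejer_coeff N k / (4 * pi\<^sup>2)) * ?e j k t)"
    proof (intro sum.cong refl)
      fix j k
      have "?e j k t = cis (- (of_int j * fst t)) * cis (- (of_int k * snd t))" by (simp add: cis_mult)
      then show "of_real (fejer_coeff N j) * cis (- (of_int j * fst t)) * (of_real (fejer_coeff N k) * cis (- (of_int k * snd t))) * of_real (1 / (4 * pi\<^sup>2)) =
        of_real (fejer_coeff N j * fejer_coeff N k / (4 * pi\<^sup>2)) * ?e j k t"
        by (simp add: mult_ac)
    qed
    finally show ?thesis .
  qed
  have ei: "integrable square_measure (?e j k)" for j k
  proof (rule integrable_square_measure_bounded[where B = 1])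
    show "?e j k \<in> borel_measurable borel" by measurable
  qed simp
  have wi: "integrable square_measure w"
    unfolding w_eq by (intro Bochner_Integration.integrable_sum Bochner_Integration.integrable_mult_right ei)
  have e_int: "(LINT t|square_measure. ?e j k t) = (if j = 0 \<and> k = 0 then of_real (4 * pi\<^sup>2) else 0)" for j k
    using integral_character[of "- j" "- k"] by simp
  have "(LINT t|square_measure. w t) = (\<Sum>j\<in>?B. \<Sum>k\<in>?B. of_real (fejer_coeff N j * fejer_coeff N k / (4 * pi\<^sup>2)) * (if j = 0 \<and> k = 0 then of_real (4 * pi\<^sup>2) else 0))"
    unfolding w_eq e_int[symmetric]
    by (simp only: Bochner_Integration.integral_sum Bochner_Integration.integrable_sum Bochner_Integration.integrable_mult_right ei integral_mult_right_zero)
  also have "\<dots> = (\<Sum>j\<in>?B. if j = 0 then (\<Sum>k\<in>?B. if k = 0 then 1 else 0) else 0)"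
  proof (intro sum.cong refl)
    fix j
    show "(\<Sum>k\<in>?B. complex_of_real (fejer_coeff N j * fejer_coeff N k / (4 * pi\<^sup>2)) * (if j = 0 \<and> k = 0 then of_real (4 * pi\<^sup>2) else 0))
      = (if j = 0 then (\<Sum>k\<in>?B. if k = 0 then 1 else 0) else 0)"
    proof (cases "j = 0")
      case True
      have "complex_of_real (fejer_coeff N j * fejer_coeff N k / (4 * pi\<^sup>2)) * (if j = 0 \<and> k = 0 then of_real (4 * pi\<^sup>2) else 0) = (if k = 0 then 1 else 0)" for k
        using True by auto
      then show ?thesis using True by (simp only: if_True refl)
    qed simp
  qed
  also have "\<dots> = 1" by (simp add: sum.delta)
  finally have w1: "(LINT t|square_measure. w t) = 1" .
  \<comment> \<open>Nonnegativity of the kernel turns the known integral of w into its L1 norm; this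
    is the point where the constant becomes exactly 1.\<close>
  have "norm (w t) = Re (w t)" for t
    unfolding w_def norm_of_real Re_complex_of_real by (rule abs_of_nonneg) (simp add: fejer_kernel_def)
  then have "(LINT t|square_measure. norm (w t)) = (LINT t|square_measure. Re (w t))" by (simp only:)
  also have "\<dots> = 1" using integral_Re[OF wi] w1 by simp
  finally have wn: "(LINT t|square_measure. norm (w t)) = 1" .
  have fz: "integrable square_measure (\<lambda>t. f (z + t) * ?e j k t)"
    "(LINT t|square_measure. f (z + t) * ?e j k t) = of_real (4 * pi\<^sup>2) * fourier_coeff f j k * cis (of_int j * fst z + of_int k * snd z)" for z j k
  proof -
    have m: "(\<lambda>t. f (z + t)) \<in> borel_measurable borel" using f by measurable
    have "set_integrable lborel square2pi (\<lambda>t. f (t + z))" using integral_square2pi_shift(2)[OF f per] int by blast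
    then have "integrable square_measure (\<lambda>t. f (z + t))" by (subst integral_square_measure(2)[OF m]) (simp add: add.commute)
    from integrable_mult_character[OF m this] show "integrable square_measure (\<lambda>t. f (z + t) * ?e j k t)" .
    define c where "c = cis (of_int j * fst z + of_int k * snd z)"
    have eq: "?e j k t = c * ?e j k (t + z)" for t unfolding c_def cis_mult by (simp add: algebra_simps)
    have fe: "(\<lambda>t. f t * ?e j k t) \<in> borel_measurable borel" using f by measurable
    have fe': "(\<lambda>t. f (t + z) * ?e j k (t + z)) \<in> borel_measurable borel" by (rule measurable_compose[OF _ fe]) measurable
    have "(LINT t|square_measure. f (z + t) * ?e j k t) = (LINT t|square_measure. c * (f (t + z) * ?e j k (t + z)))"
      by (intro Bochner_Integration.integral_cong refl, subst eq) (simp only: mult_ac add.commute)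
    also have "\<dots> = c * (LINT t|square_measure. f (t + z) * ?e j k (t + z))" by (rule integral_mult_right_zero)
    also have "(LINT t|square_measure. f (t + z) * ?e j k (t + z)) = (LINT t|square_measure. f t * ?e j k t)"
      unfolding integral_square_measure(1)[OF fe] integral_square_measure(1)[OF fe']
    proof (rule integral_square2pi_shift(1)[where g = "\<lambda>z. f z * ?e j k z", OF fe])
      have "cis (- (of_int j * (x + 2 * pi) + of_int k * y)) = cis (- (of_int j * x + of_int k * y))"
        "cis (- (of_int j * x + of_int k * (y + 2 * pi))) = cis (- (of_int j * x + of_int k * y))" for x y
        using cis_add_period[of "- (of_int j * x + of_int k * y)" "- j"] cis_add_period[of "- (of_int j * x + of_int k * y)" "- k"]
        by (simp_all add: algebra_simps)
      then show "periodic2 (\<lambda>z. f z * ?e j k z)" using per by (simp add: periodic2_def)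
    qed
    also have "\<dots> = of_real (4 * pi\<^sup>2) * fourier_coeff f j k"
      unfolding fourier_coeff_square_measure[OF f] by simp
    finally show "(LINT t|square_measure. f (z + t) * ?e j k t) = of_real (4 * pi\<^sup>2) * fourier_coeff f j k * cis (of_int j * fst z + of_int k * snd z)"
      by (simp add: c_def mult_ac)
  qed
  have mean: "fejer_mean N (fourier_coeff f) z = (LINT t|square_measure. w t * f (z + t))" for z
  proof -
    have "(LINT t|square_measure. w t * f (z + t)) = (LINT t|square_measure. (\<Sum>j\<in>?B. \<Sum>k\<in>?B. of_real (fejer_coeff N j * fejer_coeff N k / (4 * pi\<^sup>2)) * (f (z + t) * ?e j k t)))"
      unfolding w_eq sum_distrib_right by (intro Bochner_Integration.integral_cong refl sum.cong) (simp only: mult_ac)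
    also have "\<dots> = (\<Sum>j\<in>?B. \<Sum>k\<in>?B. of_real (fejer_coeff N j * fejer_coeff N k / (4 * pi\<^sup>2)) * (of_real (4 * pi\<^sup>2) * fourier_coeff f j k * cis (of_int j * fst z + of_int k * snd z)))"
      unfolding fz(2)[symmetric]
      by (simp only: Bochner_Integration.integral_sum Bochner_Integration.integrable_sum Bochner_Integration.integrable_mult_right fz(1) integral_mult_right_zero)
    also have "\<dots> = fejer_mean N (fourier_coeff f) z"
      unfolding fejer_mean_def trig_poly_def by (intro sum.cong refl) simp
    finally show ?thesis by simp
  qed
  have "Lp_norm p (\<lambda>z. LINT t|square_measure. w t * f (z + t)) \<le> ennreal (LINT t|square_measure. norm (w t)) * Lp_norm p f"
  proof (rule Lp_norm_weighted_average[OF _ p _ wi])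
    show "sigma_finite_measure square_measure"
      using finite_square_measure by (rule finite_measure.axioms(1))
    have "(\<lambda>x. f (snd x + fst x)) \<in> borel_measurable (borel \<Otimes>\<^sub>M borel)"
      by (rule measurable_compose[OF _ f]) measurable
    moreover have "sets (square_measure \<Otimes>\<^sub>M lborel) = sets (borel \<Otimes>\<^sub>M borel)" by (rule sets_pair_measure_cong) simp_all
    ultimately show "(\<lambda>(t, z). f (z + t)) \<in> borel_measurable (square_measure \<Otimes>\<^sub>M lborel)"
      by (simp add: case_prod_unfold cong: measurable_cong_sets)
    show "Lp_norm p (\<lambda>z. f (z + t)) \<le> Lp_norm p f" for t using Lp_norm_shift[OF f per] by simp
  qed
  moreover have "fejer_mean N (fourier_coeff f) = (\<lambda>z. LINT t|square_measure. w t * f (z + t))"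
    by (rule ext) (rule mean)
  ultimately show ?thesis using wn by simp
qed

lemma nn_integral_eq_Lp_norm_1:
  assumes "f \<in> borel_measurable borel"
  shows "(\<integral>\<^sup>+z. ennreal (norm (f z)) \<partial>square_measure) = Lp_norm 1 f"
  using assms by (subst nn_integral_square_measure) (auto simp: Lp_norm_lborel Let_def less_top[symmetric])

text \<open>Three terms of size epsilon: f is replaced by a polynomial T inside the mean
  (contraction for p = 1), the mean of T converges since its finitely many coefficients do, and T is
  replaced by f.\<close>

lemma fejer_mean_L1_tendsto:
  assumes f: "f \<in> borel_measurable borel" and per: "periodic2 f" and int: "set_integrable lborel square2pi f"
  shows "(\<lambda>N. \<integral>\<^sup>+z. ennreal (norm (fejer_mean N (fourier_coeff f) z - f z)) \<partial>square_measure) \<longlonglongrightarrow> 0"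
proof (rule order_tendstoI)
  fix a :: ennreal assume "0 < a"
  then obtain b where b: "0 < b" "b < a" using dense by blast
  then obtain r where r: "b = ennreal r" "r > 0" by (cases b) (auto simp: ennreal_less_zero_iff)
  define e where "e = r / 3"
  have e: "e > 0" using r by (simp add: e_def)
  obtain N0 c where T: "(\<integral>\<^sup>+z. ennreal (norm (f z - trig_poly N0 c z)) \<partial>square_measure) \<le> ennreal e"
    using trig_poly_dense_L1[OF f per int e] by metis
  let ?B = "{-int N0..int N0}"
  define T where "T = trig_poly N0 c"
  have [measurable]: "T \<in> borel_measurable borel" "f \<in> borel_measurable borel" unfolding T_def using f by simp_all
  have fi: "integrable square_measure f" using integral_square_measure(2)[OF f] int by simp
  have Ti: "integrable square_measure T" unfolding T_def by (rule trig_poly_integrable)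
  \<comment> \<open>A uniform bound for the distance of T from its Fejer mean once N exceeds the
    degree of T.\<close>
  define d where "d N = (\<Sum>j\<in>?B. \<Sum>k\<in>?B. \<bar>fejer_coeff N j * fejer_coeff N k - 1\<bar> * norm (c j k))" for N
  have "d \<longlonglongrightarrow> (\<Sum>j\<in>?B. \<Sum>k\<in>?B. \<bar>1 * 1 - 1\<bar> * norm (c j k))"
    unfolding d_def by (intro tendsto_intros fejer_coeff_tendsto)
  then have "d \<longlonglongrightarrow> 0" by simp
  then have "\<forall>\<^sub>F N in sequentially. d N < e / (4 * pi\<^sup>2)"
    by (rule order_tendstoD) (use e in simp)
  then show "\<forall>\<^sub>F N in sequentially. (\<integral>\<^sup>+z. ennreal (norm (fejer_mean N (fourier_coeff f) z - f z)) \<partial>square_measure) < a"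
    using eventually_ge_at_top[of N0]
  proof eventually_elim
    case (elim N)
    have [measurable]: "fejer_mean N q \<in> borel_measurable borel" for q unfolding fejer_mean_def by simp
    have "(\<integral>\<^sup>+z. ennreal (norm (fejer_mean N (fourier_coeff f) z - fejer_mean N (fourier_coeff T) z)) \<partial>square_measure) \<le> ennreal e"
    proof -
      have fT: "(\<lambda>z. f z - T z) \<in> borel_measurable borel" by measurable
      have "fejer_mean N (fourier_coeff f) z - fejer_mean N (fourier_coeff T) z = fejer_mean N (fourier_coeff (\<lambda>z. f z - T z)) z" for z
        unfolding fejer_mean_def trig_poly_def sum_subtractf[symmetric]
        by (intro sum.cong refl) (simp add: fourier_coeff_diff[OF f fi _ Ti] algebra_simps)
      then have "(\<integral>\<^sup>+z. ennreal (norm (fejer_mean N (fourier_coeff f) z - fejer_mean N (fourier_coeff T) z)) \<partial>square_measure)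
        = Lp_norm 1 (fejer_mean N (fourier_coeff (\<lambda>z. f z - T z)))"
        by (simp add: nn_integral_eq_Lp_norm_1)
      also have "\<dots> \<le> Lp_norm 1 (\<lambda>z. f z - T z)"
      proof (rule Lp_norm_fejer_mean_le_borel[OF _ fT])
        show "periodic2 (\<lambda>z. f z - T z)" using per periodic2_trig_poly[of N0 c] by (simp add: periodic2_def T_def)
        show "set_integrable lborel square2pi (\<lambda>z. f z - T z)"
          using integral_square_measure(2)[OF fT] fi Ti by simp
      qed simp
      also have "\<dots> \<le> ennreal e"
        unfolding nn_integral_eq_Lp_norm_1[OF fT, symmetric] unfolding T_def by (rule T)
      finally show ?thesis .
    qed
    moreover have "(\<integral>\<^sup>+z. ennreal (norm (fejer_mean N (fourier_coeff T) z - T z)) \<partial>square_measure) \<le> ennreal e"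
    proof -
      have FT: "fejer_mean N (fourier_coeff T) = trig_poly N0 (\<lambda>j k. of_real (fejer_coeff N j * fejer_coeff N k) * c j k)"
        unfolding fejer_mean_def T_def fourier_coeff_trig_poly trig_poly_pad[OF elim(2)]
        by (rule trig_poly_cong) simp
      have "norm (fejer_mean N (fourier_coeff T) z - T z) \<le> d N" for z
      proof -
        have "fejer_mean N (fourier_coeff T) z - T z = (\<Sum>j\<in>?B. \<Sum>k\<in>?B. of_real (fejer_coeff N j * fejer_coeff N k - 1) * c j k * cis (of_int j * fst z + of_int k * snd z))"
          unfolding FT unfolding T_def trig_poly_def sum_subtractf[symmetric] by (intro sum.cong refl) (simp add: algebra_simps)
        also have "norm \<dots> \<le> d N"
          unfolding d_def by (intro sum_norm_le order_trans[OF norm_sum] sum_mono) (simp only: norm_mult norm_of_real norm_cis mult_1_right order_refl)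
        finally show ?thesis .
      qed
      then have "(\<integral>\<^sup>+z. ennreal (norm (fejer_mean N (fourier_coeff T) z - T z)) \<partial>square_measure) \<le> (\<integral>\<^sup>+z. ennreal (e / (4 * pi\<^sup>2)) \<partial>square_measure)"
        using elim(1) by (intro nn_integral_mono ennreal_leI) (meson less_imp_le order_trans)
      also have "\<dots> = ennreal e" using e by (simp add: emeasure_square ennreal_mult[symmetric])
      finally show ?thesis .
    qed
    moreover have "(\<integral>\<^sup>+z. ennreal (norm (T z - f z)) \<partial>square_measure) \<le> ennreal e"
      using T by (simp add: norm_minus_commute T_def)
    moreover have "(\<integral>\<^sup>+z. ennreal (norm (fejer_mean N (fourier_coeff f) z - f z)) \<partial>square_measure) \<le>
      (\<integral>\<^sup>+z. ennreal (norm (fejer_mean N (fourier_coeff f) z - fejer_mean N (fourier_coeff T) z)) \<partial>square_measure) +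
      ((\<integral>\<^sup>+z. ennreal (norm (fejer_mean N (fourier_coeff T) z - T z)) \<partial>square_measure) +
      (\<integral>\<^sup>+z. ennreal (norm (T z - f z)) \<partial>square_measure))"
      by (rule order_trans[OF nn_integral_norm_triangle add_left_mono[OF nn_integral_norm_triangle]]) measurable
    ultimately have "(\<integral>\<^sup>+z. ennreal (norm (fejer_mean N (fourier_coeff f) z - f z)) \<partial>square_measure) \<le> ennreal e + (ennreal e + ennreal e)"
      by (meson add_mono order_trans)
    also have "\<dots> = b" using e r by (simp add: ennreal_plus[symmetric] e_def del: ennreal_plus)
    finally have "(\<integral>\<^sup>+z. ennreal (norm (fejer_mean N (fourier_coeff f) z - f z)) \<partial>square_measure) \<le> b" .
    then show ?case using b(2) by (rule le_less_trans)
  qed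
qed simp

text \<open>Convergence in L1 gives a subsequence that converges almost everywhere, and Fatou's
  lemma does the rest. It is not presupposed that f has finite p-norm, so finiteness is part of the
  conclusion when B is finite.\<close>

lemma Lp_norm_le_of_fejer_mean_borel:
  assumes p: "0 < p" and f: "f \<in> borel_measurable borel" and per: "periodic2 f" and int: "set_integrable lborel square2pi f"
    and B: "\<And>N. Lp_norm p (fejer_mean N (fourier_coeff f)) \<le> B"
  shows "Lp_norm p f \<le> B"
proof -
  define u where "u N z = fejer_mean N (fourier_coeff f) z - f z" for N z
  have fm: "fejer_mean N q \<in> borel_measurable borel" for N q unfolding fejer_mean_def by simp
  have ui: "integrable square_measure (u N)" for N
    unfolding u_def fejer_mean_def
    by (intro Bochner_Integration.integrable_diff trig_poly_integrable) (use integral_square_measure(2)[OF f] int in simp)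
  have eq: "ennreal (LINT z|square_measure. norm (u N z)) = (\<integral>\<^sup>+z. ennreal (norm (u N z)) \<partial>square_measure)" for N
    by (rule nn_integral_eq_integral[symmetric]) (auto intro: integrable_norm ui)
  have "(\<lambda>N. \<integral>\<^sup>+z. ennreal (norm (u N z)) \<partial>square_measure) \<longlonglongrightarrow> 0"
    using fejer_mean_L1_tendsto[OF f per int] by (simp add: u_def)
  then have "(\<lambda>N. ennreal (LINT z|square_measure. norm (u N z))) \<longlonglongrightarrow> ennreal 0"
    by (simp only: eq ennreal_0)
  then have "(\<lambda>N. LINT z|square_measure. norm (u N z)) \<longlonglongrightarrow> 0"
    by (subst (asm) tendsto_ennreal_iff) auto
  from tendsto_L1_AE_subseq[OF ui this] obtain r where r: "AE z in square_measure. (\<lambda>n. u (r n) z) \<longlonglongrightarrow> 0" by blast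
  have "AE z in lborel. z \<in> square2pi \<longrightarrow> (\<lambda>n. fejer_mean (r n) (fourier_coeff f) z) \<longlonglongrightarrow> f z"
  proof -
    have "AE z in lborel. 0 < (indicator square2pi z :: ennreal) \<longrightarrow> (\<lambda>n. u (r n) z) \<longlonglongrightarrow> 0"
      using r unfolding square_measure_def by (subst (asm) AE_density) auto
    then show ?thesis
      by eventually_elim (auto simp: u_def intro: LIM_zero_cancel)
  qed
  then have "AE z in lborel. (\<lambda>n. fejer_mean (r n) (fourier_coeff f) z) \<longlonglongrightarrow> f z"
    by (rule AE_periodic) (simp add: periodic2_reduce[OF per] fejer_mean_def periodic2_reduce[OF periodic2_trig_poly])
  then show ?thesis by (rule Lp_norm_lim_le[OF p fm]) (rule B)
qed

text \<open>The bridge between functions and polynomials: a norm is known through its upper bounds,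
  and these are conditions on Fourier coefficients alone, valid also when the norm is
  infinite.\<close>

lemma torus_L1_Lp_norm_le_iff:
  assumes p: "1 \<le> p" and f: "torus_L1 f"
  shows "Lp_norm p f \<le> B \<longleftrightarrow> (\<forall>N. Lp_norm p (fejer_mean N (fourier_coeff f)) \<le> B)"
proof -
  obtain g where g: "g \<in> borel_measurable borel" "periodic2 g" "AE z in lborel. f z = g z"
    "set_integrable lborel square2pi g" "\<And>j k. fourier_coeff g j k = fourier_coeff f j k"
    using torus_L1_borel_version[OF f] by blast
  have "fourier_coeff g = fourier_coeff f" by (intro ext g(5))
  moreover have "Lp_norm p f = Lp_norm p g" by (rule Lp_norm_cong_AE) (use g(3) in eventually_elim, simp)
  ultimately show ?thesis
    using Lp_norm_fejer_mean_le_borel[OF p g(1,2,4)] Lp_norm_le_of_fejer_mean_borel[OF _ g(1,2,4), of p B] p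
    by (auto intro: order_trans)
qed

section \<open>Partial sums, differences and Weyl derivatives\<close>

lemma integral_lebesgue_cong_AE_borel:
  fixes g g0 :: "'a::euclidean_space \<Rightarrow> complex"
  assumes g0: "g0 \<in> borel_measurable borel" and ae: "AE t in lborel. g t = g0 t"
  shows "integral\<^sup>L lebesgue g = integral\<^sup>L lborel g0"
proof -
  have g0': "g0 \<in> borel_measurable lborel" using g0 by simp
  then have m0: "g0 \<in> borel_measurable lebesgue" by (rule measurable_completion)
  have "g \<in> borel_measurable lebesgue" by (rule borel_measurable_completion_cong_AE[OF m0 ae])
  then have "integral\<^sup>L lebesgue g = integral\<^sup>L lebesgue g0"
    by (rule integral_cong_AE[OF _ m0]) (use ae in \<open>simp add: AE_completion_iff\<close>)
  also have "\<dots> = integral\<^sup>L lborel g0" by (rule integral_completion[OF g0'])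
  finally show ?thesis .
qed

text \<open>After multiplication by sin(t/2) the sum telescopes. The endpoints are excluded because
  there the quotient is a division by zero.\<close>

lemma dirichlet_kernel_eq_sum:
  assumes "0 < t" "t < 2 * pi"
  shows "complex_of_real (dirichlet_kernel m t) = (\<Sum>l\<in>{-int m..int m}. 1 / 2 * cis (of_int l * t))"
proof -
  have s: "of_real (sin (t / 2)) * (\<Sum>l\<in>{-int m..int m}. cis (of_int l * t)) = complex_of_real (sin ((real m + 1 / 2) * t))" for m
  proof (induction m)
    case (Suc m)
    have set_eq: "{-int (Suc m)..int (Suc m)} = insert (- int (Suc m)) (insert (int (Suc m)) {-int m..int m})" by auto
    have "(\<Sum>l\<in>{-int (Suc m)..int (Suc m)}. cis (of_int l * t)) = cis (of_int (- int (Suc m)) * t) + (cis (of_int (int (Suc m)) * t) + (\<Sum>l\<in>{-int m..int m}. cis (of_int l * t)))"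
      unfolding set_eq by (subst sum.insert; simp)+
    also have "cis (of_int (- int (Suc m)) * t) + (cis (of_int (int (Suc m)) * t) + (\<Sum>l\<in>{-int m..int m}. cis (of_int l * t)))
      = of_real (2 * cos (real (Suc m) * t)) + (\<Sum>l\<in>{-int m..int m}. cis (of_int l * t))"
    proof -
      have "cis (- u) + (cis u + X) = of_real (2 * cos u) + X" for u X by (simp add: complex_eq_iff)
      moreover have "of_int (- int (Suc m)) * t = - (real (Suc m) * t)" "of_int (int (Suc m)) * t = real (Suc m) * t" by (simp_all add: algebra_simps)
      ultimately show ?thesis by (simp only:)
    qed
    finally have "of_real (sin (t / 2)) * (\<Sum>l\<in>{-int (Suc m)..int (Suc m)}. cis (of_int l * t)) =
      of_real (2 * (sin (t / 2) * cos (real (Suc m) * t))) + of_real (sin ((real m + 1 / 2) * t))"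
      by (simp only: distrib_left Suc) (simp add: mult_ac)
    also have "2 * (sin (t / 2) * cos (real (Suc m) * t)) = sin ((real (Suc m) + 1 / 2) * t) - sin ((real m + 1 / 2) * t)"
    proof -
      have "sin ((real (Suc m) + 1 / 2) * t) = sin (real (Suc m) * t + t / 2)" "sin ((real m + 1 / 2) * t) = sin (real (Suc m) * t - t / 2)"
        by (simp_all add: algebra_simps)
      then show ?thesis by (simp only: sin_add sin_diff) simp
    qed
    finally show ?case by simp
  qed simp
  have "sin (t / 2) \<noteq> 0" using sin_gt_zero[of "t / 2"] assms by simp
  moreover have "complex_of_real (dirichlet_kernel m t) = of_real (sin ((real m + 1 / 2) * t)) / (2 * of_real (sin (t / 2)))"
    by (simp add: dirichlet_kernel_def)
  ultimately show ?thesis unfolding s[symmetric] by (simp add: sum_distrib_left[symmetric] sum_divide_distrib[symmetric])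
qed

section \<open>Weights with prescribed symbols\<close>

lemma borel_measurable_dirichlet_kernel [measurable]: "dirichlet_kernel m \<in> borel_measurable borel"
  unfolding dirichlet_kernel_def[abs_def] by measurable

text \<open>An integrable weight on the line that realises any finitely supported symbol. The index
  appears reflected in \<open>trig_window_character\<close> because the averages translate by
  +t.\<close>

definition trig_window :: "nat \<Rightarrow> (int \<Rightarrow> complex) \<Rightarrow> real \<Rightarrow> complex" where
  "trig_window n c t = indicator {0..2*pi} t *\<^sub>R (\<Sum>l\<in>{-int n..int n}. c l * cis (of_int l * t))"

lemma trig_window_integrable: "integrable lborel (trig_window n c)"
  and trig_window_character: "integrable lborel (\<lambda>t. trig_window n c t * cis (of_int j * t))"
    "(LINT t|lborel. trig_window n c t * cis (of_int j * t)) = (if \<bar>j\<bar> \<le> int n then 2 * of_real pi * c (- j) else 0)"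
proof -
  have int: "integrable lborel (\<lambda>t. indicator {0..2*pi} t *\<^sub>R g t)" if "continuous_on UNIV g" for g :: "real \<Rightarrow> complex"
    by (rule borel_integrable_compact) (auto intro: continuous_on_subset[OF that])
  show "integrable lborel (trig_window n c)"
    unfolding trig_window_def[abs_def] by (intro int continuous_intros)
  define g where "g t = (\<Sum>l\<in>{-int n..int n}. c l * cis (of_int (l + j) * t))" for t
  have eq: "trig_window n c t * cis (of_int j * t) = indicator {0..2*pi} t *\<^sub>R g t" for t
    by (simp add: trig_window_def g_def sum_distrib_right mult.assoc cis_mult distrib_right)
  have cg: "continuous_on UNIV g" unfolding g_def by (intro continuous_intros)
  show "integrable lborel (\<lambda>t. trig_window n c t * cis (of_int j * t))" unfolding eq by (rule int[OF cg])
  have "(g has_integral (\<Sum>l\<in>{-int n..int n}. c l * (if l + j = 0 then 2 * of_real pi else 0))) {0..2*pi}"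
    unfolding g_def by (intro has_integral_sum has_integral_mult_right cis_has_integral_period) simp
  then have "integral {0..2*pi} g = (\<Sum>l\<in>{-int n..int n}. c l * (if l + j = 0 then 2 * of_real pi else 0))"
    by (rule integral_unique)
  also have "\<dots> = (\<Sum>l\<in>{-int n..int n}. if l = - j then c l * (2 * of_real pi) else 0)"
    by (intro sum.cong refl) auto
  also have "\<dots> = (if \<bar>j\<bar> \<le> int n then 2 * of_real pi * c (- j) else 0)"
    by (simp only: sum.delta finite_atLeastAtMost_int atLeastAtMost_iff) auto
  finally have "integral {0..2*pi} g = (if \<bar>j\<bar> \<le> int n then 2 * of_real pi * c (- j) else 0)" .
  moreover have "(LINT t:{0..2*pi}|lborel. g t) = integral {0..2*pi} g"
    by (rule set_borel_integral_eq_integral(2)) (use int[OF cg] in \<open>simp add: set_integrable_def\<close>)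
  ultimately show "(LINT t|lborel. trig_window n c t * cis (of_int j * t)) = (if \<bar>j\<bar> \<le> int n then 2 * of_real pi * c (- j) else 0)"
    unfolding eq by (simp add: set_lebesgue_integral_def)
qed

definition dirichlet_weight :: "nat \<Rightarrow> real \<Rightarrow> complex" where
  "dirichlet_weight m t = indicator {0..2*pi} t *\<^sub>R of_real (1 / pi * dirichlet_kernel m t)"

text \<open>The two sides can differ only at 0 and 2 pi, where the kernel has the default value of a
  division by zero.\<close>

lemma dirichlet_weight_AE: "AE t in lborel. dirichlet_weight m t = trig_window m (\<lambda>l. of_real (1 / (2 * pi))) t"
proof -
  have "AE t in lborel. t \<noteq> 0 \<and> t \<noteq> 2 * pi"
    using AE_lborel_singleton[of "0::real"] AE_lborel_singleton[of "2 * pi"] by eventually_elim auto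
  then show ?thesis
  proof eventually_elim
    case (elim t)
    show ?case
    proof (cases "t \<in> {0..2*pi}")
      case True
      then have "0 < t" "t < 2 * pi" using elim by auto
      then have "of_real (1 / pi) * complex_of_real (dirichlet_kernel m t) = (\<Sum>l\<in>{-int m..int m}. of_real (1 / (2 * pi)) * cis (of_int l * t))"
        by (simp add: dirichlet_kernel_eq_sum sum_distrib_left) (simp add: mult.commute)
      then show ?thesis using True by (simp add: dirichlet_weight_def trig_window_def)
    qed (simp add: dirichlet_weight_def trig_window_def)
  qed
qed

lemma borel_measurable_dirichlet_weight [measurable]: "dirichlet_weight m \<in> borel_measurable borel"
  unfolding dirichlet_weight_def[abs_def] by measurable

lemma dirichlet_weight_integrable: "integrable lborel (dirichlet_weight m)"
  and dirichlet_weight_character: "integrable lborel (\<lambda>t. dirichlet_weight m t * cis (of_int j * t))"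
    "(LINT t|lborel. dirichlet_weight m t * cis (of_int j * t)) = (if \<bar>j\<bar> \<le> int m then 1 else 0)"
proof -
  let ?c = "\<lambda>l::int. complex_of_real (1 / (2 * pi))"
  have m: "trig_window m ?c \<in> borel_measurable lborel" using trig_window_integrable by (rule borel_measurable_integrable)
  have m2: "dirichlet_weight m \<in> borel_measurable lborel" by simp
  have c: "(\<lambda>t. cis (of_int j * t)) \<in> borel_measurable (lborel :: real measure)" by measurable
  have ae: "AE t in lborel. dirichlet_weight m t * cis (of_int j * t) = trig_window m ?c t * cis (of_int j * t)"
    using dirichlet_weight_AE[of m] by eventually_elim simp
  show "integrable lborel (dirichlet_weight m)"
    using integrable_cong_AE[OF m2 m dirichlet_weight_AE] trig_window_integrable by blast
  show "integrable lborel (\<lambda>t. dirichlet_weight m t * cis (of_int j * t))"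
    using integrable_cong_AE[OF borel_measurable_times[OF m2 c] borel_measurable_times[OF m c] ae] trig_window_character(1) by blast
  show "(LINT t|lborel. dirichlet_weight m t * cis (of_int j * t)) = (if \<bar>j\<bar> \<le> int m then 1 else 0)"
    using integral_cong_AE[OF borel_measurable_times[OF m2 c] borel_measurable_times[OF m c] ae] trig_window_character(2)[of m ?c j] by simp
qed

section \<open>Fourier coefficients of partial sums and differences\<close>

lemma measurable_axis [measurable]:
  "(\<lambda>t. (t, 0 :: real)) \<in> borel_measurable (lborel :: real measure)" "(\<lambda>t. (0 :: real, t)) \<in> borel_measurable (lborel :: real measure)"
proof -
  have "continuous_on UNIV (\<lambda>t :: real. (t, 0 :: real))" "continuous_on UNIV (\<lambda>t :: real. (0 :: real, t))"
    by (intro continuous_intros)+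
  then show "(\<lambda>t. (t, 0 :: real)) \<in> borel_measurable (lborel :: real measure)" "(\<lambda>t. (0 :: real, t)) \<in> borel_measurable (lborel :: real measure)"
    by (simp_all add: borel_measurable_continuous_onI)
qed

lemma lborel_sigma_finite: "sigma_finite_measure (lborel :: 'a::euclidean_space measure)"
  by (rule lborel.sigma_finite_measure_axioms)

lemma periodic2_add:
  assumes "periodic2 f" shows "f (x + 2 * pi + s, y) = f (x + s, y)" "f (x, y + 2 * pi + s) = f (x, y + s)"
proof -
  have "x + 2 * pi + s = x + s + 2 * pi" "y + 2 * pi + s = y + s + 2 * pi" by simp_all
  then show "f (x + 2 * pi + s, y) = f (x + s, y)" "f (x, y + 2 * pi + s) = f (x, y + s)"
    using assms by (simp_all only: periodic2_def)
qed

lemma torus_L1_psum1: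
  assumes f: "torus_L1 f"
  shows "torus_L1 (psum1 m f)" "fourier_coeff (psum1 m f) j k = (if \<bar>j\<bar> \<le> int m then fourier_coeff f j k else 0)"
proof -
  have per: "periodic2 f" using f by (simp add: torus_L1_def)
  have p: "periodic2 (psum1 m f)"
    using per by (simp add: periodic2_def psum1_def periodic2_add[OF per])
  \<comment> \<open>Agreement of f and f0 at almost every point of the line through z suffices,
    since the completed measure ignores the exceptional points.\<close>
  have eq: "psum1 m f z = (LINT t|lborel. dirichlet_weight m t * f0 (z + (t, 0)))"
    if [measurable]: "f0 \<in> borel_measurable borel" and ae: "AE t in lborel. f (z + (t, 0)) = f0 (z + (t, 0))" for f0 z
  proof -
    obtain x y where z: "z = (x, y)" by (cases z)
    have "(LINT t|lebesgue. indicator {0..2*pi} t *\<^sub>R (f (x + t, y) * of_real (dirichlet_kernel m t)))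
       = (LINT t|lborel. indicator {0..2*pi} t *\<^sub>R (f0 (x + t, y) * of_real (dirichlet_kernel m t)))"
    proof (rule integral_lebesgue_cong_AE_borel)
      show "AE t in lborel. indicator {0..2*pi} t *\<^sub>R (f (x + t, y) * of_real (dirichlet_kernel m t)) = indicator {0..2*pi} t *\<^sub>R (f0 (x + t, y) * of_real (dirichlet_kernel m t))"
        using ae by eventually_elim (simp add: z)
    qed measurable
    then have "psum1 m f z = of_real (1 / pi) * (LINT t|lborel. indicator {0..2*pi} t *\<^sub>R (f0 (x + t, y) * of_real (dirichlet_kernel m t)))"
      by (simp add: psum1_def z set_lebesgue_integral_def)
    also have "\<dots> = (LINT t|lborel. of_real (1 / pi) * (indicator {0..2*pi} t *\<^sub>R (f0 (x + t, y) * of_real (dirichlet_kernel m t))))"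
      by (rule integral_mult_right_zero[symmetric])
    also have "\<dots> = (LINT t|lborel. dirichlet_weight m t * f0 (z + (t, 0)))"
      by (intro Bochner_Integration.integral_cong refl) (simp add: dirichlet_weight_def z scaleR_conv_of_real mult_ac)
    finally show ?thesis .
  qed
  note av = torus_L1_average[OF f lborel_sigma_finite dirichlet_weight_integrable measurable_axis(1) p eq]
  show "torus_L1 (psum1 m f)" by (rule av(1))
  show "fourier_coeff (psum1 m f) j k = (if \<bar>j\<bar> \<le> int m then fourier_coeff f j k else 0)"
    using av(2)[of j k] dirichlet_weight_character(2)[of m j] by simp
qed

lemma torus_L1_psum2:
  assumes f: "torus_L1 f"
  shows "torus_L1 (psum2 m f)" "fourier_coeff (psum2 m f) j k = (if \<bar>k\<bar> \<le> int m then fourier_coeff f j k else 0)"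
proof -
  have per: "periodic2 f" using f by (simp add: torus_L1_def)
  have p: "periodic2 (psum2 m f)"
    using per by (simp add: periodic2_def psum2_def periodic2_add[OF per])
  have eq: "psum2 m f z = (LINT t|lborel. dirichlet_weight m t * f0 (z + (0, t)))"
    if [measurable]: "f0 \<in> borel_measurable borel" and ae: "AE t in lborel. f (z + (0, t)) = f0 (z + (0, t))" for f0 z
  proof -
    obtain x y where z: "z = (x, y)" by (cases z)
    have "(LINT t|lebesgue. indicator {0..2*pi} t *\<^sub>R (f (x, y + t) * of_real (dirichlet_kernel m t)))
       = (LINT t|lborel. indicator {0..2*pi} t *\<^sub>R (f0 (x, y + t) * of_real (dirichlet_kernel m t)))"
    proof (rule integral_lebesgue_cong_AE_borel)
      show "AE t in lborel. indicator {0..2*pi} t *\<^sub>R (f (x, y + t) * of_real (dirichlet_kernel m t)) = indicator {0..2*pi} t *\<^sub>R (f0 (x, y + t) * of_real (dirichlet_kernel m t))"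
        using ae by eventually_elim (simp add: z)
    qed measurable
    then have "psum2 m f z = of_real (1 / pi) * (LINT t|lborel. indicator {0..2*pi} t *\<^sub>R (f0 (x, y + t) * of_real (dirichlet_kernel m t)))"
      by (simp add: psum2_def z set_lebesgue_integral_def)
    also have "\<dots> = (LINT t|lborel. of_real (1 / pi) * (indicator {0..2*pi} t *\<^sub>R (f0 (x, y + t) * of_real (dirichlet_kernel m t))))"
      by (rule integral_mult_right_zero[symmetric])
    also have "\<dots> = (LINT t|lborel. dirichlet_weight m t * f0 (z + (0, t)))"
      by (intro Bochner_Integration.integral_cong refl) (simp add: dirichlet_weight_def z scaleR_conv_of_real mult_ac)
    finally show ?thesis .
  qed
  note av = torus_L1_average[OF f lborel_sigma_finite dirichlet_weight_integrable measurable_axis(2) p eq]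
  show "torus_L1 (psum2 m f)" by (rule av(1))
  show "fourier_coeff (psum2 m f) j k = (if \<bar>k\<bar> \<le> int m then fourier_coeff f j k else 0)"
    using av(2)[of j k] dirichlet_weight_character(2)[of m k] by simp
qed

lemma integral_tensor:
  fixes u v :: "real \<Rightarrow> complex"
  assumes u: "integrable lborel u" and v: "integrable lborel v"
  shows "integrable lborel (\<lambda>z. u (fst z) * v (snd z))"
    "(LINT z|lborel. u (fst z) * v (snd z)) = (LINT x|lborel. u x) * (LINT y|lborel. v y)"
proof -
  have [measurable]: "u \<in> borel_measurable borel" "v \<in> borel_measurable borel"
    using borel_measurable_integrable[OF u] borel_measurable_integrable[OF v] by simp_all
  have i: "integrable (lborel \<Otimes>\<^sub>M lborel) (\<lambda>z. u (fst z) * v (snd z))"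
  proof (rule lborel_pair.Fubini_integrable)
    show "integrable lborel (\<lambda>x. LINT y|lborel. norm (u (fst (x, y)) * v (snd (x, y))))"
      using u by (simp add: norm_mult)
    show "AE x in lborel. integrable lborel (\<lambda>y. u (fst (x, y)) * v (snd (x, y)))"
      using v by simp
  qed measurable
  then show "integrable lborel (\<lambda>z. u (fst z) * v (snd z))" by (simp add: lborel_prod)
  show "(LINT z|lborel. u (fst z) * v (snd z)) = (LINT x|lborel. u x) * (LINT y|lborel. v y)"
    using lborel_pair.integral_fst'[OF i] by (simp add: lborel_prod)
qed

lemma torus_L1_psum12:
  assumes f: "torus_L1 f"
  shows "torus_L1 (psum12 m n f)"
    "fourier_coeff (psum12 m n f) j k = (if \<bar>j\<bar> \<le> int m \<and> \<bar>k\<bar> \<le> int n then fourier_coeff f j k else 0)"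
proof -
  have per: "periodic2 f" using f by (simp add: torus_L1_def)
  have p: "periodic2 (psum12 m n f)"
    using per by (simp add: periodic2_def psum12_def periodic2_add[OF per])
  let ?w = "\<lambda>t. dirichlet_weight m (fst t) * dirichlet_weight n (snd t)"
  have eq: "psum12 m n f z = (LINT t|lborel. ?w t * f0 (z + t))"
    if [measurable]: "f0 \<in> borel_measurable borel" and ae: "AE t in lborel. f (z + t) = f0 (z + t)" for f0 z
  proof -
    obtain x y where z: "z = (x, y)" by (cases z)
    have zt: "(x + fst t, y + snd t) = z + t" for t by (simp add: z prod_eq_iff)
    let ?D = "\<lambda>t. complex_of_real (dirichlet_kernel m (fst t) * dirichlet_kernel n (snd t))"
    have "(LINT t|lebesgue. indicator square2pi t *\<^sub>R (f (z + t) * ?D t))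
       = (LINT t|lborel. indicator square2pi t *\<^sub>R (f0 (z + t) * ?D t))"
    proof (rule integral_lebesgue_cong_AE_borel)
      show "AE t in lborel. indicator square2pi t *\<^sub>R (f (z + t) * ?D t) = indicator square2pi t *\<^sub>R (f0 (z + t) * ?D t)"
        using ae by eventually_elim simp
    qed measurable
    then have "psum12 m n f z = of_real (1 / pi\<^sup>2) * (LINT t|lborel. indicator square2pi t *\<^sub>R (f0 (z + t) * ?D t))"
      by (simp add: psum12_def z set_lebesgue_integral_def zt[unfolded z])
    also have "\<dots> = (LINT t|lborel. of_real (1 / pi\<^sup>2) * (indicator square2pi t *\<^sub>R (f0 (z + t) * ?D t)))"
      by (rule integral_mult_right_zero[symmetric])
    also have "\<dots> = (LINT t|lborel. ?w t * f0 (z + t))"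
    proof (intro Bochner_Integration.integral_cong refl)
      fix t :: "real \<times> real"
      have "indicator square2pi t = (indicator {0..2*pi} (fst t) * indicator {0..2*pi} (snd t) :: real)"
        by (cases t) (auto simp: square2pi_def indicator_def)
      then show "of_real (1 / pi\<^sup>2) * (indicator square2pi t *\<^sub>R (f0 (z + t) * ?D t)) = ?w t * f0 (z + t)"
        by (simp add: dirichlet_weight_def scaleR_conv_of_real power2_eq_square mult_ac)
    qed
    finally show ?thesis .
  qed
  note wi = integral_tensor(1)[OF dirichlet_weight_integrable dirichlet_weight_integrable]
  have am: "(\<lambda>t. t) \<in> borel_measurable (lborel :: (real \<times> real) measure)" by simp
  note av = torus_L1_average[OF f lborel_sigma_finite wi am p eq]
  show "torus_L1 (psum12 m n f)" by (rule av(1))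
  have "(LINT t|lborel. ?w t * cis (of_int j * fst t + of_int k * snd t)) =
    (LINT t|lborel. (dirichlet_weight m (fst t) * cis (of_int j * fst t)) * (dirichlet_weight n (snd t) * cis (of_int k * snd t)))"
    by (intro Bochner_Integration.integral_cong refl) (simp add: cis_mult[symmetric] mult_ac)
  also have "\<dots> = (if \<bar>j\<bar> \<le> int m then 1 else 0) * (if \<bar>k\<bar> \<le> int n then 1 else 0)"
    unfolding dirichlet_weight_character(2)[symmetric]
    by (rule integral_tensor(2)[where u = "\<lambda>t. dirichlet_weight m t * cis (of_int j * t)" and v = "\<lambda>t. dirichlet_weight n t * cis (of_int k * t)"])
      (rule dirichlet_weight_character(1))+
  finally have W: "(LINT t|lborel. ?w t * cis (of_int j * fst t + of_int k * snd t)) = (if \<bar>j\<bar> \<le> int m then 1 else 0) * (if \<bar>k\<bar> \<le> int n then 1 else 0)" .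
  show "fourier_coeff (psum12 m n f) j k = (if \<bar>j\<bar> \<le> int m \<and> \<bar>k\<bar> \<le> int n then fourier_coeff f j k else 0)"
    using av(2)[of j k] unfolding W by simp
qed

text \<open>The series is read as an integral over counting measure, which makes a fractional
  difference an average of translates.\<close>

lemma frac_coeff_weights:
  assumes a: "\<alpha> > 0"
  shows "integrable (count_space UNIV) (\<lambda>\<nu>. complex_of_real (frac_coeff \<alpha> \<nu>))"
    "(LINT \<nu>|count_space UNIV. of_real (frac_coeff \<alpha> \<nu>) * cis (of_int j * ((\<alpha> - real \<nu>) * h))) = frac_symbol \<alpha> h j"
proof -
  show "integrable (count_space UNIV) (\<lambda>\<nu>. complex_of_real (frac_coeff \<alpha> \<nu>))"
    using summable_frac_coeff[OF a] by (simp add: integrable_count_space_nat_iff)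
  have i: "integrable (count_space UNIV) (\<lambda>\<nu>. of_real (frac_coeff \<alpha> \<nu>) * cis (of_int j * ((\<alpha> - real \<nu>) * h)))"
    using summable_frac_coeff[OF a] by (simp add: integrable_count_space_nat_iff norm_mult)
  have "cis (of_int j * ((\<alpha> - real \<nu>) * h)) = cis (\<alpha> * (h * of_int j)) * cis (- (real \<nu> * (h * of_int j)))" for \<nu>
    by (simp add: cis_mult algebra_simps)
  then have "(LINT \<nu>|count_space UNIV. of_real (frac_coeff \<alpha> \<nu>) * cis (of_int j * ((\<alpha> - real \<nu>) * h)))
    = (\<Sum>\<nu>. cis (\<alpha> * (h * of_int j)) * (of_real (frac_coeff \<alpha> \<nu>) * cis (- (real \<nu> * (h * of_int j)))))"
    unfolding integral_count_space_nat[OF i] by (simp only: mult_ac)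
  also have "\<dots> = frac_symbol \<alpha> h j"
    unfolding frac_symbol_def diff_symbol_def
    by (rule suminf_mult) (rule sums_summable[OF diff_symbol_sums[OF a]])
  finally show "(LINT \<nu>|count_space UNIV. of_real (frac_coeff \<alpha> \<nu>) * cis (of_int j * ((\<alpha> - real \<nu>) * h))) = frac_symbol \<alpha> h j" .
qed

lemma torus_L1_diff1:
  assumes f: "torus_L1 f" and a: "\<alpha> > 0"
  shows "torus_L1 (diff1 \<alpha> h f)" "fourier_coeff (diff1 \<alpha> h f) j k = frac_symbol \<alpha> h j * fourier_coeff f j k"
proof -
  have per: "periodic2 f" using f by (simp add: torus_L1_def)
  have p: "periodic2 (diff1 \<alpha> h f)"
    using per by (simp add: periodic2_def diff1_def periodic2_add[OF per])
  let ?a = "\<lambda>\<nu>. ((\<alpha> - real \<nu>) * h, 0 :: real)"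
  have eq: "diff1 \<alpha> h f z = (LINT \<nu>|count_space UNIV. of_real (frac_coeff \<alpha> \<nu>) * f0 (z + ?a \<nu>))"
    if ae: "AE \<nu> in count_space UNIV. f (z + ?a \<nu>) = f0 (z + ?a \<nu>)"
      and i: "integrable (count_space UNIV) (\<lambda>\<nu>. of_real (frac_coeff \<alpha> \<nu>) * f0 (z + ?a \<nu>))" for f0 z
  proof -
    \<comment> \<open>Counting measure has no nonempty null sets, so the agreement holds at every
      term of the series.\<close>
    have "f (z + ?a \<nu>) = f0 (z + ?a \<nu>)" for \<nu> using ae by (simp add: AE_count_space)
    then show ?thesis unfolding integral_count_space_nat[OF i]
      by (cases z) (simp add: diff1_def frac_coeff_def)
  qed
  have M: "sigma_finite_measure (count_space (UNIV :: nat set))" by (rule sigma_finite_measure_count_space)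
  have am: "?a \<in> borel_measurable (count_space UNIV)" by simp
  note av = torus_L1_average[OF f M frac_coeff_weights(1)[OF a] am p eq]
  show "torus_L1 (diff1 \<alpha> h f)" by (rule av(1))
  show "fourier_coeff (diff1 \<alpha> h f) j k = frac_symbol \<alpha> h j * fourier_coeff f j k"
    using av(2)[of j k] frac_coeff_weights(2)[OF a, of j h] by simp
qed

lemma torus_L1_diff2:
  assumes f: "torus_L1 f" and a: "\<alpha> > 0"
  shows "torus_L1 (diff2 \<alpha> h f)" "fourier_coeff (diff2 \<alpha> h f) j k = frac_symbol \<alpha> h k * fourier_coeff f j k"
proof -
  have per: "periodic2 f" using f by (simp add: torus_L1_def)
  have p: "periodic2 (diff2 \<alpha> h f)"
    using per by (simp add: periodic2_def diff2_def periodic2_add[OF per])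
  let ?a = "\<lambda>\<nu>. (0 :: real, (\<alpha> - real \<nu>) * h)"
  have eq: "diff2 \<alpha> h f z = (LINT \<nu>|count_space UNIV. of_real (frac_coeff \<alpha> \<nu>) * f0 (z + ?a \<nu>))"
    if ae: "AE \<nu> in count_space UNIV. f (z + ?a \<nu>) = f0 (z + ?a \<nu>)"
      and i: "integrable (count_space UNIV) (\<lambda>\<nu>. of_real (frac_coeff \<alpha> \<nu>) * f0 (z + ?a \<nu>))" for f0 z
  proof -
    have "f (z + ?a \<nu>) = f0 (z + ?a \<nu>)" for \<nu> using ae by (simp add: AE_count_space)
    then show ?thesis unfolding integral_count_space_nat[OF i]
      by (cases z) (simp add: diff2_def frac_coeff_def)
  qed
  have M: "sigma_finite_measure (count_space (UNIV :: nat set))" by (rule sigma_finite_measure_count_space)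
  have am: "?a \<in> borel_measurable (count_space UNIV)" by simp
  note av = torus_L1_average[OF f M frac_coeff_weights(1)[OF a] am p eq]
  show "torus_L1 (diff2 \<alpha> h f)" by (rule av(1))
  show "fourier_coeff (diff2 \<alpha> h f) j k = frac_symbol \<alpha> h k * fourier_coeff f j k"
    using av(2)[of j k] frac_coeff_weights(2)[OF a, of k h] by simp
qed

text \<open>Supplies the witnesses that \<open>weyl_deriv\<close> chooses among. A partial sum in
  one variable is in general not a polynomial in both, so its derivative is obtained by convolution
  with a \<open>trig_window\<close> in that variable.\<close>

lemma ex_torus_L1_multiplier:
  assumes f: "torus_L1 f"
  shows "\<exists>g. torus_L1 g \<and> (\<forall>j k. fourier_coeff g j k = (if \<bar>j\<bar> \<le> int n then c j else 0) * fourier_coeff f j k)"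
    and "\<exists>g. torus_L1 g \<and> (\<forall>j k. fourier_coeff g j k = (if \<bar>k\<bar> \<le> int n then c k else 0) * fourier_coeff f j k)"
proof -
  obtain f0 where f0: "f0 \<in> borel_measurable borel" "periodic2 f0" "AE z in lborel. f z = f0 z"
    "set_integrable lborel square2pi f0" "\<And>j k. fourier_coeff f0 j k = fourier_coeff f j k"
    using torus_L1_borel_version[OF f] by blast
  let ?w = "trig_window n (\<lambda>l. c (- l) / of_real (2 * pi))"
  have L1: "torus_L1 g" if "g \<in> borel_measurable borel" "periodic2 g" "set_integrable lborel square2pi g" for g
    using that set_lebesgue_integral_lebesgue_eq_lborel(2) by (auto simp: torus_L1_def intro: borel_imp_lebesgue_measurable)
  note av1 = average_of_translates[OF lborel_sigma_finite trig_window_integrable[of n "\<lambda>l. c (- l) / of_real (2 * pi)"] measurable_axis(1) f0(1,2,4)]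
  note av2 = average_of_translates[OF lborel_sigma_finite trig_window_integrable[of n "\<lambda>l. c (- l) / of_real (2 * pi)"] measurable_axis(2) f0(1,2,4)]
  show "\<exists>g. torus_L1 g \<and> (\<forall>j k. fourier_coeff g j k = (if \<bar>j\<bar> \<le> int n then c j else 0) * fourier_coeff f j k)"
  proof (intro exI conjI allI)
    show "torus_L1 (\<lambda>z. LINT t|lborel. ?w t * f0 (z + (t, 0)))" by (rule L1[OF av1(1-3)])
    show "fourier_coeff (\<lambda>z. LINT t|lborel. ?w t * f0 (z + (t, 0))) j k = (if \<bar>j\<bar> \<le> int n then c j else 0) * fourier_coeff f j k" for j k
      using av1(5)[of j k] trig_window_character(2)[of n "\<lambda>l. c (- l) / of_real (2 * pi)" j] f0(5) by simp
  qed
  show "\<exists>g. torus_L1 g \<and> (\<forall>j k. fourier_coeff g j k = (if \<bar>k\<bar> \<le> int n then c k else 0) * fourier_coeff f j k)"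
  proof (intro exI conjI allI)
    show "torus_L1 (\<lambda>z. LINT t|lborel. ?w t * f0 (z + (0, t)))" by (rule L1[OF av2(1-3)])
    show "fourier_coeff (\<lambda>z. LINT t|lborel. ?w t * f0 (z + (0, t))) j k = (if \<bar>k\<bar> \<le> int n then c k else 0) * fourier_coeff f j k" for j k
      using av2(5)[of j k] trig_window_character(2)[of n "\<lambda>l. c (- l) / of_real (2 * pi)" k] f0(5) by simp
  qed
qed

lemma torus_L1_diff_add:
  assumes f: "torus_L1 f" and g: "torus_L1 g"
  shows "torus_L1 (\<lambda>z. f z - g z)" "fourier_coeff (\<lambda>z. f z - g z) j k = fourier_coeff f j k - fourier_coeff g j k"
    "torus_L1 (\<lambda>z. f z + g z)" "fourier_coeff (\<lambda>z. f z + g z) j k = fourier_coeff f j k + fourier_coeff g j k"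
proof -
  have diff: "torus_L1 (\<lambda>z. f z - g z) \<and> fourier_coeff (\<lambda>z. f z - g z) j k = fourier_coeff f j k - fourier_coeff g j k"
    if f: "torus_L1 f" and g: "torus_L1 g" for f g
  proof -
    obtain f0 where f0: "f0 \<in> borel_measurable borel" "periodic2 f0" "AE z in lborel. f z = f0 z"
      "set_integrable lborel square2pi f0" "\<And>j k. fourier_coeff f0 j k = fourier_coeff f j k"
      using torus_L1_borel_version[OF f] by blast
    obtain g0 where g0: "g0 \<in> borel_measurable borel" "periodic2 g0" "AE z in lborel. g z = g0 z"
      "set_integrable lborel square2pi g0" "\<And>j k. fourier_coeff g0 j k = fourier_coeff g j k"
      using torus_L1_borel_version[OF g] by blast
    have m: "(\<lambda>z. f0 z - g0 z) \<in> borel_measurable borel" using f0(1) g0(1) by simp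
    have fg: "(\<lambda>z. f z - g z) \<in> borel_measurable lebesgue" using f g by (auto simp: torus_L1_def)
    have ae: "AE z in lborel. f z - g z = f0 z - g0 z" using f0(3) g0(3) by eventually_elim simp
    have i: "integrable square_measure f0" "integrable square_measure g0"
      using integral_square_measure(2) f0(1,4) g0(1,4) by auto
    have "set_integrable lborel square2pi (\<lambda>z. f0 z - g0 z)"
      using integral_square_measure(2)[OF m] i by simp
    then have "torus_L1 (\<lambda>z. f z - g z)"
      using set_integrable_square2pi_cong_AE[OF fg m ae] fg f g by (simp add: torus_L1_def periodic2_def)
    moreover have "fourier_coeff (\<lambda>z. f z - g z) j k = fourier_coeff f j k - fourier_coeff g j k"
      unfolding fourier_coeff_cong_AE[OF fg m ae] fourier_coeff_diff[OF f0(1) i(1) g0(1) i(2)] f0(5) g0(5) ..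
    ultimately show ?thesis ..
  qed
  have zero: "torus_L1 (\<lambda>z. 0)" "fourier_coeff (\<lambda>z. 0) j k = 0"
    by (simp_all add: torus_L1_def periodic2_def set_integrable_def fourier_coeff_def)
  show "torus_L1 (\<lambda>z. f z - g z)" "fourier_coeff (\<lambda>z. f z - g z) j k = fourier_coeff f j k - fourier_coeff g j k"
    using diff[OF f g] by auto
  \<comment> \<open>The sum is f - (0 - g), so that only differences need the passage to Borel
    versions.\<close>
  have "torus_L1 (\<lambda>z. 0 - g z)" "fourier_coeff (\<lambda>z. 0 - g z) j k = - fourier_coeff g j k"
    using diff[OF zero(1) g] zero(2) by auto
  with diff[OF f this(1)] show "torus_L1 (\<lambda>z. f z + g z)" "fourier_coeff (\<lambda>z. f z + g z) j k = fourier_coeff f j k + fourier_coeff g j k"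
    by auto
qed

text \<open>On a set of finite measure, |f| \<le> 1 + |f|^p.\<close>

lemma Lp_space_imp_torus_L1:
  assumes p: "1 < p" and f: "f \<in> Lp_space p"
  shows "torus_L1 f"
proof -
  have fm: "f \<in> borel_measurable lebesgue" "periodic2 f" and fin: "Lp_norm p f < \<infinity>" using f by (auto simp: Lp_space_def)
  have [measurable]: "square2pi \<in> sets lebesgue" by simp
  have [measurable]: "f \<in> borel_measurable lebesgue" by fact
  have I: "(\<integral>\<^sup>+z\<in>square2pi. ennreal (norm (f z) powr p) \<partial>lebesgue) \<noteq> \<infinity>"
    using fin by (auto simp: Lp_norm_def Let_def split: if_splits)
  have "set_integrable lebesgue square2pi f"
    unfolding set_integrable_def
  proof (rule integrableI_bounded)
    have "(\<integral>\<^sup>+z. ennreal (norm (indicator square2pi z *\<^sub>R f z)) \<partial>lebesgue) \<le>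
      (\<integral>\<^sup>+z. indicator square2pi z + ennreal (norm (f z) powr p) * indicator square2pi z \<partial>lebesgue)"
    proof (rule nn_integral_mono)
      fix z
      have "norm (f z) \<le> 1 + norm (f z) powr p"
      proof (cases "norm (f z) \<le> 1")
        case False
        then have "norm (f z) powr 1 \<le> norm (f z) powr p" using p by (intro powr_mono) auto
        then show ?thesis using False by simp
      qed (smt (verit) powr_ge_zero)
      then have "ennreal (norm (f z)) \<le> ennreal (1 + norm (f z) powr p)" by (rule ennreal_leI)
      then show "ennreal (norm (indicator square2pi z *\<^sub>R f z)) \<le> indicator square2pi z + ennreal (norm (f z) powr p) * indicator square2pi z"
        by (cases "z \<in> square2pi") (simp_all add: ennreal_plus)
    qed
    also have "\<dots> = emeasure lebesgue square2pi + (\<integral>\<^sup>+z\<in>square2pi. ennreal (norm (f z) powr p) \<partial>lebesgue)"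
      by (subst nn_integral_add) auto
    also have "\<dots> < \<infinity>"
    proof -
      have "emeasure lebesgue square2pi < \<infinity>"
        using fmeasurableD2[OF lmeasurable_compact, of square2pi] by (simp add: square2pi_def compact_Times less_top)
      then show ?thesis using I by (simp add: less_top)
    qed
    finally show "(\<integral>\<^sup>+z. ennreal (norm (indicator square2pi z *\<^sub>R f z)) \<partial>lebesgue) < \<infinity>" .
  qed measurable
  then show ?thesis using fm by (simp add: torus_L1_def)
qed

text \<open>Once one witness g exists, the chosen function has the same Fourier coefficients; that
  it may differ from g on a null set has no effect on norms.\<close>

lemma torus_L1_weyl_deriv:
  assumes "torus_L1 g" and "\<And>j k. fourier_coeff g j k = (if j \<noteq> 0 \<and> k \<noteq> 0 then weyl_factor \<rho>1 j * weyl_factor \<rho>2 k * fourier_coeff f j k else 0)"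
  shows "torus_L1 (weyl_deriv \<rho>1 \<rho>2 f)" "fourier_coeff (weyl_deriv \<rho>1 \<rho>2 f) j k = fourier_coeff g j k"
proof -
  have "is_weyl_deriv \<rho>1 \<rho>2 f g" using assms by (simp add: is_weyl_deriv_def torus_L1_def)
  then have "is_weyl_deriv \<rho>1 \<rho>2 f (weyl_deriv \<rho>1 \<rho>2 f)" unfolding weyl_deriv_def by (rule someI[where P = "is_weyl_deriv \<rho>1 \<rho>2 f"])
  then show "torus_L1 (weyl_deriv \<rho>1 \<rho>2 f)" "fourier_coeff (weyl_deriv \<rho>1 \<rho>2 f) j k = fourier_coeff g j k"
    using assms(2) by (simp_all add: is_weyl_deriv_def torus_L1_def)
qed

section \<open>Symbols of the four terms\<close>

lemma weyl_factor_0: "\<rho> > 0 \<Longrightarrow> weyl_factor \<rho> 0 = 0"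
  by (simp add: weyl_factor_def)

lemma weyl_factor_order_0: "k \<noteq> 0 \<Longrightarrow> weyl_factor 0 k = 1"
  by (simp add: weyl_factor_def)

text \<open>One inequality suffices: applied with 1 / r to the scaled coefficients it gives the
  reverse one.\<close>

lemma Lp_norm_fejer_mean_scale:
  assumes p: "1 \<le> p" and r: "r > 0"
  shows "Lp_norm p (fejer_mean N (\<lambda>j k. of_real r * c j k)) = ennreal r * Lp_norm p (fejer_mean N c)"
proof -
  have le: "Lp_norm p (fejer_mean N (\<lambda>j k. of_real r * c j k)) \<le> ennreal r * Lp_norm p (fejer_mean N c)" if r: "r > 0" for r c
  proof -
    have "fejer_mean N (\<lambda>j k. of_real r * c j k) = trig_poly N (\<lambda>j k. (of_real r * 1) * (of_real (fejer_coeff N j * fejer_coeff N k) * c j k))"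
      unfolding fejer_mean_def by (rule trig_poly_cong) simp
    then show ?thesis using Lp_multiplierD[OF Lp_multiplier_cmult[OF p Lp_multiplier_one, of "of_real r"]] r by (simp add: fejer_mean_def)
  qed
  have "ennreal r * Lp_norm p (fejer_mean N c) \<le> Lp_norm p (fejer_mean N (\<lambda>j k. of_real r * c j k))"
  proof -
    have "(\<lambda>j k. of_real (1 / r) * (of_real r * c j k)) = c" using r by (simp add: fun_eq_iff)
    then have "Lp_norm p (fejer_mean N c) \<le> ennreal (1 / r) * Lp_norm p (fejer_mean N (\<lambda>j k. of_real r * c j k))"
      using le[of "1 / r" "\<lambda>j k. of_real r * c j k"] r by simp
    then have "ennreal r * Lp_norm p (fejer_mean N c) \<le> ennreal r * (ennreal (1 / r) * Lp_norm p (fejer_mean N (\<lambda>j k. of_real r * c j k)))"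
      by (rule mult_left_mono) simp
    also have "\<dots> = (ennreal r * ennreal (1 / r)) * Lp_norm p (fejer_mean N (\<lambda>j k. of_real r * c j k))" by (simp only: mult.assoc)
    also have "ennreal r * ennreal (1 / r) = 1" using r by (simp add: ennreal_mult[symmetric])
    finally show ?thesis by simp
  qed
  with le[OF r] show ?thesis by (rule antisym)
qed

text \<open>Moves the powers of n1 and n2 from the front of a norm into the coefficients, where they
  become part of \<open>low_symbol\<close>.\<close>

lemma scaled_Lp_norm_le_iff:
  assumes p: "1 \<le> p" and W: "torus_L1 W" and r: "r > 0"
  shows "ennreal r * Lp_norm p W \<le> B \<longleftrightarrow> (\<forall>N. Lp_norm p (fejer_mean N (\<lambda>j k. of_real r * fourier_coeff W j k)) \<le> B)"
proof -
  have one: "ennreal r * ennreal (1 / r) = 1" using r by (simp add: ennreal_mult[symmetric])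
  have cancel: "ennreal (1 / r) * (ennreal r * x) = x" "ennreal r * (ennreal (1 / r) * x) = x" for x
  proof -
    have "ennreal (1 / r) * (ennreal r * x) = (ennreal r * ennreal (1 / r)) * x" by (simp only: mult_ac)
    moreover have "ennreal r * (ennreal (1 / r) * x) = (ennreal r * ennreal (1 / r)) * x" by (simp only: mult_ac)
    ultimately show "ennreal (1 / r) * (ennreal r * x) = x" "ennreal r * (ennreal (1 / r) * x) = x"
      unfolding one by simp_all
  qed
  have move: "ennreal r * x \<le> B \<longleftrightarrow> x \<le> ennreal (1 / r) * B" for x
  proof
    assume "ennreal r * x \<le> B"
    then have "ennreal (1 / r) * (ennreal r * x) \<le> ennreal (1 / r) * B" by (rule mult_left_mono) simp
    then show "x \<le> ennreal (1 / r) * B" unfolding cancel .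
  next
    assume "x \<le> ennreal (1 / r) * B"
    then have "ennreal r * x \<le> ennreal r * (ennreal (1 / r) * B)" by (rule mult_left_mono) simp
    then show "ennreal r * x \<le> B" unfolding cancel .
  qed
  show ?thesis
    unfolding Lp_norm_fejer_mean_scale[OF p r] move by (rule torus_L1_Lp_norm_le_iff[OF p W])
qed

lemma weyl_deriv_psum12:
  assumes f: "torus_L1 f" and a: "\<alpha>1 > 0" "\<alpha>2 > 0"
  shows "torus_L1 (weyl_deriv \<alpha>1 \<alpha>2 (psum12 m n f))"
    "of_real (real m powr (- \<alpha>1) * real n powr (- \<alpha>2)) * fourier_coeff (weyl_deriv \<alpha>1 \<alpha>2 (psum12 m n f)) j k
      = low_symbol \<alpha>1 m j * low_symbol \<alpha>2 n k * fourier_coeff f j k"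
proof -
  obtain g1 where g1: "torus_L1 g1" "\<And>j k. fourier_coeff g1 j k = (if \<bar>j\<bar> \<le> int m then weyl_factor \<alpha>1 j else 0) * fourier_coeff f j k"
    using ex_torus_L1_multiplier(1)[OF f, of m "weyl_factor \<alpha>1"] by blast
  obtain g where g: "torus_L1 g" "\<And>j k. fourier_coeff g j k = (if \<bar>k\<bar> \<le> int n then weyl_factor \<alpha>2 k else 0) * fourier_coeff g1 j k"
    using ex_torus_L1_multiplier(2)[OF g1(1), of n "weyl_factor \<alpha>2"] by blast
  have "fourier_coeff g j k = (if j \<noteq> 0 \<and> k \<noteq> 0 then weyl_factor \<alpha>1 j * weyl_factor \<alpha>2 k * fourier_coeff (psum12 m n f) j k else 0)" for j k
    using a by (simp add: g(2) g1(2) torus_L1_psum12(2)[OF f] weyl_factor_0)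
  note W = torus_L1_weyl_deriv[OF g(1) this]
  show "torus_L1 (weyl_deriv \<alpha>1 \<alpha>2 (psum12 m n f))" by (rule W(1))
  show "of_real (real m powr (- \<alpha>1) * real n powr (- \<alpha>2)) * fourier_coeff (weyl_deriv \<alpha>1 \<alpha>2 (psum12 m n f)) j k
      = low_symbol \<alpha>1 m j * low_symbol \<alpha>2 n k * fourier_coeff f j k"
    by (simp add: W(2) g(2) g1(2) low_symbol_def mult_ac)
qed

text \<open>The restriction to j, k \<noteq> 0 in \<open>is_weyl_deriv\<close> matches the product
  symbol: at k = 0 \<open>high_symbol\<close> vanishes, at j = 0 the power |j|^alpha does, and
  elsewhere the Weyl factor of order 0 in k is 1.\<close>

lemma weyl_deriv_psum1:
  assumes f: "torus_L1 f" and a: "\<alpha> > 0"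
  shows "torus_L1 (weyl_deriv \<alpha> 0 (psum1 m (\<lambda>z. f z - psum2 n f z)))"
    "of_real (real m powr (- \<alpha>)) * fourier_coeff (weyl_deriv \<alpha> 0 (psum1 m (\<lambda>z. f z - psum2 n f z))) j k
      = low_symbol \<alpha> m j * high_symbol n k * fourier_coeff f j k"
proof -
  let ?u = "\<lambda>z. f z - psum2 n f z"
  have u: "torus_L1 ?u" "fourier_coeff ?u j k = high_symbol n k * fourier_coeff f j k" for j k
    using torus_L1_diff_add(1,2)[OF f torus_L1_psum2(1)[OF f]] by (simp_all add: torus_L1_psum2(2)[OF f] high_symbol_def)
  obtain g where g: "torus_L1 g" "\<And>j k. fourier_coeff g j k = (if \<bar>j\<bar> \<le> int m then weyl_factor \<alpha> j else 0) * fourier_coeff ?u j k"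
    using ex_torus_L1_multiplier(1)[OF u(1), of m "weyl_factor \<alpha>"] by blast
  have "fourier_coeff g j k = (if j \<noteq> 0 \<and> k \<noteq> 0 then weyl_factor \<alpha> j * weyl_factor 0 k * fourier_coeff (psum1 m ?u) j k else 0)" for j k
    using a by (simp add: g(2) u(2) torus_L1_psum1(2)[OF u(1)] weyl_factor_0 weyl_factor_order_0 high_symbol_def)
  note W = torus_L1_weyl_deriv[OF g(1) this]
  show "torus_L1 (weyl_deriv \<alpha> 0 (psum1 m ?u))" by (rule W(1))
  show "of_real (real m powr (- \<alpha>)) * fourier_coeff (weyl_deriv \<alpha> 0 (psum1 m ?u)) j k
      = low_symbol \<alpha> m j * high_symbol n k * fourier_coeff f j k"
    by (simp add: W(2) g(2) u(2) low_symbol_def mult_ac)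
qed

lemma weyl_deriv_psum2:
  assumes f: "torus_L1 f" and a: "\<alpha> > 0"
  shows "torus_L1 (weyl_deriv 0 \<alpha> (psum2 n (\<lambda>z. f z - psum1 m f z)))"
    "of_real (real n powr (- \<alpha>)) * fourier_coeff (weyl_deriv 0 \<alpha> (psum2 n (\<lambda>z. f z - psum1 m f z))) j k
      = high_symbol m j * low_symbol \<alpha> n k * fourier_coeff f j k"
proof -
  let ?u = "\<lambda>z. f z - psum1 m f z"
  have u: "torus_L1 ?u" "fourier_coeff ?u j k = high_symbol m j * fourier_coeff f j k" for j k
    using torus_L1_diff_add(1,2)[OF f torus_L1_psum1(1)[OF f]] by (simp_all add: torus_L1_psum1(2)[OF f] high_symbol_def)
  obtain g where g: "torus_L1 g" "\<And>j k. fourier_coeff g j k = (if \<bar>k\<bar> \<le> int n then weyl_factor \<alpha> k else 0) * fourier_coeff ?u j k"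
    using ex_torus_L1_multiplier(2)[OF u(1), of n "weyl_factor \<alpha>"] by blast
  have "fourier_coeff g j k = (if j \<noteq> 0 \<and> k \<noteq> 0 then weyl_factor 0 j * weyl_factor \<alpha> k * fourier_coeff (psum2 n ?u) j k else 0)" for j k
    using a by (simp add: g(2) u(2) torus_L1_psum2(2)[OF u(1)] weyl_factor_0 weyl_factor_order_0 high_symbol_def)
  note W = torus_L1_weyl_deriv[OF g(1) this]
  show "torus_L1 (weyl_deriv 0 \<alpha> (psum2 n ?u))" by (rule W(1))
  show "of_real (real n powr (- \<alpha>)) * fourier_coeff (weyl_deriv 0 \<alpha> (psum2 n ?u)) j k
      = high_symbol m j * low_symbol \<alpha> n k * fourier_coeff f j k"
    by (simp add: W(2) g(2) u(2) low_symbol_def mult_ac)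
qed

text \<open>Inclusion and exclusion: f minus both one-variable sums plus the double sum has the
  product of the two remainder symbols.\<close>

lemma torus_L1_mixed_remainder:
  assumes f: "torus_L1 f"
  shows "torus_L1 (\<lambda>z. f z - psum1 m f z - psum2 n f z + psum12 m n f z)"
    "fourier_coeff (\<lambda>z. f z - psum1 m f z - psum2 n f z + psum12 m n f z) j k = high_symbol m j * high_symbol n k * fourier_coeff f j k"
proof -
  note d1 = torus_L1_diff_add(1,2)[OF f torus_L1_psum1(1)[OF f, of m]]
  note d2 = torus_L1_diff_add(1,2)[OF d1(1) torus_L1_psum2(1)[OF f, of n]]
  note d3 = torus_L1_diff_add(3,4)[OF d2(1) torus_L1_psum12(1)[OF f, of m n]]
  show "torus_L1 (\<lambda>z. f z - psum1 m f z - psum2 n f z + psum12 m n f z)" by (rule d3(1))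
  show "fourier_coeff (\<lambda>z. f z - psum1 m f z - psum2 n f z + psum12 m n f z) j k = high_symbol m j * high_symbol n k * fourier_coeff f j k"
    by (simp add: d3(2) d2(2) d1(2) torus_L1_psum1(2)[OF f] torus_L1_psum2(2)[OF f] torus_L1_psum12(2)[OF f] high_symbol_def)
qed

theorem theorem5p1:
  fixes p \<alpha>1 \<alpha>2 :: real
  assumes "1 < p" and "0 < \<alpha>1" and "0 < \<alpha>2"
  shows "\<exists>C>0. \<forall>f \<in> Lp0_space p. \<forall>n1 n2 :: nat. 1 \<le> n1 \<longrightarrow> 1 \<le> n2 \<longrightarrow>
    (let A = mixed_modulus p \<alpha>1 \<alpha>2 f (pi / real n1) (pi / real n2);
         B = ennreal (real n1 powr (- \<alpha>1) * real n2 powr (- \<alpha>2))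
               * Lp_norm p (weyl_deriv \<alpha>1 \<alpha>2 (psum12 n1 n2 f))
           + ennreal (real n1 powr (- \<alpha>1))
               * Lp_norm p (weyl_deriv \<alpha>1 0 (psum1 n1 (\<lambda>z. f z - psum2 n2 f z)))
           + ennreal (real n2 powr (- \<alpha>2))
               * Lp_norm p (weyl_deriv 0 \<alpha>2 (psum2 n2 (\<lambda>z. f z - psum1 n1 f z)))
           + Lp_norm p (\<lambda>z. f z - psum1 n1 f z - psum2 n2 f z + psum12 n1 n2 f z)
     in ennreal (1 / C) * B \<le> A \<and> A \<le> ennreal C * B)"
proof (rule trig_poly_mixed_equivalence[OF assms])
  fix C :: real
  assume C: "C > 0"
    and upper: "\<And>n1 n2 h1 h2 N c. \<lbrakk>1 \<le> n1; 1 \<le> n2; \<bar>h1\<bar> \<le> pi / real n1; \<bar>h2\<bar> \<le> pi / real n2\<rbrakk> \<Longrightarrow>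
      Lp_norm p (trig_poly N (\<lambda>j k. frac_symbol \<alpha>1 h1 j * frac_symbol \<alpha>2 h2 k * c j k)) \<le> ennreal C *
       (Lp_norm p (trig_poly N (\<lambda>j k. low_symbol \<alpha>1 n1 j * low_symbol \<alpha>2 n2 k * c j k)) +
        Lp_norm p (trig_poly N (\<lambda>j k. low_symbol \<alpha>1 n1 j * high_symbol n2 k * c j k)) +
        Lp_norm p (trig_poly N (\<lambda>j k. high_symbol n1 j * low_symbol \<alpha>2 n2 k * c j k)) +
        Lp_norm p (trig_poly N (\<lambda>j k. high_symbol n1 j * high_symbol n2 k * c j k)))"
    and lower: "\<And>n1 n2 \<mu> \<nu> N c B. \<lbrakk>1 \<le> n1; 1 \<le> n2; \<mu> = low_symbol \<alpha>1 n1 \<or> \<mu> = high_symbol n1;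
       \<nu> = low_symbol \<alpha>2 n2 \<or> \<nu> = high_symbol n2;
       \<And>h1 h2. \<lbrakk>\<bar>h1\<bar> \<le> pi / real n1; \<bar>h2\<bar> \<le> pi / real n2\<rbrakk> \<Longrightarrow>
         Lp_norm p (trig_poly N (\<lambda>j k. frac_symbol \<alpha>1 h1 j * frac_symbol \<alpha>2 h2 k * c j k)) \<le> B\<rbrakk> \<Longrightarrow>
       Lp_norm p (trig_poly N (\<lambda>j k. \<mu> j * \<nu> k * c j k)) \<le> ennreal C * B"
  have p: "1 \<le> p" using assms by simp
  \<comment> \<open>The lower estimate adds four bounds, one for each term; the upper one would hold
    with C.\<close>
  let ?K = "4 * C"
  show ?thesis
    unfolding Let_def
  proof (intro exI[of _ ?K] conjI ballI allI impI)
    show "0 < ?K" using C by simp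
    fix f and n1 n2 :: nat
    assume "f \<in> Lp0_space p" and n: "1 \<le> n1" "1 \<le> n2"
    then have f: "torus_L1 f" using Lp_space_imp_torus_L1[OF assms(1)] by (simp add: Lp0_space_def)
    define A where "A = mixed_modulus p \<alpha>1 \<alpha>2 f (pi / real n1) (pi / real n2)"
    define T1 where "T1 = ennreal (real n1 powr (- \<alpha>1) * real n2 powr (- \<alpha>2)) * Lp_norm p (weyl_deriv \<alpha>1 \<alpha>2 (psum12 n1 n2 f))"
    define T2 where "T2 = ennreal (real n1 powr (- \<alpha>1)) * Lp_norm p (weyl_deriv \<alpha>1 0 (psum1 n1 (\<lambda>z. f z - psum2 n2 f z)))"
    define T3 where "T3 = ennreal (real n2 powr (- \<alpha>2)) * Lp_norm p (weyl_deriv 0 \<alpha>2 (psum2 n2 (\<lambda>z. f z - psum1 n1 f z)))"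
    define T4 where "T4 = Lp_norm p (\<lambda>z. f z - psum1 n1 f z - psum2 n2 f z + psum12 n1 n2 f z)"
    \<comment> \<open>Fejer damping commutes with all the multipliers, so the same polynomial
      coefficients serve for f and for every term.\<close>
    define F where "F N j k = of_real (fejer_coeff N j * fejer_coeff N k) * fourier_coeff f j k" for N j k
    have fejer: "fejer_mean N (\<lambda>j k. \<sigma> j k * fourier_coeff f j k) = trig_poly N (\<lambda>j k. \<sigma> j k * F N j k)" for N \<sigma>
      unfolding fejer_mean_def by (rule trig_poly_cong) (simp add: F_def mult_ac)
    have r: "real n1 powr (- \<alpha>1) > 0" "real n2 powr (- \<alpha>2) > 0" using n by simp_all
    \<comment> \<open>This and the next four facts characterise the norms by their upper bounds B in
      terms of polynomials with coefficients \<open>F N\<close>; no norm is computed.\<close>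
    have T1: "T1 \<le> B \<longleftrightarrow> (\<forall>N. Lp_norm p (trig_poly N (\<lambda>j k. low_symbol \<alpha>1 n1 j * low_symbol \<alpha>2 n2 k * F N j k)) \<le> B)" for B
      unfolding T1_def scaled_Lp_norm_le_iff[OF p weyl_deriv_psum12(1)[OF f assms(2,3)] mult_pos_pos[OF r]]
        weyl_deriv_psum12(2)[OF f assms(2,3)] fejer ..
    have T2: "T2 \<le> B \<longleftrightarrow> (\<forall>N. Lp_norm p (trig_poly N (\<lambda>j k. low_symbol \<alpha>1 n1 j * high_symbol n2 k * F N j k)) \<le> B)" for B
      unfolding T2_def scaled_Lp_norm_le_iff[OF p weyl_deriv_psum1(1)[OF f assms(2)] r(1)]
        weyl_deriv_psum1(2)[OF f assms(2)] fejer ..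
    have T3: "T3 \<le> B \<longleftrightarrow> (\<forall>N. Lp_norm p (trig_poly N (\<lambda>j k. high_symbol n1 j * low_symbol \<alpha>2 n2 k * F N j k)) \<le> B)" for B
      unfolding T3_def scaled_Lp_norm_le_iff[OF p weyl_deriv_psum2(1)[OF f assms(3)] r(2)]
        weyl_deriv_psum2(2)[OF f assms(3)] fejer ..
    have T4: "T4 \<le> B \<longleftrightarrow> (\<forall>N. Lp_norm p (trig_poly N (\<lambda>j k. high_symbol n1 j * high_symbol n2 k * F N j k)) \<le> B)" for B
      unfolding T4_def torus_L1_Lp_norm_le_iff[OF p torus_L1_mixed_remainder(1)[OF f]]
        torus_L1_mixed_remainder(2)[OF f] fejer ..
    have D: "Lp_norm p (diff1 \<alpha>1 h1 (diff2 \<alpha>2 h2 f)) \<le> B \<longleftrightarrow>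
        (\<forall>N. Lp_norm p (trig_poly N (\<lambda>j k. frac_symbol \<alpha>1 h1 j * frac_symbol \<alpha>2 h2 k * F N j k)) \<le> B)" for h1 h2 B
      unfolding torus_L1_Lp_norm_le_iff[OF p torus_L1_diff1(1)[OF torus_L1_diff2(1)[OF f assms(3)] assms(2)]]
        torus_L1_diff1(2)[OF torus_L1_diff2(1)[OF f assms(3)] assms(2)] torus_L1_diff2(2)[OF f assms(3)]
        mult.assoc[symmetric] fejer ..
    have "A \<le> ennreal C * (T1 + T2 + T3 + T4)"
      unfolding A_def mixed_modulus_def
    proof (rule SUP_least, clarify)
      fix h1 h2 assume h: "\<bar>h1\<bar> \<le> pi / real n1" "\<bar>h2\<bar> \<le> pi / real n2"
      show "Lp_norm p (diff1 \<alpha>1 h1 (diff2 \<alpha>2 h2 f)) \<le> ennreal C * (T1 + T2 + T3 + T4)"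
        unfolding D
      proof
        fix N
        \<comment> \<open>Taking B to be the term itself in \<open>T1\<close> to \<open>T4\<close>
          bounds each polynomial norm by that term, uniformly in N.\<close>
        show "Lp_norm p (trig_poly N (\<lambda>j k. frac_symbol \<alpha>1 h1 j * frac_symbol \<alpha>2 h2 k * F N j k)) \<le> ennreal C * (T1 + T2 + T3 + T4)"
          by (rule order_trans[OF upper[OF n h]], rule mult_left_mono, intro add_mono)
            (use T1[of T1] T2[of T2] T3[of T3] T4[of T4] in simp_all)
      qed
    qed
    also have "\<dots> \<le> ennreal ?K * (T1 + T2 + T3 + T4)"
      using C by (intro mult_right_mono ennreal_leI) auto
    finally have up: "A \<le> ennreal ?K * (T1 + T2 + T3 + T4)" .
    have DA: "Lp_norm p (trig_poly N (\<lambda>j k. frac_symbol \<alpha>1 h1 j * frac_symbol \<alpha>2 h2 k * F N j k)) \<le> A"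
      if "\<bar>h1\<bar> \<le> pi / real n1" "\<bar>h2\<bar> \<le> pi / real n2" for h1 h2 N
    proof -
      have "Lp_norm p (diff1 \<alpha>1 h1 (diff2 \<alpha>2 h2 f)) \<le> A"
        unfolding A_def mixed_modulus_def by (rule SUP_upper2[of "(h1, h2)"]) (use that in auto)
      then show ?thesis unfolding D by simp
    qed
    \<comment> \<open>The four choices of low or high symbol in each variable, with the modulus as
      the common bound B over all admissible steps.\<close>
    have "T1 \<le> ennreal C * A" "T2 \<le> ennreal C * A" "T3 \<le> ennreal C * A" "T4 \<le> ennreal C * A"
      unfolding T1 T2 T3 T4 by (intro allI lower[OF n] DA disjI1 disjI2 refl; assumption)+
    then have "T1 + T2 + T3 + T4 \<le> ennreal C * A + ennreal C * A + ennreal C * A + ennreal C * A"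
      by (intro add_mono)
    also have "\<dots> = ennreal ?K * A"
    proof -
      have "ennreal ?K = ennreal C + ennreal C + ennreal C + ennreal C" using C by (simp flip: ennreal_plus)
      then show ?thesis by (simp add: distrib_right)
    qed
    finally have "ennreal (1 / ?K) * (T1 + T2 + T3 + T4) \<le> ennreal (1 / ?K) * (ennreal ?K * A)"
      by (rule mult_left_mono) simp
    also have "\<dots> = (ennreal (1 / ?K) * ennreal ?K) * A" by (simp only: mult.assoc)
    also have "ennreal (1 / ?K) * ennreal ?K = 1" using C by (simp flip: ennreal_mult)
    finally have lo: "ennreal (1 / ?K) * (T1 + T2 + T3 + T4) \<le> A" by simp
    show "ennreal (1 / ?K) * (ennreal (real n1 powr (- \<alpha>1) * real n2 powr (- \<alpha>2)) * Lp_norm p (weyl_deriv \<alpha>1 \<alpha>2 (psum12 n1 n2 f))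
           + ennreal (real n1 powr (- \<alpha>1)) * Lp_norm p (weyl_deriv \<alpha>1 0 (psum1 n1 (\<lambda>z. f z - psum2 n2 f z)))
           + ennreal (real n2 powr (- \<alpha>2)) * Lp_norm p (weyl_deriv 0 \<alpha>2 (psum2 n2 (\<lambda>z. f z - psum1 n1 f z)))
           + Lp_norm p (\<lambda>z. f z - psum1 n1 f z - psum2 n2 f z + psum12 n1 n2 f z))
        \<le> mixed_modulus p \<alpha>1 \<alpha>2 f (pi / real n1) (pi / real n2)"
      using lo unfolding A_def T1_def T2_def T3_def T4_def .
    show "mixed_modulus p \<alpha>1 \<alpha>2 f (pi / real n1) (pi / real n2) \<le> ennreal ?K *
        (ennreal (real n1 powr (- \<alpha>1) * real n2 powr (- \<alpha>2)) * Lp_norm p (weyl_deriv \<alpha>1 \<alpha>2 (psum12 n1 n2 f))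
           + ennreal (real n1 powr (- \<alpha>1)) * Lp_norm p (weyl_deriv \<alpha>1 0 (psum1 n1 (\<lambda>z. f z - psum2 n2 f z)))
           + ennreal (real n2 powr (- \<alpha>2)) * Lp_norm p (weyl_deriv 0 \<alpha>2 (psum2 n2 (\<lambda>z. f z - psum1 n1 f z)))
           + Lp_norm p (\<lambda>z. f z - psum1 n1 f z - psum2 n2 f z + psum12 n1 n2 f z))"
      using up unfolding A_def T1_def T2_def T3_def T4_def .
  qed
qed

end
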